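(* Let $\mathcal{H}$ be the phase space and $\mathcal{A}:D(\mathcal{A})\subset\mathcal{H}\to\mathcal{H}$ the operator of the hybrid Timoshenko model described in the context, and let $\mathcal{T}(t)=e^{t\mathcal{A}}$ be the associated contraction semigroup. For any $U_0\in\mathcal{H}$ there exists a unique mild solution $$U(t)=\left(\varphi(t),\varphi_t(t),\psi(t),\psi_t(t),v(t),V(t)\right)^\top=\mathcal{T}(t)U_0$$ to the hybrid problem $\frac{d}{dt}U=\mathcal{A}U$, $U(0)=U_0$. Moreover, if $U_0\in D(\mathcal{A})$, there exists a strong solution satisfying $$U\in C^1(0,T;\mathcal{H})\cap C(0,T;D(\mathcal{A})).$$
   Context: Let $\ell>0$, $0<\xi<\ell$, $I=(0,\xi)\cup(\xi,\ell)$, and let $\rho_1,\rho_2,\kappa,b,\gamma_1,\gamma_2,\epsilon>0$ be constants; $T>0$ is arbitrary. For a function $f$ put $[\![f]\!]_\xi=f(\xi^+)-f(\xi^-)$, and let $S=\kappa(\varphi_x+\psi)$. The hybrid model is $$\rho_1\varphi_{tt}-\kappa(\varphi_x+\psi)_x=0,\quad \rho_2\psi_{tt}-b\psi_{xx}+\kappa(\varphi_x+\psi)=0\ \text{ in } I\times(0,\infty),$$ $$\epsilon v_{tt}+\epsilon v_t+\epsilon v+S(\ell,t)=0,\quad v(t)=\varphi(\ell,t),$$ with $\varphi(0,t)=0$, $\psi_x(0,t)=0$, $\psi(\ell,t)=0$ and the transmission conditions $[\![\varphi]\!]_\xi=[\![\psi]\!]_\xi=0$, $[\![\kappa\varphi_x]\!]_\xi=\gamma_1\varphi_t(\xi,t)$,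 $[\![b\psi_x]\!]_\xi=\gamma_2\psi_t(\xi,t)$ (equivalently, on $(0,\ell)$ the damping terms $\gamma_1\delta(x-\xi)\varphi_t$ and $\gamma_2\delta(x-\xi)\psi_t$ are added to the two equations). Let $V_0=\{w\in H^1(0,\ell):w(0)=0\}$, $V_\ell=\{w\in H^1(0,\ell):w(\ell)=0\}$. The phase space $\mathcal{H}$ is the set of $(\varphi,\Phi,\psi,\Psi,v,V)\in V_0\times L^2(0,\ell)\times V_\ell\times L^2(0,\ell)\times\mathbb{C}^2$ with $v=\varphi(\ell)$, with norm $$\|(\varphi,\Phi,\psi,\Psi,v,V)\|_{\mathcal{H}}^2=\int_0^\ell\left(\kappa|\varphi_x+\psi|^2+\rho_1|\Phi|^2+b|\psi_x|^2+\rho_2|\Psi|^2\right)dx+\epsilon|v|^2+\epsilon|V|^2 .$$ The operator is $$\mathcal{A}U=\left(\Phi,\ \tfrac{\kappa}{\rho_1}(\varphi_x+\psi)_x,\ \Psi,\ \tfrac{b}{\rho_2}\psi_{xx}-\tfrac{\kappa}{\rho_2}(\varphi_x+\psi),\ V,\ -V-v-\tfrac1\epsilon S(\ell)\right)^\top$$ (derivatives taken on $I$), with domain $D(\mathcal{A})$ the set of $U\in\mathcal{H}$ such that $\varphi,\psi\in H^2(I)$, $(\Phi,\Psi)\in V_0\times V_\ell$, $[\![\kappa\varphi_x]\!]_\xi=\gamma_1\Phi(\xi)$, $[\![b\psi_x]\!]_\xi=\gamma_2\Psi(\xi)$, $\psi_x(0)=0$ and $\Phi(\ell)=V$. *)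

theory Defs
  imports "HOL-Analysis.Analysis"
begin

section \<open>Complex functions on the line modulo equality almost everywhere\<close>

definition ae_eq :: "(real \<Rightarrow> complex) \<Rightarrow> (real \<Rightarrow> complex) \<Rightarrow> bool" where
  "ae_eq f g \<longleftrightarrow> (AE x in lebesgue. f x = g x)"

lemma equivp_ae_eq: "equivp ae_eq"
proof (rule equivpI)
  show "reflp ae_eq" by (auto simp: reflp_def ae_eq_def)
  show "symp ae_eq" by (auto simp: symp_def ae_eq_def elim: eventually_mono)
  show "transp ae_eq" unfolding transp_def ae_eq_def
    by (auto elim: eventually_elim2)
qed

text \<open>Measurability is not built into the type; it is required in \<open>L2\<close> below.  For Lebesgue
  measurability it does not depend on the representative.\<close>

quotient_type aefun = "real \<Rightarrow> complex" / ae_eq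
  by (rule equivp_ae_eq)

instantiation aefun :: real_vector
begin

lift_definition zero_aefun :: aefun is "\<lambda>_. 0" .

lift_definition plus_aefun :: "aefun \<Rightarrow> aefun \<Rightarrow> aefun" is "\<lambda>f g x. f x + g x"
  unfolding ae_eq_def by (auto elim: eventually_elim2)

lift_definition minus_aefun :: "aefun \<Rightarrow> aefun \<Rightarrow> aefun" is "\<lambda>f g x. f x - g x"
  unfolding ae_eq_def by (auto elim: eventually_elim2)

lift_definition uminus_aefun :: "aefun \<Rightarrow> aefun" is "\<lambda>f x. - f x"
  unfolding ae_eq_def by (auto elim: eventually_mono)

lift_definition scaleR_aefun :: "real \<Rightarrow> aefun \<Rightarrow> aefun" is "\<lambda>r f x. r *\<^sub>R f x"
  unfolding ae_eq_def by (auto elim: eventually_mono)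

instance
  by intro_classes (transfer, simp add: ae_eq_def algebra_simps)+

end

lift_definition scaleC :: "complex \<Rightarrow> aefun \<Rightarrow> aefun" is "\<lambda>c f x. c * f x"
  unfolding ae_eq_def by (auto elim: eventually_mono)

section \<open>Lebesgue and Sobolev spaces on an open set \<open>J\<close>\<close>

text \<open>A function on \<open>J\<close> is identified with its extension by zero.\<close>

definition L2 :: "real set \<Rightarrow> aefun set" where
  "L2 J = {f. rep_aefun f \<in> borel_measurable lebesgue
            \<and> integrable lebesgue (\<lambda>x. (cmod (rep_aefun f x))\<^sup>2)
            \<and> (AE x in lebesgue. x \<notin> J \<longrightarrow> rep_aefun f x = 0)}"

definition L2_norm :: "real set \<Rightarrow> aefun \<Rightarrow> real" where
  "L2_norm J f = sqrt (LINT x:J|lebesgue. (cmod (rep_aefun f x))\<^sup>2)"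

text \<open>\<open>\<eta>\<close> is a test function in \<open>C\<^sub>c\<^sup>1(J)\<close> with derivative \<open>\<eta>'\<close>.  Real-valued test functions suffice,
  since the integration by parts formula below is linear in \<open>\<eta>\<close>.\<close>

definition test_function :: "real set \<Rightarrow> (real \<Rightarrow> real) \<Rightarrow> (real \<Rightarrow> real) \<Rightarrow> bool" where
  "test_function J \<eta> \<eta>' \<longleftrightarrow>
     (\<forall>x. (\<eta> has_real_derivative \<eta>' x) (at x)) \<and> continuous_on UNIV \<eta>' \<and>
     (\<exists>K. compact K \<and> K \<subseteq> J \<and> (\<forall>x. x \<notin> K \<longrightarrow> \<eta> x = 0))"

definition has_weak_deriv :: "real set \<Rightarrow> aefun \<Rightarrow> aefun \<Rightarrow> bool" where
  "has_weak_deriv J f g \<longleftrightarrow>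
     (\<forall>\<eta> \<eta>'. test_function J \<eta> \<eta>' \<longrightarrow>
        (LINT x:J|lebesgue. rep_aefun f x * of_real (\<eta>' x))
          = - (LINT x:J|lebesgue. rep_aefun g x * of_real (\<eta> x)))"

definition H1 :: "real set \<Rightarrow> aefun set" where
  "H1 J = {f \<in> L2 J. \<exists>g \<in> L2 J. has_weak_deriv J f g}"

definition wderiv :: "real set \<Rightarrow> aefun \<Rightarrow> aefun" where
  "wderiv J f = (THE g. g \<in> L2 J \<and> has_weak_deriv J f g)"

definition H2 :: "real set \<Rightarrow> aefun set" where
  "H2 J = {f \<in> H1 J. wderiv J f \<in> H1 J}"

text \<open>Boundary and interior values of a class: the limit along the filter \<open>F\<close> of some representative.
  The limit along \<open>at_left\<close>, \<open>at_right\<close> or \<open>at\<close> of a point is unique because a null set contains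
  no one-sided neighbourhood; for an \<open>H1\<close> class it is the value of the continuous representative.\<close>

definition trace_at :: "real filter \<Rightarrow> aefun \<Rightarrow> complex" where
  "trace_at F f = (THE c. \<exists>g. abs_aefun g = f \<and> (g \<longlongrightarrow> c) F)"

definition jump :: "real \<Rightarrow> aefun \<Rightarrow> complex" where
  "jump x f = trace_at (at_right x) f - trace_at (at_left x) f"

section \<open>The hybrid Timoshenko model\<close>

record timoshenko =
  tm_ell :: real
  tm_xi :: real
  tm_rho1 :: real
  tm_rho2 :: real
  tm_kappa :: real
  tm_b :: real
  tm_gamma1 :: real
  tm_gamma2 :: real
  tm_eps :: real

type_synonym state = "aefun \<times> aefun \<times> aefun \<times> aefun \<times> complex \<times> complex"

fun scaleC_state :: "complex \<Rightarrow> state \<Rightarrow> state" where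
  "scaleC_state c (\<phi>, \<Phi>, \<psi>, \<Psi>, v, V) =
     (scaleC c \<phi>, scaleC c \<Phi>, scaleC c \<psi>, scaleC c \<Psi>, c * v, c * V)"

definition beam :: "timoshenko \<Rightarrow> real set" where
  "beam P = {0<..<tm_ell P}"

definition beam_cut :: "timoshenko \<Rightarrow> real set" where
  "beam_cut P = {0<..<tm_xi P} \<union> {tm_xi P<..<tm_ell P}"

definition V_zero :: "timoshenko \<Rightarrow> aefun set" where
  "V_zero P = {w \<in> H1 (beam P). trace_at (at_right 0) w = 0}"

definition V_ell :: "timoshenko \<Rightarrow> aefun set" where
  "V_ell P = {w \<in> H1 (beam P). trace_at (at_left (tm_ell P)) w = 0}"

definition phase_space :: "timoshenko \<Rightarrow> state set" where
  "phase_space P = {(\<phi>, \<Phi>, \<psi>, \<Psi>, v, V).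
     \<phi> \<in> V_zero P \<and> \<Phi> \<in> L2 (beam P) \<and> \<psi> \<in> V_ell P \<and> \<Psi> \<in> L2 (beam P)
     \<and> v = trace_at (at_left (tm_ell P)) \<phi>}"

fun phase_norm :: "timoshenko \<Rightarrow> state \<Rightarrow> real" where
  "phase_norm P (\<phi>, \<Phi>, \<psi>, \<Psi>, v, V) = sqrt (
     (LINT x:beam P|lebesgue.
          tm_kappa P * (cmod (rep_aefun (wderiv (beam P) \<phi> + \<psi>) x))\<^sup>2
        + tm_rho1 P * (cmod (rep_aefun \<Phi> x))\<^sup>2
        + tm_b P * (cmod (rep_aefun (wderiv (beam P) \<psi>) x))\<^sup>2
        + tm_rho2 P * (cmod (rep_aefun \<Psi> x))\<^sup>2)
     + tm_eps P * (cmod v)\<^sup>2 + tm_eps P * (cmod V)\<^sup>2)"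

text \<open>\<open>shear P \<phi> \<psi>\<close> is the shear force \<open>S = \<kappa>(\<phi>\<^sub>x + \<psi>)\<close>.\<close>

definition shear :: "timoshenko \<Rightarrow> aefun \<Rightarrow> aefun \<Rightarrow> aefun" where
  "shear P \<phi> \<psi> = tm_kappa P *\<^sub>R (wderiv (beam_cut P) \<phi> + \<psi>)"

fun tim_op :: "timoshenko \<Rightarrow> state \<Rightarrow> state" where
  "tim_op P (\<phi>, \<Phi>, \<psi>, \<Psi>, v, V) =
     (\<Phi>,
      (tm_kappa P / tm_rho1 P) *\<^sub>R wderiv (beam_cut P) (wderiv (beam_cut P) \<phi> + \<psi>),
      \<Psi>,
      (tm_b P / tm_rho2 P) *\<^sub>R wderiv (beam_cut P) (wderiv (beam_cut P) \<psi>)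
        - (tm_kappa P / tm_rho2 P) *\<^sub>R (wderiv (beam_cut P) \<phi> + \<psi>),
      V,
      - V - v - (1 / tm_eps P) *\<^sub>R trace_at (at_left (tm_ell P)) (shear P \<phi> \<psi>))"

definition tim_dom :: "timoshenko \<Rightarrow> state set" where
  "tim_dom P = {(\<phi>, \<Phi>, \<psi>, \<Psi>, v, V).
     (\<phi>, \<Phi>, \<psi>, \<Psi>, v, V) \<in> phase_space P
     \<and> \<phi> \<in> H2 (beam_cut P) \<and> \<psi> \<in> H2 (beam_cut P)
     \<and> \<Phi> \<in> V_zero P \<and> \<Psi> \<in> V_ell P
     \<and> jump (tm_xi P) (tm_kappa P *\<^sub>R wderiv (beam_cut P) \<phi>) = tm_gamma1 P *\<^sub>R trace_at (at (tm_xi P)) \<Phi>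
     \<and> jump (tm_xi P) (tm_b P *\<^sub>R wderiv (beam_cut P) \<psi>) = tm_gamma2 P *\<^sub>R trace_at (at (tm_xi P)) \<Psi>
     \<and> trace_at (at_right 0) (wderiv (beam_cut P) \<psi>) = 0
     \<and> trace_at (at_left (tm_ell P)) \<Phi> = V}"

section \<open>Calculus and semigroups in a normed subspace\<close>

text \<open>The phase space depends on the parameters of the model, so it is a subset \<open>H\<close> of a real vector
  space with a norm function \<open>N\<close> on it, not a type.  The notions below are relative to \<open>H\<close> and \<open>N\<close>;
  \<open>sc\<close> is the multiplication by complex scalars.\<close>

definition cont_wrt :: "('v::real_vector \<Rightarrow> real) \<Rightarrow> real set \<Rightarrow> (real \<Rightarrow> 'v) \<Rightarrow> bool" where
  "cont_wrt N S U \<longleftrightarrow> (\<forall>t\<in>S. ((\<lambda>s. N (U s - U t)) \<longlongrightarrow> 0) (at t within S))"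

definition has_deriv_wrt ::
    "('v::real_vector \<Rightarrow> real) \<Rightarrow> real set \<Rightarrow> (real \<Rightarrow> 'v) \<Rightarrow> (real \<Rightarrow> 'v) \<Rightarrow> bool" where
  "has_deriv_wrt N S U U' \<longleftrightarrow>
     (\<forall>t\<in>S. ((\<lambda>s. N ((1 / (s - t)) *\<^sub>R (U s - U t) - U' t)) \<longlongrightarrow> 0) (at t within S))"

text \<open>The Riemann integral of \<open>U\<close> over \<open>{a..b}\<close>: the integral of the library with a constant gauge
  and with \<open>N\<close> in place of the norm of a type.\<close>

definition has_riemann_integral ::
    "('v::real_vector \<Rightarrow> real) \<Rightarrow> (real \<Rightarrow> 'v) \<Rightarrow> 'v \<Rightarrow> real \<Rightarrow> real \<Rightarrow> bool" where
  "has_riemann_integral N U J a b \<longleftrightarrow>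
     (\<forall>e>0. \<exists>d>0. \<forall>p. p tagged_division_of {a..b} \<and> (\<lambda>x. ball x d) fine p \<longrightarrow>
        N ((\<Sum>(x, k)\<in>p. measure lborel k *\<^sub>R U x) - J) < e)"

definition contraction_semigroup ::
    "'v::real_vector set \<Rightarrow> ('v \<Rightarrow> real) \<Rightarrow> (complex \<Rightarrow> 'v \<Rightarrow> 'v) \<Rightarrow> (real \<Rightarrow> 'v \<Rightarrow> 'v) \<Rightarrow> bool" where
  "contraction_semigroup H N sc T \<longleftrightarrow>
     (\<forall>t\<ge>0. \<forall>U\<in>H. T t U \<in> H) \<and>
     (\<forall>t\<ge>0. \<forall>U\<in>H. \<forall>W\<in>H. T t (U + W) = T t U + T t W) \<and>
     (\<forall>t\<ge>0. \<forall>c. \<forall>U\<in>H. T t (sc c U) = sc c (T t U)) \<and>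
     (\<forall>U\<in>H. T 0 U = U) \<and>
     (\<forall>s\<ge>0. \<forall>t\<ge>0. \<forall>U\<in>H. T (s + t) U = T s (T t U)) \<and>
     (\<forall>U\<in>H. ((\<lambda>t. N (T t U - U)) \<longlongrightarrow> 0) (at_right 0)) \<and>
     (\<forall>t\<ge>0. \<forall>U\<in>H. N (T t U) \<le> N U)"

text \<open>\<open>A\<close> with domain \<open>D\<close> is the infinitesimal generator of \<open>T\<close>; in particular \<open>D\<close> is exactly
  the set of \<open>U\<close> for which the difference quotients at \<open>0\<close> converge.\<close>

definition generator ::
    "'v::real_vector set \<Rightarrow> ('v \<Rightarrow> real) \<Rightarrow> (real \<Rightarrow> 'v \<Rightarrow> 'v) \<Rightarrow> 'v set \<Rightarrow> ('v \<Rightarrow> 'v) \<Rightarrow> bool" where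
  "generator H N T D A \<longleftrightarrow>
     D \<subseteq> H \<and> A ` D \<subseteq> H \<and>
     (\<forall>U\<in>H. \<forall>W\<in>H. (U \<in> D \<and> A U = W) \<longleftrightarrow>
        ((\<lambda>h. N ((1 / h) *\<^sub>R (T h U - U) - W)) \<longlongrightarrow> 0) (at_right 0))"

text \<open>Mild solutions on \<open>[0,\<infinity>)\<close> of \<open>U' = A U\<close>, \<open>U(0) = U\<^sub>0\<close>: continuous \<open>U\<close> with
  \<open>\<integral>\<^sub>0\<^sup>t U \<in> D\<close> and \<open>U(t) = U\<^sub>0 + A \<integral>\<^sub>0\<^sup>t U\<close>.\<close>

definition mild_solution ::
    "'v::real_vector set \<Rightarrow> ('v \<Rightarrow> real) \<Rightarrow> 'v set \<Rightarrow> ('v \<Rightarrow> 'v) \<Rightarrow> 'v \<Rightarrow> (real \<Rightarrow> 'v) \<Rightarrow> bool" where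
  "mild_solution H N D A U0 U \<longleftrightarrow>
     (\<forall>t\<ge>0. U t \<in> H) \<and> cont_wrt N {0..} U \<and>
     (\<forall>t\<ge>0. \<exists>J\<in>D. has_riemann_integral N U J 0 t \<and> U t = U0 + A J)"

definition graph_norm :: "('v \<Rightarrow> real) \<Rightarrow> ('v \<Rightarrow> 'v) \<Rightarrow> 'v \<Rightarrow> real" where
  "graph_norm N A X = N X + N (A X)"

text \<open>\<open>U \<in> C\<^sup>1([0,\<tau>];H) \<inter> C([0,\<tau>];D)\<close>, where \<open>D\<close> carries the graph norm, with \<open>U' = A U\<close> and
  \<open>U(0) = U\<^sub>0\<close>.\<close>

definition strong_solution ::
    "'v::real_vector set \<Rightarrow> ('v \<Rightarrow> real) \<Rightarrow> 'v set \<Rightarrow> ('v \<Rightarrow> 'v) \<Rightarrow> 'v \<Rightarrow> real \<Rightarrow> (real \<Rightarrow> 'v) \<Rightarrow> bool" where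
  "strong_solution H N D A U0 \<tau> U \<longleftrightarrow>
     (\<exists>U'. (\<forall>t\<in>{0..\<tau>}. U t \<in> H \<and> U' t \<in> H) \<and> has_deriv_wrt N {0..\<tau>} U U' \<and> cont_wrt N {0..\<tau>} U'
         \<and> (\<forall>t\<in>{0..\<tau>}. U' t = A (U t))) \<and>
     (\<forall>t\<in>{0..\<tau>}. U t \<in> D) \<and> cont_wrt (graph_norm N A) {0..\<tau>} U \<and>
     U 0 = U0"

text \<open>The second and fourth components of \<open>U\<close> are the time derivatives, in \<open>L\<^sup>2\<close>, of the first and third.\<close>

definition velocities :: "timoshenko \<Rightarrow> (real \<Rightarrow> state) \<Rightarrow> bool" where
  "velocities P U \<longleftrightarrow>
     has_deriv_wrt (L2_norm (beam P)) {0..} (\<lambda>t. fst (U t)) (\<lambda>t. fst (snd (U t))) \<and>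
     has_deriv_wrt (L2_norm (beam P)) {0..}
       (\<lambda>t. fst (snd (snd (U t)))) (\<lambda>t. fst (snd (snd (snd (U t)))))"

end

theory Submission
  imports Defs
begin

text \<open>The operator \<open>\<A>\<close> of the model generates a contraction semigroup because it is dissipative and has a bounded
inverse; existence, uniqueness and regularity of solutions are then general facts about such operators.

Dissipativity is the energy identity
\<open>Re \<langle>\<A>U, U\<rangle> = - \<gamma>\<^sub>1 |\<Phi>(\<xi>)|\<^sup>2 - \<gamma>\<^sub>2 |\<Psi>(\<xi>)|\<^sup>2 - \<epsilon> |V|\<^sup>2\<close> (\<open>tim_op_dissipative\<close>): integrating by parts on the two
pieces of the beam, the jumps at \<open>\<xi>\<close> turn into the two damping terms, and the shear force at the end \<open>x = \<ell>\<close>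
cancels against the equation of the tip.

The bounded inverse comes from integrating the stationary equations (\<open>tim_op_bounded_inverse\<close>).  Given the right
hand side, the velocities are known, hence so are the jumps at \<open>\<xi>\<close>; one integration gives the shear force up to an
additive constant, a second one gives \<open>\<psi>\<^sub>x\<close>, and then \<open>\<phi>\<^sub>x\<close> is known.  The only unknown left is that constant, and
the tip equation is a scalar linear equation for it whose coefficient does not vanish (\<open>determinant_nonzero\<close>).

The Sobolev side of the argument is reduced to primitives: a class has a weak derivative on the cut beam exactly if
it is \<open>c + d 1\<^bsub>x > \<xi>\<^esub>\<close> plus the primitive of a square integrable class (\<open>H1_Cut\<close>, from the lemma of du Bois-Reymond).
All traces, jumps and weak derivatives can be read off from \<open>c\<close>, \<open>d\<close> and the primitive, the phase space is
parametrised by \<open>(\<phi>\<^sub>x, \<Phi>, \<psi>\<^sub>x, \<Psi>, V)\<close>, and the domain of \<open>\<A>\<close> by the second derivatives, the derivatives of the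
velocities and one constant (\<open>tim_dom_iff\<close>).  Integration by parts for primitives is Fubini's theorem
(\<open>integral_by_parts_primitives\<close>), and the phase space is complete because \<open>L\<^sup>2\<close> is (\<open>L2_complete\<close>).

On the abstract side, a dissipative \<open>A\<close> with bounded inverse has bijective \<open>I - h A\<close> for every \<open>h > 0\<close>
(\<open>solvable_pos\<close>), which makes its domain dense (\<open>dense\<close>).  The semigroup is the limit of the implicit Euler scheme
with dyadic step sizes; halving the step changes the result on \<open>D(A\<^sup>2)\<close> by a geometrically decaying amount
(\<open>euler_step\<close>).  That its generator is exactly \<open>A\<close> follows from a Taylor estimate and from the maximality of
dissipative operators with a resolvent (\<open>generates\<close>).  Because \<open>A\<close> is onto, any initial value is \<open>x = A y\<close> with \<open>y\<close> in the
domain, so that \<open>\<integral>\<^sub>0\<^sup>t S(s) x ds = S(t) y - y\<close>: this is the mild solution (\<open>mild_solution_S\<close>), and the components of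
the same identity identify \<open>\<Phi>\<close> and \<open>\<Psi>\<close> as the time derivatives of \<open>\<phi>\<close> and \<open>\<psi>\<close> (\<open>velocities_of_solution\<close>).  The
integral \<open>Z\<close> of the difference of two mild solutions satisfies \<open>Z' = A Z\<close>, \<open>Z(0) = 0\<close>, and dissipativity forces
\<open>Z = 0\<close> (\<open>mild_solution_unique\<close>).\<close>

section \<open>Subspaces with an inner product\<close>

text \<open>The space is a subset \<open>H\<close> of a vector space and not a type, because the phase space of the model depends on its
parameters.  The inner product is real-valued: for a complex space it is the real part of the Hermitian product, which
induces the same norm and is all that dissipativity needs.\<close>

locale real_inner_subspace =
  fixes H :: "'v::real_vector set" and N :: "'v \<Rightarrow> real" and ip :: "'v \<Rightarrow> 'v \<Rightarrow> real"
  assumes subspace_H: "subspace H"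
    and ip_add: "x \<in> H \<Longrightarrow> y \<in> H \<Longrightarrow> z \<in> H \<Longrightarrow> ip (x + y) z = ip x z + ip y z"
    and ip_scale: "x \<in> H \<Longrightarrow> y \<in> H \<Longrightarrow> ip (r *\<^sub>R x) y = r * ip x y"
    and ip_sym: "x \<in> H \<Longrightarrow> y \<in> H \<Longrightarrow> ip x y = ip y x"
    and ip_nonneg: "x \<in> H \<Longrightarrow> 0 \<le> ip x x"
    and N_eq: "x \<in> H \<Longrightarrow> N x = sqrt (ip x x)"
begin

lemma H_zero [simp, intro]: "0 \<in> H"
  and H_add [simp, intro]: "x \<in> H \<Longrightarrow> y \<in> H \<Longrightarrow> x + y \<in> H"
  and H_diff [simp, intro]: "x \<in> H \<Longrightarrow> y \<in> H \<Longrightarrow> x - y \<in> H"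
  and H_scale [simp, intro]: "x \<in> H \<Longrightarrow> r *\<^sub>R x \<in> H"
  and H_minus [simp, intro]: "x \<in> H \<Longrightarrow> - x \<in> H"
  using subspace_H
  by (auto simp: subspace_0 subspace_add subspace_diff subspace_scale subspace_neg)

lemma H_sum: "(\<And>i. i \<in> I \<Longrightarrow> f i \<in> H) \<Longrightarrow> sum f I \<in> H"
  using subspace_H by (rule subspace_sum)

lemma ip_add2: "x \<in> H \<Longrightarrow> y \<in> H \<Longrightarrow> z \<in> H \<Longrightarrow> ip z (x + y) = ip z x + ip z y"
  by (metis ip_add ip_sym H_add)

lemma ip_scale2: "x \<in> H \<Longrightarrow> y \<in> H \<Longrightarrow> ip y (r *\<^sub>R x) = r * ip y x"
  by (metis ip_scale ip_sym H_scale)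

lemma ip_diff: "x \<in> H \<Longrightarrow> y \<in> H \<Longrightarrow> z \<in> H \<Longrightarrow> ip (x - y) z = ip x z - ip y z"
  using ip_add[of x "(-1) *\<^sub>R y" z] ip_scale[of y z "-1"] by simp

lemma ip_diff2: "x \<in> H \<Longrightarrow> y \<in> H \<Longrightarrow> z \<in> H \<Longrightarrow> ip z (x - y) = ip z x - ip z y"
  by (metis ip_diff ip_sym H_diff)

lemmas ip_simps = ip_add ip_add2 ip_scale ip_scale2 ip_diff ip_diff2

lemma N_nonneg [simp]: "x \<in> H \<Longrightarrow> 0 \<le> N x"
  by (simp add: N_eq ip_nonneg)

lemma N_sq: "x \<in> H \<Longrightarrow> (N x)\<^sup>2 = ip x x"
  by (simp add: N_eq ip_nonneg)

lemma N_zero [simp]: "N 0 = 0"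
  using ip_scale[of 0 0 0] by (simp add: N_eq)

lemma N_scale: "x \<in> H \<Longrightarrow> N (r *\<^sub>R x) = \<bar>r\<bar> * N x"
  by (simp add: N_eq ip_simps real_sqrt_mult flip: mult.assoc)

lemma N_minus: "x \<in> H \<Longrightarrow> N (- x) = N x"
  using N_scale[of x "-1"] by simp

lemma N_diff_commute: "x \<in> H \<Longrightarrow> y \<in> H \<Longrightarrow> N (x - y) = N (y - x)"
  using N_minus[of "x - y"] by simp

lemma quadratic_nonneg: "x \<in> H \<Longrightarrow> y \<in> H \<Longrightarrow> 0 \<le> ip x x + 2 * t * ip x y + t\<^sup>2 * ip y y"
  using ip_nonneg[of "x + t *\<^sub>R y"] ip_sym[of x y]
  by (simp add: ip_simps power2_eq_square algebra_simps)

lemma Cauchy_Schwarz: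
  assumes "x \<in> H" "y \<in> H" shows "ip x y \<le> N x * N y"
proof (cases "ip y y = 0")
  case True
  have "ip x y = 0"
  proof (rule ccontr)
    assume "ip x y \<noteq> 0"
    then have "2 * (- (ip x x + 1) / (2 * ip x y)) * ip x y = - (ip x x + 1)" by simp
    then show False
      using quadratic_nonneg[OF assms, of "- (ip x x + 1) / (2 * ip x y)"] True by simp
  qed
  then show ?thesis using True assms by simp
next
  case False
  then have pos: "ip y y > 0" using ip_nonneg[OF assms(2)] by simp
  have "0 \<le> ip x x - (ip x y)\<^sup>2 / ip y y"
    using quadratic_nonneg[OF assms, of "- ip x y / ip y y"] pos
    by (simp add: field_simps power2_eq_square)
  then have "(ip x y)\<^sup>2 \<le> (N x)\<^sup>2 * (N y)\<^sup>2" using pos assms by (simp add: N_sq field_simps)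
  then have "(ip x y)\<^sup>2 \<le> (N x * N y)\<^sup>2" by (simp add: power_mult_distrib)
  then show ?thesis using assms by (meson N_nonneg mult_nonneg_nonneg power2_le_imp_le)
qed

lemma N_triangle: "x \<in> H \<Longrightarrow> y \<in> H \<Longrightarrow> N (x + y) \<le> N x + N y"
proof -
  assume a: "x \<in> H" "y \<in> H"
  then have "(N (x + y))\<^sup>2 \<le> (N x + N y)\<^sup>2"
    using Cauchy_Schwarz[OF a] ip_sym[OF a]
    by (simp add: N_sq power2_sum ip_simps)
  then show ?thesis using a by (meson N_nonneg add_nonneg_nonneg power2_le_imp_le)
qed

lemma N_triangle_diff: "x \<in> H \<Longrightarrow> y \<in> H \<Longrightarrow> N (x - y) \<le> N x + N y"
  using N_triangle[of x "- y"] N_minus[of y] by simp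

lemma N_triangle_through: "x \<in> H \<Longrightarrow> y \<in> H \<Longrightarrow> z \<in> H \<Longrightarrow> N (x - z) \<le> N (x - y) + N (y - z)"
  using N_triangle[of "x - y" "y - z"] by simp

lemma N_reverse_triangle: "x \<in> H \<Longrightarrow> y \<in> H \<Longrightarrow> \<bar>N x - N y\<bar> \<le> N (x - y)"
  using N_triangle[of "x - y" y] N_triangle[of "y - x" x] N_diff_commute[of x y] by simp

lemma N_sum: "(\<And>i. i \<in> I \<Longrightarrow> f i \<in> H) \<Longrightarrow> N (sum f I) \<le> (\<Sum>i\<in>I. N (f i))"
proof (induction I rule: infinite_finite_induct)
  case (insert i I)
  have "N (f i + sum f I) \<le> N (f i) + N (sum f I)"
    by (intro N_triangle H_sum) (use insert in auto)
  moreover have "N (sum f I) \<le> (\<Sum>i\<in>I. N (f i))" using insert by blast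
  ultimately show ?case using insert.hyps by simp
qed auto

lemma parallelogram:
  "x \<in> H \<Longrightarrow> y \<in> H \<Longrightarrow> (N (x + y))\<^sup>2 + (N (x - y))\<^sup>2 = 2 * (N x)\<^sup>2 + 2 * (N y)\<^sup>2"
  by (simp add: N_sq ip_simps)

end

locale hilbert_subspace = real_inner_subspace +
  assumes ip_definite: "x \<in> H \<Longrightarrow> ip x x = 0 \<Longrightarrow> x = 0"
    and complete: "(\<And>n. X n \<in> H) \<Longrightarrow> (\<And>e. e > 0 \<Longrightarrow> \<exists>M. \<forall>m\<ge>M. \<forall>n\<ge>M. N (X m - X n) < e)
      \<Longrightarrow> \<exists>x\<in>H. (\<lambda>n. N (X n - x)) \<longlonglongrightarrow> 0"
begin

lemma N_eq_0: "x \<in> H \<Longrightarrow> N x = 0 \<longleftrightarrow> x = 0"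
  using ip_definite N_sq[of x] by fastforce

lemma N_le_0: "x \<in> H \<Longrightarrow> N x \<le> 0 \<Longrightarrow> x = 0"
  using N_eq_0[of x] N_nonneg[of x] by linarith

lemma N_tendsto_unique:
  assumes "F \<noteq> bot" "x \<in> H" "y \<in> H" "\<forall>\<^sub>F n in F. X n \<in> H"
    and "((\<lambda>n. N (X n - x)) \<longlongrightarrow> 0) F" "((\<lambda>n. N (X n - y)) \<longlongrightarrow> 0) F"
  shows "x = y"
proof -
  have "((\<lambda>n. N (X n - x) + N (X n - y)) \<longlongrightarrow> 0 + 0) F"
    by (intro tendsto_add assms)
  moreover have "\<forall>\<^sub>F n in F. N (x - y) \<le> N (X n - x) + N (X n - y)"
    using assms(4) by eventually_elim (metis N_diff_commute N_triangle_through assms(2,3))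
  ultimately have "N (x - y) \<le> 0"
    using tendsto_lowerbound assms(1) by force
  then show ?thesis using N_le_0[of "x - y"] assms by simp
qed

lemma N_tendsto:
  assumes "\<forall>\<^sub>F n in F. X n \<in> H" "x \<in> H" "((\<lambda>n. N (X n - x)) \<longlongrightarrow> 0) F"
  shows "((\<lambda>n. N (X n)) \<longlongrightarrow> N x) F"
proof -
  have "((\<lambda>n. N (X n) - N x) \<longlongrightarrow> 0) F"
    by (rule tendsto_0_le[OF assms(3), of _ 1])
      (use assms(1) in \<open>eventually_elim; use N_reverse_triangle[OF _ assms(2)] in fastforce\<close>)
  then show ?thesis by (subst Lim_null)
qed

text \<open>The form of completeness used for limits of iterations, where consecutive differences decay geometrically.\<close>

lemma geometric_limit:
  assumes "\<And>n. X n \<in> H" and q: "0 \<le> q" "q < 1" and step: "\<And>n. N (X (Suc n) - X n) \<le> C * q ^ n"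
  shows "\<exists>x\<in>H. (\<lambda>n. N (X n - x)) \<longlonglongrightarrow> 0"
proof (rule complete)
  fix e :: real assume "e > 0"
  have C: "C \<ge> 0" using order_trans[OF N_nonneg step[of 0]] assms(1) by simp
  have tail: "N (X (n + k) - X n) \<le> C / (1 - q) * q ^ n" for n k
  proof -
    have "N (X (n + k) - X n) \<le> (\<Sum>j<k. C * q ^ (n + j))"
    proof (induction k)
      case (Suc k)
      then show ?case
        using N_triangle_through[of "X (n + Suc k)" "X (n + k)" "X n"] step[of "n + k"] assms(1)
        by simp
    qed simp
    also have "\<dots> = C * q ^ n * (\<Sum>j<k. q ^ j)"
      by (simp add: power_add sum_distrib_left mult_ac)
    also have "\<dots> = C * q ^ n * ((1 - q ^ k) / (1 - q))"
      using q by (simp add: sum_gp_strict)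
    also have "\<dots> \<le> C * q ^ n * (1 / (1 - q))"
      using q C by (intro mult_left_mono divide_right_mono) auto
    finally show ?thesis by simp
  qed
  have "(\<lambda>n. 2 * (C / (1 - q) * q ^ n)) \<longlonglongrightarrow> 0"
    using q by (intro tendsto_mult_right_zero LIMSEQ_power_zero) auto
  then have "\<forall>\<^sub>F n in sequentially. 2 * (C / (1 - q) * q ^ n) < e"
    using \<open>e > 0\<close> by (rule order_tendstoD(2))
  then obtain M where M: "2 * (C / (1 - q) * q ^ M) < e"
    by (auto simp: eventually_sequentially)
  show "\<exists>M. \<forall>m\<ge>M. \<forall>n\<ge>M. N (X m - X n) < e"
  proof (intro exI[of _ M] allI impI)
    fix m n assume "M \<le> m" "M \<le> n"
    then have "N (X m - X M) \<le> C / (1 - q) * q ^ M" "N (X n - X M) \<le> C / (1 - q) * q ^ M"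
      using tail[of M "m - M"] tail[of M "n - M"] by auto
    then show "N (X m - X n) < e"
      using N_triangle_through[of "X m" "X M" "X n"] N_diff_commute[of "X M" "X n"] assms(1) M
      by fastforce
  qed
qed (use assms in auto)

lemma contraction_fixed_point:
  assumes F: "\<And>x. x \<in> H \<Longrightarrow> F x \<in> H" and q: "0 \<le> q" "q < 1"
    and lip: "\<And>x y. x \<in> H \<Longrightarrow> y \<in> H \<Longrightarrow> N (F x - F y) \<le> q * N (x - y)"
  shows "\<exists>x\<in>H. F x = x"
proof -
  define X where "X n = (F ^^ n) 0" for n
  have X: "X n \<in> H" for n by (induction n) (auto simp: X_def F)
  have XS: "X (Suc n) = F (X n)" for n by (simp add: X_def)
  have "N (X (Suc n) - X n) \<le> N (X 1 - X 0) * q ^ n" for n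
  proof (induction n)
    case (Suc n)
    have "N (X (Suc (Suc n)) - X (Suc n)) \<le> q * N (X (Suc n) - X n)"
      unfolding XS by (intro lip F X)
    also have "\<dots> \<le> q * (N (X 1 - X 0) * q ^ n)" using Suc q by (intro mult_left_mono)
    finally show ?case by (simp add: mult_ac)
  qed simp
  then obtain x where x: "x \<in> H" "(\<lambda>n. N (X n - x)) \<longlonglongrightarrow> 0"
    using geometric_limit[of X q "N (X 1 - X 0)"] X q by blast
  have "(\<lambda>n. N (X (Suc n) - F x)) \<longlonglongrightarrow> 0"
    by (rule tendsto_0_le[OF x(2), of _ q])
      (use lip X x(1) q in \<open>auto simp: XS F mult.commute\<close>)
  then have "F x = x"
    using N_tendsto_unique[of sequentially "F x" x "\<lambda>n. X (Suc n)"] x X F LIMSEQ_Suc by auto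
  then show ?thesis using x(1) by blast
qed

end

section \<open>Dissipative operators with bounded inverse\<close>

text \<open>Dissipativity together with \<open>0\<close> in the resolvent set replaces the range condition of the Lumer-Phillips theorem.
Density of \<open>D\<close> and injectivity of \<open>A\<close> are consequences.\<close>

locale dissipative_bijection = hilbert_subspace H N ip
  for H :: "'v::real_vector set" and N ip +
  fixes D :: "'v set" and A :: "'v \<Rightarrow> 'v"
  assumes subspace_D: "subspace D" and D_H: "D \<subseteq> H"
    and A_H: "x \<in> D \<Longrightarrow> A x \<in> H"
    and A_add: "x \<in> D \<Longrightarrow> y \<in> D \<Longrightarrow> A (x + y) = A x + A y"
    and A_scale: "x \<in> D \<Longrightarrow> A (r *\<^sub>R x) = r *\<^sub>R A x"
    and dissipative: "x \<in> D \<Longrightarrow> ip (A x) x \<le> 0"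
    and bounded_inverse: "\<exists>K. \<forall>f\<in>H. \<exists>x\<in>D. A x = f \<and> N x \<le> K * N f"
begin

lemma D_zero [simp, intro]: "0 \<in> D"
  and D_add [simp, intro]: "x \<in> D \<Longrightarrow> y \<in> D \<Longrightarrow> x + y \<in> D"
  and D_diff [simp, intro]: "x \<in> D \<Longrightarrow> y \<in> D \<Longrightarrow> x - y \<in> D"
  and D_scale [simp, intro]: "x \<in> D \<Longrightarrow> r *\<^sub>R x \<in> D"
  and D_minus [simp, intro]: "x \<in> D \<Longrightarrow> - x \<in> D"
  using subspace_D
  by (auto simp: subspace_0 subspace_add subspace_diff subspace_scale subspace_neg)

lemma D_imp_H [simp, intro]: "x \<in> D \<Longrightarrow> x \<in> H" using D_H by blast

lemma A_in_H [simp, intro]: "x \<in> D \<Longrightarrow> A x \<in> H" by (rule A_H)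

lemma A_diff: "x \<in> D \<Longrightarrow> y \<in> D \<Longrightarrow> A (x - y) = A x - A y"
  using A_add[of x "(-1) *\<^sub>R y"] A_scale[of y "-1"] by simp

lemma A_zero [simp]: "A 0 = 0"
  using A_scale[of 0 0] by simp

lemma expansive:
  assumes "x \<in> D" "0 \<le> h" shows "N x \<le> N (x - h *\<^sub>R A x)"
proof -
  have "(N x)\<^sup>2 \<le> ip x x - h * ip (A x) x"
    using assms dissipative[of x] by (simp add: N_sq mult_nonneg_nonpos)
  also have "\<dots> = ip (x - h *\<^sub>R A x) x" using assms by (simp add: ip_simps)
  also have "\<dots> \<le> N (x - h *\<^sub>R A x) * N x" using assms by (intro Cauchy_Schwarz) auto
  finally have *: "N x * N x \<le> N (x - h *\<^sub>R A x) * N x" by (simp add: power2_eq_square)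
  show ?thesis
  proof (cases "N x = 0")
    case False
    then have "N x > 0" using N_nonneg[OF D_imp_H[OF assms(1)]] by simp
    then show ?thesis using * by simp
  qed (use assms in auto)
qed

definition solvable :: "real \<Rightarrow> bool" where
  "solvable h \<longleftrightarrow> (\<forall>f\<in>H. \<exists>x\<in>D. x - h *\<^sub>R A x = f)"

text \<open>For large \<open>h\<close> the operator \<open>I - h A\<close> is a small perturbation of \<open>- h A\<close>, which is invertible.  This needs the inverse to
be single valued, and dissipativity gives that: if \<open>A u = 0\<close> and \<open>A z = u\<close>, then testing it at \<open>u + s z\<close> yields
\<open>s |u|\<^sup>2 + s\<^sup>2 \<langle>u, z\<rangle> \<le> 0\<close> for every \<open>s\<close>, which for small \<open>s > 0\<close> is possible only if \<open>u = 0\<close>.\<close>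

lemma solvable_large: "\<exists>K>0. \<forall>h>K. solvable h"
proof -
  from bounded_inverse obtain K where K: "\<forall>f\<in>H. \<exists>x\<in>D. A x = f \<and> N x \<le> K * N f" ..
  have ker: "u = 0" if u: "u \<in> D" "A u = 0" for u
  proof (rule ccontr)
    assume "u \<noteq> 0"
    obtain z where z: "z \<in> D" "A z = u" using K D_imp_H[OF u(1)] by blast
    define a g c where "a = ip u u" and "g = ip u z" and "c = \<bar>g\<bar> + 1"
    have "a \<noteq> 0" using ip_definite[of u] u(1) \<open>u \<noteq> 0\<close> by (auto simp: a_def)
    then have a: "a > 0" using ip_nonneg[OF D_imp_H[OF u(1)]] by (simp add: a_def)
    have "ip (A (u + s *\<^sub>R z)) (u + s *\<^sub>R z) = s * (a + s * g)" for s
      using u z by (simp add: A_add A_scale ip_scale ip_scale2 ip_add2 a_def g_def distrib_left)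
    moreover have "ip (A (u + s *\<^sub>R z)) (u + s *\<^sub>R z) \<le> 0" for s
      by (intro dissipative D_add D_scale u z)
    ultimately have q: "s * (a + s * g) \<le> 0" for s by metis
    have c: "c > 0" by (simp add: c_def add_nonneg_pos)
    then have "a / c > 0" using a by simp
    then have "a + (a / c) * g \<le> 0" using q[of "a / c"] by (meson mult_pos_pos not_le)
    moreover have "a * \<bar>g\<bar> < a * c" using a by (simp add: c_def)
    then have "(a / c) * \<bar>g\<bar> < a" using c by (simp add: field_simps)
    moreover have "(a / c) * (- g) \<le> (a / c) * \<bar>g\<bar>"
      using a c by (intro mult_left_mono) auto
    ultimately show False by simp
  qed
  have inj: "x = y" if "x \<in> D" "y \<in> D" "A x = A y" for x y
  proof -
    have "A (x - y) = 0" using that A_diff[of x y] by simp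
    then have "x - y = 0" by (rule ker[rotated]) (use that in auto)
    then show "x = y" by simp
  qed
  have "\<forall>f\<in>H. \<exists>x. x \<in> D \<and> A x = f \<and> N x \<le> K * N f" using K by blast
  from bchoice[OF this] obtain B where B': "\<forall>f\<in>H. B f \<in> D \<and> A (B f) = f \<and> N (B f) \<le> K * N f" ..
  then have B: "B f \<in> D" "A (B f) = f" "N (B f) \<le> K * N f" if "f \<in> H" for f
    using that by auto
  have Bdiff: "B f - B g = B (f - g)" if "f \<in> H" "g \<in> H" for f g
    by (rule inj) (use that B in \<open>auto simp: A_diff\<close>)
  have "solvable h" if h: "h > \<bar>K\<bar> + 1" for h
    unfolding solvable_def
  proof
    fix f assume f: "f \<in> H"
    \<comment> \<open>With \<open>x = B z\<close> the equation \<open>x - h A x = f\<close> reads \<open>z = (B z - f) / h\<close>.\<close>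
    have "\<exists>z\<in>H. (1 / h) *\<^sub>R (B z - f) = z"
    proof (rule contraction_fixed_point)
      show "0 \<le> \<bar>K\<bar> / h" "\<bar>K\<bar> / h < 1" using h by auto
      fix x y assume xy: "x \<in> H" "y \<in> H"
      have "N ((1 / h) *\<^sub>R (B x - f) - (1 / h) *\<^sub>R (B y - f)) = N ((1 / h) *\<^sub>R B (x - y))"
        using xy by (simp add: Bdiff flip: scaleR_diff_right)
      also have "\<dots> \<le> (1 / h) * (K * N (x - y))"
        using xy h B[of "x - y"] by (simp add: N_scale divide_right_mono)
      also have "\<dots> \<le> (1 / h) * (\<bar>K\<bar> * N (x - y))"
        using xy h by (intro mult_left_mono mult_right_mono) auto
      finally show "N ((1 / h) *\<^sub>R (B x - f) - (1 / h) *\<^sub>R (B y - f)) \<le> \<bar>K\<bar> / h * N (x - y)" by simp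
    qed (use f B in auto)
    then obtain z where z: "z \<in> H" "(1 / h) *\<^sub>R (B z - f) = z" by blast
    have "h *\<^sub>R z = h *\<^sub>R ((1 / h) *\<^sub>R (B z - f))" by (simp only: z(2))
    moreover have "h \<noteq> 0" using h by auto
    ultimately have "B z - f = h *\<^sub>R z" by simp
    then show "\<exists>x\<in>D. x - h *\<^sub>R A x = f"
      using B[OF z(1)] by (intro bexI[of _ "B z"]) (auto simp: algebra_simps)
  qed
  then show ?thesis by (intro exI[of _ "\<bar>K\<bar> + 1"]) auto
qed

text \<open>Solvability propagates from \<open>h\<close> to smaller \<open>h'\<close>: with \<open>q = h / h' - 1\<close> the equation \<open>x - h' A x = f\<close> is equivalent to
\<open>x - h A x = (1 + q) f - q x\<close>, and since the solution operator for \<open>h\<close> does not increase the norm this is a fixed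
point equation for a contraction as long as \<open>q < 1\<close>, that is \<open>h' > h / 2\<close>.\<close>

lemma solvable_smaller:
  assumes "solvable h" "0 < h'" "h / 2 < h'" "h' \<le> h"
  shows "solvable h'"
  unfolding solvable_def
proof
  fix f assume f: "f \<in> H"
  have "\<forall>f\<in>H. \<exists>x. x \<in> D \<and> x - h *\<^sub>R A x = f" using assms(1) unfolding solvable_def by blast
  then obtain R where R: "\<And>f. f \<in> H \<Longrightarrow> R f \<in> D" "\<And>f. f \<in> H \<Longrightarrow> R f - h *\<^sub>R A (R f) = f"
    by metis
  have lip: "N (R f - R g) \<le> N (f - g)" if "f \<in> H" "g \<in> H" for f g
  proof -
    have "(R f - R g) - h *\<^sub>R A (R f - R g) = (R f - h *\<^sub>R A (R f)) - (R g - h *\<^sub>R A (R g))"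
      using R(1) that by (simp add: A_diff algebra_simps)
    also have "\<dots> = f - g" using R(2) that by simp
    finally have "(R f - R g) - h *\<^sub>R A (R f - R g) = f - g" .
    then show ?thesis using expansive[of "R f - R g" h] R(1) that assms by auto
  qed
  define q where "q = h / h' - 1"
  have q: "0 \<le> q" "q < 1" using assms by (auto simp: q_def field_simps)
  have "\<exists>x\<in>H. R ((1 + q) *\<^sub>R f - q *\<^sub>R x) = x"
  proof (rule contraction_fixed_point)
    fix x y assume xy: "x \<in> H" "y \<in> H"
    have "N (R ((1 + q) *\<^sub>R f - q *\<^sub>R x) - R ((1 + q) *\<^sub>R f - q *\<^sub>R y))
        \<le> N (q *\<^sub>R (y - x))"
      using lip[of "(1 + q) *\<^sub>R f - q *\<^sub>R x" "(1 + q) *\<^sub>R f - q *\<^sub>R y"] xy f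
      by (simp add: algebra_simps)
    also have "\<dots> = q * N (x - y)" using xy q N_diff_commute by (simp add: N_scale)
    finally show "N (R ((1 + q) *\<^sub>R f - q *\<^sub>R x) - R ((1 + q) *\<^sub>R f - q *\<^sub>R y)) \<le> q * N (x - y)" .
  qed (use q R f in auto)
  then obtain x where x: "x \<in> H" "R ((1 + q) *\<^sub>R f - q *\<^sub>R x) = x" by blast
  have xD: "x \<in> D" using R(1)[of "(1 + q) *\<^sub>R f - q *\<^sub>R x"] x f by auto
  have "x - h *\<^sub>R A x = (1 + q) *\<^sub>R f - q *\<^sub>R x" using R(2)[of "(1 + q) *\<^sub>R f - q *\<^sub>R x"] x f by auto
  then have "(1 + q) *\<^sub>R x - h *\<^sub>R A x = (1 + q) *\<^sub>R f" by (simp add: algebra_simps)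
  moreover have "h = (1 + q) * h'" using assms by (simp add: q_def)
  ultimately have "(1 + q) *\<^sub>R (x - h' *\<^sub>R A x) = (1 + q) *\<^sub>R f" by (simp add: algebra_simps)
  then have "x - h' *\<^sub>R A x = f" using q by simp
  then show "\<exists>x\<in>D. x - h' *\<^sub>R A x = f" using xD by blast
qed

text \<open>Continuation from a large \<open>h\<close> downwards; the ratio \<open>2/3\<close> may be any number in \<open>(1/2, 1)\<close>, so that each step is
covered by the preceding lemma.\<close>

lemma solvable_pos: assumes "0 < h" shows "solvable h"
proof -
  obtain K where K: "K > 0" "\<And>h. h > K \<Longrightarrow> solvable h" using solvable_large by blast
  have "solvable h" if "(2/3) ^ n * (K + 1) \<le> h" for n h
    using that
  proof (induction n arbitrary: h)
    case (Suc n)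
    have "2/3 * ((2/3) ^ n * (K + 1)) \<le> h" using Suc.prems by (simp only: power_Suc mult.assoc)
    then have le: "(2/3) ^ n * (K + 1) \<le> 3/2 * h" by simp
    then have "solvable (3/2 * h)" by (rule Suc.IH)
    have "0 < (2/3 :: real) ^ n" by (rule zero_less_power) simp
    then have "0 < (2/3) ^ n * (K + 1)" using K(1) by (intro mult_pos_pos) linarith+
    then have "0 < 3/2 * h" using le by (rule less_le_trans)
    then have "h > 0" by simp
    show ?case
      by (rule solvable_smaller[OF \<open>solvable (3/2 * h)\<close>]) (use \<open>h > 0\<close> in auto)
  qed (use K in auto)
  moreover obtain n where "(2/3) ^ n < h / (K + 1)"
    using real_arch_pow_inv[of "h / (K + 1)" "2/3"] assms K by auto
  then have "(2/3) ^ n * (K + 1) \<le> h" using K by (simp add: pos_less_divide_eq)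
  ultimately show ?thesis by blast
qed

text \<open>The distance of \<open>x\<close> to \<open>D\<close> is approached by a sequence that is Cauchy by the parallelogram law; its limit \<open>y\<close> leaves a
residual \<open>z = x - y\<close> orthogonal to \<open>D\<close>.  Writing \<open>z = w - A w\<close> with \<open>w\<close> in \<open>D\<close> gives
\<open>0 = \<langle>z, w\<rangle> = |w|\<^sup>2 - \<langle>A w, w\<rangle> \<ge> |w|\<^sup>2\<close>, hence \<open>z = 0\<close>.\<close>

lemma dense:
  assumes x: "x \<in> H" and "e > 0" shows "\<exists>d\<in>D. N (x - d) < e"
proof -
  define \<delta> where "\<delta> = Inf ((\<lambda>d. (N (x - d))\<^sup>2) ` D)"
  have bdd: "bdd_below ((\<lambda>d. (N (x - d))\<^sup>2) ` D)" by (rule bdd_belowI[of _ 0]) auto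
  have \<delta>: "\<delta> \<le> (N (x - d))\<^sup>2" if "d \<in> D" for d
    unfolding \<delta>_def using that bdd by (intro cInf_lower) auto
  have "\<exists>d\<in>D. (N (x - d))\<^sup>2 < \<delta> + 1 / Suc n" for n
  proof -
    have "\<exists>y\<in>(\<lambda>d. (N (x - d))\<^sup>2) ` D. y < \<delta> + 1 / Suc n"
      using cInf_lessD[of "(\<lambda>d. (N (x - d))\<^sup>2) ` D" "\<delta> + 1 / Suc n"] D_zero unfolding \<delta>_def by force
    then show ?thesis by blast
  qed
  then obtain d where d: "\<And>n. d n \<in> D" and dmin: "\<And>n. (N (x - d n))\<^sup>2 < \<delta> + 1 / Suc n"
    by metis
  have close: "(N (d m - d n))\<^sup>2 \<le> 2 / Suc m + 2 / Suc n" for m n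
  proof -
    have mid: "\<delta> \<le> (N (x - (1/2) *\<^sub>R (d m + d n)))\<^sup>2" using d by (intro \<delta>) auto
    have "(N (2 *\<^sub>R (x - (1/2) *\<^sub>R (d m + d n))))\<^sup>2 = 4 * (N (x - (1/2) *\<^sub>R (d m + d n)))\<^sup>2"
      using d x by (subst N_scale) (auto simp: power_mult_distrib)
    moreover have "2 *\<^sub>R (x - (1/2) *\<^sub>R (d m + d n)) = (x - d m) + (x - d n)"
      by (simp add: algebra_simps scaleR_2)
    moreover have "(N ((x - d m) + (x - d n)))\<^sup>2 + (N ((x - d m) - (x - d n)))\<^sup>2
        = 2 * (N (x - d m))\<^sup>2 + 2 * (N (x - d n))\<^sup>2"
      using d x by (intro parallelogram) auto
    moreover have "N ((x - d m) - (x - d n)) = N (d m - d n)"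
      using d N_diff_commute[of "d n" "d m"] by simp
    ultimately show ?thesis using mid dmin[of m] dmin[of n] by simp
  qed
  have "\<exists>y\<in>H. (\<lambda>n. N (d n - y)) \<longlonglongrightarrow> 0"
  proof (rule complete)
    fix e :: real assume "e > 0"
    obtain M where M: "inverse (Suc M) < e\<^sup>2 / 4"
      using reals_Archimedean[of "e\<^sup>2 / 4"] \<open>e > 0\<close> by auto
    show "\<exists>M. \<forall>m\<ge>M. \<forall>n\<ge>M. N (d m - d n) < e"
    proof (intro exI allI impI)
      fix m n assume mn: "M \<le> m" "M \<le> n"
      then have "1 / Suc m \<le> 1 / Suc M" "1 / Suc n \<le> 1 / Suc M"
        by (auto intro!: divide_left_mono)
      then have "(N (d m - d n))\<^sup>2 < e\<^sup>2" using close[of m n] M by (simp add: inverse_eq_divide)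
      then show "N (d m - d n) < e" using \<open>e > 0\<close> by (simp add: power2_less_imp_less)
    qed
  qed (use d in auto)
  then obtain y where y: "y \<in> H" "(\<lambda>n. N (d n - y)) \<longlonglongrightarrow> 0" by blast
  define z where "z = x - y"
  have z: "z \<in> H" using x y by (simp add: z_def)
  have lim: "(\<lambda>n. N ((x - d n) - z')) \<longlonglongrightarrow> 0" if "z' = z" for z'
    using y N_diff_commute[OF D_imp_H[OF d] y(1)] by (simp add: that z_def)
  have zmin: "(N z)\<^sup>2 \<le> \<delta>"
  proof -
    have "(\<lambda>n. (N (x - d n))\<^sup>2) \<longlonglongrightarrow> (N z)\<^sup>2"
      by (intro tendsto_power N_tendsto lim) (use x d z in auto)
    moreover have "(\<lambda>n. \<delta> + 1 / Suc n) \<longlonglongrightarrow> \<delta> + 0"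
      by (intro tendsto_add tendsto_const LIMSEQ_Suc[OF lim_inverse_n'])
    ultimately show ?thesis
      using dmin by (intro LIMSEQ_le[of _ _ "\<lambda>n. \<delta> + 1 / Suc n"]) (auto intro: less_imp_le)
  qed
  have orth: "ip z w = 0" if w: "w \<in> D" for w
  proof -
    have "\<delta> \<le> (N (z + t *\<^sub>R w))\<^sup>2" for t
    proof -
      have "(\<lambda>n. (N (x - d n + t *\<^sub>R w))\<^sup>2) \<longlonglongrightarrow> (N (z + t *\<^sub>R w))\<^sup>2"
        by (intro tendsto_power N_tendsto) (use x d z w lim in auto)
      moreover have "\<delta> \<le> (N (x - d n + t *\<^sub>R w))\<^sup>2" for n
        using \<delta>[of "d n - t *\<^sub>R w"] d w by (simp add: algebra_simps)
      ultimately show ?thesis by (meson LIMSEQ_le_const)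
    qed
    note lower = this
    have eq: "(N (z + t *\<^sub>R w))\<^sup>2 = (N z)\<^sup>2 + (2 * t * ip z w + t\<^sup>2 * ip w w)" for t
      using z w ip_sym[of z w]
      by (simp add: N_sq ip_add ip_add2 ip_scale ip_scale2) (simp add: power2_eq_square algebra_simps)
    have q: "0 \<le> 2 * t * ip z w + t\<^sup>2 * ip w w" for t
    proof -
      have "(N z)\<^sup>2 \<le> (N z)\<^sup>2 + (2 * t * ip z w + t\<^sup>2 * ip w w)"
        using order_trans[OF zmin lower[of t]] eq[of t] by simp
      then show ?thesis by simp
    qed
    define c where "c = ip w w + 1"
    have c: "c > 0" "ip w w < c" using ip_nonneg[of w] w by (auto simp: c_def)
    \<comment> \<open>The quadratic in \<open>t\<close> is nonnegative; at \<open>t = - \<langle>z, w\<rangle> / c\<close> with \<open>c > |w|\<^sup>2\<close> this forces \<open>\<langle>z, w\<rangle> = 0\<close>,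
      also when \<open>w = 0\<close>.\<close>
    have "0 \<le> 2 * (- ip z w / c) * ip z w + (- ip z w / c)\<^sup>2 * ip w w" by (rule q)
    also have "\<dots> \<le> 2 * (- ip z w / c) * ip z w + (- ip z w / c)\<^sup>2 * c"
      using c by (intro add_left_mono mult_left_mono) auto
    also have "\<dots> = - (ip z w)\<^sup>2 / c" using c by (simp add: field_simps power2_eq_square)
    finally show ?thesis using c by (simp add: divide_le_0_iff zero_le_divide_iff)
  qed
  obtain w where w: "w \<in> D" "w - 1 *\<^sub>R A w = z"
    using solvable_pos[of 1] z unfolding solvable_def by auto
  have "ip w w \<le> ip w w - ip (A w) w" using dissipative[OF w(1)] by simp
  also have "\<dots> = ip z w" using w by (simp add: ip_simps flip: w(2))
  finally have "ip w w = 0" using orth[OF w(1)] ip_nonneg[of w] w by simp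
  then have "w = 0" using w by (intro ip_definite) auto
  then have "x = y" using w by (simp add: z_def)
  then have "\<forall>\<^sub>F n in sequentially. N (d n - x) < e"
    using order_tendstoD(2)[OF y(2) \<open>e > 0\<close>] by simp
  then obtain n where "N (d n - x) < e" by (auto simp: eventually_sequentially)
  then have "N (x - d n) < e" using N_diff_commute[OF D_imp_H[OF d] x] by simp
  then show ?thesis using d by blast
qed

section \<open>Resolvents and their powers\<close>

text \<open>The resolvent \<open>(I - h A)\<^sup>-\<^sup>1\<close>: one step of the implicit Euler scheme with step size \<open>h\<close>.\<close>

definition R :: "real \<Rightarrow> 'v \<Rightarrow> 'v" where
  "R h f = (SOME x. x \<in> D \<and> x - h *\<^sub>R A x = f)"

lemma R_D [simp, intro]: "0 < h \<Longrightarrow> f \<in> H \<Longrightarrow> R h f \<in> D"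
  and R_eq: "0 < h \<Longrightarrow> f \<in> H \<Longrightarrow> R h f - h *\<^sub>R A (R h f) = f"
proof -
  assume "0 < h" "f \<in> H"
  then have "\<exists>x. x \<in> D \<and> x - h *\<^sub>R A x = f" using solvable_pos unfolding solvable_def by blast
  from someI_ex[OF this] show "R h f \<in> D" "R h f - h *\<^sub>R A (R h f) = f" by (simp_all add: R_def)
qed

lemma R_unique:
  assumes "0 < h" "x \<in> D" "x - h *\<^sub>R A x = f" shows "R h f = x"
proof -
  have f: "f \<in> H" using assms(2) by (auto simp flip: assms(3))
  let ?y = "R h f - x"
  have "?y - h *\<^sub>R A ?y = (R h f - h *\<^sub>R A (R h f)) - (x - h *\<^sub>R A x)"
    using assms(1,2) f by (simp add: A_diff scaleR_diff_right)
  also have "\<dots> = 0" using assms f by (simp add: R_eq)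
  finally have "N ?y \<le> 0"
    using expansive[of ?y h] assms(1,2) f by simp
  then have "?y = 0" by (rule N_le_0[rotated]) (use assms(1,2) f in auto)
  then show ?thesis by simp
qed

lemma R_add: "0 < h \<Longrightarrow> f \<in> H \<Longrightarrow> g \<in> H \<Longrightarrow> R h (f + g) = R h f + R h g"
proof (rule R_unique)
  assume h: "0 < h" "f \<in> H" "g \<in> H"
  have "R h f + R h g - h *\<^sub>R A (R h f + R h g)
      = (R h f - h *\<^sub>R A (R h f)) + (R h g - h *\<^sub>R A (R h g))"
    using h by (simp add: A_add scaleR_add_right)
  then show "R h f + R h g - h *\<^sub>R A (R h f + R h g) = f + g" by (simp add: R_eq h)
qed auto

lemma R_scale: "0 < h \<Longrightarrow> f \<in> H \<Longrightarrow> R h (r *\<^sub>R f) = r *\<^sub>R R h f"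
proof (rule R_unique)
  assume h: "0 < h" "f \<in> H"
  have "r *\<^sub>R R h f - h *\<^sub>R A (r *\<^sub>R R h f) = r *\<^sub>R (R h f - h *\<^sub>R A (R h f))"
    using h by (simp add: A_scale scaleR_diff_right)
  then show "r *\<^sub>R R h f - h *\<^sub>R A (r *\<^sub>R R h f) = r *\<^sub>R f" by (simp add: R_eq h)
qed auto

lemma R_diff: "0 < h \<Longrightarrow> f \<in> H \<Longrightarrow> g \<in> H \<Longrightarrow> R h (f - g) = R h f - R h g"
  using R_add[of h f "(-1) *\<^sub>R g"] R_scale[of h g "-1"] by simp

lemma R_contraction: assumes "0 < h" "f \<in> H" shows "N (R h f) \<le> N f"
  using expansive[of "R h f" h] assms by (simp add: R_eq)

lemma A_R: assumes "0 < h" "x \<in> D"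
  shows "A (R h x) = R h (A x)" and "A (R h x) \<in> D"
proof -
  have e: "h *\<^sub>R A (R h x) = R h x - x" using R_eq[of h x] assms by (simp add: algebra_simps)
  then have "A (R h x) = (1 / h) *\<^sub>R (R h x - x)" using assms
    by (metis less_irrefl nonzero_divide_eq_eq scaleR_one scaleR_scaleR)
  then show D: "A (R h x) \<in> D" using assms by simp
  have "A (R h x) - h *\<^sub>R A (A (R h x)) = A (R h x - h *\<^sub>R A (R h x))"
    using assms D by (simp add: A_diff A_scale)
  also have "\<dots> = A x" using assms by (simp add: R_eq)
  finally show "A (R h x) = R h (A x)" by (rule R_unique[symmetric, OF assms(1) D])
qed

lemma R_near: assumes "0 < h" "x \<in> D" shows "N (R h x - x) \<le> h * N (A x)"
proof -
  have "R h x - x = h *\<^sub>R R h (A x)"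
    using R_eq[of h x] A_R(1)[OF assms] assms by (simp add: algebra_simps)
  then show ?thesis using R_contraction[of h "A x"] assms by (simp add: N_scale)
qed

lemma Rn_H [simp, intro]: "0 < h \<Longrightarrow> x \<in> H \<Longrightarrow> (R h ^^ n) x \<in> H"
  by (induction n) auto

lemma Rn_D [simp, intro]: "0 < h \<Longrightarrow> x \<in> D \<Longrightarrow> (R h ^^ n) x \<in> D"
  by (induction n) auto

lemma Rn_add: "0 < h \<Longrightarrow> x \<in> H \<Longrightarrow> y \<in> H \<Longrightarrow> (R h ^^ n) (x + y) = (R h ^^ n) x + (R h ^^ n) y"
  by (induction n) (auto simp: R_add)

lemma Rn_diff: "0 < h \<Longrightarrow> x \<in> H \<Longrightarrow> y \<in> H \<Longrightarrow> (R h ^^ n) (x - y) = (R h ^^ n) x - (R h ^^ n) y"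
  by (induction n) (auto simp: R_diff)

lemma Rn_contraction: "0 < h \<Longrightarrow> x \<in> H \<Longrightarrow> N ((R h ^^ n) x) \<le> N x"
proof (induction n)
  case (Suc n)
  then have "N (R h ((R h ^^ n) x)) \<le> N ((R h ^^ n) x)" by (intro R_contraction) auto
  with Suc show ?case by simp
qed auto

lemma A_Rn: "0 < h \<Longrightarrow> x \<in> D \<Longrightarrow> A ((R h ^^ n) x) = (R h ^^ n) (A x)"
  by (induction n) (auto simp: A_R)

lemma Rn_near: assumes h: "0 < h" and x: "x \<in> D" shows "N ((R h ^^ n) x - x) \<le> n * h * N (A x)"
proof (induction n)
  case (Suc n)
  have "N (R h ((R h ^^ n) x) - (R h ^^ n) x) \<le> h * N (A ((R h ^^ n) x))"
    using assms by (intro R_near) auto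
  also have "\<dots> \<le> h * N (A x)"
    using assms Rn_contraction[of h "A x" n] by (simp add: A_Rn)
  finally show ?case
    using Suc N_triangle_through[of "R h ((R h ^^ n) x)" "(R h ^^ n) x" x] assms
    by (simp add: algebra_simps)
qed auto

text \<open>On \<open>D\<close> the scheme is Lipschitz in time, uniformly in the step size.  This absorbs every difference of one step
caused by rounding times down to multiples of the step size.\<close>

lemma Rn_lipschitz:
  assumes h: "0 < h" and x: "x \<in> D" and "m \<le> n"
  shows "N ((R h ^^ n) x - (R h ^^ m) x) \<le> (real n - real m) * h * N (A x)"
proof -
  have "(R h ^^ n) x = (R h ^^ m) ((R h ^^ (n - m)) x)"
    using assms(3) by (simp flip: funpow_add[THEN fun_cong, unfolded o_def])
  then have "N ((R h ^^ n) x - (R h ^^ m) x) = N ((R h ^^ m) ((R h ^^ (n - m)) x - x))"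
    using assms by (simp add: Rn_diff)
  also have "\<dots> \<le> N ((R h ^^ (n - m)) x - x)" using assms by (intro Rn_contraction) auto
  also have "\<dots> \<le> real (n - m) * h * N (A x)" by (rule Rn_near[OF h x])
  finally show ?thesis using assms(3) by (simp add: of_nat_diff)
qed

text \<open>One step compared with two steps of half the size: \<open>(I - (h/2) A)\<^sup>2 = (I - h A) + (h\<^sup>2/4) A\<^sup>2\<close>, so the two results differ by
\<open>h\<^sup>2/4\<close> times resolvents applied to \<open>A\<^sup>2 x\<close>.\<close>

lemma R_halving:
  assumes h: "0 < h" and x: "x \<in> D" "A x \<in> D"
  shows "N (R h x - R (h/2) (R (h/2) x)) \<le> h\<^sup>2 / 4 * N (A (A x))"
proof -
  define k where "k = h / 2"
  have k: "0 < k" using h by (simp add: k_def)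
  define z y where "z = R k x" and "y = R k z"
  have z: "z \<in> D" "z - k *\<^sub>R A z = x"
    unfolding z_def using k x(1) by (auto intro: R_eq)
  have y: "y \<in> D" "A y \<in> D" "y - k *\<^sub>R A y = z"
    unfolding y_def using k z(1) by (auto intro: A_R(2) R_eq)
  have AAy: "A (A y) = R k (R k (A (A x)))"
  proof -
    have "A y = R k (R k (A x))" using k x z(1) A_R(1)[OF k x(1)] A_R(1)[OF k z(1)]
      by (simp add: y_def z_def)
    then show ?thesis using A_R(1)[OF k x(2)] A_R(1)[OF k R_D[OF k D_imp_H[OF x(2)]]] by simp
  qed
  have "A z = A y - k *\<^sub>R A (A y)"
    using y(1,2) by (simp add: A_diff A_scale flip: y(3))
  then have "x = (y - k *\<^sub>R A y) - k *\<^sub>R (A y - k *\<^sub>R A (A y))" using y(3) z(2) by simp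
  also have "\<dots> = y - (2 * k) *\<^sub>R A y + (k * k) *\<^sub>R A (A y)"
    by (simp add: scaleR_diff_right scaleR_2 flip: scaleR_scaleR)
  finally have "y - h *\<^sub>R A y = x - (k * k) *\<^sub>R A (A y)" by (simp add: k_def)
  then have "R h (x - (k * k) *\<^sub>R A (A y)) = y" using h y by (intro R_unique) auto
  then have "R h x - y = (k * k) *\<^sub>R R h (A (A y))"
    using h x y by (simp add: R_diff R_scale algebra_simps)
  then have "N (R h x - y) = k * k * N (R h (A (A y)))" using h y by (simp add: N_scale)
  also have "\<dots> \<le> k * k * N (A (A x))"
  proof (intro mult_left_mono)
    have "N (R h (A (A y))) \<le> N (R k (R k (A (A x))))"
      using R_contraction[OF h A_in_H[OF y(2)]] AAy by simp
    also have "\<dots> \<le> N (R k (A (A x)))" using k x by (intro R_contraction) auto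
    also have "\<dots> \<le> N (A (A x))" using k x by (intro R_contraction) auto
    finally show "N (R h (A (A y))) \<le> N (A (A x))" .
  qed (use k in auto)
  finally show ?thesis by (simp add: k_def z_def y_def power2_eq_square)
qed

text \<open>The local errors add up and are not amplified, since resolvents do not increase the norm and commute with \<open>A\<close>.\<close>

lemma Rn_halving:
  assumes h: "0 < h" and x: "x \<in> D" "A x \<in> D"
  shows "N ((R h ^^ n) x - (R (h/2) ^^ (2 * n)) x) \<le> n * (h\<^sup>2 / 4 * N (A (A x)))"
  using x
proof (induction n arbitrary: x)
  case (Suc n)
  let ?S = "\<lambda>x. R (h/2) (R (h/2) x)"
  have Sx: "?S x \<in> D" "A (?S x) \<in> D" "N (A (A (?S x))) \<le> N (A (A x))"
  proof -
    show "?S x \<in> D" using h Suc.prems by auto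
    show "A (?S x) \<in> D" using h Suc.prems by (intro A_R) auto
    have "A (A (?S x)) = ?S (A (A x))" using h Suc.prems by (simp add: A_R)
    then show "N (A (A (?S x))) \<le> N (A (A x))"
      using Rn_contraction[of "h/2" "A (A x)" 2] h Suc.prems by (simp add: numeral_2_eq_2)
  qed
  have "N ((R h ^^ Suc n) x - (R (h/2) ^^ (2 * Suc n)) x)
      = N ((R h ^^ n) (R h x - ?S x) + ((R h ^^ n) (?S x) - (R (h/2) ^^ (2 * n)) (?S x)))"
    using h Suc.prems by (simp add: Rn_diff funpow_swap1)
  moreover have "N ((R h ^^ n) (R h x - ?S x) + ((R h ^^ n) (?S x) - (R (h/2) ^^ (2 * n)) (?S x)))
      \<le> N ((R h ^^ n) (R h x - ?S x)) + N ((R h ^^ n) (?S x) - (R (h/2) ^^ (2 * n)) (?S x))"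
    using h Suc.prems by (intro N_triangle) auto
  moreover have "N ((R h ^^ n) (R h x - ?S x)) \<le> h\<^sup>2 / 4 * N (A (A x))"
    by (rule order_trans[OF Rn_contraction R_halving]) (use h Suc.prems in auto)
  moreover have "N ((R h ^^ n) (?S x) - (R (h/2) ^^ (2 * n)) (?S x)) \<le> n * (h\<^sup>2 / 4 * N (A (A (?S x))))"
    by (rule Suc.IH[OF Sx(1,2)])
  moreover have "n * (h\<^sup>2 / 4 * N (A (A (?S x)))) \<le> n * (h\<^sup>2 / 4 * N (A (A x)))"
    using Sx(3) by (intro mult_left_mono) auto
  moreover have "Suc n * (h\<^sup>2 / 4 * N (A (A x))) = h\<^sup>2 / 4 * N (A (A x)) + n * (h\<^sup>2 / 4 * N (A (A x)))"
    by (simp add: distrib_right)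
  ultimately show ?case by linarith
qed auto

text \<open>A discrete Taylor formula, uniform in the step size, which survives the passage to the limit and yields the derivative
of the semigroup at \<open>0\<close>.\<close>

lemma Rn_taylor:
  assumes h: "0 < h" and x: "x \<in> D" "A x \<in> D"
  shows "N ((R h ^^ m) x - x - (m * h) *\<^sub>R A x) \<le> (m * h)\<^sup>2 * N (A (A x))"
proof (induction m)
  case (Suc m)
  let ?y = "(R h ^^ m) x"
  have "R h ?y - ?y = h *\<^sub>R A (R h ?y)" using R_eq[OF h, of ?y] h x by (simp add: algebra_simps)
  also have "A (R h ?y) = (R h ^^ Suc m) (A x)" using A_Rn[OF h x(1), of "Suc m"] by simp
  finally have e: "R h ?y - ?y = h *\<^sub>R (R h ^^ Suc m) (A x)" .
  have "(R h ^^ Suc m) x - x - (Suc m * h) *\<^sub>R A x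
      = (?y - x - (m * h) *\<^sub>R A x) + (R h ?y - ?y - h *\<^sub>R A x)"
    by (simp add: distrib_right scaleR_add_left)
  also have "R h ?y - ?y - h *\<^sub>R A x = h *\<^sub>R ((R h ^^ Suc m) (A x) - A x)"
    unfolding e by (simp only: scaleR_diff_right)
  finally have "N ((R h ^^ Suc m) x - x - (Suc m * h) *\<^sub>R A x)
      = N ((?y - x - (m * h) *\<^sub>R A x) + h *\<^sub>R ((R h ^^ Suc m) (A x) - A x))"
    by (rule arg_cong)
  moreover have "N ((?y - x - (m * h) *\<^sub>R A x) + h *\<^sub>R ((R h ^^ Suc m) (A x) - A x))
     \<le> N (?y - x - (m * h) *\<^sub>R A x) + N (h *\<^sub>R ((R h ^^ Suc m) (A x) - A x))"
    by (intro N_triangle H_scale H_diff Rn_H D_imp_H h x)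
  moreover have "N (h *\<^sub>R ((R h ^^ Suc m) (A x) - A x)) = h * N ((R h ^^ Suc m) (A x) - A x)"
    using h by (subst N_scale) (auto intro!: H_diff Rn_H simp: x simp del: funpow.simps)
  moreover have "h * N ((R h ^^ Suc m) (A x) - A x) \<le> h * (Suc m * h * N (A (A x)))"
    by (intro mult_left_mono Rn_near h x less_imp_le[OF h])
  moreover have "((m * h)\<^sup>2 + h * (Suc m * h)) * N (A (A x))
      = (m * h)\<^sup>2 * N (A (A x)) + h * (Suc m * h * N (A (A x)))"
    by (simp only: distrib_right mult.assoc)
  ultimately have "N ((R h ^^ Suc m) x - x - (Suc m * h) *\<^sub>R A x)
     \<le> ((m * h)\<^sup>2 + h * (Suc m * h)) * N (A (A x))" using Suc by linarith
  also have "\<dots> \<le> (Suc m * h)\<^sup>2 * N (A (A x))"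
  proof (intro mult_right_mono)
    have "0 \<le> m * h\<^sup>2" by simp
    then show "(m * h)\<^sup>2 + h * (Suc m * h) \<le> (Suc m * h)\<^sup>2"
      by (simp add: power2_eq_square algebra_simps)
  qed (use x in auto)
  finally show ?case .
qed auto

section \<open>Convergence of the implicit Euler scheme\<close>

lemma R_tendsto:
  assumes x: "x \<in> H" and "e > 0" shows "\<exists>h>0. N (R h x - x) < e"
proof -
  obtain d where d: "d \<in> D" "N (x - d) < e / 3" using dense[OF x, of "e/3"] assms(2) by auto
  define c h where "c = N (A d) + 1" and "h = e / (3 * c)"
  have pos: "c > 0" unfolding c_def using N_nonneg[OF A_H[OF d(1)]] by linarith
  have h: "h > 0" using pos \<open>e > 0\<close> by (simp add: h_def)
  have "h * N (A d) < h * c" using h by (simp add: c_def)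
  also have "\<dots> = e / 3" using pos by (simp add: h_def)
  finally have 1: "N (R h d - d) < e / 3" using R_near[OF h d(1)] by linarith
  have 2: "N (R h x - R h d) \<le> N (x - d)"
    using R_contraction[OF h, of "x - d"] R_diff[OF h x, of d] x d by simp
  have "N (R h x - x) \<le> N (R h x - R h d) + N (R h d - x)"
    using h x d by (intro N_triangle_through) auto
  also have "N (R h d - x) \<le> N (R h d - d) + N (d - x)"
    using h x d by (intro N_triangle_through) auto
  finally have "N (R h x - x) < e"
    using 1 2 d(2) N_diff_commute[OF x D_imp_H[OF d(1)]] by linarith
  then show ?thesis using h by blast
qed

text \<open>The error estimates need \<open>x\<close> in the domain of \<open>A\<^sup>2\<close>; applying a resolvent with small \<open>h\<close> to an element of \<open>D\<close> gets there
with a small change.\<close>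

lemma dense_square:
  assumes x: "x \<in> H" and "e > 0" shows "\<exists>d\<in>D. A d \<in> D \<and> N (x - d) < e"
proof -
  obtain d where d: "d \<in> D" "N (x - d) < e / 2" using dense[OF x, of "e/2"] assms(2) by auto
  obtain h where h: "h > 0" "N (R h d - d) < e / 2" using R_tendsto[of d "e/2"] d assms(2) by auto
  have "N (x - R h d) \<le> N (x - d) + N (d - R h d)"
    using h x d by (intro N_triangle_through) auto
  moreover have "N (d - R h d) = N (R h d - d)"
    using h d by (intro N_diff_commute) auto
  ultimately have "N (x - R h d) < e" using h d by linarith
  then show ?thesis using A_R(2)[OF h(1) d(1)] h d by (intro bexI[of _ "R h d"]) auto
qed

text \<open>Dyadic step sizes make consecutive approximations comparable by halving; time \<open>t\<close> is reached up to one step by rounding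
down the number of steps.\<close>

definition stepsize :: "nat \<Rightarrow> real" where "stepsize j = (1/2) ^ j"

definition steps :: "nat \<Rightarrow> real \<Rightarrow> nat" where "steps j t = nat \<lfloor>t / stepsize j\<rfloor>"

definition euler :: "nat \<Rightarrow> real \<Rightarrow> 'v \<Rightarrow> 'v" where
  "euler j t x = (R (stepsize j) ^^ steps j t) x"

lemma stepsize_pos [simp]: "0 < stepsize j" by (simp add: stepsize_def)

lemma stepsize_Suc: "stepsize (Suc j) = stepsize j / 2" by (simp add: stepsize_def)

lemma stepsize_tendsto: "stepsize \<longlonglongrightarrow> 0"
  unfolding stepsize_def by (intro LIMSEQ_power_zero) auto

lemma steps_bounds:
  assumes "0 \<le> t" shows "steps j t * stepsize j \<le> t" "t < steps j t * stepsize j + stepsize j"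
proof -
  have "real (steps j t) = of_int \<lfloor>t / stepsize j\<rfloor>"
    using assms by (simp add: steps_def less_imp_le)
  then have "real (steps j t) \<le> t / stepsize j" "t / stepsize j < real (steps j t) + 1"
    by linarith+
  then show "steps j t * stepsize j \<le> t" "t < steps j t * stepsize j + stepsize j"
    by (simp_all add: pos_le_divide_eq pos_divide_less_eq distrib_right)
qed

lemma steps_Suc:
  assumes "0 \<le> t" shows "2 * steps j t \<le> steps (Suc j) t" "steps (Suc j) t \<le> 2 * steps j t + 1"
proof -
  have "t / stepsize (Suc j) = 2 * (t / stepsize j)" by (simp add: stepsize_Suc)
  moreover have "0 \<le> t / stepsize j" using assms by (simp add: less_imp_le)
  ultimately show "2 * steps j t \<le> steps (Suc j) t" "steps (Suc j) t \<le> 2 * steps j t + 1"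
    unfolding steps_def by linarith+
qed

lemma steps_add:
  assumes "0 \<le> s" "0 \<le> t"
  shows "steps j s + steps j t \<le> steps j (s + t)" "steps j (s + t) \<le> steps j s + steps j t + 1"
proof -
  have "(s + t) / stepsize j = s / stepsize j + t / stepsize j" by (rule add_divide_distrib)
  moreover have "0 \<le> s / stepsize j" "0 \<le> t / stepsize j" using assms by (simp_all add: less_imp_le)
  ultimately show "steps j s + steps j t \<le> steps j (s + t)" "steps j (s + t) \<le> steps j s + steps j t + 1"
    unfolding steps_def by linarith+
qed

lemma euler_H [simp, intro]: "x \<in> H \<Longrightarrow> euler j t x \<in> H"
  and euler_D [simp, intro]: "x \<in> D \<Longrightarrow> euler j t x \<in> D"
  and euler_add: "x \<in> H \<Longrightarrow> y \<in> H \<Longrightarrow> euler j t (x + y) = euler j t x + euler j t y"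
  and euler_diff: "x \<in> H \<Longrightarrow> y \<in> H \<Longrightarrow> euler j t (x - y) = euler j t x - euler j t y"
  and euler_contraction: "x \<in> H \<Longrightarrow> N (euler j t x) \<le> N x"
  unfolding euler_def by (auto simp: Rn_add Rn_diff Rn_contraction)

lemma euler_lipschitz: "x \<in> H \<Longrightarrow> y \<in> H \<Longrightarrow> N (euler j t x - euler j t y) \<le> N (x - y)"
  using euler_contraction[of "x - y" j t] by (simp add: euler_diff)

text \<open>Halving the step size in \<open>steps j t\<close> steps costs at most a multiple of \<open>t\<close> times the step size; passing to level \<open>j + 1\<close> may in addition
require one more half step, since rounding down at the two levels can differ by that much.\<close>

lemma euler_step:
  assumes x: "x \<in> D" "A x \<in> D" and t: "0 \<le> t"
  shows "N (euler (Suc j) t x - euler j t x) \<le> (N (A x) + t * N (A (A x))) * (1/2) ^ j"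
proof -
  let ?h = "stepsize j" and ?m = "steps j t" and ?m' = "steps (Suc j) t"
  let ?y = "(R (?h/2) ^^ (2 * ?m)) x"
  have h: "?h > 0" "?h/2 > 0" by simp_all
  have nn: "0 \<le> N (A x)" "0 \<le> N (A (A x))" using x by simp_all
  have "N (euler (Suc j) t x - ?y) \<le> (real ?m' - real (2 * ?m)) * (?h/2) * N (A x)"
    unfolding euler_def stepsize_Suc by (intro Rn_lipschitz h x steps_Suc t)
  also have "\<dots> \<le> 1 * ?h * N (A x)"
    using steps_Suc[OF t, of j] h nn by (intro mult_right_mono mult_mono) (auto intro: less_imp_le)
  finally have 1: "N (euler (Suc j) t x - ?y) \<le> ?h * N (A x)" by simp
  have "N (euler j t x - ?y) \<le> ?m * (?h\<^sup>2 / 4 * N (A (A x)))"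
    unfolding euler_def by (intro Rn_halving h x)
  also have "\<dots> = (?m * ?h) * (?h / 4 * N (A (A x)))" by (simp add: power2_eq_square)
  also have "\<dots> \<le> t * (?h * N (A (A x)))"
    using steps_bounds[OF t, of j] h nn t by (intro mult_mono mult_right_mono) auto
  finally have 2: "N (euler j t x - ?y) \<le> t * (?h * N (A (A x)))" .
  have yH: "?y \<in> H" using x by auto
  have "N (euler (Suc j) t x - euler j t x) \<le> N (euler (Suc j) t x - ?y) + N (?y - euler j t x)"
    using x yH by (intro N_triangle_through) auto
  moreover have "N (?y - euler j t x) = N (euler j t x - ?y)"
    using x yH by (intro N_diff_commute) auto
  ultimately have "N (euler (Suc j) t x - euler j t x) \<le> ?h * N (A x) + t * (?h * N (A (A x)))"
    using 1 2 by linarith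
  then show ?thesis by (simp add: stepsize_def algebra_simps)
qed

lemma euler_converges:
  assumes x: "x \<in> H" and t: "0 \<le> t"
  shows "\<exists>y\<in>H. (\<lambda>j. N (euler j t x - y)) \<longlonglongrightarrow> 0"
proof (rule complete)
  fix e :: real assume "e > 0"
  obtain d where d: "d \<in> D" "A d \<in> D" "N (x - d) < e / 4"
    using dense_square[OF x, of "e/4"] \<open>e > 0\<close> by auto
  have "\<exists>y\<in>H. (\<lambda>j. N (euler j t d - y)) \<longlonglongrightarrow> 0"
    by (rule geometric_limit[of _ "1/2" "N (A d) + t * N (A (A d))"])
      (use d t euler_step in auto)
  then obtain y where y: "y \<in> H" "(\<lambda>j. N (euler j t d - y)) \<longlonglongrightarrow> 0" by blast
  have "\<forall>\<^sub>F j in sequentially. N (euler j t d - y) < e / 4"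
    by (rule order_tendstoD(2)[OF y(2)]) (use \<open>e > 0\<close> in simp)
  then obtain M where M: "\<And>j. j \<ge> M \<Longrightarrow> N (euler j t d - y) < e / 4"
    by (auto simp: eventually_sequentially)
  have near: "N (euler j t x - y) < e / 2" if "j \<ge> M" for j
  proof -
    have "N (euler j t x - y) \<le> N (euler j t x - euler j t d) + N (euler j t d - y)"
      using x d y by (intro N_triangle_through) auto
    moreover have "N (euler j t x - euler j t d) \<le> N (x - d)"
      using x d by (intro euler_lipschitz) auto
    ultimately show ?thesis using M[OF that] d(3) by linarith
  qed
  show "\<exists>M. \<forall>m\<ge>M. \<forall>n\<ge>M. N (euler m t x - euler n t x) < e"
  proof (intro exI allI impI)
    fix m n assume mn: "M \<le> m" "M \<le> n"
    have "N (euler m t x - euler n t x) \<le> N (euler m t x - y) + N (y - euler n t x)"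
      using x y by (intro N_triangle_through) auto
    moreover have "N (y - euler n t x) = N (euler n t x - y)"
      using x y by (intro N_diff_commute) auto
    ultimately show "N (euler m t x - euler n t x) < e"
      using near[OF mn(1)] near[OF mn(2)] by linarith
  qed
qed (use x in auto)

text \<open>The semigroup generated by \<open>A\<close>.\<close>

definition T :: "real \<Rightarrow> 'v \<Rightarrow> 'v" where
  "T t x = (SOME y. y \<in> H \<and> (\<lambda>j. N (euler j t x - y)) \<longlonglongrightarrow> 0)"

lemma T_H [simp, intro]: "0 \<le> t \<Longrightarrow> x \<in> H \<Longrightarrow> T t x \<in> H"
  and T_lim: "0 \<le> t \<Longrightarrow> x \<in> H \<Longrightarrow> (\<lambda>j. N (euler j t x - T t x)) \<longlonglongrightarrow> 0"
proof -
  assume "0 \<le> t" "x \<in> H"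
  then have "\<exists>y. y \<in> H \<and> (\<lambda>j. N (euler j t x - y)) \<longlonglongrightarrow> 0" using euler_converges by blast
  from someI_ex[OF this] show "T t x \<in> H" "(\<lambda>j. N (euler j t x - T t x)) \<longlonglongrightarrow> 0"
    by (simp_all add: T_def)
qed

lemma T_unique:
  assumes "0 \<le> t" "x \<in> H" "y \<in> H" "(\<lambda>j. N (euler j t x - y)) \<longlonglongrightarrow> 0"
  shows "T t x = y"
  by (rule N_tendsto_unique[OF _ _ _ _ T_lim[OF assms(1,2)] assms(4)]) (use assms in auto)

lemma T_add:
  assumes t: "0 \<le> t" and x: "x \<in> H" and y: "y \<in> H" shows "T t (x + y) = T t x + T t y"
proof (rule T_unique[OF t])
  show "(\<lambda>j. N (euler j t (x + y) - (T t x + T t y))) \<longlonglongrightarrow> 0"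
  proof (rule tendsto_sandwich[OF _ _ tendsto_const])
    show "(\<lambda>j. N (euler j t x - T t x) + N (euler j t y - T t y)) \<longlonglongrightarrow> 0"
      by (rule tendsto_add_zero[OF T_lim[OF t x] T_lim[OF t y]])
    show "\<forall>\<^sub>F j in sequentially. N (euler j t (x + y) - (T t x + T t y))
        \<le> N (euler j t x - T t x) + N (euler j t y - T t y)"
    proof (rule always_eventually, rule allI)
      fix j
      have "euler j t (x + y) - (T t x + T t y) = (euler j t x - T t x) + (euler j t y - T t y)"
        using x y by (simp add: euler_add)
      moreover have "N ((euler j t x - T t x) + (euler j t y - T t y))
        \<le> N (euler j t x - T t x) + N (euler j t y - T t y)"
        using t x y by (intro N_triangle) auto
      ultimately show "N (euler j t (x + y) - (T t x + T t y))
        \<le> N (euler j t x - T t x) + N (euler j t y - T t y)" by (simp only:)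
    qed
  qed (use t x y in \<open>auto intro!: always_eventually N_nonneg\<close>)
qed (use t x y in auto)

text \<open>Whatever is bounded and commutes with \<open>A\<close> commutes with the scheme and so with its limit.  This covers multiplication by
complex scalars, although the locale only knows the real structure.\<close>

lemma T_commute:
  assumes CH: "\<And>x. x \<in> H \<Longrightarrow> C x \<in> H" and CD: "\<And>x. x \<in> D \<Longrightarrow> C x \<in> D"
    and diff: "\<And>x y. x \<in> H \<Longrightarrow> y \<in> H \<Longrightarrow> C (x - y) = C x - C y"
    and scale: "\<And>x r. x \<in> H \<Longrightarrow> C (r *\<^sub>R x) = r *\<^sub>R C x"
    and bounded: "\<And>x. x \<in> H \<Longrightarrow> N (C x) \<le> K * N x"
    and comm: "\<And>x. x \<in> D \<Longrightarrow> A (C x) = C (A x)"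
    and t: "0 \<le> t" and x: "x \<in> H"
  shows "T t (C x) = C (T t x)"
proof (rule T_unique[OF t])
  have R: "R h (C f) = C (R h f)" if h: "0 < h" and f: "f \<in> H" for h f
  proof (rule R_unique[OF h])
    have "C (R h f) - h *\<^sub>R A (C (R h f)) = C (R h f - h *\<^sub>R A (R h f))"
      using h f by (simp add: comm diff scale)
    then show "C (R h f) - h *\<^sub>R A (C (R h f)) = C f" by (simp add: R_eq h f)
  qed (use CD h f in auto)
  have Rn: "(R h ^^ n) (C x) = C ((R h ^^ n) x)" if h: "0 < h" for h n
    using x h by (induction n) (auto simp: R)
  have "(\<lambda>j. K * N (euler j t x - T t x)) \<longlonglongrightarrow> 0"
    by (intro tendsto_mult_right_zero T_lim t x)
  then show "(\<lambda>j. N (euler j t (C x) - C (T t x))) \<longlonglongrightarrow> 0"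
  proof (rule tendsto_sandwich[OF _ _ tendsto_const, rotated 2])
    show "\<forall>\<^sub>F j in sequentially. N (euler j t (C x) - C (T t x)) \<le> K * N (euler j t x - T t x)"
    proof (rule always_eventually, rule allI)
      fix j
      have "euler j t (C x) - C (T t x) = C (euler j t x - T t x)"
        using t x by (simp add: euler_def Rn diff)
      then show "N (euler j t (C x) - C (T t x)) \<le> K * N (euler j t x - T t x)"
        using t x bounded[of "euler j t x - T t x"] by auto
    qed
    show "\<forall>\<^sub>F j in sequentially. 0 \<le> N (euler j t (C x) - C (T t x))"
      using t x CH by (intro always_eventually) auto
  qed
qed (use t x CH in auto)

lemma T_contraction: assumes t: "0 \<le> t" and x: "x \<in> H" shows "N (T t x) \<le> N x"
proof (rule LIMSEQ_le_const2)
  show "(\<lambda>j. N (euler j t x)) \<longlonglongrightarrow> N (T t x)"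
    by (rule N_tendsto[OF _ _ T_lim]) (use t x in auto)
qed (use x euler_contraction in auto)

lemma T_scale: "0 \<le> t \<Longrightarrow> x \<in> H \<Longrightarrow> T t (r *\<^sub>R x) = r *\<^sub>R T t x"
  by (rule T_commute[where C = "\<lambda>x. r *\<^sub>R x" and K = "\<bar>r\<bar>"])
    (auto simp: scaleR_diff_right N_scale A_scale mult.commute)

lemma T_diff: "0 \<le> t \<Longrightarrow> x \<in> H \<Longrightarrow> y \<in> H \<Longrightarrow> T t (x - y) = T t x - T t y"
  using T_add[of t x "(-1) *\<^sub>R y"] T_scale[of t y "-1"] by simp

lemma T_lipschitz: "0 \<le> t \<Longrightarrow> x \<in> H \<Longrightarrow> y \<in> H \<Longrightarrow> N (T t x - T t y) \<le> N (x - y)"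
  using T_contraction[of t "x - y"] T_diff[of t x y] by simp

lemma T_0: "x \<in> H \<Longrightarrow> T 0 x = x"
  by (rule T_unique) (auto simp: euler_def steps_def)

text \<open>The numbers of steps for \<open>s\<close>, \<open>t\<close> and \<open>s + t\<close> add up except for at most one step, which on \<open>D\<close> costs a multiple of the
step size; density and contractivity extend the identity to \<open>H\<close>.\<close>

lemma T_semigroup:
  assumes s: "0 \<le> s" and t: "0 \<le> t" and x: "x \<in> H"
  shows "T (s + t) x = T s (T t x)"
proof -
  have onD: "T (s + t) d = T s (T t d)" if d: "d \<in> D" for d
  proof (rule T_unique)
    have dH: "d \<in> H" using d by auto
    have TdH: "T t d \<in> H" using t dH by auto
    show "(\<lambda>j. N (euler j (s + t) d - T s (T t d))) \<longlonglongrightarrow> 0"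
    proof (rule tendsto_sandwich[OF _ _ tendsto_const])
      show "(\<lambda>j. stepsize j * N (A d) + (N (euler j t d - T t d)
          + N (euler j s (T t d) - T s (T t d)))) \<longlonglongrightarrow> 0"
        by (intro tendsto_add_zero tendsto_mult_left_zero stepsize_tendsto T_lim s t dH TdH)
      show "\<forall>\<^sub>F j in sequentially. N (euler j (s + t) d - T s (T t d)) \<le> stepsize j * N (A d)
          + (N (euler j t d - T t d) + N (euler j s (T t d) - T s (T t d)))"
      proof (rule always_eventually, rule allI)
        fix j
        have e: "euler j s (euler j t d) = (R (stepsize j) ^^ (steps j s + steps j t)) d"
          by (simp add: euler_def funpow_add)
        have "N (euler j (s + t) d - euler j s (euler j t d))
            \<le> (real (steps j (s + t)) - real (steps j s + steps j t)) * stepsize j * N (A d)"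
          unfolding e unfolding euler_def by (intro Rn_lipschitz d steps_add s t) auto
        also have "\<dots> \<le> 1 * stepsize j * N (A d)"
          using steps_add[OF s t, of j] d by (intro mult_right_mono) (auto intro: less_imp_le)
        finally have 1: "N (euler j (s + t) d - euler j s (euler j t d)) \<le> stepsize j * N (A d)" by simp
        have 2: "N (euler j s (euler j t d) - euler j s (T t d)) \<le> N (euler j t d - T t d)"
          using dH TdH by (intro euler_lipschitz) auto
        have "N (euler j (s + t) d - T s (T t d)) \<le> N (euler j (s + t) d - euler j s (euler j t d))
            + N (euler j s (euler j t d) - T s (T t d))"
          using dH TdH s by (intro N_triangle_through) auto
        moreover have "N (euler j s (euler j t d) - T s (T t d))
            \<le> N (euler j s (euler j t d) - euler j s (T t d)) + N (euler j s (T t d) - T s (T t d))"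
          using dH TdH s by (intro N_triangle_through) auto
        ultimately show "N (euler j (s + t) d - T s (T t d)) \<le> stepsize j * N (A d)
            + (N (euler j t d - T t d) + N (euler j s (T t d) - T s (T t d)))"
          using 1 2 by linarith
      qed
      show "\<forall>\<^sub>F j in sequentially. 0 \<le> N (euler j (s + t) d - T s (T t d))"
        using dH TdH s by (intro always_eventually) auto
    qed
  qed (use d s t in auto)
  let ?u = "T (s + t) x" and ?v = "T s (T t x)"
  have uv: "?u \<in> H" "?v \<in> H" using s t x by auto
  have "N (?u - ?v) \<le> e" if "e > 0" for e
  proof -
    obtain d where d: "d \<in> D" "N (x - d) < e / 2" using dense[OF x, of "e/2"] \<open>e > 0\<close> by auto
    have dH: "d \<in> H" using d by auto
    have "N (?u - ?v) \<le> N (?u - T (s + t) d) + N (T (s + t) d - ?v)"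
      using uv dH s t by (intro N_triangle_through) auto
    moreover have "N (?u - T (s + t) d) \<le> N (x - d)" using s t x dH by (intro T_lipschitz) auto
    moreover have "N (T (s + t) d - ?v) \<le> N (x - d)"
    proof -
      have "N (T s (T t d) - ?v) \<le> N (T t d - T t x)" using s t x dH by (intro T_lipschitz) auto
      also have "\<dots> \<le> N (d - x)" using t x dH by (intro T_lipschitz) auto
      finally show ?thesis using onD[OF d(1)] N_diff_commute[OF x dH] by simp
    qed
    ultimately show ?thesis using d(2) by linarith
  qed
  then have "N (?u - ?v) \<le> 0" by (rule field_le_epsilon[of _ 0, simplified])
  then have "?u - ?v = 0" by (rule N_le_0[rotated]) (use uv in auto)
  then show ?thesis by simp
qed

lemma T_near: assumes t: "0 \<le> t" and x: "x \<in> D" shows "N (T t x - x) \<le> t * N (A x)"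
proof (rule LIMSEQ_le_const2)
  have xH: "x \<in> H" using x by auto
  have "(\<lambda>j. N ((euler j t x - x) - (T t x - x))) \<longlonglongrightarrow> 0" using T_lim[OF t xH] by simp
  then show "(\<lambda>j. N (euler j t x - x)) \<longlonglongrightarrow> N (T t x - x)"
    by (rule N_tendsto[rotated 2]) (use t xH in auto)
  have "N (euler j t x - x) \<le> t * N (A x)" for j
  proof -
    have "N (euler j t x - x) \<le> steps j t * stepsize j * N (A x)"
      unfolding euler_def by (intro Rn_near x) auto
    also have "\<dots> \<le> t * N (A x)" using steps_bounds[OF t] x by (intro mult_right_mono) auto
    finally show ?thesis .
  qed
  then show "\<exists>M. \<forall>j\<ge>M. N (euler j t x - x) \<le> t * N (A x)" by blast
qed

text \<open>Limit of the discrete Taylor formula.\<close>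

lemma T_taylor:
  assumes t: "0 \<le> t" and x: "x \<in> D" "A x \<in> D"
  shows "N (T t x - x - t *\<^sub>R A x) \<le> t\<^sup>2 * N (A (A x))"
proof (rule LIMSEQ_le_const2)
  have xH: "x \<in> H" using x by auto
  let ?s = "\<lambda>j. steps j t * stepsize j"
  have s: "?s \<longlonglongrightarrow> t"
  proof (rule tendsto_sandwich)
    show "(\<lambda>j. t - stepsize j) \<longlonglongrightarrow> t" using tendsto_diff[OF tendsto_const stepsize_tendsto, of t] by simp
    show "(\<lambda>j. t) \<longlonglongrightarrow> t" by simp
    show "\<forall>\<^sub>F j in sequentially. t - stepsize j \<le> ?s j" "\<forall>\<^sub>F j in sequentially. ?s j \<le> t"
      using steps_bounds[OF t] by (auto intro!: always_eventually simp: less_imp_le diff_le_eq)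
  qed
  show "(\<lambda>j. N (euler j t x - x - ?s j *\<^sub>R A x)) \<longlonglongrightarrow> N (T t x - x - t *\<^sub>R A x)"
  proof (rule N_tendsto)
    show "(\<lambda>j. N ((euler j t x - x - ?s j *\<^sub>R A x) - (T t x - x - t *\<^sub>R A x))) \<longlonglongrightarrow> 0"
    proof (rule tendsto_sandwich[OF _ _ tendsto_const])
      have "(\<lambda>j. \<bar>t - ?s j\<bar>) \<longlonglongrightarrow> \<bar>t - t\<bar>" by (intro tendsto_intros s)
      then show "(\<lambda>j. N (euler j t x - T t x) + \<bar>t - ?s j\<bar> * N (A x)) \<longlonglongrightarrow> 0"
        by (intro tendsto_add_zero tendsto_mult_left_zero T_lim t xH) simp
      show "\<forall>\<^sub>F j in sequentially. N ((euler j t x - x - ?s j *\<^sub>R A x) - (T t x - x - t *\<^sub>R A x))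
          \<le> N (euler j t x - T t x) + \<bar>t - ?s j\<bar> * N (A x)"
      proof (rule always_eventually, rule allI)
        fix j
        have "(euler j t x - x - ?s j *\<^sub>R A x) - (T t x - x - t *\<^sub>R A x)
            = (euler j t x - T t x) + (t - ?s j) *\<^sub>R A x"
          by (simp add: scaleR_diff_left)
        moreover have "N ((euler j t x - T t x) + (t - ?s j) *\<^sub>R A x)
            \<le> N (euler j t x - T t x) + N ((t - ?s j) *\<^sub>R A x)"
          using t x xH by (intro N_triangle) auto
        moreover have "N ((t - ?s j) *\<^sub>R A x) = \<bar>t - ?s j\<bar> * N (A x)" using x by (intro N_scale) auto
        ultimately show "N ((euler j t x - x - ?s j *\<^sub>R A x) - (T t x - x - t *\<^sub>R A x))
          \<le> N (euler j t x - T t x) + \<bar>t - ?s j\<bar> * N (A x)" by (simp only:)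
      qed
      show "\<forall>\<^sub>F j in sequentially. 0 \<le> N ((euler j t x - x - ?s j *\<^sub>R A x) - (T t x - x - t *\<^sub>R A x))"
        using t x xH by (intro always_eventually allI N_nonneg H_diff H_scale) auto
    qed
  qed (use t x xH in \<open>auto intro!: always_eventually H_diff H_scale\<close>)
  have "N (euler j t x - x - ?s j *\<^sub>R A x) \<le> t\<^sup>2 * N (A (A x))" for j
  proof -
    have "N (euler j t x - x - ?s j *\<^sub>R A x) \<le> (?s j)\<^sup>2 * N (A (A x))"
      unfolding euler_def by (intro Rn_taylor x) auto
    also have "\<dots> \<le> t\<^sup>2 * N (A (A x))"
      using steps_bounds[OF t, of j] x
      by (intro mult_right_mono power_mono) (auto intro!: mult_nonneg_nonneg less_imp_le)
    finally show ?thesis .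
  qed
  then show "\<exists>M. \<forall>j\<ge>M. N (euler j t x - x - ?s j *\<^sub>R A x) \<le> t\<^sup>2 * N (A (A x))" by blast
qed

end

section \<open>The generated semigroup\<close>

lemma tendsto_0_at_right:
  fixes f :: "real \<Rightarrow> real"
  assumes "\<And>e. e > 0 \<Longrightarrow> \<exists>\<delta>>0. \<forall>h. 0 < h \<and> h < \<delta> \<longrightarrow> f h \<le> e" and "\<And>h. 0 < h \<Longrightarrow> 0 \<le> f h"
  shows "(f \<longlongrightarrow> 0) (at_right 0)"
proof (rule tendstoI)
  fix e :: real assume "e > 0"
  then obtain \<delta> where \<delta>: "\<delta> > 0" "\<And>h. 0 < h \<Longrightarrow> h < \<delta> \<Longrightarrow> f h \<le> e / 2"
    using assms(1)[of "e / 2"] by auto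
  have "dist (f h) 0 < e" if "0 < h" "h < \<delta>" for h
    using \<delta>(2)[OF that] assms(2)[OF that(1)] \<open>e > 0\<close> by simp
  then show "\<forall>\<^sub>F h in at_right 0. dist (f h) 0 < e"
    unfolding eventually_at_right_field using \<delta>(1) by blast
qed

lemma tendsto_0_at_rightD:
  fixes f :: "real \<Rightarrow> real"
  assumes "(f \<longlongrightarrow> 0) (at_right 0)" "e > 0"
  shows "\<exists>\<delta>>0. \<forall>h. 0 < h \<and> h < \<delta> \<longrightarrow> f h < e"
  using order_tendstoD(2)[OF assms] unfolding eventually_at_right_field by auto

context dissipative_bijection begin

text \<open>On the domain of \<open>A\<^sup>2\<close> this is the Taylor formula.  For general \<open>x\<close> in \<open>D\<close> approximate by \<open>x' = R k x\<close>: then \<open>A x' = R k (A x)\<close>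
is close to \<open>A x\<close>, and difference quotients of \<open>x - x'\<close> are bounded by \<open>|A (x - x')|\<close>.\<close>

lemma T_derivative:
  assumes x: "x \<in> D"
  shows "((\<lambda>h. N ((1 / h) *\<^sub>R (T h x - x) - A x)) \<longlongrightarrow> 0) (at_right 0)"
proof (rule tendsto_0_at_right)
  have xH: "x \<in> H" using x by auto
  fix e :: real assume "e > 0"
  obtain k where k: "k > 0" "N (R k (A x) - A x) < e / 4"
    using R_tendsto[of "A x" "e / 4"] x \<open>e > 0\<close> by auto
  define x' where "x' = R k x"
  have x': "x' \<in> D" "A x' \<in> D" "N (A x' - A x) < e / 4"
    using A_R[OF k(1) x] k x by (auto simp: x'_def)
  have x'H: "x' \<in> H" using x' by auto
  define c where "c = N (A (A x')) + 1"
  have c: "c > 0" using N_nonneg[OF A_H[OF x'(2)]] by (simp add: c_def)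
  show "\<exists>\<delta>>0. \<forall>h. 0 < h \<and> h < \<delta> \<longrightarrow> N ((1 / h) *\<^sub>R (T h x - x) - A x) \<le> e"
  proof (intro exI[of _ "e / (2 * c)"] conjI allI impI)
    show "0 < e / (2 * c)" using c \<open>e > 0\<close> by simp
    fix h assume h: "0 < h \<and> h < e / (2 * c)"
    then have h0: "0 \<le> h" "h > 0" by auto
    let ?q = "\<lambda>u. (1 / h) *\<^sub>R (T h u - u)"
    have qH: "?q u \<in> H" if "u \<in> H" for u using that h0 by auto
    have "T h x - x - (T h x' - x') = T h (x - x') - (x - x')"
      using T_diff[OF h0(1) xH x'H] by simp
    then have "?q x - ?q x' = ?q (x - x')" by (simp flip: scaleR_diff_right)
    also have "N \<dots> = (1 / h) * N (T h (x - x') - (x - x'))"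
      using h0 xH x'H by (subst N_scale) auto
    also have "\<dots> \<le> (1 / h) * (h * N (A (x - x')))"
      using h0 T_near[OF h0(1), of "x - x'"] x x' by (intro mult_left_mono) auto
    also have "\<dots> = N (A x' - A x)" using h0 A_diff[OF x x'(1)] x x' N_diff_commute[of "A x" "A x'"] by simp
    finally have 1: "N (?q x - ?q x') \<le> N (A x' - A x)" .
    have "?q x' - A x' = (1 / h) *\<^sub>R (T h x' - x' - h *\<^sub>R A x')"
      using h0 by (simp add: scaleR_diff_right)
    then have "N (?q x' - A x') = (1 / h) * N (T h x' - x' - h *\<^sub>R A x')"
      using h0 x' x'H N_scale[of "T h x' - x' - h *\<^sub>R A x'" "1 / h"] by auto
    also have "\<dots> \<le> (1 / h) * (h\<^sup>2 * N (A (A x')))"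
      using h0 T_taylor[OF h0(1) x'(1,2)] by (intro mult_left_mono) auto
    also have "\<dots> \<le> h * c" using h0 by (simp add: power2_eq_square c_def)
    also have "\<dots> \<le> e / 2" using h c by (simp add: field_simps)
    finally have 2: "N (?q x' - A x') \<le> e / 2" .
    have "N (?q x - A x) \<le> N (?q x - ?q x') + N (?q x' - A x)"
      using qH xH x'H x by (intro N_triangle_through) auto
    moreover have "N (?q x' - A x) \<le> N (?q x' - A x') + N (A x' - A x)"
      using qH x'H x x' by (intro N_triangle_through) auto
    ultimately show "N (?q x - A x) \<le> e" using 1 2 x'(3) by linarith
  qed
next
  fix h :: real assume "0 < h"
  then show "0 \<le> N ((1 / h) *\<^sub>R (T h x - x) - A x)"
    using x by (intro N_nonneg H_diff H_scale T_H) auto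
qed

text \<open>The generator of a contraction semigroup is dissipative, and an operator for which \<open>I - A\<close> is already onto has no proper
dissipative extension.  Concretely: solve \<open>y - A y = u - w\<close> in \<open>D\<close>; then \<open>z = u - y\<close> has derivative \<open>z\<close> at \<open>0\<close>, which for
\<open>z \<noteq> 0\<close> would make the norm grow.\<close>

lemma derivative_imp_domain:
  assumes u: "u \<in> H" and w: "w \<in> H"
    and lim: "((\<lambda>h. N ((1 / h) *\<^sub>R (T h u - u) - w)) \<longlongrightarrow> 0) (at_right 0)"
  shows "u \<in> D \<and> A u = w"
proof -
  define y where "y = R 1 (u - w)"
  have y: "y \<in> D" "y - A y = u - w" using R_eq[of 1 "u - w"] u w by (auto simp: y_def)
  define z where "z = u - y"
  have yH: "y \<in> H" using y by auto
  have zH: "z \<in> H" using u yH by (simp add: z_def)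
  have z: "w - A y = z" using y(2) by (simp add: z_def algebra_simps)
  let ?q = "\<lambda>h u. (1 / h) *\<^sub>R (T h u - u)"
  have "N z \<le> e" if "e > 0" for e
  proof -
    obtain \<delta> where \<delta>: "\<delta> > 0" "\<And>h. 0 < h \<Longrightarrow> h < \<delta> \<Longrightarrow> N (?q h u - w) < e / 2"
      using tendsto_0_at_rightD[OF lim, of "e / 2"] \<open>e > 0\<close> by auto
    obtain \<delta>' where \<delta>': "\<delta>' > 0" "\<And>h. 0 < h \<Longrightarrow> h < \<delta>' \<Longrightarrow> N (?q h y - A y) < e / 2"
      using tendsto_0_at_rightD[OF T_derivative[OF y(1)], of "e / 2"] \<open>e > 0\<close> by auto
    define h where "h = min \<delta> \<delta>' / 2"
    have h: "0 < h" "h < \<delta>" "h < \<delta>'" "0 \<le> h" using \<delta>(1) \<delta>'(1) by (auto simp: h_def)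
    have qH: "?q h v \<in> H" if "v \<in> H" for v using that h by auto
    have "T h u - u - (T h y - y) = T h z - z"
      using T_diff[OF h(4) u yH] by (simp add: z_def)
    then have "?q h z = ?q h u - ?q h y" by (simp flip: scaleR_diff_right)
    then have "?q h z - z = (?q h u - w) - (?q h y - A y)" by (simp flip: z)
    then have "N (?q h z - z) = N ((?q h u - w) - (?q h y - A y))" by (rule arg_cong)
    moreover have "N ((?q h u - w) - (?q h y - A y)) \<le> N (?q h u - w) + N (?q h y - A y)"
      using qH u w y yH by (intro N_triangle_diff) auto
    ultimately have small: "N (?q h z - z) \<le> e" using \<delta>(2)[OF h(1,2)] \<delta>'(2)[OF h(1,3)] by linarith
    have TzH: "T h z \<in> H" using h zH by auto
    \<comment> \<open>If \<open>T h z = z + h z + o(h)\<close>, then \<open>(1 + h) |z| \<le> |T h z| + o(h) \<le> |z| + o(h)\<close>.\<close>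
    have "(1 + 1 / h) *\<^sub>R z = (z - ?q h z) + (1 / h) *\<^sub>R T h z" by (simp add: algebra_simps)
    then have "N ((1 + 1 / h) *\<^sub>R z) \<le> N (z - ?q h z) + N ((1 / h) *\<^sub>R T h z)"
      using N_triangle[of "z - ?q h z" "(1 / h) *\<^sub>R T h z"] zH TzH by auto
    moreover have "N ((1 + 1 / h) *\<^sub>R z) = (1 + 1 / h) * N z" using N_scale[OF zH, of "1 + 1 / h"] h by simp
    moreover have "N ((1 / h) *\<^sub>R T h z) = (1 / h) * N (T h z)" using N_scale[OF TzH, of "1 / h"] h by simp
    moreover have "(1 / h) * N (T h z) \<le> (1 / h) * N z" using h zH T_contraction by (intro mult_left_mono) auto
    moreover have "N (z - ?q h z) = N (?q h z - z)" using zH qH[OF zH] by (rule N_diff_commute)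
    moreover have "(1 + 1 / h) * N z = N z + (1 / h) * N z" by (simp add: distrib_right)
    ultimately show ?thesis using small by linarith
  qed
  then have "N z \<le> 0" by (rule field_le_epsilon[of _ 0, simplified])
  then have "z = 0" using zH by (rule N_le_0[rotated])
  then have "u = y" "A y = w" using z by (auto simp: z_def)
  then show ?thesis using y(1) by simp
qed

end

locale complex_dissipative_bijection = dissipative_bijection H N ip D A
  for H :: "'v::real_vector set" and N ip D A +
  fixes sc :: "complex \<Rightarrow> 'v \<Rightarrow> 'v"
  assumes sc_H: "x \<in> H \<Longrightarrow> sc c x \<in> H" and sc_D: "x \<in> D \<Longrightarrow> sc c x \<in> D"
    and sc_diff: "x \<in> H \<Longrightarrow> y \<in> H \<Longrightarrow> sc c (x - y) = sc c x - sc c y"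
    and sc_scale: "x \<in> H \<Longrightarrow> sc c (r *\<^sub>R x) = r *\<^sub>R sc c x"
    and sc_real: "x \<in> H \<Longrightarrow> sc (complex_of_real r) x = r *\<^sub>R x"
    and sc_N: "x \<in> H \<Longrightarrow> N (sc c x) \<le> cmod c * N x"
    and sc_A: "x \<in> D \<Longrightarrow> A (sc c x) = sc c (A x)"
begin

theorem generates: "contraction_semigroup H N sc T" "generator H N T D A"
proof -
  have cont: "((\<lambda>t. N (T t x - x)) \<longlongrightarrow> 0) (at_right 0)" if x: "x \<in> H" for x
  proof (rule tendsto_0_at_right)
    fix e :: real assume "e > 0"
    obtain d where d: "d \<in> D" "N (x - d) < e / 4" using dense[OF x, of "e/4"] \<open>e > 0\<close> by auto
    have dH: "d \<in> H" using d by auto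
    define c where "c = N (A d) + 1"
    have c: "c > 0" using N_nonneg[OF A_H[OF d(1)]] by (simp add: c_def)
    show "\<exists>\<delta>>0. \<forall>h. 0 < h \<and> h < \<delta> \<longrightarrow> N (T h x - x) \<le> e"
    proof (intro exI[of _ "e / (2 * c)"] conjI allI impI)
      show "0 < e / (2 * c)" using c \<open>e > 0\<close> by simp
      fix h assume h: "0 < h \<and> h < e / (2 * c)"
      then have h0: "0 \<le> h" by simp
      have "N (T h x - x) \<le> N (T h x - T h d) + N (T h d - x)"
        using h0 x dH by (intro N_triangle_through) auto
      moreover have "N (T h d - x) \<le> N (T h d - d) + N (d - x)"
        using h0 x dH by (intro N_triangle_through) auto
      moreover have "N (T h x - T h d) \<le> N (x - d)" using h0 x dH by (rule T_lipschitz)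
      moreover have "N (d - x) = N (x - d)" using x dH by (intro N_diff_commute) auto
      moreover have "N (T h d - d) \<le> h * N (A d)" using h0 d(1) by (rule T_near)
      moreover have "h * N (A d) \<le> h * c" using h0 by (intro mult_left_mono) (auto simp: c_def)
      moreover have "h * c \<le> e / 2" using h c by (simp add: field_simps)
      ultimately show "N (T h x - x) \<le> e" using d(2) by linarith
    qed
  qed (use x in auto)
  have sc: "T t (sc c x) = sc c (T t x)" if "t \<ge> 0" "x \<in> H" for t c x
    by (rule T_commute[where C = "sc c" and K = "cmod c"])
      (use that sc_H sc_D sc_diff sc_scale sc_N sc_A in auto)
  show "contraction_semigroup H N sc T"
    unfolding contraction_semigroup_def
    by (intro conjI allI impI ballI)
      (rule T_H T_add sc T_0 T_semigroup cont T_contraction; assumption)+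
  show "generator H N T D A"
    unfolding generator_def
  proof (intro conjI ballI)
    show "D \<subseteq> H" by (rule D_H)
    show "A ` D \<subseteq> H" using A_H by blast
    fix U W assume "U \<in> H" "W \<in> H"
    then show "(U \<in> D \<and> A U = W) \<longleftrightarrow>
        ((\<lambda>h. N ((1 / h) *\<^sub>R (T h U - U) - W)) \<longlongrightarrow> 0) (at_right 0)"
      using T_derivative[of U] derivative_imp_domain[of U W] by auto
  qed
qed

end

section \<open>Mild and strong solutions\<close>

text \<open>Telescoping over a tagged division, needed for functions with values in a vector space without a norm on its type.\<close>

lemma sum_increments_tagged_division:
  fixes f :: "real \<Rightarrow> 'a::ab_group_add"
  assumes "a \<le> b" and "p tagged_division_of {a..b}"
  shows "(\<Sum>(x, K)\<in>p. f (Sup K) - f (Inf K)) = f b - f a"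
proof -
  let ?f = "\<lambda>K::real set. if K = {} then 0 else f (interval_upperbound K) - f (interval_lowerbound K)"
  interpret operative_real plus 0 ?f
    rewrites "comm_monoid_set.F (+) 0 = sum"
    by standard[1] (auto simp add: sum_def)
  have p_td: "p tagged_division_of cbox a b"
    using assms(2) box_real(2) by presburger
  have "cbox a b \<noteq> {}" using assms(1) by auto
  then have "f b - f a = (\<Sum>(x, l)\<in>p. if l = {} then 0 else f (interval_upperbound l) - f (interval_lowerbound l))"
    using p_td tagged_division assms by force
  then show ?thesis
    using assms by (auto intro!: sum.cong)
qed

lemma tagged_interval:
  assumes "p tagged_division_of {a..b::real}" "(x, k) \<in> p"
  obtains c d where "k = {c..d}" "a \<le> c" "c \<le> x" "x \<le> d" "d \<le> b"
    "Inf k = c" "Sup k = d" "measure lborel k = d - c"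
proof -
  obtain c d where k: "k = {c..d}" using tagged_division_ofD(4)[OF assms] by (auto simp: box_real)
  have x: "x \<in> k" "k \<subseteq> {a..b}" using tagged_division_ofD(2,3)[OF assms] by auto
  then have "c \<le> x" "x \<le> d" using k by auto
  then have "c \<in> k" "d \<in> k" using k by auto
  then show thesis using x k \<open>c \<le> x\<close> \<open>x \<le> d\<close> by (intro that[of c d]) auto
qed

lemma has_riemann_integralD:
  assumes "has_riemann_integral N U J a b" and "e > 0"
  obtains d where "d > 0" "\<forall>p. p tagged_division_of {a..b} \<longrightarrow> (\<lambda>x. ball x d) fine p
      \<longrightarrow> N ((\<Sum>(x, k)\<in>p. measure lborel k *\<^sub>R U x) - J) < e"
proof -
  from assms(1)[unfolded has_riemann_integral_def, rule_format, OF assms(2)]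
  obtain d where "0 < d" and d: "\<forall>p. p tagged_division_of {a..b} \<and> (\<lambda>x. ball x d) fine p \<longrightarrow>
      N ((\<Sum>(x, k)\<in>p. measure lborel k *\<^sub>R U x) - J) < e" by (elim exE conjE)
  show thesis by (rule that[OF \<open>0 < d\<close>]) (use d in blast)
qed

text \<open>Any contraction semigroup generated by \<open>A\<close>, not just the one constructed above: the solution theory uses only the
semigroup laws and the generator.\<close>

locale generated_semigroup = complex_dissipative_bijection H N ip D A sc
  for H :: "'v::real_vector set" and N ip D A sc +
  fixes S :: "real \<Rightarrow> 'v \<Rightarrow> 'v"
  assumes semigroup: "contraction_semigroup H N sc S" and generator: "generator H N S D A"
begin

lemma S_H [simp, intro]: "0 \<le> t \<Longrightarrow> x \<in> H \<Longrightarrow> S t x \<in> H"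
  and S_add: "0 \<le> t \<Longrightarrow> x \<in> H \<Longrightarrow> y \<in> H \<Longrightarrow> S t (x + y) = S t x + S t y"
  and S_sc: "0 \<le> t \<Longrightarrow> x \<in> H \<Longrightarrow> S t (sc c x) = sc c (S t x)"
  and S_0: "x \<in> H \<Longrightarrow> S 0 x = x"
  and S_plus: "0 \<le> s \<Longrightarrow> 0 \<le> t \<Longrightarrow> x \<in> H \<Longrightarrow> S (s + t) x = S s (S t x)"
  and S_continuous_0: "x \<in> H \<Longrightarrow> ((\<lambda>t. N (S t x - x)) \<longlongrightarrow> 0) (at_right 0)"
  and S_contraction: "0 \<le> t \<Longrightarrow> x \<in> H \<Longrightarrow> N (S t x) \<le> N x"
  using semigroup unfolding contraction_semigroup_def by blast+

lemma S_scale: "0 \<le> t \<Longrightarrow> x \<in> H \<Longrightarrow> S t (r *\<^sub>R x) = r *\<^sub>R S t x"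
  using S_sc[of t x "complex_of_real r"] sc_real[of x r] sc_real[of "S t x" r] by auto

lemma S_diff: "0 \<le> t \<Longrightarrow> x \<in> H \<Longrightarrow> y \<in> H \<Longrightarrow> S t (x - y) = S t x - S t y"
  using S_add[of t x "(-1) *\<^sub>R y"] S_scale[of t y "-1"] by simp

lemma S_lipschitz: "0 \<le> t \<Longrightarrow> x \<in> H \<Longrightarrow> y \<in> H \<Longrightarrow> N (S t x - S t y) \<le> N (x - y)"
  using S_contraction[of t "x - y"] S_diff[of t x y] by simp

lemma S_derivative_0:
  assumes x: "x \<in> D" shows "((\<lambda>h. N ((1 / h) *\<^sub>R (S h x - x) - A x)) \<longlongrightarrow> 0) (at_right 0)"
  using generator x D_imp_H[OF x] A_H[OF x] unfolding generator_def by blast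

text \<open>\<open>S t\<close> commutes with the difference quotients at \<open>0\<close> and is a contraction, so it maps their limits to limits.\<close>

lemma S_domain:
  assumes x: "x \<in> D" and t: "0 \<le> t"
  shows "S t x \<in> D" "A (S t x) = S t (A x)"
proof -
  have xH: "x \<in> H" using x by auto
  have "((\<lambda>h. N ((1 / h) *\<^sub>R (S h (S t x) - S t x) - S t (A x))) \<longlongrightarrow> 0) (at_right 0)"
  proof (rule tendsto_sandwich[OF _ _ tendsto_const S_derivative_0[OF x]])
    have "0 \<le> N ((1 / h) *\<^sub>R (S h (S t x) - S t x) - S t (A x))
        \<and> N ((1 / h) *\<^sub>R (S h (S t x) - S t x) - S t (A x)) \<le> N ((1 / h) *\<^sub>R (S h x - x) - A x)"
      if h: "0 < h" for h
    proof
      have h0: "0 \<le> h" using h by simp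
      have q: "(1 / h) *\<^sub>R (S h x - x) \<in> H" using h0 xH by auto
      have "S h (S t x) = S t (S h x)"
        using S_plus[OF h0 t xH] S_plus[OF t h0 xH] by (simp add: add.commute)
      then have "(1 / h) *\<^sub>R (S h (S t x) - S t x) - S t (A x) = S t ((1 / h) *\<^sub>R (S h x - x) - A x)"
        using h0 t xH x q by (simp add: S_diff S_scale)
      then show "N ((1 / h) *\<^sub>R (S h (S t x) - S t x) - S t (A x)) \<le> N ((1 / h) *\<^sub>R (S h x - x) - A x)"
        using S_contraction[OF t, of "(1 / h) *\<^sub>R (S h x - x) - A x"] q x by simp
      show "0 \<le> N ((1 / h) *\<^sub>R (S h (S t x) - S t x) - S t (A x))"
        using h0 t xH x by (intro N_nonneg H_diff H_scale S_H) auto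
    qed
    then show "\<forall>\<^sub>F h in at_right 0. 0 \<le> N ((1 / h) *\<^sub>R (S h (S t x) - S t x) - S t (A x))"
      "\<forall>\<^sub>F h in at_right 0. N ((1 / h) *\<^sub>R (S h (S t x) - S t x) - S t (A x))
          \<le> N ((1 / h) *\<^sub>R (S h x - x) - A x)"
      by (auto intro!: eventually_mono[OF eventually_at_right_less])
  qed
  moreover have "S t x \<in> H" "S t (A x) \<in> H" using x xH t by auto
  ultimately have "S t x \<in> D \<and> A (S t x) = S t (A x)"
    using generator unfolding generator_def by blast
  then show "S t x \<in> D" "A (S t x) = S t (A x)" by auto
qed

lemma S_continuous_uniform:
  assumes x: "x \<in> H" and "e > 0"
  shows "\<exists>\<delta>>0. \<forall>s t. 0 \<le> s \<and> 0 \<le> t \<and> \<bar>s - t\<bar> < \<delta> \<longrightarrow> N (S s x - S t x) < e"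
proof -
  obtain \<delta> where \<delta>: "\<delta> > 0" "\<And>h. 0 < h \<Longrightarrow> h < \<delta> \<Longrightarrow> N (S h x - x) < e"
    using tendsto_0_at_rightD[OF S_continuous_0[OF x] \<open>e > 0\<close>] by auto
  have less: "N (S s x - S t x) < e" if "0 \<le> t" "t \<le> s" "s - t < \<delta>" for s t
  proof (cases "s = t")
    case False
    have st: "0 \<le> s - t" using that by simp
    have "S s x = S t (S (s - t) x)" using S_plus[OF that(1) st x] by simp
    then have "N (S s x - S t x) \<le> N (S (s - t) x - x)"
      using S_lipschitz[OF that(1), of "S (s - t) x" x] st x by simp
    also have "\<dots> < e" using that False by (intro \<delta>) auto
    finally show ?thesis .
  qed (use \<open>e > 0\<close> in simp)
  have "N (S s x - S t x) < e" if "0 \<le> s" "0 \<le> t" "\<bar>s - t\<bar> < \<delta>" for s t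
  proof (cases "t \<le> s")
    case False
    have "N (S s x - S t x) = N (S t x - S s x)" using that x by (intro N_diff_commute) auto
    also have "\<dots> < e" using that False by (intro less) auto
    finally show ?thesis .
  qed (use that less in auto)
  then show ?thesis using \<delta>(1) by blast
qed

lemma cont_wrt_S: assumes x: "x \<in> H" shows "cont_wrt N {0..} (\<lambda>t. S t x)"
  unfolding cont_wrt_def
proof (rule ballI, rule tendstoI)
  fix t e :: real assume t: "t \<in> {0..}" and "e > 0"
  obtain \<delta> where \<delta>: "\<delta> > 0" "\<And>s t. 0 \<le> s \<Longrightarrow> 0 \<le> t \<Longrightarrow> \<bar>s - t\<bar> < \<delta> \<Longrightarrow> N (S s x - S t x) < e"
    using S_continuous_uniform[OF x \<open>e > 0\<close>] by auto
  have "dist (N (S s x - S t x)) 0 < e" if "s \<in> {0..}" "dist s t < \<delta>" for s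
    using \<delta>(2)[of s t] that t x by (simp add: dist_real_def)
  then show "\<forall>\<^sub>F s in at t within {0..}. dist (N (S s x - S t x)) 0 < e"
    unfolding eventually_at using \<delta>(1) by blast
qed

text \<open>The orbit of \<open>x\<close> in \<open>D\<close> is differentiable uniformly in time: \<open>S t\<close> is a contraction, so the approximation at time \<open>t\<close> is
no worse than at time \<open>0\<close>.  For increments to the left the derivative is moved from the left end point to the right one by
uniform continuity of the orbit of \<open>A x\<close>.\<close>

lemma S_increment:
  assumes x: "x \<in> D" and "e > 0"
  shows "\<exists>\<delta>>0. \<forall>s t. 0 \<le> s \<and> 0 \<le> t \<and> \<bar>s - t\<bar> < \<delta> \<longrightarrow>
    N (S s x - S t x - (s - t) *\<^sub>R S t (A x)) \<le> e * \<bar>s - t\<bar>"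
proof -
  have xH: "x \<in> H" "A x \<in> H" using x by auto
  obtain \<delta> where \<delta>: "\<delta> > 0" "\<And>h. 0 < h \<Longrightarrow> h < \<delta> \<Longrightarrow> N ((1 / h) *\<^sub>R (S h x - x) - A x) < e / 2"
    using tendsto_0_at_rightD[OF S_derivative_0[OF x], of "e/2"] \<open>e > 0\<close> by auto
  obtain \<delta>' where \<delta>': "\<delta>' > 0" "\<And>s t. 0 \<le> s \<Longrightarrow> 0 \<le> t \<Longrightarrow> \<bar>s - t\<bar> < \<delta>' \<Longrightarrow> N (S s (A x) - S t (A x)) < e / 2"
    using S_continuous_uniform[OF xH(2), of "e/2"] \<open>e > 0\<close> by auto
  have fwd: "N (S s x - S t x - (s - t) *\<^sub>R S t (A x)) \<le> e / 2 * (s - t)"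
    if "0 \<le> t" "t < s" "s - t < \<delta>" for s t
  proof -
    define h where "h = s - t"
    have h: "0 < h" "h < \<delta>" "0 \<le> h" using that by (auto simp: h_def)
    let ?u = "S h x - x - h *\<^sub>R A x"
    have uH: "?u \<in> H" using h xH by (intro H_diff H_scale S_H) auto
    have "S s x = S t (S h x)" using S_plus[OF that(1) h(3) xH(1)] by (simp add: h_def)
    then have "S s x - S t x - h *\<^sub>R S t (A x) = S t ?u"
      using that h xH by (simp add: S_diff S_scale)
    then have "N (S s x - S t x - h *\<^sub>R S t (A x)) \<le> N ?u"
      using S_contraction[OF that(1) uH] by simp
    also have "?u = h *\<^sub>R ((1 / h) *\<^sub>R (S h x - x) - A x)" using h by (simp add: scaleR_diff_right)
    also have "N \<dots> = h * N ((1 / h) *\<^sub>R (S h x - x) - A x)"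
      using h xH by (subst N_scale) auto
    also have "\<dots> \<le> h * (e / 2)" using \<delta>(2)[OF h(1,2)] h by (intro mult_left_mono) auto
    finally show ?thesis by (simp add: h_def mult.commute)
  qed
  have "N (S s x - S t x - (s - t) *\<^sub>R S t (A x)) \<le> e * \<bar>s - t\<bar>"
    if st: "0 \<le> s" "0 \<le> t" "\<bar>s - t\<bar> < min \<delta> \<delta>'" for s t
  proof (cases s t rule: linorder_cases)
    case less
    let ?u = "S t x - S s x - (t - s) *\<^sub>R S s (A x)" and ?v = "(t - s) *\<^sub>R (S s (A x) - S t (A x))"
    have uv: "?u \<in> H" "?v \<in> H" using st xH by (auto intro!: H_diff H_scale S_H)
    have "S s x - S t x - (s - t) *\<^sub>R S t (A x) = - (?u + ?v)" by (simp add: algebra_simps)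
    then have "N (S s x - S t x - (s - t) *\<^sub>R S t (A x)) = N (?u + ?v)"
      using N_minus[OF H_add[OF uv]] by (simp only:)
    also have "\<dots> \<le> N ?u + N ?v" using uv by (rule N_triangle)
    also have "N ?v = (t - s) * N (S s (A x) - S t (A x))"
      using less st xH by (subst N_scale) auto
    finally have "N (S s x - S t x - (s - t) *\<^sub>R S t (A x)) \<le> N ?u + (t - s) * N (S s (A x) - S t (A x))" .
    moreover have "N ?u \<le> e / 2 * (t - s)" using less st by (intro fwd) auto
    moreover have "(t - s) * N (S s (A x) - S t (A x)) \<le> (t - s) * (e / 2)"
      using less \<delta>'(2)[of s t] st by (intro mult_left_mono) auto
    ultimately show ?thesis using less by (simp add: algebra_simps)
  next
    case equal
    then show ?thesis using st xH by simp
  next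
    case greater
    have "N (S s x - S t x - (s - t) *\<^sub>R S t (A x)) \<le> e / 2 * (s - t)"
      using greater st by (intro fwd) auto
    also have "\<dots> \<le> e * \<bar>s - t\<bar>" using greater \<open>e > 0\<close> by (intro mult_mono) auto
    finally show ?thesis .
  qed
  then show ?thesis using \<delta>(1) \<delta>'(1) by (intro exI[of _ "min \<delta> \<delta>'"]) auto
qed

lemma has_deriv_wrt_S:
  assumes x: "x \<in> D" shows "has_deriv_wrt N {0..} (\<lambda>t. S t x) (\<lambda>t. S t (A x))"
  unfolding has_deriv_wrt_def
proof (rule ballI, rule tendstoI)
  fix t e :: real assume t: "t \<in> {0..}" and "e > 0"
  obtain \<delta> where \<delta>: "\<delta> > 0" "\<And>s t. 0 \<le> s \<Longrightarrow> 0 \<le> t \<Longrightarrow> \<bar>s - t\<bar> < \<delta> \<Longrightarrow>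
      N (S s x - S t x - (s - t) *\<^sub>R S t (A x)) \<le> e / 2 * \<bar>s - t\<bar>"
    using S_increment[OF x, of "e/2"] \<open>e > 0\<close> by auto
  have "dist (N ((1 / (s - t)) *\<^sub>R (S s x - S t x) - S t (A x))) 0 < e"
    if s: "s \<in> {0..}" "s \<noteq> t" "dist s t < \<delta>" for s
  proof -
    let ?u = "S s x - S t x - (s - t) *\<^sub>R S t (A x)"
    have xH: "x \<in> H" "A x \<in> H" using x by auto
    have uH: "?u \<in> H" using s t xH by (intro H_diff H_scale S_H) auto
    have "(1 / (s - t)) *\<^sub>R (S s x - S t x) - S t (A x) = (1 / (s - t)) *\<^sub>R ?u"
      using s by (simp add: scaleR_diff_right)
    then have "N ((1 / (s - t)) *\<^sub>R (S s x - S t x) - S t (A x)) = N ?u / \<bar>s - t\<bar>"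
      using N_scale[OF uH, of "1 / (s - t)"] by simp
    also have "\<dots> \<le> e / 2"
      using \<delta>(2)[of s t] s t by (simp add: dist_real_def pos_divide_le_eq)
    finally show ?thesis
      using \<open>e > 0\<close> s t xH
      by (simp add: abs_of_nonneg[OF N_nonneg[OF H_diff[OF H_scale]]] )
  qed
  then show "\<forall>\<^sub>F s in at t within {0..}. dist (N ((1 / (s - t)) *\<^sub>R (S s x - S t x) - S t (A x))) 0 < e"
    unfolding eventually_at using \<delta>(1) by blast
qed

text \<open>The fundamental theorem of calculus; by uniformity of the derivative one gauge radius serves all tags.\<close>

lemma has_riemann_integral_S:
  assumes x: "x \<in> D" and t: "0 \<le> t"
  shows "has_riemann_integral N (\<lambda>s. S s (A x)) (S t x - x) 0 t"
  unfolding has_riemann_integral_def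
proof (intro allI impI)
  fix e :: real assume "e > 0"
  have xH: "x \<in> H" "A x \<in> H" using x by auto
  define e' where "e' = e / (t + 1)"
  have e': "e' > 0" using \<open>e > 0\<close> t by (simp add: e'_def)
  obtain \<delta> where \<delta>: "\<delta> > 0" "\<And>s t. 0 \<le> s \<Longrightarrow> 0 \<le> t \<Longrightarrow> \<bar>s - t\<bar> < \<delta> \<Longrightarrow>
      N (S s x - S t x - (s - t) *\<^sub>R S t (A x)) \<le> e' * \<bar>s - t\<bar>"
    using S_increment[OF x e'] by auto
  show "\<exists>d>0. \<forall>p. p tagged_division_of {0..t} \<and> (\<lambda>x. ball x d) fine p \<longrightarrow>
      N ((\<Sum>(s, k)\<in>p. measure lborel k *\<^sub>R S s (A x)) - (S t x - x)) < e"
  proof (intro exI[of _ \<delta>] conjI \<delta>(1) allI impI, elim conjE)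
    fix p assume p: "p tagged_division_of {0..t}" and fine: "(\<lambda>x. ball x \<delta>) fine p"
    let ?g = "\<lambda>(s, k). measure lborel k *\<^sub>R S s (A x) - (S (Sup k) x - S (Inf k) x)"
    have piece: "?g q \<in> H \<and> N (?g q) \<le> e' * (Sup (snd q) - Inf (snd q))" if "q \<in> p" for q
    proof -
      obtain s k where q': "q = (s, k)" by (cases q)
      then have q: "q = (s, k)" "(s, k) \<in> p" using that by auto
      obtain a b where k: "k = {a..b}" "0 \<le> a" "a \<le> s" "s \<le> b" "b \<le> t"
        "Inf k = a" "Sup k = b" "measure lborel k = b - a"
        using tagged_interval[OF p q(2)] .
      have "k \<subseteq> ball s \<delta>" using fine q(2) unfolding fine_def by blast
      moreover have "a \<in> k" "b \<in> k" using k by auto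
      ultimately have ab: "\<bar>a - s\<bar> < \<delta>" "\<bar>b - s\<bar> < \<delta>" by (auto simp: dist_real_def abs_minus_commute)
      let ?u = "\<lambda>r. S r x - S s x - (r - s) *\<^sub>R S s (A x)"
      have nn: "0 \<le> s" "0 \<le> b" using k by auto
      have uH: "?u a \<in> H" "?u b \<in> H" using k nn xH by (auto intro!: H_diff H_scale S_H)
      have g: "?g q = ?u a - ?u b" unfolding q using k by (simp add: algebra_simps)
      have "N (?u a - ?u b) \<le> N (?u a) + N (?u b)" using uH by (rule N_triangle_diff)
      also have "\<dots> \<le> e' * (s - a) + e' * (b - s)"
        using \<delta>(2)[of a s] \<delta>(2)[of b s] ab k nn by auto
      also have "\<dots> = e' * (b - a)" by (simp add: algebra_simps)
      finally have "N (?u a - ?u b) \<le> e' * (b - a)" .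
      moreover have "Sup (snd q) - Inf (snd q) = b - a" using k q by simp
      ultimately show ?thesis unfolding g using H_diff[OF uH] by (simp only:)
    qed
    have "(\<Sum>(s, k)\<in>p. measure lborel k *\<^sub>R S s (A x)) - (S t x - x) = sum ?g p"
      using sum_increments_tagged_division[OF t p, of "\<lambda>r. S r x"] S_0[OF xH(1)]
      by (simp add: sum_subtractf split_def)
    also have "N \<dots> \<le> (\<Sum>q\<in>p. N (?g q))" using piece by (intro N_sum) blast
    also have "\<dots> \<le> (\<Sum>q\<in>p. e' * (Sup (snd q) - Inf (snd q)))" using piece by (intro sum_mono) blast
    also have "\<dots> = e' * t"
      using sum_increments_tagged_division[OF t p, of "\<lambda>r. r"]
      by (simp add: split_def flip: sum_distrib_left)
    also have "\<dots> < e" using t \<open>e > 0\<close> by (simp add: e'_def divide_simps)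
    finally show "N ((\<Sum>(s, k)\<in>p. measure lborel k *\<^sub>R S s (A x)) - (S t x - x)) < e" .
  qed
qed

lemma range_A: assumes "x \<in> H" shows "\<exists>y\<in>D. A y = x"
  using bounded_inverse assms by blast

text \<open>Since \<open>A\<close> is onto, \<open>x = A y\<close> for some \<open>y\<close> in \<open>D\<close>, and the orbit of \<open>x\<close> is the derivative of the orbit of \<open>y\<close>: the integral of
the orbit of \<open>x\<close> is \<open>S t y - y\<close>, visibly in \<open>D\<close>, with image \<open>S t x - x\<close> under \<open>A\<close>.\<close>

theorem mild_solution_S:
  assumes x: "x \<in> H" shows "mild_solution H N D A x (\<lambda>t. S t x)"
proof -
  obtain y where y: "y \<in> D" "A y = x" using range_A[OF x] by blast
  show ?thesis
    unfolding mild_solution_def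
  proof (intro conjI allI impI)
    show "cont_wrt N {0..} (\<lambda>t. S t x)" by (rule cont_wrt_S[OF x])
    fix t :: real assume t: "0 \<le> t"
    show "S t x \<in> H" using t x by auto
    have "S t y - y \<in> D" using S_domain[OF y(1) t] y by auto
    moreover have "has_riemann_integral N (\<lambda>t. S t x) (S t y - y) 0 t"
      using has_riemann_integral_S[OF y(1) t] y(2) by simp
    moreover have "S t x = x + A (S t y - y)" using S_domain[OF y(1) t] y by (simp add: A_diff)
    ultimately show "\<exists>J\<in>D. has_riemann_integral N (\<lambda>t. S t x) J 0 t \<and> S t x = x + A J" by blast
  qed
qed

theorem strong_solution_S:
  assumes x: "x \<in> D" and "\<tau> > 0" shows "strong_solution H N D A x \<tau> (\<lambda>t. S t x)"
proof -
  have xH: "x \<in> H" "A x \<in> H" using x by auto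
  have mono: "(f \<longlongrightarrow> 0) (at t within {0..\<tau>})" if "(f \<longlongrightarrow> 0) (at t within {0..})" for f :: "real \<Rightarrow> real" and t
    using that by (rule tendsto_within_subset) auto
  have c: "cont_wrt N {0..\<tau>} (\<lambda>t. S t y)" if "y \<in> H" for y
    using cont_wrt_S[OF that] unfolding cont_wrt_def by (auto intro: mono)
  have d: "has_deriv_wrt N {0..\<tau>} (\<lambda>t. S t x) (\<lambda>t. S t (A x))"
    using has_deriv_wrt_S[OF x] unfolding has_deriv_wrt_def by (auto intro: mono)
  have g: "cont_wrt (graph_norm N A) {0..\<tau>} (\<lambda>t. S t x)"
    unfolding cont_wrt_def
  proof
    fix t assume t: "t \<in> {0..\<tau>}"
    have "((\<lambda>s. N (S s x - S t x) + N (S s (A x) - S t (A x))) \<longlongrightarrow> 0) (at t within {0..\<tau>})"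
      using c[OF xH(1)] c[OF xH(2)] t unfolding cont_wrt_def by (intro tendsto_add_zero) auto
    moreover have "\<forall>\<^sub>F s in at t within {0..\<tau>}. N (S s x - S t x) + N (S s (A x) - S t (A x))
        = graph_norm N A (S s x - S t x)"
    proof (rule eventually_at_topological[THEN iffD2], intro exI[of _ UNIV] conjI ballI impI)
      fix s assume "s \<in> {0..\<tau>}"
      then show "N (S s x - S t x) + N (S s (A x) - S t (A x)) = graph_norm N A (S s x - S t x)"
        using S_domain[OF x, of s] S_domain[OF x, of t] t by (simp add: graph_norm_def A_diff)
    qed auto
    ultimately show "((\<lambda>s. graph_norm N A (S s x - S t x)) \<longlongrightarrow> 0) (at t within {0..\<tau>})"
      by (rule Lim_transform_eventually)
  qed
  show ?thesis
    unfolding strong_solution_def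
    using d c[OF xH(2)] g S_domain[OF x] xH S_0[OF xH(1)]
    by (intro conjI exI[of _ "\<lambda>t. S t (A x)"]) auto
qed


text \<open>The increment of the integral over a short interval is the length times a nearby value.  Joining fine divisions of
\<open>[0, a]\<close> and \<open>[a, b]\<close> gives a fine division of \<open>[0, b]\<close>, so the sum over the second part approximates the increment.\<close>

lemma riemann_integral_increment:
  assumes J: "J1 \<in> H" "J2 \<in> H" "has_riemann_integral N U J1 0 a" "has_riemann_integral N U J2 0 b"
    and ab: "0 \<le> a" "a \<le> b" and U: "\<And>r. 0 \<le> r \<Longrightarrow> r \<le> b \<Longrightarrow> U r \<in> H" and c: "c \<in> H"
    and near: "\<And>r. a \<le> r \<Longrightarrow> r \<le> b \<Longrightarrow> N (U r - c) \<le> e"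
  shows "N (J2 - J1 - (b - a) *\<^sub>R c) \<le> e * (b - a)"
proof (rule field_le_epsilon)
  fix \<eta> :: real assume "\<eta> > 0"
  then have "\<eta> / 2 > 0" by simp
  let ?m = "measure lborel"
  let ?f = "\<lambda>(x, k). ?m k *\<^sub>R U x"
  obtain d1 where d1: "d1 > 0" "\<forall>p. p tagged_division_of {0..a} \<longrightarrow> (\<lambda>x. ball x d1) fine p
      \<longrightarrow> N (sum ?f p - J1) < \<eta> / 2"
    using has_riemann_integralD[OF J(3) \<open>\<eta> / 2 > 0\<close>] .
  obtain d2 where d2: "d2 > 0" "\<forall>p. p tagged_division_of {0..b} \<longrightarrow> (\<lambda>x. ball x d2) fine p
      \<longrightarrow> N (sum ?f p - J2) < \<eta> / 2"
    using has_riemann_integralD[OF J(4) \<open>\<eta> / 2 > 0\<close>] .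
  define d where "d = min d1 d2"
  have d: "d > 0" using d1 d2 by (simp add: d_def)
  have finer: "(\<lambda>x. ball x d1) fine p \<and> (\<lambda>x. ball x d2) fine p" if "(\<lambda>x. ball x d) fine p"
    for p :: "(real \<times> real set) set"
    using that unfolding fine_def d_def by fastforce
  obtain p1 where p1: "p1 tagged_division_of {0..a}" "(\<lambda>x. ball x d) fine p1"
    using fine_division_exists_real[OF gauge_ball[OF d]] by blast
  obtain p2 where p2: "p2 tagged_division_of {a..b}" "(\<lambda>x. ball x d) fine p2"
    using fine_division_exists_real[OF gauge_ball[OF d]] by blast
  have "interior {0..a} \<inter> interior {a..b} = {}" by (auto simp: interior_atLeastAtMost_real)
  then have "p1 \<union> p2 tagged_division_of {0..a} \<union> {a..b}"
    by (rule tagged_division_Un[OF p1(1) p2(1)])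
  moreover have "{0..a} \<union> {a..b} = {0..b}" using ab by auto
  ultimately have p: "p1 \<union> p2 tagged_division_of {0..b}" by simp
  have fin: "finite p1" "finite p2" using p1(1) p2(1) by auto
  \<comment> \<open>A tagged interval that occurs in both divisions is the degenerate interval at \<open>a\<close> and has length \<open>0\<close>.\<close>
  have "sum ?f (p1 \<union> p2) = sum ?f p1 + sum ?f p2"
  proof (rule sum.union_inter_neutral[OF fin], rule ballI)
    fix q assume q: "q \<in> p1 \<inter> p2"
    obtain x k where xk: "q = (x, k)" by (cases q)
    have "(x, k) \<in> p1" "(x, k) \<in> p2" using q xk by auto
    obtain u v where uv: "0 \<le> u" "u \<le> x" "x \<le> v" "v \<le> a" "Inf k = u" "?m k = v - u"
      using tagged_interval[OF p1(1) \<open>(x, k) \<in> p1\<close>] by metis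
    obtain u' v' where "a \<le> u'" "u' \<le> x" "Inf k = u'"
      using tagged_interval[OF p2(1) \<open>(x, k) \<in> p2\<close>] by metis
    then have "?m k = 0" using uv by linarith
    then show "?f q = 0" using xk by simp
  qed
  have piece1: "?f q \<in> H" if "q \<in> p1" for q
  proof -
    obtain x k where q: "q = (x, k)" by (cases q)
    then have "(x, k) \<in> p1" using that by simp
    then have "x \<in> {0..a}" using tagged_division_ofD(2,3)[OF p1(1)] by blast
    then show ?thesis using U q ab by auto
  qed
  let ?g = "\<lambda>(x, k). ?m k *\<^sub>R (U x - c)"
  have piece2: "?f q \<in> H \<and> ?g q \<in> H \<and> N (?g q) \<le> e * (Sup (snd q) - Inf (snd q))" if "q \<in> p2" for q
  proof -
    obtain x k where q: "q = (x, k)" by (cases q)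
    then have "(x, k) \<in> p2" using that by simp
    from tagged_interval[OF p2(1) this] obtain u v where k: "k = {u..v}" "a \<le> u" "u \<le> x" "x \<le> v" "v \<le> b"
        "Inf k = u" "Sup k = v" "?m k = v - u" .
    have x: "0 \<le> x" "a \<le> x" "x \<le> b" using k ab by auto
    have "N ((v - u) *\<^sub>R (U x - c)) = (v - u) * N (U x - c)"
      using k x U c by (subst N_scale) auto
    also have "\<dots> \<le> (v - u) * e" using k x near by (intro mult_left_mono) auto
    finally show ?thesis using q k x U c by (simp add: mult.commute)
  qed
  have len: "(\<Sum>q\<in>p2. Sup (snd q) - Inf (snd q)) = b - a"
    using sum_increments_tagged_division[OF ab(2) p2(1), of "\<lambda>r. r"] by (simp add: split_def)
  have "?m (snd q) = Sup (snd q) - Inf (snd q)" if "q \<in> p2" for q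
  proof -
    obtain x k where q: "q = (x, k)" by (cases q)
    then have "(x, k) \<in> p2" using that by simp
    from tagged_interval[OF p2(1) this] obtain u v where "Inf k = u" "Sup k = v" "?m k = v - u" by metis
    then show ?thesis using q by simp
  qed
  then have "(\<Sum>q\<in>p2. ?m (snd q)) = b - a" unfolding len[symmetric] by (intro sum.cong) auto
  then have "(\<Sum>q\<in>p2. ?m (snd q) *\<^sub>R c) = (b - a) *\<^sub>R c" by (simp flip: scaleR_left.sum)
  moreover have "sum ?g p2 = sum ?f p2 - (\<Sum>q\<in>p2. ?m (snd q) *\<^sub>R c)"
    by (simp add: split_def scaleR_diff_right flip: sum_subtractf)
  ultimately have sumg: "sum ?g p2 = sum ?f p2 - (b - a) *\<^sub>R c" by simp
  have in1: "sum ?f p1 \<in> H" and in2: "sum ?f p2 \<in> H" and ing: "sum ?g p2 \<in> H"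
    using piece1 piece2 by (blast intro: H_sum)+
  have "J2 - J1 - (b - a) *\<^sub>R c = (J2 - sum ?f (p1 \<union> p2)) + ((sum ?f p1 - J1) + sum ?g p2)"
    unfolding sumg \<open>sum ?f (p1 \<union> p2) = _\<close> by simp
  then have "N (J2 - J1 - (b - a) *\<^sub>R c)
      = N ((J2 - sum ?f (p1 \<union> p2)) + ((sum ?f p1 - J1) + sum ?g p2))" by (rule arg_cong)
  moreover have "N ((J2 - sum ?f (p1 \<union> p2)) + ((sum ?f p1 - J1) + sum ?g p2))
      \<le> N (J2 - sum ?f (p1 \<union> p2)) + N ((sum ?f p1 - J1) + sum ?g p2)"
    unfolding \<open>sum ?f (p1 \<union> p2) = _\<close>
    by (intro N_triangle H_add H_diff J in1 in2 ing)
  moreover have "N ((sum ?f p1 - J1) + sum ?g p2) \<le> N (sum ?f p1 - J1) + N (sum ?g p2)"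
    by (intro N_triangle H_diff J in1 ing)
  moreover have "N (J2 - sum ?f (p1 \<union> p2)) = N (sum ?f (p1 \<union> p2) - J2)"
    unfolding \<open>sum ?f (p1 \<union> p2) = _\<close> by (intro N_diff_commute H_add J in1 in2)
  moreover have "N (sum ?f (p1 \<union> p2) - J2) < \<eta> / 2"
    using finer p1 p2 by (intro d2(2)[rule_format] p) (auto intro: fine_Un)
  moreover have "N (sum ?f p1 - J1) < \<eta> / 2" using finer p1 by (intro d1(2)[rule_format]) auto
  moreover have "N (sum ?g p2) \<le> e * (b - a)"
  proof -
    have "N (sum ?g p2) \<le> (\<Sum>q\<in>p2. N (?g q))" using piece2 by (intro N_sum) blast
    also have "\<dots> \<le> (\<Sum>q\<in>p2. e * (Sup (snd q) - Inf (snd q)))" using piece2 by (intro sum_mono) blast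
    also have "\<dots> = e * (b - a)" unfolding len[symmetric] by (simp add: sum_distrib_left)
    finally show ?thesis .
  qed
  ultimately show "N (J2 - J1 - (b - a) *\<^sub>R c) \<le> e * (b - a) + \<eta>" by linarith
qed

lemma riemann_integral_0:
  assumes J: "J \<in> H" "has_riemann_integral N U J 0 0" and U: "U 0 \<in> H" shows "J = 0"
proof -
  have "N J \<le> e" if "e > 0" for e
  proof -
    obtain d where d: "d > 0" "\<forall>p. p tagged_division_of {0..0} \<longrightarrow> (\<lambda>x. ball x d) fine p
      \<longrightarrow> N ((\<Sum>(x, k)\<in>p. measure lborel k *\<^sub>R U x) - J) < e"
      using has_riemann_integralD[OF J(2) \<open>e > 0\<close>] .
    obtain p where p: "p tagged_division_of {0..0::real}" "(\<lambda>x. ball x d) fine p"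
      using fine_division_exists_real[OF gauge_ball[OF d(1)]] by blast
    have "(\<Sum>(x, k)\<in>p. measure lborel k *\<^sub>R U x) = 0"
    proof (rule sum.neutral, rule ballI)
      fix q assume "q \<in> p"
      obtain x k where q: "q = (x, k)" by (cases q)
      then have "(x, k) \<in> p" using \<open>q \<in> p\<close> by simp
      from tagged_interval[OF p(1) this] obtain u v where "0 \<le> u" "u \<le> x" "x \<le> v" "v \<le> 0"
        "measure lborel k = v - u" by metis
      then have "measure lborel k = 0" by linarith
      then show "(case q of (x, k) \<Rightarrow> measure lborel k *\<^sub>R U x) = 0" using q by simp
    qed
    then show ?thesis using d(2)[rule_format, OF p] N_minus[OF J(1)] by simp
  qed
  then have "N J \<le> 0" by (rule field_le_epsilon[of _ 0, simplified])
  then show ?thesis by (rule N_le_0[OF J(1)])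
qed

text \<open>The difference \<open>Z\<close> of the integrals of two mild solutions lies in \<open>D\<close>, vanishes at \<open>0\<close>, and \<open>A Z\<close> is its derivative.
Dissipativity gives \<open>|Z b| \<le> |Z b - (b - a) A (Z b)|\<close>, and the right hand side is \<open>|Z a|\<close> up to an error \<open>4 e (b - a)\<close> if
both solutions vary by less than \<open>e\<close> around the tag.  Summing over a gauge-fine division of \<open>[0, t]\<close> bounds \<open>|Z t|\<close> by
\<open>4 e t\<close>.  A gauge that depends on the tag makes pointwise continuity of the solutions sufficient.\<close>

theorem mild_solution_unique:
  assumes W: "mild_solution H N D A x W" and x: "x \<in> H" and t: "0 \<le> t" shows "W t = S t x"
proof -
  have U: "mild_solution H N D A x (\<lambda>t. S t x)" by (rule mild_solution_S[OF x])
  have "\<forall>t\<in>{0..}. \<exists>J. J \<in> D \<and> has_riemann_integral N W J 0 t \<and> W t = x + A J"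
    using W unfolding mild_solution_def by auto
  from bchoice[OF this] obtain I where I: "\<And>t. 0 \<le> t \<Longrightarrow> I t \<in> D"
    "\<And>t. 0 \<le> t \<Longrightarrow> has_riemann_integral N W (I t) 0 t" "\<And>t. 0 \<le> t \<Longrightarrow> W t = x + A (I t)" by auto
  have "\<forall>t\<in>{0..}. \<exists>J. J \<in> D \<and> has_riemann_integral N (\<lambda>t. S t x) J 0 t \<and> S t x = x + A J"
    using U unfolding mild_solution_def by auto
  from bchoice[OF this] obtain J where J: "\<And>t. 0 \<le> t \<Longrightarrow> J t \<in> D"
    "\<And>t. 0 \<le> t \<Longrightarrow> has_riemann_integral N (\<lambda>t. S t x) (J t) 0 t" "\<And>t. 0 \<le> t \<Longrightarrow> S t x = x + A (J t)" by auto
  have WH: "W r \<in> H" if "0 \<le> r" for r using W that unfolding mild_solution_def by auto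
  have SH: "S r x \<in> H" if "0 \<le> r" for r using that x by auto
  define Z where "Z r = I r - J r" for r
  have Z: "Z r \<in> D" "A (Z r) = W r - S r x" if "0 \<le> r" for r
    using I(1,3)[OF that] J(1,3)[OF that] by (auto simp: Z_def A_diff)
  have Z0: "Z 0 = 0"
    using riemann_integral_0[OF _ I(2) WH] riemann_integral_0[OF _ J(2) SH] I(1) J(1)
    by (simp add: Z_def)
  have "N (Z t) \<le> \<epsilon>" if "\<epsilon> > 0" for \<epsilon>
  proof -
    define e where "e = \<epsilon> / (4 * (t + 1))"
    have e: "e > 0" using that t by (simp add: e_def)
    have near: "\<exists>d>0. \<forall>r\<ge>0. \<bar>r - s\<bar> < d \<longrightarrow> N (V r - V s) < e"
      if V: "cont_wrt N {0..} V" and s: "0 \<le> s" and "N 0 = 0" for V s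
    proof -
      have "\<forall>\<^sub>F r in at s within {0..}. N (V r - V s) < e"
        using V s e unfolding cont_wrt_def by (intro order_tendstoD(2)) auto
      then obtain d where d: "d > 0" "\<And>r. 0 \<le> r \<Longrightarrow> r \<noteq> s \<Longrightarrow> dist r s < d \<Longrightarrow> N (V r - V s) < e"
        unfolding eventually_at by auto
      have "N (V r - V s) < e" if "r \<ge> 0" "\<bar>r - s\<bar> < d" for r
        using d(2)[of r] that e by (cases "r = s") (auto simp: dist_real_def)
      then show ?thesis using d(1) by blast
    qed
    have "\<exists>d>0. \<forall>r\<ge>0. 0 \<le> s \<longrightarrow> \<bar>r - s\<bar> < d \<longrightarrow> N (W r - W s) < e \<and> N (S r x - S s x) < e" for s
    proof (cases "0 \<le> s")
      case True
      obtain d1 where d1: "d1 > 0" "\<forall>r\<ge>0. \<bar>r - s\<bar> < d1 \<longrightarrow> N (W r - W s) < e"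
        using near[of W s] W True unfolding mild_solution_def by auto
      obtain d2 where d2: "d2 > 0" "\<forall>r\<ge>0. \<bar>r - s\<bar> < d2 \<longrightarrow> N (S r x - S s x) < e"
        using near[of "\<lambda>r. S r x" s] U True unfolding mild_solution_def by auto
      show ?thesis using d1 d2 by (intro exI[of _ "min d1 d2"]) auto
    qed (auto intro: exI[of _ 1])
    then obtain d where d: "\<And>s. d s > 0" "\<And>s r. 0 \<le> r \<Longrightarrow> 0 \<le> s \<Longrightarrow> \<bar>r - s\<bar> < d s
        \<Longrightarrow> N (W r - W s) < e \<and> N (S r x - S s x) < e" by metis
    obtain p where p: "p tagged_division_of {0..t}" "(\<lambda>s. ball s (d s)) fine p"
      using fine_division_exists_real[OF gauge_ball_dependent] d(1) by blast
    have piece: "N (Z (Sup (snd q))) - N (Z (Inf (snd q))) \<le> 4 * e * (Sup (snd q) - Inf (snd q))"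
      if "q \<in> p" for q
    proof -
      obtain s k where q: "q = (s, k)" by (cases q)
      then have sk: "(s, k) \<in> p" using that by simp
      from tagged_interval[OF p(1) this] obtain a b where k: "k = {a..b}" "0 \<le> a" "a \<le> s" "s \<le> b" "b \<le> t"
          "Inf k = a" "Sup k = b" "measure lborel k = b - a" .
      have ball: "k \<subseteq> ball s (d s)" using p(2) sk unfolding fine_def by blast
      have s: "0 \<le> s" "0 \<le> b" "a \<le> b" using k by auto
      have close: "N (W r - W b) \<le> 2 * e" "N (S r x - S b x) \<le> 2 * e" if "a \<le> r" "r \<le> b" for r
      proof -
        have r: "0 \<le> r" using that k by simp
        have "r \<in> k" "b \<in> k" using that k by auto
        then have "r \<in> ball s (d s)" "b \<in> ball s (d s)" using ball by blast+
        then have rb: "\<bar>r - s\<bar> < d s" "\<bar>b - s\<bar> < d s" by (auto simp: dist_real_def)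
        have "N (W r - W b) \<le> N (W r - W s) + N (W s - W b)" by (intro N_triangle_through WH r s)
        moreover have "N (W s - W b) = N (W b - W s)" by (intro N_diff_commute WH s)
        ultimately show "N (W r - W b) \<le> 2 * e"
          using d(2)[OF r s(1) rb(1)] d(2)[OF s(2,1) rb(2)] by linarith
        have "N (S r x - S b x) \<le> N (S r x - S s x) + N (S s x - S b x)" by (intro N_triangle_through SH r s)
        moreover have "N (S s x - S b x) = N (S b x - S s x)" by (intro N_diff_commute SH s)
        ultimately show "N (S r x - S b x) \<le> 2 * e"
          using d(2)[OF r s(1) rb(1)] d(2)[OF s(2,1) rb(2)] by linarith
      qed
      have 1: "N (I b - I a - (b - a) *\<^sub>R W b) \<le> 2 * e * (b - a)"
        by (rule riemann_integral_increment[OF _ _ I(2) I(2)]) (use I(1) k s WH close in auto)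
      have 2: "N (J b - J a - (b - a) *\<^sub>R S b x) \<le> 2 * e * (b - a)"
        by (rule riemann_integral_increment[OF _ _ J(2) J(2)]) (use J(1) k s SH close in auto)
      let ?i = "I b - I a - (b - a) *\<^sub>R W b" and ?j = "J b - J a - (b - a) *\<^sub>R S b x"
      have IJ: "I a \<in> H" "I b \<in> H" "J a \<in> H" "J b \<in> H" using I(1) J(1) k s by auto
      have ij: "?i \<in> H" "?j \<in> H" using IJ WH[OF s(2)] SH[OF s(2)] by auto
      have ZH: "Z a \<in> H" "Z b \<in> D" using Z k s by auto
      have "N (Z b) \<le> N (Z b - (b - a) *\<^sub>R A (Z b))" using ZH s by (intro expansive) auto
      also have "Z b - (b - a) *\<^sub>R A (Z b) = Z a + (?i - ?j)"
        unfolding Z(2)[OF s(2)] by (simp add: Z_def algebra_simps)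
      also have "N \<dots> \<le> N (Z a) + N (?i - ?j)" by (intro N_triangle H_diff ZH ij)
      finally have "N (Z b) \<le> N (Z a) + N (?i - ?j)" .
      moreover have "N (?i - ?j) \<le> N ?i + N ?j" using ij by (rule N_triangle_diff)
      ultimately have "N (Z b) - N (Z a) \<le> 4 * e * (b - a)" using 1 2 by linarith
      then show ?thesis using q k by simp
    qed
    have "N (Z t) = (\<Sum>q\<in>p. N (Z (Sup (snd q))) - N (Z (Inf (snd q))))"
      using sum_increments_tagged_division[OF t p(1), of "\<lambda>r. N (Z r)"] Z0 by (simp add: split_def)
    also have "\<dots> \<le> (\<Sum>q\<in>p. 4 * e * (Sup (snd q) - Inf (snd q)))" using piece by (intro sum_mono) blast
    also have "\<dots> = 4 * e * t"
      using sum_increments_tagged_division[OF t p(1), of "\<lambda>r. r"]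
      by (simp add: split_def flip: sum_distrib_left)
    also have "\<dots> \<le> \<epsilon>" using t that by (simp add: e_def divide_simps)
    finally show ?thesis .
  qed
  then have "N (Z t) \<le> 0" by (rule field_le_epsilon[of _ 0, simplified])
  then have "Z t = 0" using Z(1)[OF t] by (intro N_le_0) auto
  then show ?thesis using I(3)[OF t] J(3)[OF t] by (simp add: Z_def)
qed

end

section \<open>Algebra of classes modulo equality almost everywhere\<close>

text \<open>By completeness of Lebesgue measure, measurability is a property of the class.\<close>

lemma measurable_lebesgue_AE_cong:
  fixes f g :: "real \<Rightarrow> 'b::topological_space"
  assumes f: "f \<in> borel_measurable lebesgue" and ae: "AE x in lebesgue. f x = g x"
  shows "g \<in> borel_measurable lebesgue"
proof (rule measurableI)
  fix S :: "'b set" assume S: "S \<in> sets borel"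
  show "g -` S \<inter> space lebesgue \<in> sets lebesgue"
  proof (rule completion.in_sets_AE)
    show "AE x in lebesgue. x \<in> f -` S \<inter> space lebesgue \<longleftrightarrow> x \<in> g -` S \<inter> space lebesgue"
      using ae by (auto elim: eventually_mono)
    show "f -` S \<inter> space lebesgue \<in> sets lebesgue" using f S by (rule measurable_sets)
  qed auto
qed auto

lemma abs_rep_aefun [simp]: "abs_aefun (rep_aefun f) = f"
  by (rule Quotient3_abs_rep[OF Quotient3_aefun])

lemma abs_aefun_eq_iff: "abs_aefun f = abs_aefun g \<longleftrightarrow> (AE x in lebesgue. f x = g x)"
  by (simp add: aefun.abs_eq_iff ae_eq_def)

lemma rep_abs_aefun: "AE x in lebesgue. rep_aefun (abs_aefun f) x = f x"
  using abs_aefun_eq_iff[of "rep_aefun (abs_aefun f)" f] by simp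

lemma aefun_eq_iff: "f = g \<longleftrightarrow> (AE x in lebesgue. rep_aefun f x = rep_aefun g x)"
  using abs_aefun_eq_iff[of "rep_aefun f" "rep_aefun g"] by simp

lemma rep_plus: "AE x in lebesgue. rep_aefun (f + g) x = rep_aefun f x + rep_aefun g x"
  using rep_abs_aefun plus_aefun.abs_eq[of "rep_aefun f" "rep_aefun g"] by simp

lemma rep_minus: "AE x in lebesgue. rep_aefun (f - g) x = rep_aefun f x - rep_aefun g x"
  using rep_abs_aefun minus_aefun.abs_eq[of "rep_aefun f" "rep_aefun g"] by simp

lemma rep_scaleR: "AE x in lebesgue. rep_aefun (r *\<^sub>R f) x = r *\<^sub>R rep_aefun f x"
  using rep_abs_aefun scaleR_aefun.abs_eq[of r "rep_aefun f"] by simp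

lemma rep_scaleC: "AE x in lebesgue. rep_aefun (scaleC c f) x = c * rep_aefun f x"
  using rep_abs_aefun scaleC.abs_eq[of c "rep_aefun f"] by simp

lemma rep_zero: "AE x in lebesgue. rep_aefun 0 x = 0"
  using rep_abs_aefun[of "\<lambda>_. 0"] zero_aefun.abs_eq by simp

lemma scaleR_eq_scaleC: "r *\<^sub>R f = scaleC (complex_of_real r) f"
  unfolding aefun_eq_iff using rep_scaleR[of r f] rep_scaleC[of "complex_of_real r" f]
  by eventually_elim (simp add: scaleR_conv_of_real)

lemma scaleC_add: "scaleC c (f + g) = scaleC c f + scaleC c g"
  unfolding aefun_eq_iff
  using rep_scaleC[of c "f + g"] rep_plus[of f g] rep_plus[of "scaleC c f" "scaleC c g"]
    rep_scaleC[of c f] rep_scaleC[of c g]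
  by eventually_elim (simp add: algebra_simps)

lemma scaleC_scaleC: "scaleC c (scaleC d f) = scaleC (c * d) f"
  unfolding aefun_eq_iff
  using rep_scaleC[of c "scaleC d f"] rep_scaleC[of d f] rep_scaleC[of "c * d" f]
  by eventually_elim simp

lemma scaleC_scaleR: "scaleC c (r *\<^sub>R f) = r *\<^sub>R scaleC c f"
  by (simp add: scaleR_eq_scaleC scaleC_scaleC mult.commute)

lemma scaleC_diff: "scaleC c (f - g) = scaleC c f - scaleC c g"
  using scaleC_add[of c f "(-1) *\<^sub>R g"] scaleC_scaleR[of c "-1" g] by simp

section \<open>The space of square integrable classes\<close>

lemma L2_abs:
  assumes "u \<in> borel_measurable lebesgue" "integrable lebesgue (\<lambda>x. (cmod (u x))\<^sup>2)"
    and "AE x in lebesgue. x \<notin> J \<longrightarrow> u x = 0"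
  shows "abs_aefun u \<in> L2 J"
proof -
  let ?v = "rep_aefun (abs_aefun u)"
  have ae: "AE x in lebesgue. u x = ?v x" using rep_abs_aefun[of u] by (auto elim: eventually_mono)
  have v: "?v \<in> borel_measurable lebesgue" by (rule measurable_lebesgue_AE_cong[OF assms(1) ae])
  have "integrable lebesgue (\<lambda>x. (cmod (?v x))\<^sup>2)"
  proof (rule integrable_cong_AE_imp[OF assms(2)])
    show "(\<lambda>x. (cmod (?v x))\<^sup>2) \<in> borel_measurable lebesgue" using v by measurable
    show "AE x in lebesgue. (cmod (u x))\<^sup>2 = (cmod (?v x))\<^sup>2" using ae by (auto elim: eventually_mono)
  qed
  moreover have "AE x in lebesgue. x \<notin> J \<longrightarrow> ?v x = 0"
    using ae assms(3) by eventually_elim simp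
  ultimately show ?thesis using v by (simp add: L2_def)
qed

lemma L2_measurable: "f \<in> L2 J \<Longrightarrow> rep_aefun f \<in> borel_measurable lebesgue"
  and L2_square_integrable: "f \<in> L2 J \<Longrightarrow> integrable lebesgue (\<lambda>x. (cmod (rep_aefun f x))\<^sup>2)"
  and L2_AE_zero: "f \<in> L2 J \<Longrightarrow> AE x in lebesgue. x \<notin> J \<longrightarrow> rep_aefun f x = 0"
  by (auto simp: L2_def)

lemma square_integrable_add:
  fixes u v :: "real \<Rightarrow> complex"
  assumes [measurable]: "u \<in> borel_measurable lebesgue" "v \<in> borel_measurable lebesgue"
    and "integrable lebesgue (\<lambda>x. (cmod (u x))\<^sup>2)" "integrable lebesgue (\<lambda>x. (cmod (v x))\<^sup>2)"
  shows "integrable lebesgue (\<lambda>x. (cmod (u x + v x))\<^sup>2)"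
proof (rule Bochner_Integration.integrable_bound)
  show "integrable lebesgue (\<lambda>x. 2 * (cmod (u x))\<^sup>2 + 2 * (cmod (v x))\<^sup>2)" using assms by simp
  show "AE x in lebesgue. norm ((cmod (u x + v x))\<^sup>2) \<le> norm (2 * (cmod (u x))\<^sup>2 + 2 * (cmod (v x))\<^sup>2)"
  proof (rule AE_I2)
    fix x
    have "(cmod (u x + v x))\<^sup>2 \<le> (cmod (u x) + cmod (v x))\<^sup>2"
      by (intro power_mono norm_triangle_ineq) auto
    also have "\<dots> \<le> 2 * (cmod (u x))\<^sup>2 + 2 * (cmod (v x))\<^sup>2"
      using sum_squares_bound[of "cmod (u x)" "cmod (v x)"] by (simp add: power2_sum)
    finally show "norm ((cmod (u x + v x))\<^sup>2) \<le> norm (2 * (cmod (u x))\<^sup>2 + 2 * (cmod (v x))\<^sup>2)" by simp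
  qed
qed measurable

lemma L2_add: "f \<in> L2 J \<Longrightarrow> g \<in> L2 J \<Longrightarrow> f + g \<in> L2 J"
proof -
  assume f: "f \<in> L2 J" and g: "g \<in> L2 J"
  have "AE x in lebesgue. x \<notin> J \<longrightarrow> rep_aefun f x + rep_aefun g x = 0"
    using L2_AE_zero[OF f] L2_AE_zero[OF g] by eventually_elim simp
  then have "abs_aefun (\<lambda>x. rep_aefun f x + rep_aefun g x) \<in> L2 J"
    by (intro L2_abs square_integrable_add borel_measurable_add L2_measurable[OF f] L2_measurable[OF g]
        L2_square_integrable[OF f] L2_square_integrable[OF g])
  then show ?thesis using plus_aefun.abs_eq[of "rep_aefun f" "rep_aefun g"] by simp
qed

lemma L2_scaleC: "f \<in> L2 J \<Longrightarrow> scaleC c f \<in> L2 J"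
proof -
  assume f: "f \<in> L2 J"
  have "abs_aefun (\<lambda>x. c * rep_aefun f x) \<in> L2 J"
  proof (rule L2_abs)
    show "integrable lebesgue (\<lambda>x. (cmod (c * rep_aefun f x))\<^sup>2)"
      using L2_square_integrable[OF f] by (simp add: norm_mult power_mult_distrib)
    show "AE x in lebesgue. x \<notin> J \<longrightarrow> c * rep_aefun f x = 0" using L2_AE_zero[OF f] by eventually_elim simp
  qed (use L2_measurable[OF f] in measurable)
  then show ?thesis using scaleC.abs_eq[of c "rep_aefun f"] by simp
qed

lemma L2_zero: "0 \<in> L2 J"
  unfolding zero_aefun.abs_eq by (rule L2_abs) auto

lemma subspace_L2: "subspace (L2 J)"
  by (auto simp: subspace_def L2_zero L2_add L2_scaleC scaleR_eq_scaleC)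

lemma L2_diff: "f \<in> L2 J \<Longrightarrow> g \<in> L2 J \<Longrightarrow> f - g \<in> L2 J"
  and L2_scaleR: "f \<in> L2 J \<Longrightarrow> r *\<^sub>R f \<in> L2 J"
  using subspace_L2 by (auto simp: subspace_diff subspace_scale)

lemma Re_mult_cnj_self: "Re (z * cnj z) = (cmod z)\<^sup>2"
  by (simp add: cmod_power2 flip: power2_eq_square)

text \<open>The real part of the Hermitian product.  Integrating over the whole line is correct since the classes vanish outside
their domain.\<close>

definition L2_ip :: "aefun \<Rightarrow> aefun \<Rightarrow> real" where
  "L2_ip f g = (LINT x|lebesgue. Re (rep_aefun f x * cnj (rep_aefun g x)))"

lemma L2_integrable_mult:
  assumes f: "f \<in> L2 J" and g: "g \<in> L2 J'"
  shows "integrable lebesgue (\<lambda>x. rep_aefun f x * cnj (rep_aefun g x))"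
    and "integrable lebesgue (\<lambda>x. rep_aefun f x * rep_aefun g x)"
    and "integrable lebesgue (\<lambda>x. Re (rep_aefun f x * cnj (rep_aefun g x)))"
proof -
  note [measurable] = L2_measurable[OF f] L2_measurable[OF g]
  have [measurable]: "(\<lambda>x. cnj (rep_aefun g x)) \<in> borel_measurable lebesgue"
    by (rule measurable_compose[OF L2_measurable[OF g] borel_measurable_continuous_onI])
      (intro continuous_intros)
  have i: "integrable lebesgue (\<lambda>x. (cmod (rep_aefun f x))\<^sup>2 + (cmod (rep_aefun g x))\<^sup>2)"
    using L2_square_integrable[OF f] L2_square_integrable[OF g] by simp
  have b: "a * b \<le> a\<^sup>2 + b\<^sup>2" if "0 \<le> a" "0 \<le> b" for a b :: real
    using sum_squares_bound[of a b] mult_nonneg_nonneg[OF that] by linarith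
  show 1: "integrable lebesgue (\<lambda>x. rep_aefun f x * cnj (rep_aefun g x))"
    by (rule Bochner_Integration.integrable_bound[OF i]) (measurable, auto simp: norm_mult b intro!: AE_I2)
  show "integrable lebesgue (\<lambda>x. rep_aefun f x * rep_aefun g x)"
    by (rule Bochner_Integration.integrable_bound[OF i]) (measurable, auto simp: norm_mult b intro!: AE_I2)
  show "integrable lebesgue (\<lambda>x. Re (rep_aefun f x * cnj (rep_aefun g x)))"
    using 1 by (rule integrable_Re)
qed

lemma set_integral_L2:
  assumes f: "f \<in> L2 J" and u: "\<And>x. rep_aefun f x = 0 \<Longrightarrow> u x = (0 :: 'b::{banach, second_countable_topology})"
    and "J \<subseteq> K" "K \<in> sets lebesgue" "u \<in> borel_measurable lebesgue"
  shows "(LINT x:K|lebesgue. u x) = (LINT x|lebesgue. u x)"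
  unfolding set_lebesgue_integral_def
proof (rule integral_cong_AE)
  show "AE x in lebesgue. indicator K x *\<^sub>R u x = u x"
    using L2_AE_zero[OF f] by eventually_elim (use u assms(3) in \<open>auto simp: indicator_def\<close>)
qed (use assms in auto)

lemma L2_norm_eq:
  assumes f: "f \<in> L2 J" and "J \<in> sets lebesgue"
  shows "L2_norm J f = sqrt (L2_ip f f)"
proof -
  have "(LINT x:J|lebesgue. (cmod (rep_aefun f x))\<^sup>2) = (LINT x|lebesgue. (cmod (rep_aefun f x))\<^sup>2)"
    by (rule set_integral_L2[OF f]) (use L2_measurable[OF f] assms in auto)
  also have "\<dots> = L2_ip f f" unfolding L2_ip_def by (simp add: cmod_power2 flip: power2_eq_square)
  finally show ?thesis by (simp add: L2_norm_def)
qed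

lemma real_inner_subspace_L2:
  assumes "J \<in> sets lebesgue" shows "real_inner_subspace (L2 J) (L2_norm J) L2_ip"
proof
  show "subspace (L2 J)" by (rule subspace_L2)
  fix f g h assume f: "f \<in> L2 J" and g: "g \<in> L2 J"
  show "L2_ip (f + g) h = L2_ip f h + L2_ip g h" if h: "h \<in> L2 J"
  proof -
    have "L2_ip (f + g) h = (LINT x|lebesgue. Re (rep_aefun f x * cnj (rep_aefun h x))
        + Re (rep_aefun g x * cnj (rep_aefun h x)))"
      unfolding L2_ip_def
    proof (rule integral_cong_AE)
      show "AE x in lebesgue. Re (rep_aefun (f + g) x * cnj (rep_aefun h x))
          = Re (rep_aefun f x * cnj (rep_aefun h x)) + Re (rep_aefun g x * cnj (rep_aefun h x))"
        using rep_plus[of f g] by eventually_elim (simp add: algebra_simps)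
    qed (use L2_integrable_mult(3) f g h L2_add in
        \<open>auto intro!: borel_measurable_integrable Bochner_Integration.integrable_add simp del: complex_cnj_cancel_iff times_complex.sel\<close>)
    also have "\<dots> = L2_ip f h + L2_ip g h"
      unfolding L2_ip_def by (intro Bochner_Integration.integral_add L2_integrable_mult(3)[OF f h] L2_integrable_mult(3)[OF g h])
    finally show ?thesis .
  qed
  show "L2_ip (r *\<^sub>R f) g = r * L2_ip f g" for r
  proof -
    have "L2_ip (r *\<^sub>R f) g = (LINT x|lebesgue. r * Re (rep_aefun f x * cnj (rep_aefun g x)))"
      unfolding L2_ip_def
    proof (rule integral_cong_AE)
      show "AE x in lebesgue. Re (rep_aefun (r *\<^sub>R f) x * cnj (rep_aefun g x))
          = r * Re (rep_aefun f x * cnj (rep_aefun g x))"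
        using rep_scaleR[of r f] by eventually_elim (simp add: algebra_simps)
    qed (use L2_integrable_mult(3) f g L2_scaleR in
        \<open>auto intro!: borel_measurable_integrable integrable_mult_right simp del: times_complex.sel\<close>)
    then show ?thesis by (simp add: L2_ip_def)
  qed
  show "L2_ip f g = L2_ip g f"
    unfolding L2_ip_def by (rule Bochner_Integration.integral_cong) (auto simp: algebra_simps)
  show "0 \<le> L2_ip f f"
    unfolding L2_ip_def by (intro integral_nonneg_AE) auto
  show "L2_norm J f = sqrt (L2_ip f f)" by (rule L2_norm_eq[OF f assms])
qed

lemma L2_ip_definite: assumes "f \<in> L2 J" "L2_ip f f = 0" shows "f = 0"
proof -
  have "AE x in lebesgue. Re (rep_aefun f x * cnj (rep_aefun f x)) = 0"
    using assms(2) L2_integrable_mult(3)[OF assms(1) assms(1)]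
    by (subst (asm) L2_ip_def, subst (asm) integral_nonneg_eq_0_iff_AE) auto
  then have "AE x in lebesgue. rep_aefun f x = 0"
    by eventually_elim (simp add: complex_eq_iff sum_power2_eq_zero_iff flip: power2_eq_square)
  then show ?thesis unfolding aefun_eq_iff using rep_zero by eventually_elim simp
qed


lemma L2_ip_cong_AE:
  assumes "AE x in lebesgue. Re (rep_aefun f x * cnj (rep_aefun g x)) = u x"
    and "f \<in> L2 J" "g \<in> L2 J'" "u \<in> borel_measurable lebesgue"
  shows "L2_ip f g = (LINT x|lebesgue. u x)"
  unfolding L2_ip_def
  by (rule integral_cong_AE) (use assms L2_integrable_mult(3) in \<open>auto simp del: times_complex.sel\<close>)

text \<open>Cauchy-Schwarz against the indicator of \<open>B\<close>.\<close>

lemma L2_integral_bound: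
  assumes f: "f \<in> L2 J" and B: "B \<in> lmeasurable"
  shows "set_integrable lebesgue B (rep_aefun f)"
    and "(LINT x:B|lebesgue. cmod (rep_aefun f x)) \<le> sqrt (measure lebesgue B) * sqrt (L2_ip f f)"
proof -
  note [measurable] = L2_measurable[OF f]
  have [measurable]: "B \<in> sets lebesgue" using B by auto
  interpret L: real_inner_subspace "L2 UNIV" "L2_norm UNIV" L2_ip
    by (rule real_inner_subspace_L2) auto
  define u where "u = abs_aefun (\<lambda>x. of_real (cmod (rep_aefun f x)))"
  define w where "w = abs_aefun (indicator B)"
  have u: "u \<in> L2 UNIV"
    unfolding u_def by (rule L2_abs) (use L2_square_integrable[OF f] in \<open>auto\<close>)
  have sq: "(cmod (indicator B x))\<^sup>2 = indicat_real B x" for x by (simp add: indicator_def)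
  have w: "w \<in> L2 UNIV"
    unfolding w_def by (rule L2_abs) (use B in \<open>auto simp: sq fmeasurable_def\<close>)
  have ru: "AE x in lebesgue. rep_aefun u x = of_real (cmod (rep_aefun f x))"
    unfolding u_def by (rule rep_abs_aefun)
  have rw: "AE x in lebesgue. rep_aefun w x = indicator B x"
    unfolding w_def by (rule rep_abs_aefun)
  have uw: "AE x in lebesgue. Re (rep_aefun u x * cnj (rep_aefun w x)) = indicator B x *\<^sub>R cmod (rep_aefun f x)"
    using ru rw by eventually_elim (simp add: indicator_def)
  have "integrable lebesgue (\<lambda>x. indicator B x *\<^sub>R cmod (rep_aefun f x))"
    by (rule integrable_cong_AE_imp[OF L2_integrable_mult(3)[OF u w] _ uw]) measurable
  then show "set_integrable lebesgue B (rep_aefun f)"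
    unfolding set_integrable_def
    by (rule Bochner_Integration.integrable_bound) (auto simp: indicator_def)
  have "(LINT x:B|lebesgue. cmod (rep_aefun f x)) = L2_ip u w"
    unfolding set_lebesgue_integral_def by (rule L2_ip_cong_AE[OF uw u w, symmetric]) measurable
  also have "\<dots> \<le> sqrt (L2_ip u u) * sqrt (L2_ip w w)"
    using L.Cauchy_Schwarz[OF u w] L.N_eq u w by simp
  also have "L2_ip u u = (LINT x|lebesgue. (cmod (rep_aefun f x))\<^sup>2)"
    by (rule L2_ip_cong_AE[OF _ u u])
      (use ru in \<open>eventually_elim, auto simp: power2_eq_square\<close>)
  also have "\<dots> = L2_ip f f"
    unfolding L2_ip_def by (simp add: cmod_power2 flip: power2_eq_square)
  also have "L2_ip w w = (LINT x|lebesgue. indicat_real B x)"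
    by (rule L2_ip_cong_AE[OF _ w w])
      (use rw in \<open>eventually_elim, auto simp: indicator_def\<close>)
  also have "\<dots> = measure lebesgue B" by simp
  finally show "(LINT x:B|lebesgue. cmod (rep_aefun f x)) \<le> sqrt (measure lebesgue B) * sqrt (L2_ip f f)"
    by (simp add: mult.commute)
qed

text \<open>The Riesz-Fischer argument: a subsequence with increments below \<open>(1/2)\<^sup>k\<close> converges almost everywhere, Fatou's lemma shows
that its pointwise limit is also its limit in \<open>L\<^sup>2\<close>, and a Cauchy sequence follows its subsequences.\<close>

lemma L2_complete:
  assumes J: "J \<in> lmeasurable" and X: "\<And>n. X n \<in> L2 J"
    and Cauchy: "\<And>e. e > 0 \<Longrightarrow> \<exists>M. \<forall>m\<ge>M. \<forall>n\<ge>M. L2_norm J (X m - X n) < e"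
  shows "\<exists>f\<in>L2 J. (\<lambda>n. L2_norm J (X n - f)) \<longlonglongrightarrow> 0"
proof -
  have [measurable]: "J \<in> sets lebesgue" using J by auto
  interpret L: real_inner_subspace "L2 J" "L2_norm J" L2_ip
    by (rule real_inner_subspace_L2) auto
  have "\<forall>k. \<exists>M. \<forall>m\<ge>M. \<forall>n\<ge>M. L2_norm J (X m - X n) < (1/2) ^ k" using Cauchy by simp
  then obtain M where M: "\<And>k m n. M k \<le> m \<Longrightarrow> M k \<le> n \<Longrightarrow> L2_norm J (X m - X n) < (1/2) ^ k" by metis
  define r where "r k = (\<Sum>i\<le>k. M i)" for k
  have r_ge: "M k \<le> r m" if "k \<le> m" for k m
    unfolding r_def by (rule member_le_sum) (use that in auto)
  define f where "f k = rep_aefun (X (r k))" for k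
  have [measurable]: "f k \<in> borel_measurable lebesgue" for k
    unfolding f_def by (rule L2_measurable[OF X])
  have Xr: "X (r m) - X (r k) \<in> L2 J" for m k by (intro L2_diff X)
  have close: "L2_norm J (X (r m) - X (r k)) \<le> (1/2) ^ k" if "k \<le> m" for m k
    using M[of k "r m" "r k"] r_ge[OF that] r_ge[of k k] by simp
  have rep_diff: "AE x in lebesgue. rep_aefun (X (r m) - X (r k)) x = f m x - f k x" for m k
    unfolding f_def by (rule rep_minus)
  have offJ: "AE x in lebesgue. x \<notin> J \<longrightarrow> f k x = 0" for k
    unfolding f_def by (rule L2_AE_zero[OF X])
  \<comment> \<open>On a set of finite measure the \<open>L\<^sup>2\<close> norm bounds the \<open>L\<^sup>1\<close> norm, so along the fast subsequence the
    increments are summable in \<open>L\<^sup>1\<close> and hence, almost everywhere, absolutely summable pointwise.\<close>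
  have L1: "(\<integral>\<^sup>+x. ennreal (cmod (f (Suc k) x - f k x)) \<partial>lebesgue)
      \<le> ennreal (sqrt (measure lebesgue J) * (1/2) ^ k)" for k
  proof -
    let ?h = "X (r (Suc k)) - X (r k)"
    have "(\<integral>\<^sup>+x. ennreal (cmod (f (Suc k) x - f k x)) \<partial>lebesgue)
        = (\<integral>\<^sup>+x. ennreal (indicator J x *\<^sub>R cmod (rep_aefun ?h x)) \<partial>lebesgue)"
      by (rule nn_integral_cong_AE)
        (use rep_diff[of "Suc k" k] offJ[of k] offJ[of "Suc k"] in \<open>eventually_elim, auto simp: indicator_def\<close>)
    also have "\<dots> = ennreal (LINT x:J|lebesgue. cmod (rep_aefun ?h x))"
      unfolding set_lebesgue_integral_def
      using set_integrable_norm[OF L2_integral_bound(1)[OF Xr J]]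
      by (intro nn_integral_eq_integral) (auto simp: set_integrable_def)
    also have "\<dots> \<le> ennreal (sqrt (measure lebesgue J) * (1/2) ^ k)"
    proof (rule ennreal_leI)
      have "(LINT x:J|lebesgue. cmod (rep_aefun ?h x)) \<le> sqrt (measure lebesgue J) * L2_norm J ?h"
        using L2_integral_bound(2)[OF Xr J] L.N_eq[OF Xr] by simp
      also have "\<dots> \<le> sqrt (measure lebesgue J) * (1/2) ^ k"
        by (intro mult_left_mono close) auto
      finally show "(LINT x:J|lebesgue. cmod (rep_aefun ?h x)) \<le> sqrt (measure lebesgue J) * (1/2) ^ k" .
    qed
    finally show ?thesis .
  qed
  have "(\<integral>\<^sup>+x. (\<Sum>k. ennreal (cmod (f (Suc k) x - f k x))) \<partial>lebesgue)
      = (\<Sum>k. \<integral>\<^sup>+x. ennreal (cmod (f (Suc k) x - f k x)) \<partial>lebesgue)"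
    by (rule nn_integral_suminf) measurable
  also have "\<dots> \<le> (\<Sum>k. ennreal (sqrt (measure lebesgue J) * (1/2) ^ k))"
    by (rule suminf_le[OF L1]) auto
  also have "\<dots> = ennreal (\<Sum>k. sqrt (measure lebesgue J) * (1/2) ^ k)"
    by (rule suminf_ennreal2) (auto intro!: summable_mult summable_geometric)
  also have "\<dots> < \<infinity>" by simp
  finally have "(\<integral>\<^sup>+x. (\<Sum>k. ennreal (cmod (f (Suc k) x - f k x))) \<partial>lebesgue) \<noteq> \<infinity>" by simp
  then have "AE x in lebesgue. (\<Sum>k. ennreal (cmod (f (Suc k) x - f k x))) \<noteq> \<infinity>"
    by (intro nn_integral_PInf_AE) measurable
  then have conv: "AE x in lebesgue. convergent (\<lambda>k. f k x)"
  proof eventually_elim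
    case (elim x)
    then have "summable (\<lambda>k. cmod (f (Suc k) x - f k x))"
      by (intro summable_suminf_not_top) auto
    then have "summable (\<lambda>k. f (Suc k) x - f k x)" by (rule summable_norm_cancel)
    then have "convergent (\<lambda>n. \<Sum>k<n. f (Suc k) x - f k x)" by (simp add: summable_iff_convergent)
    then have "convergent (\<lambda>n. f n x - f 0 x)" by (simp add: sum_lessThan_telescope[of "\<lambda>k. f k x"])
    then have "convergent (\<lambda>n. (f n x - f 0 x) + f 0 x)" by (intro convergent_add convergent_const)
    then show ?case by simp
  qed
  define g where "g x = lim (\<lambda>k. f k x)" for x
  have [measurable]: "g \<in> borel_measurable lebesgue"
    unfolding g_def by (rule borel_measurable_lim_metric) measurable
  have lim: "AE x in lebesgue. (\<lambda>k. f k x) \<longlonglongrightarrow> g x"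
    using conv by eventually_elim (simp add: g_def convergent_LIMSEQ_iff)
  have fatou: "(\<integral>\<^sup>+x. ennreal ((cmod (f k x - g x))\<^sup>2) \<partial>lebesgue) \<le> ennreal (((1/2) ^ k)\<^sup>2)" for k
  proof -
    have "(\<integral>\<^sup>+x. ennreal ((cmod (f k x - g x))\<^sup>2) \<partial>lebesgue)
        = (\<integral>\<^sup>+x. liminf (\<lambda>m. ennreal ((cmod (f m x - f k x))\<^sup>2)) \<partial>lebesgue)"
    proof (rule nn_integral_cong_AE, use lim in eventually_elim)
      case (elim x)
      then have "(\<lambda>m. ennreal ((cmod (f m x - f k x))\<^sup>2)) \<longlonglongrightarrow> ennreal ((cmod (g x - f k x))\<^sup>2)"
        by (intro tendsto_intros)
      then have "liminf (\<lambda>m. ennreal ((cmod (f m x - f k x))\<^sup>2)) = ennreal ((cmod (g x - f k x))\<^sup>2)"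
        by (intro lim_imp_Liminf) auto
      then show ?case by (simp add: norm_minus_commute)
    qed
    also have "\<dots> \<le> liminf (\<lambda>m. \<integral>\<^sup>+x. ennreal ((cmod (f m x - f k x))\<^sup>2) \<partial>lebesgue)"
      by (rule nn_integral_liminf) measurable
    also have "\<dots> \<le> ennreal (((1/2) ^ k)\<^sup>2)"
    proof (rule Liminf_le)
      show "\<forall>\<^sub>F m in sequentially. (\<integral>\<^sup>+x. ennreal ((cmod (f m x - f k x))\<^sup>2) \<partial>lebesgue) \<le> ennreal (((1/2) ^ k)\<^sup>2)"
        using eventually_ge_at_top[of k]
      proof eventually_elim
        case (elim m)
        let ?h = "X (r m) - X (r k)"
        have "(\<integral>\<^sup>+x. ennreal ((cmod (f m x - f k x))\<^sup>2) \<partial>lebesgue)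
            = (\<integral>\<^sup>+x. ennreal ((cmod (rep_aefun ?h x))\<^sup>2) \<partial>lebesgue)"
          by (rule nn_integral_cong_AE) (use rep_diff[of m k] in \<open>eventually_elim, auto\<close>)
        also have "\<dots> = ennreal (LINT x|lebesgue. (cmod (rep_aefun ?h x))\<^sup>2)"
          by (rule nn_integral_eq_integral[OF L2_square_integrable[OF Xr]]) auto
        also have "(LINT x|lebesgue. (cmod (rep_aefun ?h x))\<^sup>2) = (L2_norm J ?h)\<^sup>2"
          unfolding L.N_sq[OF Xr] L2_ip_def by (simp add: cmod_power2 flip: power2_eq_square)
        also have "ennreal \<dots> \<le> ennreal (((1/2) ^ k)\<^sup>2)"
          by (intro ennreal_leI power_mono close elim L.N_nonneg Xr)
        finally show ?case .
      qed
    qed auto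
    finally show ?thesis .
  qed
  have sqi: "integrable lebesgue (\<lambda>x. (cmod (f k x - g x))\<^sup>2)" for k
    by (rule integrableI_bounded) (use le_less_trans[OF fatou[of k]] in \<open>auto simp: power2_eq_square\<close>)
  have "integrable lebesgue (\<lambda>x. (cmod ((g x - f 0 x) + f 0 x))\<^sup>2)"
    using sqi[of 0] L2_square_integrable[OF X[of "r 0"]]
    by (intro square_integrable_add) (auto simp: norm_minus_commute f_def[symmetric])
  then have sqg: "integrable lebesgue (\<lambda>x. (cmod (g x))\<^sup>2)" by simp
  have "AE x in lebesgue. \<forall>k. x \<notin> J \<longrightarrow> f k x = 0" 
    by (subst AE_all_countable) (rule allI, rule offJ)
  then have "AE x in lebesgue. x \<notin> J \<longrightarrow> g x = 0"
    using lim by eventually_elim (auto simp: LIMSEQ_const_iff)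
  then have G: "abs_aefun g \<in> L2 J" using sqg by (intro L2_abs) auto
  let ?G = "abs_aefun g"
  have near: "L2_norm J (X (r k) - ?G) \<le> (1/2) ^ k" for k
  proof -
    have h: "X (r k) - ?G \<in> L2 J" by (intro L2_diff X G)
    have ae: "AE x in lebesgue. rep_aefun (X (r k) - ?G) x = f k x - g x"
      using rep_minus[of "X (r k)" ?G] rep_abs_aefun[of g] by eventually_elim (simp add: f_def)
    have "L2_ip (X (r k) - ?G) (X (r k) - ?G) = (LINT x|lebesgue. (cmod (f k x - g x))\<^sup>2)"
    proof (rule L2_ip_cong_AE[OF _ h h])
      show "AE x in lebesgue. Re (rep_aefun (X (r k) - ?G) x * cnj (rep_aefun (X (r k) - ?G) x)) = (cmod (f k x - g x))\<^sup>2"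
        using ae by eventually_elim (simp only: Re_mult_cnj_self)
    qed measurable
    moreover have "ennreal (LINT x|lebesgue. (cmod (f k x - g x))\<^sup>2) \<le> ennreal (((1/2) ^ k)\<^sup>2)"
      using nn_integral_eq_integral[OF sqi[of k]] fatou[of k] by simp
    ultimately have "L2_ip (X (r k) - ?G) (X (r k) - ?G) \<le> ((1/2) ^ k)\<^sup>2" by (simp add: ennreal_le_iff)
    then have "(L2_norm J (X (r k) - ?G))\<^sup>2 \<le> ((1/2) ^ k)\<^sup>2" by (simp only: L.N_sq[OF h])
    then show ?thesis by (rule power2_le_imp_le) simp
  qed
  have "(\<lambda>n. L2_norm J (X n - ?G)) \<longlonglongrightarrow> 0"
  proof (rule LIMSEQ_I)
    fix e :: real assume "e > 0"
    obtain k where k: "(1/2) ^ k < e / 2" using real_arch_pow_inv[of "e/2" "1/2"] \<open>e > 0\<close> by auto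
    have "L2_norm J (X n - ?G) < e" if n: "n \<ge> M k" for n
    proof -
      have "L2_norm J (X n - ?G) \<le> L2_norm J (X n - X (r k)) + L2_norm J (X (r k) - ?G)"
        by (intro L.N_triangle_through X G)
      then show ?thesis using M[OF n r_ge[of k k]] near[of k] k by linarith
    qed
    moreover have "0 \<le> L2_norm J (X n - ?G)" for n by (intro L.N_nonneg L2_diff X G)
    ultimately show "\<exists>n0. \<forall>n\<ge>n0. norm (L2_norm J (X n - ?G) - 0) < e" by auto
  qed
  then show ?thesis using G by blast
qed

section \<open>Primitives and integration by parts\<close>

lemma sigma_finite_lebesgue: "sigma_finite_measure (lebesgue :: real measure)"
proof
  let ?A = "range (\<lambda>n::nat. {- real n..real n})"
  have "countable ?A" by simp
  moreover have "?A \<subseteq> sets lebesgue" by auto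
  moreover have "\<Union>?A = space lebesgue"
  proof -
    have "\<exists>n::nat. x \<in> {- real n..real n}" for x
    proof -
      obtain n :: nat where "\<bar>x\<bar> \<le> real n" using real_arch_simple by blast
      then show ?thesis by (intro exI[of _ n]) auto
    qed
    then show ?thesis by auto
  qed
  moreover have "\<forall>a\<in>?A. emeasure lebesgue a \<noteq> \<infinity>" by auto
  ultimately show "\<exists>A. countable A \<and> A \<subseteq> sets lebesgue \<and> \<Union>A = space lebesgue \<and>
      (\<forall>a\<in>A. emeasure (lebesgue :: real measure) a \<noteq> \<infinity>)" by blast
qed

text \<open>Fubini on the triangles \<open>y \<le> x\<close> and \<open>y > x\<close> of the plane: the two integrals on the left are the integrals of
\<open>g(y) h(x)\<close> over them.\<close>

theorem integral_by_parts_primitives: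
  fixes g h :: "real \<Rightarrow> complex"
  assumes g: "integrable lebesgue g" and h: "integrable lebesgue h"
  shows "integrable lebesgue (\<lambda>x. (LINT y:{..x}|lebesgue. g y) * h x)"
    and "integrable lebesgue (\<lambda>x. g x * (LINT y:{..x}|lebesgue. h y))"
    and "(LINT x|lebesgue. (LINT y:{..x}|lebesgue. g y) * h x)
      + (LINT x|lebesgue. g x * (LINT y:{..x}|lebesgue. h y))
      = (LINT x|lebesgue. g x) * (LINT x|lebesgue. h x)"
proof -
  interpret sigma_finite_measure "lebesgue :: real measure" by (rule sigma_finite_lebesgue)
  interpret P: pair_sigma_finite "lebesgue :: real measure" "lebesgue :: real measure" ..
  note [measurable] = borel_measurable_integrable[OF g] borel_measurable_integrable[OF h]
  let ?L = "lebesgue :: real measure"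
  have id: "(\<lambda>x. x) \<in> borel_measurable ?L" by (intro measurable_completion) simp
  note [measurable] = measurable_compose[OF measurable_fst[of ?L ?L] id]
    measurable_compose[OF measurable_snd[of ?L ?L] id]
    measurable_compose[OF measurable_snd[of ?L ?L] borel_measurable_integrable[OF g]]
    measurable_compose[OF measurable_fst[of ?L ?L] borel_measurable_integrable[OF h]]
  have int: "integrable (?L \<Otimes>\<^sub>M ?L) (\<lambda>p. g (snd p) * h (fst p))"
  proof (rule P.Fubini_integrable)
    show "(\<lambda>p. g (snd p) * h (fst p)) \<in> borel_measurable (?L \<Otimes>\<^sub>M ?L)" by measurable
    show "integrable ?L (\<lambda>x. LINT y|?L. norm (g (snd (x, y)) * h (fst (x, y))))"
      using g h by (simp add: norm_mult)
    show "AE x in ?L. integrable ?L (\<lambda>y. g (snd (x, y)) * h (fst (x, y)))"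
      using g by simp
  qed
  have set1 [measurable]: "{p. snd p \<le> fst p} \<in> sets (?L \<Otimes>\<^sub>M ?L)"
  proof -
    have "{p \<in> space (?L \<Otimes>\<^sub>M ?L). snd p \<le> fst p} \<in> sets (?L \<Otimes>\<^sub>M ?L)" by measurable
    then show ?thesis by (simp add: space_pair_measure)
  qed
  let ?F1 = "\<lambda>x y. indicator {..x} y *\<^sub>R g y * h x" and ?F2 = "\<lambda>x y. (1 - indicat_real {..x} y) *\<^sub>R g y * h x"
  have i1: "integrable (?L \<Otimes>\<^sub>M ?L) (case_prod ?F1)"
  proof (rule Bochner_Integration.integrable_bound[OF int])
    have "case_prod ?F1 = (\<lambda>p. indicat_real {p. snd p \<le> fst p} p *\<^sub>R (g (snd p) * h (fst p)))"
      by (auto simp: fun_eq_iff indicator_def)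
    then show "case_prod ?F1 \<in> borel_measurable (?L \<Otimes>\<^sub>M ?L)" by simp
  qed (auto simp: indicator_def intro!: AE_I2)
  have i2: "integrable (?L \<Otimes>\<^sub>M ?L) (case_prod ?F2)"
  proof (rule Bochner_Integration.integrable_bound[OF int])
    have "case_prod ?F2 = (\<lambda>p. (1 - indicat_real {p. snd p \<le> fst p} p) *\<^sub>R (g (snd p) * h (fst p)))"
      by (auto simp: fun_eq_iff indicator_def)
    then show "case_prod ?F2 \<in> borel_measurable (?L \<Otimes>\<^sub>M ?L)" by simp
  qed (auto simp: indicator_def intro!: AE_I2)
  have in1: "(LINT y|?L. ?F1 x y) = (LINT y:{..x}|lebesgue. g y) * h x" for x
    unfolding set_lebesgue_integral_def by (rule integral_mult_left_zero)
  have in2: "(LINT x|?L. ?F2 x y) = g y * (LINT x:{..y}|lebesgue. h x)" for y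
  proof -
    have "(LINT x|?L. ?F2 x y) = (LINT x|?L. g y * (indicator {..y} x *\<^sub>R h x))"
    proof (rule integral_cong_AE)
      have "AE x in ?L. x \<noteq> y" by (rule AE_completion) (rule AE_lborel_singleton)
      then show "AE x in ?L. ?F2 x y = g y * (indicator {..y} x *\<^sub>R h x)"
        by eventually_elim (auto simp: indicator_def)
      have "(\<lambda>x. 1 - indicat_real {..x} y) = indicator {..<y}" by (auto simp: indicator_def)
      moreover have "indicat_real {..<y} \<in> borel_measurable ?L" by (rule borel_measurable_indicator) simp
      ultimately have [measurable]: "(\<lambda>x. 1 - indicat_real {..x} y) \<in> borel_measurable ?L" by (simp only:)
      then show "(\<lambda>x. ?F2 x y) \<in> borel_measurable ?L"
        by (intro borel_measurable_times borel_measurable_const borel_measurable_scaleR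
            borel_measurable_integrable[OF h])
    qed (intro borel_measurable_times borel_measurable_const borel_measurable_scaleR
          borel_measurable_indicator borel_measurable_integrable[OF h]; simp)
    then show ?thesis
      unfolding set_lebesgue_integral_def by (simp only: integral_mult_right_zero)
  qed
  show "integrable lebesgue (\<lambda>x. (LINT y:{..x}|lebesgue. g y) * h x)"
    using P.integrable_fst[OF i1] unfolding in1 .
  show "integrable lebesgue (\<lambda>x. g x * (LINT y:{..x}|lebesgue. h y))"
    using P.integrable_snd[OF i2] unfolding in2 .
  have "(LINT x|lebesgue. (LINT y:{..x}|lebesgue. g y) * h x)
      + (LINT x|lebesgue. g x * (LINT y:{..x}|lebesgue. h y))
      = integral\<^sup>L (?L \<Otimes>\<^sub>M ?L) (case_prod ?F1) + integral\<^sup>L (?L \<Otimes>\<^sub>M ?L) (case_prod ?F2)"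
    unfolding P.integral_fst[OF i1, symmetric] P.integral_snd[OF i2, symmetric] in1 in2 ..
  also have "\<dots> = integral\<^sup>L (?L \<Otimes>\<^sub>M ?L) (\<lambda>p. case_prod ?F1 p + case_prod ?F2 p)"
    by (rule Bochner_Integration.integral_add[OF i1 i2, symmetric])
  also have "(\<lambda>p. case_prod ?F1 p + case_prod ?F2 p) = case_prod (\<lambda>x y. g y * h x)"
    by (auto simp: fun_eq_iff algebra_simps indicator_def)
  also have "integral\<^sup>L (?L \<Otimes>\<^sub>M ?L) (case_prod (\<lambda>x y. g y * h x)) = (LINT x|?L. (LINT y|?L. g y * h x))"
  proof (rule P.integral_fst[symmetric])
    show "integrable (?L \<Otimes>\<^sub>M ?L) (case_prod (\<lambda>x y. g y * h x))" using int by (simp add: split_def)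
  qed
  also have "\<dots> = (LINT x|lebesgue. g x) * (LINT x|lebesgue. h x)" by simp
  finally show "(LINT x|lebesgue. (LINT y:{..x}|lebesgue. g y) * h x)
      + (LINT x|lebesgue. g x * (LINT y:{..x}|lebesgue. h y))
      = (LINT x|lebesgue. g x) * (LINT x|lebesgue. h x)" .
qed

section \<open>Test functions\<close>

lemma test_function_mono: "test_function J \<eta> \<eta>' \<Longrightarrow> J \<subseteq> J' \<Longrightarrow> test_function J' \<eta> \<eta>'"
  unfolding test_function_def by blast

text \<open>The derivative vanishes off the support as well, since the complement of a compact set is open; the remaining properties
are continuity on a compact set and the fundamental theorem of calculus from a point left of the support.\<close>

lemma test_function_props:
  assumes t: "test_function J \<eta> \<eta>'"
  shows "continuous_on UNIV \<eta>" "continuous_on UNIV \<eta>'" "integrable lebesgue \<eta>" "integrable lebesgue \<eta>'"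
    "x \<notin> J \<Longrightarrow> \<eta> x = 0" "x \<notin> J \<Longrightarrow> \<eta>' x = 0"
    "(LINT y:{..x}|lebesgue. \<eta>' y) = \<eta> x" "(LINT y|lebesgue. \<eta>' y) = 0"
    "bounded (range \<eta>)" "bounded (range \<eta>')"
proof -
  have d: "(\<eta> has_real_derivative \<eta>' x) (at x)" for x using t by (simp add: test_function_def)
  show c': "continuous_on UNIV \<eta>'" using t by (simp add: test_function_def)
  show c: "continuous_on UNIV \<eta>" using DERIV_isCont[OF d] by (simp add: continuous_at_imp_continuous_on)
  obtain K where K: "compact K" "K \<subseteq> J" "\<And>x. x \<notin> K \<Longrightarrow> \<eta> x = 0"
    using t unfolding test_function_def by auto
  have K': "\<eta>' x = 0" if "x \<notin> K" for x
  proof -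
    have "open (- K)" using K(1) by (simp add: compact_imp_closed open_Compl)
    then have "((\<lambda>_. 0) has_real_derivative \<eta>' x) (at x)"
      by (rule has_field_derivative_transform_within_open[OF d[of x]]) (use that K(3) in auto)
    then show ?thesis using DERIV_unique[OF _ DERIV_const] by blast
  qed
  show "x \<notin> J \<Longrightarrow> \<eta> x = 0" "x \<notin> J \<Longrightarrow> \<eta>' x = 0" using K K' by blast+
  have int: "integrable lebesgue f" if f: "continuous_on UNIV f" "\<And>x. x \<notin> K \<Longrightarrow> f x = 0" for f :: "real \<Rightarrow> real"
  proof -
    have m: "f \<in> borel_measurable lborel" using f(1) by (simp add: borel_measurable_continuous_onI)
    have "integrable lborel (\<lambda>x. indicator K x *\<^sub>R f x)"
      using f(1) by (intro borel_integrable_compact K continuous_on_subset[OF f(1)]) auto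
    moreover have "(\<lambda>x. indicator K x *\<^sub>R f x) = f" using f(2) by (auto simp: indicator_def fun_eq_iff)
    ultimately show ?thesis using m by (simp add: integrable_completion)
  qed
  show "integrable lebesgue \<eta>" "integrable lebesgue \<eta>'" using int c c' K(3) K' by auto
  have bd: "bounded (range f)" if f: "continuous_on UNIV f" "\<And>x. x \<notin> K \<Longrightarrow> f x = 0" for f :: "real \<Rightarrow> real"
  proof -
    have "bounded (f ` K)" using f(1) K(1)
      by (intro compact_imp_bounded compact_continuous_image continuous_on_subset[OF f(1)]) auto
    then have "bounded (insert 0 (f ` K))" by simp
    then show ?thesis by (rule bounded_subset) (use f(2) in auto)
  qed
  show "bounded (range \<eta>)" "bounded (range \<eta>')" using bd c c' K(3) K' by auto
  obtain M where M: "\<And>x. x \<in> K \<Longrightarrow> \<bar>x\<bar> \<le> M"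
    using compact_imp_bounded[OF K(1)] unfolding bounded_iff by auto
  define m where "m = \<bar>M\<bar> + 1"
  have out: "\<eta> x = 0" "\<eta>' x = 0" if "\<bar>x\<bar> \<ge> m" for x
    using that M[of x] K(3)[of x] K'[of x] by (force simp: m_def)+
  have prim: "(LINT y:{..x}|lebesgue. \<eta>' y) = \<eta> x" for x
  proof -
    define a where "a = min (- m) x"
    have a: "a \<le> x" "\<eta> a = 0" using out(1)[of a] by (auto simp: a_def m_def)
    have "(\<lambda>y. indicator {..x} y *\<^sub>R \<eta>' y) = (\<lambda>y. \<eta>' y * indicator {a..x} y)"
      using out(2) by (fastforce simp: fun_eq_iff indicator_def a_def)
    then have "(LINT y:{..x}|lebesgue. \<eta>' y) = (LINT y|lebesgue. \<eta>' y * indicator {a..x} y)"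
      by (simp add: set_lebesgue_integral_def)
    also have "\<dots> = (LINT y|lborel. \<eta>' y * indicator {a..x} y)"
      using borel_measurable_continuous_onI[OF c'] by (intro integral_completion) simp
    also have "\<dots> = \<eta> x - \<eta> a"
      using d c' a by (intro integral_FTC_Icc_real) (auto simp: continuous_on_eq_continuous_at)
    finally show ?thesis using a by simp
  qed
  then show "(LINT y:{..x}|lebesgue. \<eta>' y) = \<eta> x" .
  have "(LINT y|lebesgue. \<eta>' y) = (LINT y:{..m}|lebesgue. \<eta>' y)"
    unfolding set_lebesgue_integral_def
    by (rule Bochner_Integration.integral_cong) (use out(2) in \<open>auto simp: indicator_def m_def\<close>)
  then show "(LINT y|lebesgue. \<eta>' y) = 0" using prim[of m] out(1)[of m] by (simp add: m_def)
qed

text \<open>A continuously differentiable function that vanishes exactly on the left half line, the building block for bumps.\<close>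

definition pos_square :: "real \<Rightarrow> real" where "pos_square t = (max 0 t)\<^sup>2"

lemma pos_square_deriv: "(pos_square has_real_derivative 2 * max 0 t) (at t)"
proof (cases t "0::real" rule: linorder_cases)
  case less
  have "((\<lambda>_. 0) has_real_derivative 2 * max 0 t) (at t)" using less by simp
  then show ?thesis
    by (rule has_field_derivative_transform_within_open[of _ _ _ "{..<0}"])
      (use less in \<open>auto simp: pos_square_def\<close>)
next
  case equal
  have "((\<lambda>h. (pos_square (0 + h) - pos_square 0) / h) \<longlongrightarrow> 0) (at 0)"
  proof (rule Lim_null_comparison)
    show "\<forall>\<^sub>F h in at 0. norm ((pos_square (0 + h) - pos_square 0) / h) \<le> \<bar>h\<bar>"
      by (intro always_eventually allI) (auto simp: pos_square_def max_def power2_eq_square)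
    show "((\<lambda>h::real. \<bar>h\<bar>) \<longlongrightarrow> 0) (at 0)" by (rule tendsto_rabs_zero) (rule tendsto_ident_at)
  qed
  then show ?thesis using equal by (simp add: DERIV_def)
next
  case greater
  have "((\<lambda>t. t\<^sup>2) has_real_derivative 2 * max 0 t) (at t)"
    using greater by (auto intro!: derivative_eq_intros)
  then show ?thesis
    by (rule has_field_derivative_transform_within_open[of _ _ _ "{0<..}"])
      (use greater in \<open>auto simp: pos_square_def\<close>)
qed

definition bump_weight :: "real \<Rightarrow> real \<Rightarrow> real \<Rightarrow> real" where
  "bump_weight c d x = pos_square (x - c) * pos_square (d - x)"

text \<open>With the weight \<open>w = ((x - c)\<^sup>+)\<^sup>2 ((d - x)\<^sup>+)\<^sup>2\<close>, which is positive exactly on the open interval, \<open>s w / (1 + s w)\<close> increases to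
the indicator of the interval as \<open>s\<close> tends to infinity, without any explicit mollification.\<close>

definition bump :: "real \<Rightarrow> real \<Rightarrow> real \<Rightarrow> real \<Rightarrow> real" where
  "bump s c d x = s * bump_weight c d x / (1 + s * bump_weight c d x)"

lemma bump_weight_nonneg [simp]: "0 \<le> bump_weight c d x"
  by (simp add: bump_weight_def pos_square_def)

lemma bump_weight_pos: "c < x \<Longrightarrow> x < d \<Longrightarrow> 0 < bump_weight c d x"
  by (simp add: bump_weight_def pos_square_def)

lemma bump_weight_0: "\<not> (c < x \<and> x < d) \<Longrightarrow> bump_weight c d x = 0"
  by (auto simp: bump_weight_def pos_square_def max_def)

lemma bump_bounds: "0 \<le> s \<Longrightarrow> 0 \<le> bump s c d x" "0 \<le> s \<Longrightarrow> bump s c d x \<le> 1"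
proof -
  assume s: "0 \<le> s"
  have "0 \<le> s * bump_weight c d x" using s by simp
  then show "0 \<le> bump s c d x" "bump s c d x \<le> 1" by (auto simp: bump_def divide_le_eq)
qed

lemma bump_test_function:
  assumes s: "0 \<le> s" and J: "{c..d} \<subseteq> J"
  shows "\<exists>\<eta>'. test_function J (bump s c d) \<eta>'"
proof -
  define w' where "w' x = 2 * max 0 (x - c) * pos_square (d - x) - pos_square (x - c) * (2 * max 0 (d - x))" for x
  have w: "(bump_weight c d has_real_derivative w' x) (at x)" for x
    unfolding bump_weight_def[abs_def] w'_def
    by (rule derivative_eq_intros DERIV_chain2[OF pos_square_deriv] refl)+ simp
  have pos: "1 + s * bump_weight c d x \<noteq> 0" for x
    using s add_pos_nonneg[of 1 "s * bump_weight c d x"] by simp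
  define \<eta>' where "\<eta>' x = s * w' x / (1 + s * bump_weight c d x)\<^sup>2" for x
  have d: "(bump s c d has_real_derivative \<eta>' x) (at x)" for x
    unfolding bump_def[abs_def] \<eta>'_def
    by (rule derivative_eq_intros w refl pos)+ (simp add: power2_eq_square algebra_simps)
  have ps: "continuous_on UNIV (\<lambda>x. pos_square (f x))" if "continuous_on UNIV f" for f :: "real \<Rightarrow> real"
    unfolding pos_square_def by (intro continuous_intros that)
  have "continuous_on UNIV w'" unfolding w'_def by (intro continuous_intros ps)
  moreover have "continuous_on UNIV (bump_weight c d)" unfolding bump_weight_def[abs_def] by (intro continuous_intros ps)
  ultimately have "continuous_on UNIV \<eta>'"
    unfolding \<eta>'_def by (intro continuous_intros) (use pos in auto)
  moreover have "bump s c d x = 0" if "x \<notin> {c..d}" for x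
    using that bump_weight_0[of c x d] by (auto simp: bump_def)
  ultimately show ?thesis using d J unfolding test_function_def by blast
qed

text \<open>The interval is shrunk so that the support is a compact subset of the open interval.\<close>

definition inner_bump :: "real \<Rightarrow> real \<Rightarrow> nat \<Rightarrow> real \<Rightarrow> real" where
  "inner_bump c d n = bump (real n) (c + 1 / Suc n) (d - 1 / Suc n)"

lemma inner_bump_tendsto: "(\<lambda>n. inner_bump c d n x) \<longlonglongrightarrow> indicator {c<..<d} x"
proof (cases "c < x \<and> x < d")
  case True
  let ?w = "\<lambda>n. bump_weight (c + 1 / Suc n) (d - 1 / Suc n) x"
  have l: "(\<lambda>n. 1 / real (Suc n)) \<longlonglongrightarrow> 0" using LIMSEQ_Suc[OF lim_inverse_n'] by simp
  have "?w \<longlonglongrightarrow> (max 0 (x - (c + 0)))\<^sup>2 * (max 0 (d - 0 - x))\<^sup>2"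
    unfolding bump_weight_def pos_square_def by (intro tendsto_intros l)
  moreover have "(max 0 (x - (c + 0)))\<^sup>2 * (max 0 (d - 0 - x))\<^sup>2 > 0" using True by simp
  ultimately have "filterlim (\<lambda>n. ?w n * real n) at_top sequentially"
    by (intro filterlim_tendsto_pos_mult_at_top[of _ _ _ real] filterlim_real_sequentially)
  then have "filterlim (\<lambda>n. 1 + real n * ?w n) at_top sequentially"
    by (intro filterlim_tendsto_add_at_top[OF tendsto_const]) (simp add: mult.commute)
  then have "(\<lambda>n. inverse (1 + real n * ?w n)) \<longlonglongrightarrow> 0"
    by (rule tendsto_inverse_0_at_top)
  then have "(\<lambda>n. 1 - inverse (1 + real n * ?w n)) \<longlonglongrightarrow> 1 - 0" by (intro tendsto_intros)
  moreover have "1 - inverse (1 + real n * ?w n) = inner_bump c d n x" for n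
  proof -
    have "0 < 1 + real n * ?w n" by (intro add_pos_nonneg) auto
    then show ?thesis unfolding inner_bump_def bump_def by (simp add: field_simps)
  qed
  ultimately show ?thesis using True by simp
next
  case False
  have "\<not> (c + 1 / Suc n < x \<and> x < d - 1 / Suc n)" for n
  proof -
    have "0 < 1 / real (Suc n)" by simp
    then show ?thesis using False by linarith
  qed
  then have "inner_bump c d n x = 0" for n
    by (simp add: inner_bump_def bump_def bump_weight_0)
  then show ?thesis using False by simp
qed

lemma inner_bump_test_function:
  assumes "{c<..<d} \<subseteq> J" shows "\<exists>\<eta>'. test_function J (inner_bump c d n) \<eta>'"
  unfolding inner_bump_def
proof (rule bump_test_function)
  define e where "e = 1 / real (Suc n)"
  have "0 < e" by (simp add: e_def)
  then have "{c + e..d - e} \<subseteq> {c<..<d}" by auto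
  then show "{c + 1 / Suc n..d - 1 / Suc n} \<subseteq> J" using assms unfolding e_def by blast
qed simp

lemma borel_measurable_indicator_scaleR:
  fixes v :: "real \<Rightarrow> complex"
  shows "A \<in> sets lebesgue \<Longrightarrow> v \<in> borel_measurable lebesgue
    \<Longrightarrow> (\<lambda>x. indicat_real A x *\<^sub>R v x) \<in> borel_measurable lebesgue"
  by (intro borel_measurable_scaleR borel_measurable_indicator)

section \<open>Two lemmas of the calculus of variations\<close>

text \<open>Intervals generate the Borel sets, and a Lebesgue set differs from a Borel set by a null set.\<close>

lemma AE_zero_if_integrals_over_intervals_vanish:
  fixes v :: "real \<Rightarrow> complex"
  assumes v: "integrable lebesgue v" and zero: "\<And>c d. (LINT x:{c<..<d}|lebesgue. v x) = 0"
    and total: "(LINT x|lebesgue. v x) = 0"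
  shows "AE x in lebesgue. v x = 0"
proof (rule sigma_finite_measure.density_zero[OF sigma_finite_lebesgue v])
  note [measurable] = borel_measurable_integrable[OF v]
  have vs: "set_integrable lebesgue A v" if "A \<in> sets lebesgue" for A
    unfolding set_integrable_def using that by (intro integrable_mult_indicator v)
  have borel: "(LINT x:A|lebesgue. v x) = 0" if "A \<in> sets borel" for A
    using that
  proof (induction A rule: borel_set_induct)
    case (interval a b)
    have "(LINT x:{a..b}|lebesgue. v x) = (LINT x:{a<..<b}|lebesgue. v x)"
      unfolding set_lebesgue_integral_def
    proof (rule integral_cong_AE)
      have "AE x in lebesgue. x \<noteq> a" "AE x in lebesgue. x \<noteq> b"
        by (auto intro: AE_completion AE_lborel_singleton)
      then show "AE x in lebesgue. indicat_real {a..b} x *\<^sub>R v x = indicat_real {a<..<b} x *\<^sub>R v x"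
        by eventually_elim (auto simp: indicator_def)
    qed (auto intro!: borel_measurable_indicator_scaleR borel_measurable_integrable[OF v])
    then show ?case using zero by simp
  next
    case (compl A)
    have "(LINT x:-A|lebesgue. v x) = (LINT x|lebesgue. v x - indicator A x *\<^sub>R v x)"
      unfolding set_lebesgue_integral_def
      by (rule Bochner_Integration.integral_cong) (auto simp: indicator_def)
    also have "\<dots> = (LINT x|lebesgue. v x) - (LINT x:A|lebesgue. v x)"
      unfolding set_lebesgue_integral_def
      using compl(1) v by (intro Bochner_Integration.integral_diff integrable_mult_indicator) auto
    finally show ?case using compl(2) total by simp
  next
    case (union f)
    have "(LINT x:(\<Union>i. f i)|lebesgue. v x) = (\<Sum>i. (LINT x:f i|lebesgue. v x))"
      using union by (intro lebesgue_integral_countable_add vs) (auto simp: disjoint_family_on_def)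
    then show ?case using union by simp
  qed (simp add: set_lebesgue_integral_def)
  fix A :: "real set" assume A: "A \<in> sets lebesgue"
  let ?B = "main_part lborel A"
  have B: "?B \<in> sets borel" using main_part_sets[OF A] by simp
  have ae: "AE x in lebesgue. x \<in> ?B \<longleftrightarrow> x \<in> A" by (rule AE_completion[OF AE_in_main_part[OF A]])
  have "(LINT x:A|lebesgue. v x) = (LINT x:?B|lebesgue. v x)"
    unfolding set_lebesgue_integral_def
  proof (rule integral_cong_AE)
    show "AE x in lebesgue. indicat_real A x *\<^sub>R v x = indicat_real ?B x *\<^sub>R v x"
      using ae by eventually_elim (auto simp: indicator_def)
  qed (use A B in \<open>auto intro!: borel_measurable_indicator_scaleR borel_measurable_integrable[OF v]\<close>)
  then show "(LINT x:A|lebesgue. v x) = 0" using borel[OF B] by simp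
qed

text \<open>Testing with bumps that exhaust a subinterval gives integral zero over every subinterval, by dominated convergence.\<close>

lemma fundamental_lemma:
  fixes u :: "real \<Rightarrow> complex"
  assumes u: "set_integrable lebesgue {a<..<b} u"
    and zero: "\<And>\<eta> \<eta>'. test_function {a<..<b} \<eta> \<eta>' \<Longrightarrow> (LINT x:{a<..<b}|lebesgue. u x * of_real (\<eta> x)) = 0"
  shows "AE x in lebesgue. x \<in> {a<..<b} \<longrightarrow> u x = 0"
proof -
  define v where "v x = indicator {a<..<b} x *\<^sub>R u x" for x
  have v: "integrable lebesgue v" using u unfolding set_integrable_def v_def .
  note [measurable] = borel_measurable_integrable[OF v]
  have int: "(LINT x:{c<..<d}|lebesgue. v x) = 0" for c d
  proof -
    define c' d' where "c' = max a c" and "d' = min b d"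
    let ?\<eta> = "inner_bump c' d'"
    have sub: "{c'<..<d'} \<subseteq> {a<..<b}" by (auto simp: c'_def d'_def)
    have "(\<lambda>n. LINT x|lebesgue. v x * of_real (?\<eta> n x)) \<longlonglongrightarrow> (LINT x|lebesgue. v x * of_real (indicator {c'<..<d'} x))"
    proof (rule integral_dominated_convergence)
      show "integrable lebesgue (\<lambda>x. cmod (v x))" using v by simp
      show "AE x in lebesgue. (\<lambda>n. v x * of_real (?\<eta> n x)) \<longlonglongrightarrow> v x * of_real (indicator {c'<..<d'} x)"
        by (intro AE_I2 tendsto_intros inner_bump_tendsto)
      show "AE x in lebesgue. cmod (v x * of_real (?\<eta> n x)) \<le> cmod (v x)" for n
      proof (intro AE_I2)
        fix x
        have "\<bar>?\<eta> n x\<bar> \<le> 1" using bump_bounds[of "real n"] by (simp add: inner_bump_def)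
        then show "cmod (v x * of_real (?\<eta> n x)) \<le> cmod (v x)"
          by (simp add: norm_mult mult_left_le)
      qed
      have meas: "?\<eta> n \<in> borel_measurable lebesgue" for n
      proof -
        obtain \<eta>' where "test_function {a<..<b} (?\<eta> n) \<eta>'" using inner_bump_test_function[OF sub] by blast
        then show ?thesis using test_function_props(3) by blast
      qed
      then show "(\<lambda>x. v x * of_real (?\<eta> n x)) \<in> borel_measurable lebesgue" for n by measurable
      have "indicat_real {c'<..<d'} \<in> borel_measurable lebesgue"
        by (rule borel_measurable_indicator) simp
      then show "(\<lambda>x. v x * of_real (indicator {c'<..<d'} x)) \<in> borel_measurable lebesgue" by measurable
    qed
    moreover have "(LINT x|lebesgue. v x * of_real (?\<eta> n x)) = 0" for n
    proof -
      obtain \<eta>' where "test_function {a<..<b} (?\<eta> n) \<eta>'" using inner_bump_test_function[OF sub] by blast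
      from zero[OF this] show ?thesis by (simp add: set_lebesgue_integral_def v_def)
    qed
    ultimately have "(LINT x|lebesgue. v x * of_real (indicator {c'<..<d'} x)) = 0"
      by (simp add: LIMSEQ_const_iff)
    moreover have "v x * of_real (indicator {c'<..<d'} x) = indicat_real {c<..<d} x *\<^sub>R v x" for x
      by (auto simp: v_def indicator_def c'_def d'_def)
    ultimately show ?thesis by (simp add: set_lebesgue_integral_def)
  qed
  have "(LINT x|lebesgue. v x) = (LINT x:{a<..<b}|lebesgue. v x)"
    unfolding set_lebesgue_integral_def v_def
    by (rule Bochner_Integration.integral_cong) (auto simp: indicator_def)
  then have "AE x in lebesgue. v x = 0"
    using int by (intro AE_zero_if_integrals_over_intervals_vanish v) auto
  then show ?thesis by eventually_elim (auto simp: v_def)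
qed

lemma antiderivative_exists:
  fixes f :: "real \<Rightarrow> real"
  assumes "continuous_on UNIV f" shows "\<exists>F. \<forall>x. (F has_real_derivative f x) (at x)"
proof -
  have "\<exists>F. \<forall>x::real. (-\<infinity>::ereal) < x \<longrightarrow> x < (\<infinity>::ereal) \<longrightarrow> (F has_vector_derivative f x) (at x)"
    by (rule einterval_antiderivative) (use assms in \<open>auto simp: continuous_on_eq_continuous_at\<close>)
  then show ?thesis by (auto simp: has_real_derivative_iff_has_vector_derivative)
qed

text \<open>A primitive of \<open>f\<close> is constant on either side of \<open>[p, q]\<close>, and the two constants agree since the integral of \<open>f\<close> vanishes;
subtracting the constant makes the support compact.\<close>

lemma test_function_primitive:
  assumes f: "continuous_on UNIV f" "\<And>x. x \<notin> {p..q} \<Longrightarrow> f x = 0" and pq: "p \<le> q" "{p..q} \<subseteq> J"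
    and zero: "(LINT x|lebesgue. f x) = 0"
  shows "\<exists>\<eta>. test_function J \<eta> f"
proof -
  obtain F where F: "\<And>x. (F has_real_derivative f x) (at x)" using antiderivative_exists[OF f(1)] by blast
  have fp: "f x = 0" if "x \<in> {..<p} \<or> x \<in> {q<..}" for x using that f(2)[of x] by auto
  have const: "\<exists>c. \<forall>x\<in>S. F x = c" if "convex S" "\<And>x. x \<in> S \<Longrightarrow> f x = 0" for S
    by (rule has_field_derivative_zero_constant[OF that(1)])
      (use that(2) F in \<open>metis has_field_derivative_at_within\<close>)
  have cF: "isCont F x" for x using DERIV_isCont[OF F] .
  have left: "F x = F p" if "x < p" for x
  proof -
    obtain c where c: "\<And>x. x < p \<Longrightarrow> F x = c" using const[of "{..<p}"] fp by auto
    have "(F \<longlongrightarrow> F p) (at_left p)" using cF[of p] by (simp add: isCont_def filterlim_at_split)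
    moreover have "(F \<longlongrightarrow> c) (at_left p)"
      by (rule tendsto_eventually) (auto simp: eventually_at_left_field intro!: exI[of _ "p - 1"] c)
    ultimately show ?thesis using c[OF that] tendsto_unique trivial_limit_at_left_real by blast
  qed
  have right: "F x = F q" if "q < x" for x
  proof -
    obtain c where c: "\<And>x. q < x \<Longrightarrow> F x = c" using const[of "{q<..}"] fp by auto
    have "(F \<longlongrightarrow> F q) (at_right q)" using cF[of q] by (simp add: isCont_def filterlim_at_split)
    moreover have "(F \<longlongrightarrow> c) (at_right q)"
      by (rule tendsto_eventually) (auto simp: eventually_at_right_field intro!: exI[of _ "q + 1"] c)
    ultimately show ?thesis using c[OF that] tendsto_unique trivial_limit_at_right_real by blast
  qed
  have "(LINT x|lebesgue. f x) = (LINT x|lborel. f x)"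
    using borel_measurable_continuous_onI[OF f(1)] by (intro integral_completion) simp
  also have "\<dots> = (LINT x|lborel. f x * indicator {p..q} x)"
    by (rule Bochner_Integration.integral_cong) (use f(2) in \<open>auto simp: indicator_def\<close>)
  also have "\<dots> = F q - F p"
    using F f(1) pq by (intro integral_FTC_Icc_real) (auto simp: continuous_on_eq_continuous_at)
  finally have eq: "F q = F p" using zero by simp
  have "test_function J (\<lambda>x. F x - F p) f"
    unfolding test_function_def
  proof (intro conjI allI f(1) exI[of _ "{p..q}"] impI)
    show "((\<lambda>x. F x - F p) has_real_derivative f x) (at x)" for x
      using DERIV_diff[OF F DERIV_const] by simp
    show "F x - F p = 0" if "x \<notin> {p..q}" for x
      using that left[of x] right[of x] eq by (cases "x < p") auto
  qed (use pq in auto)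
  then show ?thesis by blast
qed

text \<open>Any test function \<open>\<theta>\<close> becomes the derivative of a test function after a multiple of one fixed bump \<open>\<theta>\<^sub>0\<close> is subtracted to
make its integral zero.  Hence \<open>\<integral> u \<theta> = c \<integral> \<theta>\<close> with \<open>c = \<integral> u \<theta>\<^sub>0 / \<integral> \<theta>\<^sub>0\<close>, and the fundamental lemma applies to \<open>u - c\<close>.\<close>

lemma du_Bois_Reymond:
  fixes u :: "real \<Rightarrow> complex"
  assumes ab: "a < b" and u: "set_integrable lebesgue {a<..<b} u"
    and zero: "\<And>\<eta> \<eta>'. test_function {a<..<b} \<eta> \<eta>' \<Longrightarrow> (LINT x:{a<..<b}|lebesgue. u x * of_real (\<eta>' x)) = 0"
  shows "\<exists>c. AE x in lebesgue. x \<in> {a<..<b} \<longrightarrow> u x = c"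
proof -
  let ?J = "{a<..<b}"
  define v where "v x = indicator ?J x *\<^sub>R u x" for x
  have v: "integrable lebesgue v" using u unfolding set_integrable_def v_def .
  note [measurable] = borel_measurable_integrable[OF v]
  have pair: "(LINT x:?J|lebesgue. u x * of_real (f x)) = (LINT x|lebesgue. v x * of_real (f x))" for f
    unfolding set_lebesgue_integral_def by (rule Bochner_Integration.integral_cong) (auto simp: v_def)
  have vint: "integrable lebesgue (\<lambda>x. v x * of_real (f x))"
    if f: "f \<in> borel_measurable lebesgue" "bounded (range f)" for f :: "real \<Rightarrow> real"
  proof -
    obtain B where B: "\<And>x. \<bar>f x\<bar> \<le> B" using f(2) unfolding bounded_iff by auto
    show ?thesis
    proof (rule Bochner_Integration.integrable_bound)
      show "integrable lebesgue (\<lambda>x. B * cmod (v x))" using v by simp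
      show "AE x in lebesgue. norm (v x * of_real (f x)) \<le> norm (B * cmod (v x))"
      proof (rule AE_I2)
        fix x
        have "0 \<le> B" using B[of x] by linarith
        then show "norm (v x * of_real (f x)) \<le> norm (B * cmod (v x))"
          using mult_right_mono[OF B[of x], of "cmod (v x)"] by (simp add: norm_mult mult.commute)
      qed
    qed (use f in measurable)
  qed
  \<comment> \<open>The middle third of the interval carries \<open>\<theta>\<^sub>0\<close>.\<close>
  define a' b' where "a' = (2 * a + b) / 3" and "b' = (a + 2 * b) / 3"
  have ab': "a < a'" "a' < b'" "b' < b" using ab by (auto simp: a'_def b'_def)
  define \<theta>\<^sub>0 where "\<theta>\<^sub>0 = bump 1 a' b'"
  obtain \<theta>\<^sub>0' where t0: "test_function {a'..b'} \<theta>\<^sub>0 \<theta>\<^sub>0'"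
    using bump_test_function[of 1 a' b' "{a'..b'}"] by (auto simp: \<theta>\<^sub>0_def)
  note p0 = test_function_props[OF t0]
  define k where "k = (LINT x|lebesgue. \<theta>\<^sub>0 x)"
  have k: "k \<noteq> 0"
  proof
    assume "k = 0"
    then have "AE x in lebesgue. \<theta>\<^sub>0 x = 0"
      using p0(3) unfolding k_def
      by (subst (asm) integral_nonneg_eq_0_iff_AE) (auto simp: \<theta>\<^sub>0_def bump_bounds)
    moreover have "\<theta>\<^sub>0 x \<noteq> 0" if "x \<in> {a'<..<b'}" for x
    proof -
      have "0 < bump_weight a' b' x" using that by (intro bump_weight_pos) auto
      then show ?thesis by (simp add: \<theta>\<^sub>0_def bump_def)
    qed
    ultimately have "AE x in lebesgue. x \<notin> {a'<..<b'}" by (auto elim: eventually_mono)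
    moreover have eq: "{x \<in> space lebesgue. \<not> x \<notin> {a'<..<b'}} = {a'<..<b'}" by auto
    ultimately have "emeasure lebesgue {a'<..<b'} = 0"
      using AE_iff_measurable[OF _ eq] by simp
    then show False using ab' by simp
  qed
  define c where "c = (LINT x|lebesgue. v x * of_real (\<theta>\<^sub>0 x)) / of_real k"
  have "AE x in lebesgue. x \<in> ?J \<longrightarrow> u x - c = 0"
  proof (rule fundamental_lemma)
    show "set_integrable lebesgue ?J (\<lambda>x. u x - c)"
      unfolding set_integrable_def scaleR_diff_right
      by (intro Bochner_Integration.integrable_diff u[unfolded set_integrable_def]
          integrable_scaleR_left integrable_real_indicator) (use ab in auto)
    fix \<theta> \<theta>' assume t: "test_function ?J \<theta> \<theta>'"
    note p = test_function_props[OF t]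
    obtain K where K: "compact K" "K \<subseteq> ?J" "\<And>x. x \<notin> K \<Longrightarrow> \<theta> x = 0"
      using t unfolding test_function_def by auto
    define L where "L = K \<union> {a'..b'}"
    have L: "compact L" "L \<noteq> {}" "L \<subseteq> ?J" using K ab' by (auto simp: L_def)
    obtain q where q: "q \<in> L" "\<And>x. x \<in> L \<Longrightarrow> x \<le> q" using compact_attains_sup[OF L(1,2)] by blast
    obtain r where r: "r \<in> L" "\<And>x. x \<in> L \<Longrightarrow> r \<le> x" using compact_attains_inf[OF L(1,2)] by blast
    define s where "s = (LINT x|lebesgue. \<theta> x)"
    define f where "f x = \<theta> x - s / k * \<theta>\<^sub>0 x" for x
    have "\<exists>\<eta>. test_function ?J \<eta> f"
    proof (rule test_function_primitive[of f r q])
      show "continuous_on UNIV f" unfolding f_def by (intro continuous_intros p p0)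
      show "f x = 0" if "x \<notin> {r..q}" for x
      proof -
        have "x \<notin> L" using that q r by fastforce
        then show ?thesis using K(3)[of x] p0(5)[of x] by (simp add: f_def L_def)
      qed
      show "r \<le> q" using r q by blast
      have "q \<in> ?J" "r \<in> ?J" using q(1) r(1) L(3) by blast+
      then show "{r..q} \<subseteq> ?J" by auto
      have "(LINT x|lebesgue. f x) = s - s / k * k"
        unfolding f_def s_def k_def using p(3) p0(3) by simp
      then show "(LINT x|lebesgue. f x) = 0" using k by simp
    qed
    then obtain \<eta> where "test_function ?J \<eta> f" ..
    from zero[OF this] have "0 = (LINT x|lebesgue. v x * of_real (f x))" by (simp add: pair)
    also have "\<dots> = (LINT x|lebesgue. v x * of_real (\<theta> x) - of_real (s / k) * (v x * of_real (\<theta>\<^sub>0 x)))"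
      by (rule Bochner_Integration.integral_cong) (auto simp: f_def algebra_simps)
    also have "\<dots> = (LINT x|lebesgue. v x * of_real (\<theta> x)) - of_real (s / k) * (LINT x|lebesgue. v x * of_real (\<theta>\<^sub>0 x))"
      using vint[OF borel_measurable_integrable[OF p(3)] p(9)] vint[OF borel_measurable_integrable[OF p0(3)] p0(9)]
      by (subst Bochner_Integration.integral_diff) auto
    finally have e: "(LINT x|lebesgue. v x * of_real (\<theta> x)) = of_real s * c" using k by (simp add: c_def)
    have "(LINT x:?J|lebesgue. (u x - c) * of_real (\<theta> x)) = (LINT x|lebesgue. v x * of_real (\<theta> x) - c * of_real (\<theta> x))"
      unfolding set_lebesgue_integral_def
      by (rule Bochner_Integration.integral_cong) (use p(5) in \<open>auto simp: v_def indicator_def algebra_simps\<close>)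
    also have "\<dots> = (LINT x|lebesgue. v x * of_real (\<theta> x)) - c * of_real s"
      using vint[OF borel_measurable_integrable[OF p(3)] p(9)] p(3)
      by (subst Bochner_Integration.integral_diff) (auto simp: s_def)
    finally show "(LINT x:?J|lebesgue. (u x - c) * of_real (\<theta> x)) = 0" using e by (simp add: mult.commute)
  qed
  then have "AE x in lebesgue. x \<in> ?J \<longrightarrow> u x = c" by eventually_elim simp
  then show ?thesis by blast
qed

section \<open>Piecewise primitives on the beam\<close>

text \<open>The primitive that vanishes at the left end, for classes supported in the beam; integrating from \<open>-\<infinity>\<close> avoids case
distinctions.\<close>

definition prim :: "aefun \<Rightarrow> real \<Rightarrow> complex" where
  "prim g x = (LINT y:{..x}|lebesgue. rep_aefun g y)"

text \<open>The point \<open>\<xi>\<close> is a null set, so square integrability does not see the cut; weak derivatives do.\<close>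

locale beam_with_cut =
  fixes l \<xi> :: real
  assumes xi_pos: "0 < \<xi>" and xi_less: "\<xi> < l"
begin

abbreviation "\<Omega> \<equiv> {0<..<l}"
abbreviation "Cut \<equiv> {0<..<\<xi>} \<union> {\<xi><..<l}"
abbreviation "norm2 \<equiv> L2_norm \<Omega>"

lemma l_pos: "0 < l" using xi_pos xi_less by simp

sublocale L2: real_inner_subspace "L2 \<Omega>" norm2 L2_ip
  by (rule real_inner_subspace_L2) simp

lemma norm2_eq: "f \<in> L2 \<Omega> \<Longrightarrow> norm2 f = sqrt (L2_ip f f)" by (rule L2.N_eq)

lemma AE_not_xi: "AE x in lebesgue. x \<noteq> \<xi>"
  by (rule AE_completion) (rule AE_lborel_singleton)

lemma AE_Cut: "AE x in lebesgue. x \<in> Cut \<longleftrightarrow> x \<in> \<Omega>"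
  using AE_not_xi by eventually_elim (use xi_pos xi_less in auto)

lemma L2_Cut: "L2 Cut = L2 \<Omega>"
proof -
  have "(AE x in lebesgue. x \<notin> Cut \<longrightarrow> u x = 0) \<longleftrightarrow> (AE x in lebesgue. x \<notin> \<Omega> \<longrightarrow> u x = 0)"
    for u :: "real \<Rightarrow> complex"
  proof
    assume "AE x in lebesgue. x \<notin> Cut \<longrightarrow> u x = 0"
    then show "AE x in lebesgue. x \<notin> \<Omega> \<longrightarrow> u x = 0" using AE_Cut by eventually_elim blast
  next
    assume "AE x in lebesgue. x \<notin> \<Omega> \<longrightarrow> u x = 0"
    then show "AE x in lebesgue. x \<notin> Cut \<longrightarrow> u x = 0" using AE_Cut by eventually_elim blast
  qed
  then show ?thesis unfolding L2_def by auto
qed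

lemma Omega_lmeasurable [simp]: "\<Omega> \<in> lmeasurable" by (simp add: lmeasurable_interval)

lemma integrable_rep: assumes g: "g \<in> L2 \<Omega>" shows "integrable lebesgue (rep_aefun g)"
proof (rule integrable_cong_AE_imp)
  show "integrable lebesgue (\<lambda>x. indicator \<Omega> x *\<^sub>R rep_aefun g x)"
    using L2_integral_bound(1)[OF g Omega_lmeasurable] unfolding set_integrable_def .
  show "AE x in lebesgue. indicator \<Omega> x *\<^sub>R rep_aefun g x = rep_aefun g x"
    using L2_AE_zero[OF g] by eventually_elim (auto simp: indicator_def)
qed (rule L2_measurable[OF g])

lemma set_integrable_rep:
  "g \<in> L2 \<Omega> \<Longrightarrow> A \<in> sets lebesgue \<Longrightarrow> set_integrable lebesgue A (rep_aefun g)"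
  unfolding set_integrable_def by (intro integrable_mult_indicator integrable_rep)

lemma prim_cong:
  assumes g: "g \<in> L2 \<Omega>" and u: "u \<in> borel_measurable lebesgue" and ae: "AE x in lebesgue. rep_aefun g x = u x"
  shows "prim g x = (LINT y:{..x}|lebesgue. u y)"
  unfolding prim_def set_lebesgue_integral_def
proof (rule integral_cong_AE)
  show "AE y in lebesgue. indicator {..x} y *\<^sub>R rep_aefun g y = indicator {..x} y *\<^sub>R u y"
    using ae by eventually_elim simp
qed (intro borel_measurable_indicator_scaleR L2_measurable[OF g] u; simp)+

lemma prim_add:
  assumes g: "g \<in> L2 \<Omega>" and h: "h \<in> L2 \<Omega>" shows "prim (g + h) x = prim g x + prim h x"
proof -
  have "prim (g + h) x = (LINT y:{..x}|lebesgue. rep_aefun g y + rep_aefun h y)"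
    by (intro prim_cong L2_add g h rep_plus borel_measurable_add L2_measurable[OF g] L2_measurable[OF h])
  also have "\<dots> = prim g x + prim h x"
    unfolding prim_def by (intro set_integral_add set_integrable_rep g h) auto
  finally show ?thesis .
qed

lemma prim_scaleC:
  assumes g: "g \<in> L2 \<Omega>" shows "prim (scaleC k g) x = k * prim g x"
proof -
  have "prim (scaleC k g) x = (LINT y:{..x}|lebesgue. k * rep_aefun g y)"
    by (intro prim_cong L2_scaleC g rep_scaleC borel_measurable_times borel_measurable_const L2_measurable[OF g])
  then show ?thesis by (simp add: prim_def)
qed

lemma prim_scaleR: "g \<in> L2 \<Omega> \<Longrightarrow> prim (r *\<^sub>R g) x = r *\<^sub>R prim g x"
  by (simp add: scaleR_eq_scaleC prim_scaleC scaleR_conv_of_real)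

lemma prim_diff: "g \<in> L2 \<Omega> \<Longrightarrow> h \<in> L2 \<Omega> \<Longrightarrow> prim (g - h) x = prim g x - prim h x"
  using prim_add[of g "(-1) *\<^sub>R h" x] prim_scaleR[of h "-1" x] L2_scaleR[of h \<Omega> "-1"] by simp

lemma prim_increment:
  assumes g: "g \<in> L2 \<Omega>" and xy: "x \<le> y"
  shows "cmod (prim g y - prim g x) \<le> sqrt (y - x) * norm2 g"
proof -
  have "prim g y = prim g x + (LINT z:{x<..y}|lebesgue. rep_aefun g z)"
    unfolding prim_def
    by (subst set_integral_Un[symmetric]) (auto intro!: set_integrable_rep g simp: ivl_disj_un xy)
  then have "cmod (prim g y - prim g x) = cmod (LINT z:{x<..y}|lebesgue. rep_aefun g z)" by simp
  also have "\<dots> \<le> (LINT z:{x<..y}|lebesgue. cmod (rep_aefun g z))"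
    using integral_norm_bound[of lebesgue "\<lambda>z. indicator {x<..y} z *\<^sub>R rep_aefun g z"]
    by (simp add: set_lebesgue_integral_def)
  also have "\<dots> \<le> sqrt (measure lebesgue {x<..y}) * sqrt (L2_ip g g)"
    by (rule L2_integral_bound(2)[OF g]) (use xy in \<open>simp add: fmeasurable_def\<close>)
  finally show ?thesis using xy g by (simp add: norm2_eq)
qed

lemma prim_nonpos: assumes g: "g \<in> L2 \<Omega>" and x: "x \<le> 0" shows "prim g x = 0"
proof -
  have "prim g x = (LINT y|(lebesgue :: real measure). 0)"
    unfolding prim_def set_lebesgue_integral_def
  proof (rule integral_cong_AE)
    show "AE y in lebesgue. indicat_real {..x} y *\<^sub>R rep_aefun g y = 0"
      using L2_AE_zero[OF g] by eventually_elim (use x in \<open>auto simp: indicator_def\<close>)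
  qed (intro borel_measurable_indicator_scaleR L2_measurable[OF g] borel_measurable_const; simp)+
  then show ?thesis by simp
qed

lemma prim_total: assumes g: "g \<in> L2 \<Omega>" shows "(LINT y|lebesgue. rep_aefun g y) = prim g l"
  unfolding prim_def set_lebesgue_integral_def
proof (rule integral_cong_AE)
  show "AE y in lebesgue. rep_aefun g y = indicat_real {..l} y *\<^sub>R rep_aefun g y"
    using L2_AE_zero[OF g] by eventually_elim (auto simp: indicator_def)
qed (intro borel_measurable_indicator_scaleR L2_measurable[OF g]; simp)+

lemma prim_bound: assumes g: "g \<in> L2 \<Omega>" and x: "x \<le> l" shows "cmod (prim g x) \<le> sqrt l * norm2 g"
proof (cases "x \<le> 0")
  case False
  have "cmod (prim g x) \<le> sqrt x * norm2 g"
    using prim_increment[OF g, of 0 x] prim_nonpos[OF g, of 0] False by simp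
  also have "\<dots> \<le> sqrt l * norm2 g" using x g by (intro mult_right_mono) auto
  finally show ?thesis .
qed (use prim_nonpos[OF g] g l_pos in auto)

lemma prim_continuous: assumes g: "g \<in> L2 \<Omega>" shows "isCont (prim g) x"
proof -
  have "((\<lambda>y. prim g y - prim g x) \<longlongrightarrow> 0) (at x)"
  proof (rule Lim_null_comparison)
    show "\<forall>\<^sub>F y in at x. norm (prim g y - prim g x) \<le> sqrt \<bar>y - x\<bar> * norm2 g"
    proof (intro always_eventually allI)
      fix y
      show "norm (prim g y - prim g x) \<le> sqrt \<bar>y - x\<bar> * norm2 g"
        using prim_increment[OF g, of x y] prim_increment[OF g, of y x]
        by (cases "x \<le> y") (auto simp: norm_minus_commute)
    qed
    have "((\<lambda>y. sqrt \<bar>y - x\<bar> * norm2 g) \<longlongrightarrow> sqrt \<bar>x - x\<bar> * norm2 g) (at x)" by (intro tendsto_intros)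
    then show "((\<lambda>y. sqrt \<bar>y - x\<bar> * norm2 g) \<longlongrightarrow> 0) (at x)" by simp
  qed
  then show ?thesis unfolding isCont_def by (rule LIM_zero_cancel)
qed

lemma prim_measurable: "g \<in> L2 \<Omega> \<Longrightarrow> prim g \<in> borel_measurable lebesgue"
  using prim_continuous
  by (intro measurable_completion) (auto intro!: borel_measurable_continuous_onI continuous_at_imp_continuous_on)

text \<open>The class on the beam of a function given by a formula.\<close>

definition cls :: "(real \<Rightarrow> complex) \<Rightarrow> aefun" where
  "cls u = abs_aefun (\<lambda>x. if x \<in> \<Omega> then u x else 0)"

lemma rep_cls: "AE x in lebesgue. rep_aefun (cls u) x = (if x \<in> \<Omega> then u x else 0)"
  unfolding cls_def by (rule rep_abs_aefun)

lemma cls_L2: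
  assumes u: "u \<in> borel_measurable lebesgue" and C: "\<And>x. x \<in> \<Omega> \<Longrightarrow> cmod (u x) \<le> C" "0 \<le> C"
  shows "cls u \<in> L2 \<Omega>" "norm2 (cls u) \<le> C * sqrt l"
proof -
  let ?v = "\<lambda>x. if x \<in> \<Omega> then u x else 0"
  have v: "?v \<in> borel_measurable lebesgue" using u by (intro measurable_If_set) auto
  have bound: "AE x in lebesgue. norm ((cmod (?v x))\<^sup>2) \<le> norm (indicat_real \<Omega> x * C\<^sup>2)"
    using C by (intro AE_I2) (auto intro: power_mono)
  have intC: "integrable lebesgue (\<lambda>x. indicat_real \<Omega> x * C\<^sup>2)"
    by (intro integrable_mult_left integrable_real_indicator) (use l_pos in auto)
  have int: "integrable lebesgue (\<lambda>x. (cmod (?v x))\<^sup>2)"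
    by (rule Bochner_Integration.integrable_bound[OF intC _ bound]) (use v in measurable)
  show L2: "cls u \<in> L2 \<Omega>" unfolding cls_def by (rule L2_abs[OF v int]) simp
  have "L2_ip (cls u) (cls u) = (LINT x|lebesgue. (cmod (?v x))\<^sup>2)"
  proof (rule L2_ip_cong_AE[OF _ L2 L2])
    show "AE x in lebesgue. Re (rep_aefun (cls u) x * cnj (rep_aefun (cls u) x)) = (cmod (?v x))\<^sup>2"
      using rep_cls[of u] by eventually_elim (simp only: Re_mult_cnj_self)
  qed (rule borel_measurable_integrable[OF int])
  also have "\<dots> \<le> (LINT x|lebesgue. indicat_real \<Omega> x * C\<^sup>2)"
    by (rule integral_mono_AE[OF int intC]) (use bound in \<open>auto elim: eventually_mono\<close>)
  also have "\<dots> = (C * sqrt l)\<^sup>2" using l_pos by (simp add: power_mult_distrib)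
  finally have "(norm2 (cls u))\<^sup>2 \<le> (C * sqrt l)\<^sup>2" using L2.N_sq[OF L2] by simp
  then show "norm2 (cls u) \<le> C * sqrt l" by (rule power2_le_imp_le) (use C l_pos in auto)
qed

lemma cls_add: "cls u + cls v = cls (\<lambda>x. u x + v x)"
  unfolding aefun_eq_iff using rep_plus[of "cls u" "cls v"] rep_cls[of u] rep_cls[of v] rep_cls[of "\<lambda>x. u x + v x"]
  by eventually_elim simp

lemma cls_scaleC: "scaleC k (cls u) = cls (\<lambda>x. k * u x)"
  unfolding aefun_eq_iff using rep_scaleC[of k "cls u"] rep_cls[of u] rep_cls[of "\<lambda>x. k * u x"]
  by eventually_elim simp

lemma eq_clsI:
  assumes f: "f \<in> L2 \<Omega>" and ae: "AE x in lebesgue. x \<in> \<Omega> \<longrightarrow> rep_aefun f x = u x"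
  shows "f = cls u"
  unfolding aefun_eq_iff using ae L2_AE_zero[OF f] rep_cls[of u] by eventually_elim auto

text \<open>The class of \<open>c + d 1\<^bsub>x > \<xi>\<^esub> + \<integral>\<^sub>0\<^sup>x g\<close>: value \<open>c\<close> at the left end, jump \<open>d\<close> at \<open>\<xi>\<close> and weak derivative \<open>g\<close> on the cut beam.
The classes with \<open>d = 0\<close> have the weak derivative \<open>g\<close> on the whole beam.\<close>

definition W :: "complex \<Rightarrow> complex \<Rightarrow> aefun \<Rightarrow> aefun" where
  "W c d g = cls (\<lambda>x. c + (if \<xi> < x then d else 0) + prim g x)"

lemma W_measurable:
  assumes g: "g \<in> L2 \<Omega>"
  shows "(\<lambda>x. c + (if \<xi> < x then d else 0) + prim g x) \<in> borel_measurable lebesgue"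
proof (intro borel_measurable_add prim_measurable[OF g] borel_measurable_const)
  have "(\<lambda>x. if x \<in> {\<xi><..} then d else 0) \<in> borel_measurable lebesgue"
    by (intro measurable_If_set) auto
  then show "(\<lambda>x. if \<xi> < x then d else 0) \<in> borel_measurable lebesgue" by simp
qed

lemma W_L2: "g \<in> L2 \<Omega> \<Longrightarrow> W c d g \<in> L2 \<Omega>"
  and W_bound: "g \<in> L2 \<Omega> \<Longrightarrow> norm2 (W c d g) \<le> (cmod c + cmod d + sqrt l * norm2 g) * sqrt l"
proof -
  assume g: "g \<in> L2 \<Omega>"
  have b: "cmod (c + (if \<xi> < x then d else 0) + prim g x) \<le> cmod c + cmod d + sqrt l * norm2 g"
    if "x \<in> \<Omega>" for x
  proof -
    have "cmod (c + (if \<xi> < x then d else 0) + prim g x) \<le> cmod c + cmod (if \<xi> < x then d else 0) + cmod (prim g x)"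
      by (intro order_trans[OF norm_triangle_ineq] add_right_mono norm_triangle_ineq)
    moreover have "cmod (prim g x) \<le> sqrt l * norm2 g" using that by (intro prim_bound g) auto
    moreover have "cmod (if \<xi> < x then d else 0) \<le> cmod d" by simp
    ultimately show ?thesis by linarith
  qed
  have nn: "0 \<le> cmod c + cmod d + sqrt l * norm2 g" using g l_pos by (intro add_nonneg_nonneg mult_nonneg_nonneg) auto
  show "W c d g \<in> L2 \<Omega>" unfolding W_def by (rule cls_L2(1)[OF W_measurable[OF g] b nn])
  show "norm2 (W c d g) \<le> (cmod c + cmod d + sqrt l * norm2 g) * sqrt l"
    unfolding W_def by (rule cls_L2(2)[OF W_measurable[OF g] b nn])
qed

lemma W_add: "g \<in> L2 \<Omega> \<Longrightarrow> h \<in> L2 \<Omega> \<Longrightarrow> W c d g + W c' d' h = W (c + c') (d + d') (g + h)"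
  unfolding W_def cls_add by (rule arg_cong[where f = cls]) (auto simp: fun_eq_iff prim_add)

lemma W_scaleC: "g \<in> L2 \<Omega> \<Longrightarrow> scaleC k (W c d g) = W (k * c) (k * d) (scaleC k g)"
  unfolding W_def cls_scaleC by (rule arg_cong[where f = cls]) (auto simp: fun_eq_iff prim_scaleC algebra_simps)

lemma W_scaleR: "g \<in> L2 \<Omega> \<Longrightarrow> r *\<^sub>R W c d g = W (r *\<^sub>R c) (r *\<^sub>R d) (r *\<^sub>R g)"
  by (simp add: scaleR_eq_scaleC W_scaleC scaleR_conv_of_real)

lemma W_diff: "g \<in> L2 \<Omega> \<Longrightarrow> h \<in> L2 \<Omega> \<Longrightarrow> W c d g - W c' d' h = W (c - c') (d - d') (g - h)"
  using W_add[of g "(-1) *\<^sub>R h" c d "-c'" "-d'"] W_scaleR[of h "-1" c' d'] L2_scaleR[of h \<Omega> "-1"]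
  by (simp add: diff_conv_add_uminus del: add_uminus_conv_diff)

section \<open>Traces\<close>

text \<open>Two representatives agree on a set that every filter of interest meets, so limits of representatives are unique.\<close>

lemma trace_at_unique:
  assumes g: "(g \<longlongrightarrow> c) F" and F: "F \<noteq> bot"
    and freq: "\<And>S. AE x in lebesgue. x \<in> S \<Longrightarrow> \<exists>\<^sub>F x in F. x \<in> S"
  shows "trace_at F (abs_aefun g) = c"
  unfolding trace_at_def
proof (rule the_equality)
  show "\<exists>g'. abs_aefun g' = abs_aefun g \<and> (g' \<longlongrightarrow> c) F" using g by blast
  fix c' assume "\<exists>g'. abs_aefun g' = abs_aefun g \<and> (g' \<longlongrightarrow> c') F"
  then obtain g' where g': "AE x in lebesgue. g' x = g x" "(g' \<longlongrightarrow> c') F" by (auto simp: abs_aefun_eq_iff)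
  have lim: "((\<lambda>x. g' x - g x) \<longlongrightarrow> c' - c) F" by (intro tendsto_diff g g')
  show "c' = c"
  proof (rule ccontr)
    assume "c' \<noteq> c"
    then have "\<forall>\<^sub>F x in F. g' x - g x \<noteq> 0" using lim by (intro tendsto_imp_eventually_ne) auto
    moreover have "\<exists>\<^sub>F x in F. x \<in> {x. g' x = g x}" by (rule freq) (use g' in simp)
    ultimately show False by (simp add: frequently_def)
  qed
qed

text \<open>A null set contains no interval, hence no one-sided neighbourhood.\<close>

lemma frequently_at_side:
  fixes a :: real
  assumes ae: "AE x in lebesgue. x \<in> S" shows "\<exists>\<^sub>F x in at_right a. x \<in> S" "\<exists>\<^sub>F x in at_left a. x \<in> S" "\<exists>\<^sub>F x in at a. x \<in> S"
proof -
  have hit: "\<exists>x\<in>{p<..<q}. x \<in> S" if "p < q" for p q :: real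
  proof (rule ccontr)
    assume "\<not> (\<exists>x\<in>{p<..<q}. x \<in> S)"
    then have "AE x in lebesgue. x \<notin> {p<..<q}" using ae by (auto elim: eventually_mono)
    moreover have eq: "{x \<in> space lebesgue. \<not> x \<notin> {p<..<q}} = {p<..<q}" by auto
    ultimately have "emeasure lebesgue {p<..<q} = 0" using AE_iff_measurable[OF _ eq] by simp
    then show False using that by simp
  qed
  show r: "\<exists>\<^sub>F x in at_right a. x \<in> S"
    unfolding frequently_def eventually_at_right_field
  proof (rule notI, elim exE conjE)
    fix b assume b: "a < b" "\<forall>y>a. y < b \<longrightarrow> y \<notin> S"
    then show False using hit[OF b(1)] by auto
  qed
  show "\<exists>\<^sub>F x in at_left a. x \<in> S"
    unfolding frequently_def eventually_at_left_field
  proof (rule notI, elim exE conjE)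
    fix b assume b: "b < a" "\<forall>y>b. y < a \<longrightarrow> y \<notin> S"
    then show False using hit[OF b(1)] by auto
  qed
  show "\<exists>\<^sub>F x in at a. x \<in> S"
    using r unfolding frequently_def by (simp add: eventually_at_split)
qed

lemma trace_cls:
  assumes u: "(u \<longlongrightarrow> c) F" and ev: "\<forall>\<^sub>F x in F. x \<in> \<Omega>" and F: "F = at_right a \<or> F = at_left a \<or> F = at a"
  shows "trace_at F (cls u) = c"
  unfolding cls_def
proof (rule trace_at_unique)
  show "((\<lambda>x. if x \<in> \<Omega> then u x else 0) \<longlongrightarrow> c) F"
    using u by (rule Lim_transform_eventually) (use ev in eventually_elim, simp)
  show "F \<noteq> bot" using F by (elim disjE) simp_all
  show "\<exists>\<^sub>F x in F. x \<in> S" if "AE x in lebesgue. x \<in> S" for S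
    using frequently_at_side[OF that] F by auto
qed

lemma ev_Omega: "\<forall>\<^sub>F x in at_right 0. x \<in> \<Omega>" "\<forall>\<^sub>F x in at_left l. x \<in> \<Omega>"
    "\<forall>\<^sub>F x in at_left \<xi>. x \<in> \<Omega>" "\<forall>\<^sub>F x in at_right \<xi>. x \<in> \<Omega>" "\<forall>\<^sub>F x in at \<xi>. x \<in> \<Omega>"
proof -
  show r: "\<forall>\<^sub>F x in at_right 0. x \<in> \<Omega>" "\<forall>\<^sub>F x in at_right \<xi>. x \<in> \<Omega>"
    unfolding eventually_at_right_field using l_pos xi_less xi_pos by (auto intro!: exI[of _ l])
  show l: "\<forall>\<^sub>F x in at_left l. x \<in> \<Omega>" "\<forall>\<^sub>F x in at_left \<xi>. x \<in> \<Omega>"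
    unfolding eventually_at_left_field using l_pos xi_less xi_pos by (auto intro!: exI[of _ 0])
  show "\<forall>\<^sub>F x in at \<xi>. x \<in> \<Omega>" using r l by (simp add: eventually_at_split)
qed

lemma W_lim:
  assumes g: "g \<in> L2 \<Omega>" and s: "\<forall>\<^sub>F x in F. (\<xi> < x) = s" and F: "F \<le> at a"
  shows "((\<lambda>x. c + (if \<xi> < x then d else 0) + prim g x) \<longlongrightarrow> c + (if s then d else 0) + prim g a) F"
proof -
  have "(prim g \<longlongrightarrow> prim g a) F"
    using prim_continuous[OF g, of a] F unfolding isCont_def by (rule tendsto_mono[rotated])
  then have "((\<lambda>x. c + (if s then d else 0) + prim g x) \<longlongrightarrow> c + (if s then d else 0) + prim g a) F"
    by (intro tendsto_intros)
  then show ?thesis by (rule Lim_transform_eventually) (use s in eventually_elim, simp)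
qed

lemma trace_W:
  assumes g: "g \<in> L2 \<Omega>"
  shows "trace_at (at_right 0) (W c d g) = c"
    and "trace_at (at_left l) (W c d g) = c + d + prim g l"
    and "trace_at (at_left \<xi>) (W c d g) = c + prim g \<xi>"
    and "trace_at (at_right \<xi>) (W c d g) = c + d + prim g \<xi>"
    and "trace_at (at \<xi>) (W c 0 g) = c + prim g \<xi>"
proof -
  have le: "at_right a \<le> at a" "at_left a \<le> at a" for a :: real by (rule at_le, simp)+
  have "\<forall>\<^sub>F x in at_right 0. (\<xi> < x) = False"
    unfolding eventually_at_right_field using xi_pos by (auto intro!: exI[of _ \<xi>])
  from trace_cls[OF W_lim[OF g this le(1)] ev_Omega(1) disjI1[OF refl]] show "trace_at (at_right 0) (W c d g) = c"
    using prim_nonpos[OF g, of 0] by (simp add: W_def)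
  have "\<forall>\<^sub>F x in at_left l. (\<xi> < x) = True"
    unfolding eventually_at_left_field using xi_less by (auto intro!: exI[of _ \<xi>])
  from trace_cls[OF W_lim[OF g this le(2)] ev_Omega(2) disjI2[OF disjI1[OF refl]]] show "trace_at (at_left l) (W c d g) = c + d + prim g l"
    by (simp add: W_def)
  have "\<forall>\<^sub>F x in at_left \<xi>. (\<xi> < x) = False"
    unfolding eventually_at_left_field by (auto intro!: exI[of _ "\<xi> - 1"])
  from trace_cls[OF W_lim[OF g this le(2)] ev_Omega(3) disjI2[OF disjI1[OF refl]]] show "trace_at (at_left \<xi>) (W c d g) = c + prim g \<xi>"
    by (simp add: W_def)
  have "\<forall>\<^sub>F x in at_right \<xi>. (\<xi> < x) = True"
    unfolding eventually_at_right_field by (auto intro!: exI[of _ "\<xi> + 1"])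
  from trace_cls[OF W_lim[OF g this le(1)] ev_Omega(4) disjI1[OF refl]] show "trace_at (at_right \<xi>) (W c d g) = c + d + prim g \<xi>"
    by (simp add: W_def)
  have "((\<lambda>x. c + (if \<xi> < x then 0 else 0) + prim g x) \<longlongrightarrow> c + prim g \<xi>) (at \<xi>)"
    using prim_continuous[OF g, of \<xi>] unfolding isCont_def by (auto intro!: tendsto_intros)
  from trace_cls[OF this ev_Omega(5) disjI2[OF disjI2[OF refl]]] show "trace_at (at \<xi>) (W c 0 g) = c + prim g \<xi>"
    by (simp add: W_def)
qed

section \<open>Weak derivatives on the beam and on the cut beam\<close>

lemma test_function_pairing:
  assumes t: "test_function J \<eta> \<eta>'" and J: "J \<in> sets lebesgue"
  shows "(LINT x:J|lebesgue. u x * complex_of_real (\<eta> x)) = (LINT x|lebesgue. u x * of_real (\<eta> x))"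
    and "(LINT x:J|lebesgue. u x * complex_of_real (\<eta>' x)) = (LINT x|lebesgue. u x * of_real (\<eta>' x))"
  unfolding set_lebesgue_integral_def
  by (rule Bochner_Integration.integral_cong; use test_function_props(5,6)[OF t] in \<open>auto simp: indicator_def\<close>)+

lemma test_function_meas:
  assumes t: "test_function J \<eta> \<eta>'"
  shows "(\<lambda>x. complex_of_real (\<eta> x)) \<in> borel_measurable lebesgue"
    "(\<lambda>x. complex_of_real (\<eta>' x)) \<in> borel_measurable lebesgue"
    "integrable lebesgue (\<lambda>x. complex_of_real (\<eta> x))"
    "integrable lebesgue (\<lambda>x. complex_of_real (\<eta>' x))"
  using test_function_props(3,4)[OF t] by (auto intro: borel_measurable_integrable)

text \<open>A test function is the primitive of its derivative, with total integral zero, so the boundary term of integration by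
parts disappears.\<close>

lemma prim_by_parts_test:
  assumes g: "g \<in> L2 \<Omega>" and t: "test_function J \<eta> \<eta>'"
  shows "integrable lebesgue (\<lambda>x. prim g x * of_real (\<eta>' x))"
    and "integrable lebesgue (\<lambda>x. rep_aefun g x * of_real (\<eta> x))"
    and "(LINT x|lebesgue. prim g x * of_real (\<eta>' x)) = - (LINT x|lebesgue. rep_aefun g x * of_real (\<eta> x))"
proof -
  have p: "(LINT y:{..x}|lebesgue. complex_of_real (\<eta>' y)) = of_real (\<eta> x)" for x
  proof -
    have "(LINT y:{..x}|lebesgue. complex_of_real (\<eta>' y)) = of_real (LINT y:{..x}|lebesgue. \<eta>' y)"
      unfolding set_lebesgue_integral_def by (subst integral_complex_of_real[symmetric]) (simp add: scaleR_conv_of_real)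
    then show ?thesis using test_function_props(7)[OF t] by simp
  qed
  have z: "(LINT y|lebesgue. complex_of_real (\<eta>' y)) = 0"
    using test_function_props(8)[OF t] by simp
  note b = integral_by_parts_primitives[OF integrable_rep[OF g] test_function_meas(4)[OF t]]
  show "integrable lebesgue (\<lambda>x. prim g x * of_real (\<eta>' x))" using b(1) unfolding prim_def .
  show "integrable lebesgue (\<lambda>x. rep_aefun g x * of_real (\<eta> x))" using b(2) unfolding p .
  show "(LINT x|lebesgue. prim g x * of_real (\<eta>' x)) = - (LINT x|lebesgue. rep_aefun g x * of_real (\<eta> x))"
    using b(3) unfolding p z prim_def[symmetric] by (simp add: eq_neg_iff_add_eq_0)
qed

text \<open>Against a test function \<open>\<eta>\<close> the constant \<open>c\<close> contributes \<open>\<integral> \<eta>' = 0\<close>, and the jump contributes \<open>d\<close> times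
\<open>\<integral>\<^bsub>x > \<xi>\<^esub> \<eta>' = - \<eta>(\<xi>)\<close>, which vanishes if \<open>\<xi>\<close> is not in \<open>J\<close>.\<close>

lemma weak_deriv_W:
  assumes g: "g \<in> L2 \<Omega>" and J: "J \<in> sets lebesgue" "J \<subseteq> \<Omega>" and d: "d = 0 \<or> \<xi> \<notin> J"
  shows "has_weak_deriv J (W c d g) g"
  unfolding has_weak_deriv_def
proof (intro allI impI)
  fix \<eta> \<eta>' assume t: "test_function J \<eta> \<eta>'"
  note p = test_function_props[OF t] and m = test_function_meas[OF t] and b = prim_by_parts_test[OF g t]
  define H where "H = (\<lambda>x. indicat_real {\<xi><..} x *\<^sub>R complex_of_real (\<eta>' x))"
  have H: "integrable lebesgue H" unfolding H_def by (intro integrable_mult_indicator m) auto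
  have "(LINT x:J|lebesgue. rep_aefun (W c d g) x * of_real (\<eta>' x))
      = (LINT x|lebesgue. rep_aefun (W c d g) x * of_real (\<eta>' x))"
    by (rule test_function_pairing(2)[OF t J(1)])
  also have "\<dots> = (LINT x|lebesgue. (c * of_real (\<eta>' x) + d * H x) + prim g x * of_real (\<eta>' x))"
  proof (rule integral_cong_AE)
    show "AE x in lebesgue. rep_aefun (W c d g) x * of_real (\<eta>' x)
        = (c * of_real (\<eta>' x) + d * H x) + prim g x * of_real (\<eta>' x)"
      using rep_cls[of "\<lambda>x. c + (if \<xi> < x then d else 0) + prim g x"] unfolding W_def
    proof eventually_elim
      case (elim x)
      show ?case
      proof (cases "x \<in> \<Omega>")
        case False
        then have "\<eta>' x = 0" using p(6) J(2) by blast
        then show ?thesis by (simp add: H_def)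
      qed (use elim in \<open>simp add: H_def indicator_def algebra_simps\<close>)
    qed
    show "(\<lambda>x. rep_aefun (W c d g) x * of_real (\<eta>' x)) \<in> borel_measurable lebesgue"
      by (intro borel_measurable_times L2_measurable[OF W_L2[OF g]] m)
    show "(\<lambda>x. (c * of_real (\<eta>' x) + d * H x) + prim g x * of_real (\<eta>' x)) \<in> borel_measurable lebesgue"
      by (intro borel_measurable_add borel_measurable_times borel_measurable_const m
          borel_measurable_integrable[OF H] prim_measurable[OF g])
  qed
  also have "\<dots> = (c * (LINT x|lebesgue. of_real (\<eta>' x)) + d * (LINT x|lebesgue. H x))
      + (LINT x|lebesgue. prim g x * of_real (\<eta>' x))"
    using m(4) H b(1) by (simp add: Bochner_Integration.integral_add)
  also have "(LINT x|lebesgue. complex_of_real (\<eta>' x)) = 0" using p(8) by simp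
  also have "d * (LINT x|lebesgue. H x) = 0"
  proof (cases "d = 0")
    case False
    have "H = (\<lambda>x. complex_of_real (\<eta>' x - indicat_real {..\<xi>} x *\<^sub>R \<eta>' x))"
      by (auto simp: H_def fun_eq_iff indicator_def)
    then have "(LINT x|lebesgue. H x) = of_real (LINT x|lebesgue. \<eta>' x - indicat_real {..\<xi>} x *\<^sub>R \<eta>' x)"
      by (simp only: integral_complex_of_real)
    also have "(LINT x|lebesgue. \<eta>' x - indicat_real {..\<xi>} x *\<^sub>R \<eta>' x)
        = (LINT x|lebesgue. \<eta>' x) - (LINT x|lebesgue. indicat_real {..\<xi>} x *\<^sub>R \<eta>' x)"
      by (intro Bochner_Integration.integral_diff p(4) integrable_mult_indicator) simp
    also have "\<dots> = 0 - \<eta> \<xi>"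
      using p(7)[of \<xi>] p(8) unfolding set_lebesgue_integral_def by (simp only:)
    also have "\<eta> \<xi> = 0" using False d p(5) by blast
    finally show ?thesis by simp
  qed simp
  also have "(LINT x|lebesgue. prim g x * of_real (\<eta>' x)) = - (LINT x|lebesgue. rep_aefun g x * of_real (\<eta> x))"
    by (rule b(3))
  also have "(LINT x|lebesgue. rep_aefun g x * of_real (\<eta> x)) = (LINT x:J|lebesgue. rep_aefun g x * of_real (\<eta> x))"
    by (rule test_function_pairing(1)[OF t J(1), symmetric])
  finally show "(LINT x:J|lebesgue. rep_aefun (W c d g) x * of_real (\<eta>' x))
      = - (LINT x:J|lebesgue. rep_aefun g x * of_real (\<eta> x))" by simp
qed

lemma weak_deriv_full:
  assumes "has_weak_deriv J f g" "test_function J \<eta> \<eta>'" "J \<in> sets lebesgue"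
  shows "(LINT x|lebesgue. rep_aefun f x * of_real (\<eta>' x)) = - (LINT x|lebesgue. rep_aefun g x * of_real (\<eta> x))"
proof -
  have "(LINT x:J|lebesgue. rep_aefun f x * of_real (\<eta>' x)) = - (LINT x:J|lebesgue. rep_aefun g x * of_real (\<eta> x))"
    using assms(1,2) unfolding has_weak_deriv_def by blast
  then show ?thesis by (simp only: test_function_pairing[OF assms(2,3)])
qed

lemma weak_deriv_mono:
  assumes w: "has_weak_deriv J f g" and sub: "J' \<subseteq> J" "J \<in> sets lebesgue" "J' \<in> sets lebesgue"
  shows "has_weak_deriv J' f g"
  unfolding has_weak_deriv_def
proof (intro allI impI)
  fix \<eta> \<eta>' assume t: "test_function J' \<eta> \<eta>'"
  have t': "test_function J \<eta> \<eta>'" using t sub(1) by (rule test_function_mono)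
  from w[unfolded has_weak_deriv_def] t'
  have "(LINT x:J|lebesgue. rep_aefun f x * of_real (\<eta>' x)) = - (LINT x:J|lebesgue. rep_aefun g x * of_real (\<eta> x))"
    by blast
  then show "(LINT x:J'|lebesgue. rep_aefun f x * of_real (\<eta>' x)) = - (LINT x:J'|lebesgue. rep_aefun g x * of_real (\<eta> x))"
    by (simp add: test_function_pairing[OF t sub(3)] test_function_pairing[OF t' sub(2)])
qed

text \<open>The lemma of du Bois-Reymond for \<open>f\<close> minus the primitive of its weak derivative.\<close>

lemma weak_deriv_imp_primitive:
  assumes f: "f \<in> L2 \<Omega>" and g: "g \<in> L2 \<Omega>" and w: "has_weak_deriv {a<..<b} f g" and ab: "a < b"
  shows "\<exists>c. AE x in lebesgue. x \<in> {a<..<b} \<longrightarrow> rep_aefun f x = c + prim g x"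
proof -
  let ?J = "{a<..<b}"
  let ?u = "\<lambda>x. rep_aefun f x - prim g x"
  have ip: "set_integrable lebesgue ?J (prim g)"
    unfolding set_integrable_def
  proof (rule Bochner_Integration.integrable_bound)
    let ?B = "sqrt l * norm2 g"
    show "integrable lebesgue (\<lambda>x. indicat_real ?J x * ?B)"
      by (intro integrable_mult_left integrable_real_indicator) (use ab in auto)
    show "(\<lambda>x. indicat_real ?J x *\<^sub>R prim g x) \<in> borel_measurable lebesgue"
      by (intro borel_measurable_indicator_scaleR prim_measurable g) simp
    have "cmod (prim g x) \<le> ?B" for x
    proof (cases "x \<le> l")
      case False
      have "prim g x = prim g l"
        unfolding prim_def set_lebesgue_integral_def
      proof (rule integral_cong_AE)
        show "AE y in lebesgue. indicat_real {..x} y *\<^sub>R rep_aefun g y = indicat_real {..l} y *\<^sub>R rep_aefun g y"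
          using L2_AE_zero[OF g] by eventually_elim (use False in \<open>auto simp: indicator_def\<close>)
      qed (intro borel_measurable_indicator_scaleR L2_measurable[OF g]; simp)+
      then show ?thesis using prim_bound[OF g, of l] by simp
    qed (rule prim_bound[OF g])
    then show "AE x in lebesgue. norm (indicat_real ?J x *\<^sub>R prim g x) \<le> norm (indicat_real ?J x * ?B)"
      by (intro AE_I2) (auto simp: indicator_def intro: order_trans[OF _ abs_ge_self])
  qed
  have "\<exists>c. AE x in lebesgue. x \<in> ?J \<longrightarrow> ?u x = c"
  proof (rule du_Bois_Reymond[OF ab])
    show "set_integrable lebesgue ?J ?u"
      using set_integrable_rep[OF f, of ?J] ip
      unfolding set_integrable_def scaleR_diff_right by (intro Bochner_Integration.integrable_diff) auto
    fix \<eta> \<eta>' assume t: "test_function ?J \<eta> \<eta>'"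
    note tp = test_function_pairing[OF t, of _, simplified] and b = prim_by_parts_test[OF g t]
    obtain B where B: "\<And>x. \<bar>\<eta>' x\<bar> \<le> B" using test_function_props(10)[OF t] unfolding bounded_iff by auto
    have fi: "integrable lebesgue (\<lambda>x. rep_aefun f x * of_real (\<eta>' x))"
    proof (rule Bochner_Integration.integrable_bound)
      show "integrable lebesgue (\<lambda>x. B * cmod (rep_aefun f x))" using integrable_rep[OF f] by simp
      show "(\<lambda>x. rep_aefun f x * of_real (\<eta>' x)) \<in> borel_measurable lebesgue"
        by (intro borel_measurable_times L2_measurable[OF f] test_function_meas[OF t])
      show "AE x in lebesgue. norm (rep_aefun f x * of_real (\<eta>' x)) \<le> norm (B * cmod (rep_aefun f x))"
      proof (rule AE_I2)
        fix x
        have "0 \<le> B" using B[of x] by linarith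
        then show "norm (rep_aefun f x * of_real (\<eta>' x)) \<le> norm (B * cmod (rep_aefun f x))"
          using mult_right_mono[OF B[of x], of "cmod (rep_aefun f x)"] by (simp add: norm_mult mult.commute)
      qed
    qed
    have "(LINT x:?J|lebesgue. ?u x * of_real (\<eta>' x)) = (LINT x|lebesgue. ?u x * of_real (\<eta>' x))"
      by (rule test_function_pairing(2)[OF t]) simp
    also have "\<dots> = (LINT x|lebesgue. rep_aefun f x * of_real (\<eta>' x)) - (LINT x|lebesgue. prim g x * of_real (\<eta>' x))"
      unfolding left_diff_distrib by (rule Bochner_Integration.integral_diff[OF fi b(1)])
    also have "(LINT x|lebesgue. rep_aefun f x * of_real (\<eta>' x)) = - (LINT x|lebesgue. rep_aefun g x * of_real (\<eta> x))"
      by (rule weak_deriv_full[OF w t]) simp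
    finally show "(LINT x:?J|lebesgue. ?u x * of_real (\<eta>' x)) = 0" using b(3) by simp
  qed
  then obtain c where c: "AE x in lebesgue. x \<in> ?J \<longrightarrow> ?u x = c" by blast
  have "AE x in lebesgue. x \<in> ?J \<longrightarrow> rep_aefun f x = c + prim g x"
    using c by eventually_elim (auto simp: algebra_simps)
  then show ?thesis by blast
qed

text \<open>Apply the preceding lemma to both pieces; the difference of the two constants is the jump.\<close>

lemma weak_deriv_Cut_imp_W:
  assumes f: "f \<in> L2 \<Omega>" and g: "g \<in> L2 \<Omega>" and w: "has_weak_deriv Cut f g"
  shows "\<exists>c d. f = W c d g"
proof -
  have w1: "has_weak_deriv {0<..<\<xi>} f g" by (rule weak_deriv_mono[OF w]) auto
  have w2: "has_weak_deriv {\<xi><..<l} f g" by (rule weak_deriv_mono[OF w]) auto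
  obtain c1 where c1: "AE x in lebesgue. x \<in> {0<..<\<xi>} \<longrightarrow> rep_aefun f x = c1 + prim g x"
    using weak_deriv_imp_primitive[OF f g w1 xi_pos] by blast
  obtain c2 where c2: "AE x in lebesgue. x \<in> {\<xi><..<l} \<longrightarrow> rep_aefun f x = c2 + prim g x"
    using weak_deriv_imp_primitive[OF f g w2 xi_less] by blast
  have "f = W c1 (c2 - c1) g"
    unfolding W_def
  proof (rule eq_clsI[OF f])
    show "AE x in lebesgue. x \<in> \<Omega> \<longrightarrow> rep_aefun f x = c1 + (if \<xi> < x then c2 - c1 else 0) + prim g x"
      using c1 c2 AE_not_xi by eventually_elim auto
  qed
  then show ?thesis by blast
qed

lemma weak_deriv_Omega_imp_W:
  assumes f: "f \<in> L2 \<Omega>" and g: "g \<in> L2 \<Omega>" and w: "has_weak_deriv \<Omega> f g"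
  shows "\<exists>c. f = W c 0 g"
proof -
  obtain c where c: "AE x in lebesgue. x \<in> \<Omega> \<longrightarrow> rep_aefun f x = c + prim g x"
    using weak_deriv_imp_primitive[OF f g w l_pos] by blast
  have "f = W c 0 g" unfolding W_def by (rule eq_clsI[OF f]) (use c in eventually_elim, simp)
  then show ?thesis by blast
qed

lemma Cut_sub: "Cut \<subseteq> \<Omega>" using xi_pos xi_less by auto

lemma weak_deriv_unique:
  assumes g: "g \<in> L2 \<Omega>" and h: "h \<in> L2 \<Omega>" and wg: "has_weak_deriv Cut f g" and wh: "has_weak_deriv Cut f h"
  shows "g = h"
proof -
  have ae: "AE x in lebesgue. x \<in> {a<..<b} \<longrightarrow> rep_aefun g x - rep_aefun h x = 0"
    if sub: "{a<..<b} \<subseteq> Cut" and ab: "a < b" for a b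
  proof (rule fundamental_lemma)
    let ?J = "{a<..<b}"
    show "set_integrable lebesgue ?J (\<lambda>x. rep_aefun g x - rep_aefun h x)"
      using set_integrable_rep[OF g, of ?J] set_integrable_rep[OF h, of ?J]
      unfolding set_integrable_def scaleR_diff_right by (intro Bochner_Integration.integrable_diff) auto
    fix \<eta> \<eta>' assume t: "test_function ?J \<eta> \<eta>'"
    have w: "has_weak_deriv ?J f g" "has_weak_deriv ?J f h"
      by (rule weak_deriv_mono[OF wg sub] weak_deriv_mono[OF wh sub]; simp)+
    have eq: "(LINT x|lebesgue. rep_aefun g x * of_real (\<eta> x)) = (LINT x|lebesgue. rep_aefun h x * of_real (\<eta> x))"
      using weak_deriv_full[OF w(1) t] weak_deriv_full[OF w(2) t] by simp
    have "(LINT x:?J|lebesgue. (rep_aefun g x - rep_aefun h x) * of_real (\<eta> x))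
        = (LINT x|lebesgue. (rep_aefun g x - rep_aefun h x) * of_real (\<eta> x))"
      by (rule test_function_pairing(1)[OF t]) simp
    also have "\<dots> = (LINT x|lebesgue. rep_aefun g x * of_real (\<eta> x)) - (LINT x|lebesgue. rep_aefun h x * of_real (\<eta> x))"
      unfolding left_diff_distrib
      by (rule Bochner_Integration.integral_diff[OF prim_by_parts_test(2)[OF g t] prim_by_parts_test(2)[OF h t]])
    finally show "(LINT x:?J|lebesgue. (rep_aefun g x - rep_aefun h x) * of_real (\<eta> x)) = 0" using eq by simp
  qed
  have "AE x in lebesgue. x \<in> {0<..<\<xi>} \<longrightarrow> rep_aefun g x - rep_aefun h x = 0" by (rule ae) (use xi_pos in auto)
  moreover have "AE x in lebesgue. x \<in> {\<xi><..<l} \<longrightarrow> rep_aefun g x - rep_aefun h x = 0" by (rule ae) (use xi_less in auto)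
  ultimately show ?thesis
    unfolding aefun_eq_iff using AE_not_xi L2_AE_zero[OF g] L2_AE_zero[OF h] by eventually_elim auto
qed

lemma wderiv_Cut_W: assumes g: "g \<in> L2 \<Omega>" shows "wderiv Cut (W c d g) = g"
  unfolding wderiv_def L2_Cut
proof (rule the_equality)
  show w: "g \<in> L2 \<Omega> \<and> has_weak_deriv Cut (W c d g) g"
    using g Cut_sub by (intro conjI weak_deriv_W) auto
  fix h assume "h \<in> L2 \<Omega> \<and> has_weak_deriv Cut (W c d g) h"
  then show "h = g" using w weak_deriv_unique by blast
qed

lemma wderiv_Omega_W: assumes g: "g \<in> L2 \<Omega>" shows "wderiv \<Omega> (W c 0 g) = g"
  unfolding wderiv_def
proof (rule the_equality)
  show w: "g \<in> L2 \<Omega> \<and> has_weak_deriv \<Omega> (W c 0 g) g"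
    using g by (intro conjI weak_deriv_W) auto
  fix h assume h: "h \<in> L2 \<Omega> \<and> has_weak_deriv \<Omega> (W c 0 g) h"
  show "h = g"
    by (rule weak_deriv_unique[of h g "W c 0 g"]) (use w h Cut_sub in \<open>auto intro: weak_deriv_mono\<close>)
qed

lemma H1_Cut: "f \<in> H1 Cut \<longleftrightarrow> (\<exists>c d. \<exists>g\<in>L2 \<Omega>. f = W c d g)"
proof
  assume "f \<in> H1 Cut"
  then show "\<exists>c d. \<exists>g\<in>L2 \<Omega>. f = W c d g"
    unfolding H1_def L2_Cut using weak_deriv_Cut_imp_W by blast
next
  assume "\<exists>c d. \<exists>g\<in>L2 \<Omega>. f = W c d g"
  then obtain c d g where g: "g \<in> L2 \<Omega>" "f = W c d g" by blast
  have "has_weak_deriv Cut f g" unfolding g(2) by (rule weak_deriv_W[OF g(1)]) (use Cut_sub in auto)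
  then show "f \<in> H1 Cut" unfolding H1_def L2_Cut using g W_L2 by blast
qed

lemma H1_Omega: "f \<in> H1 \<Omega> \<longleftrightarrow> (\<exists>c. \<exists>g\<in>L2 \<Omega>. f = W c 0 g)"
proof
  assume "f \<in> H1 \<Omega>"
  then show "\<exists>c. \<exists>g\<in>L2 \<Omega>. f = W c 0 g"
    unfolding H1_def using weak_deriv_Omega_imp_W by blast
next
  assume "\<exists>c. \<exists>g\<in>L2 \<Omega>. f = W c 0 g"
  then obtain c g where g: "g \<in> L2 \<Omega>" "f = W c 0 g" by blast
  have "has_weak_deriv \<Omega> f g" unfolding g(2) by (rule weak_deriv_W[OF g(1)]) auto
  then show "f \<in> H1 \<Omega>" unfolding H1_def using g W_L2 by blast
qed

lemma prim_cnj:
  "(LINT y:{..x}|lebesgue. cnj (rep_aefun h y)) = cnj (prim h x)"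
proof -
  have "(LINT y:{..x}|lebesgue. cnj (rep_aefun h y)) = (LINT y|lebesgue. cnj (indicator {..x} y *\<^sub>R rep_aefun h y))"
    by (simp add: set_lebesgue_integral_def)
  also have "\<dots> = cnj (LINT y|lebesgue. indicator {..x} y *\<^sub>R rep_aefun h y)" by (rule Bochner_Integration.integral_cnj)
  finally show ?thesis unfolding prim_def set_lebesgue_integral_def .
qed

text \<open>The boundary terms are the products of the values at \<open>l\<close> and at \<open>0\<close>, and the jump \<open>d\<close> of the first factor times the
value at \<open>\<xi>\<close> of the second factor, which is continuous.\<close>

theorem integration_by_parts:
  assumes g: "g \<in> L2 \<Omega>" and h: "h \<in> L2 \<Omega>"
  shows "L2_ip (W c d g) h + L2_ip g (W c' 0 h)
    = Re ((c + d + prim g l) * cnj (c' + prim h l) - c * cnj c' - d * cnj (c' + prim h \<xi>))"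
proof -
  let ?g = "rep_aefun g" and ?h = "\<lambda>x. cnj (rep_aefun h x)"
  have hi: "integrable lebesgue ?h" using integrable_rep[OF h] by simp
  note gi = integrable_rep[OF g]
  note b = integral_by_parts_primitives[OF gi hi, folded prim_def[of g], unfolded prim_cnj]
  define H where "H = (\<lambda>x. indicat_real {\<xi><..} x *\<^sub>R ?h x)"
  have H: "integrable lebesgue H" unfolding H_def by (intro integrable_mult_indicator hi) auto
  have th: "(LINT x|lebesgue. ?h x) = cnj (prim h l)" using prim_total[OF h] by simp
  have tH: "(LINT x|lebesgue. H x) = cnj (prim h l) - cnj (prim h \<xi>)"
  proof -
    have "H = (\<lambda>x. ?h x - indicat_real {..\<xi>} x *\<^sub>R ?h x)"
      by (auto simp: H_def fun_eq_iff indicator_def)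
    then have "(LINT x|lebesgue. H x) = (LINT x|lebesgue. ?h x - indicat_real {..\<xi>} x *\<^sub>R ?h x)" by simp
    also have "\<dots> = (LINT x|lebesgue. ?h x) - (LINT x|lebesgue. indicat_real {..\<xi>} x *\<^sub>R ?h x)"
      by (intro Bochner_Integration.integral_diff hi integrable_mult_indicator) auto
    also have "(LINT x|lebesgue. indicat_real {..\<xi>} x *\<^sub>R ?h x) = cnj (prim h \<xi>)"
      using prim_cnj[of \<xi> h] unfolding set_lebesgue_integral_def .
    finally show ?thesis by (simp only: th)
  qed
  have WL: "W c d g \<in> L2 \<Omega>" "W c' 0 h \<in> L2 \<Omega>" using g h by (auto intro: W_L2)
  have "L2_ip (W c d g) h = (LINT x|lebesgue. Re ((c * ?h x + d * H x) + prim g x * ?h x))"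
  proof (rule L2_ip_cong_AE[OF _ WL(1) h])
    show "AE x in lebesgue. Re (rep_aefun (W c d g) x * ?h x) = Re ((c * ?h x + d * H x) + prim g x * ?h x)"
      using rep_cls[of "\<lambda>x. c + (if \<xi> < x then d else 0) + prim g x"] L2_AE_zero[OF h] unfolding W_def[symmetric]
    proof eventually_elim
      case (elim x)
      show ?case
      proof (cases "x \<in> \<Omega>")
        case False
        then have "?h x = 0" using elim by simp
        then show ?thesis by (simp add: H_def)
      next
        case True
        then have "rep_aefun (W c d g) x * ?h x = (c * ?h x + d * H x) + prim g x * ?h x"
          using elim by (simp add: H_def indicator_def algebra_simps)
        then show ?thesis by (rule arg_cong)
      qed
    qed
    show "(\<lambda>x. Re ((c * ?h x + d * H x) + prim g x * ?h x)) \<in> borel_measurable lebesgue"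
      by (intro borel_measurable_integrable integrable_Re Bochner_Integration.integrable_add
          integrable_mult_right hi H b(1))
  qed
  also have "\<dots> = Re (LINT x|lebesgue. (c * ?h x + d * H x) + prim g x * ?h x)"
    by (intro integral_Re Bochner_Integration.integrable_add integrable_mult_right hi H b(1))
  also have "(LINT x|lebesgue. (c * ?h x + d * H x) + prim g x * ?h x)
      = (c * cnj (prim h l) + d * (cnj (prim h l) - cnj (prim h \<xi>))) + (LINT x|lebesgue. prim g x * ?h x)"
    using hi H b(1) th tH by (simp add: Bochner_Integration.integral_add)
  finally have 1: "L2_ip (W c d g) h
      = Re ((c * cnj (prim h l) + d * (cnj (prim h l) - cnj (prim h \<xi>))) + (LINT x|lebesgue. prim g x * ?h x))" .
  have "L2_ip g (W c' 0 h) = (LINT x|lebesgue. Re (cnj c' * ?g x + ?g x * cnj (prim h x)))"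
  proof (rule L2_ip_cong_AE[OF _ g WL(2)])
    show "AE x in lebesgue. Re (?g x * cnj (rep_aefun (W c' 0 h) x)) = Re (cnj c' * ?g x + ?g x * cnj (prim h x))"
      using rep_cls[of "\<lambda>x. c' + (if \<xi> < x then 0 else 0) + prim h x"] L2_AE_zero[OF g] unfolding W_def[symmetric]
    proof eventually_elim
      case (elim x)
      show ?case
      proof (cases "x \<in> \<Omega>")
        case False
        then have "?g x = 0" using elim by simp
        then show ?thesis by simp
      next
        case True
        then have "?g x * cnj (rep_aefun (W c' 0 h) x) = cnj c' * ?g x + ?g x * cnj (prim h x)"
          using elim by (simp add: algebra_simps)
        then show ?thesis by (rule arg_cong)
      qed
    qed
    show "(\<lambda>x. Re (cnj c' * ?g x + ?g x * cnj (prim h x))) \<in> borel_measurable lebesgue"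
      by (intro borel_measurable_integrable integrable_Re Bochner_Integration.integrable_add
          integrable_mult_right gi b(2))
  qed
  also have "\<dots> = Re (LINT x|lebesgue. cnj c' * ?g x + ?g x * cnj (prim h x))"
    by (intro integral_Re Bochner_Integration.integrable_add integrable_mult_right gi b(2))
  also have "(LINT x|lebesgue. cnj c' * ?g x + ?g x * cnj (prim h x))
      = cnj c' * prim g l + (LINT x|lebesgue. ?g x * cnj (prim h x))"
    using gi b(2) prim_total[OF g] by (simp add: Bochner_Integration.integral_add)
  finally have 2: "L2_ip g (W c' 0 h) = Re (cnj c' * prim g l + (LINT x|lebesgue. ?g x * cnj (prim h x)))" .
  have "L2_ip (W c d g) h + L2_ip g (W c' 0 h)
      = Re ((c * cnj (prim h l) + d * (cnj (prim h l) - cnj (prim h \<xi>))) + cnj c' * prim g l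
        + ((LINT x|lebesgue. prim g x * ?h x) + (LINT x|lebesgue. ?g x * cnj (prim h x))))"
    unfolding 1 2 by simp
  also have "(LINT x|lebesgue. prim g x * ?h x) + (LINT x|lebesgue. ?g x * cnj (prim h x)) = prim g l * cnj (prim h l)"
    using b(3) th prim_total[OF g] by simp
  also have "(c * cnj (prim h l) + d * (cnj (prim h l) - cnj (prim h \<xi>))) + cnj c' * prim g l + prim g l * cnj (prim h l)
      = (c + d + prim g l) * cnj (c' + prim h l) - c * cnj c' - d * cnj (c' + prim h \<xi>)"
    by (simp add: algebra_simps)
  finally show ?thesis .
qed

section \<open>Functions pinned at one end\<close>

text \<open>A function in \<open>H\<^sup>1\<close> that vanishes at the left or at the right end is determined by its derivative.\<close>

definition from_left :: "aefun \<Rightarrow> aefun" where "from_left p = W 0 0 p"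
definition from_right :: "aefun \<Rightarrow> aefun" where "from_right q = W (- prim q l) 0 q"

lemma from_left_L2 [simp, intro]: "p \<in> L2 \<Omega> \<Longrightarrow> from_left p \<in> L2 \<Omega>"
  and from_right_L2 [simp, intro]: "q \<in> L2 \<Omega> \<Longrightarrow> from_right q \<in> L2 \<Omega>"
  by (simp_all add: from_left_def from_right_def W_L2)

lemma from_left_add: "p \<in> L2 \<Omega> \<Longrightarrow> q \<in> L2 \<Omega> \<Longrightarrow> from_left (p + q) = from_left p + from_left q"
  and from_right_add: "p \<in> L2 \<Omega> \<Longrightarrow> q \<in> L2 \<Omega> \<Longrightarrow> from_right (p + q) = from_right p + from_right q"
  and from_left_diff: "p \<in> L2 \<Omega> \<Longrightarrow> q \<in> L2 \<Omega> \<Longrightarrow> from_left (p - q) = from_left p - from_left q"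
  and from_right_diff: "p \<in> L2 \<Omega> \<Longrightarrow> q \<in> L2 \<Omega> \<Longrightarrow> from_right (p - q) = from_right p - from_right q"
  by (simp_all add: from_left_def from_right_def W_add W_diff prim_add prim_diff)

lemma from_left_scaleC: "p \<in> L2 \<Omega> \<Longrightarrow> from_left (scaleC k p) = scaleC k (from_left p)"
  and from_right_scaleC: "p \<in> L2 \<Omega> \<Longrightarrow> from_right (scaleC k p) = scaleC k (from_right p)"
  by (simp_all add: from_left_def from_right_def W_scaleC prim_scaleC)

lemma from_left_scaleR: "p \<in> L2 \<Omega> \<Longrightarrow> from_left (r *\<^sub>R p) = r *\<^sub>R from_left p"
  and from_right_scaleR: "p \<in> L2 \<Omega> \<Longrightarrow> from_right (r *\<^sub>R p) = r *\<^sub>R from_right p"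
  by (simp_all add: scaleR_eq_scaleC from_left_scaleC from_right_scaleC)

lemma from_right_bound: assumes q: "q \<in> L2 \<Omega>" shows "norm2 (from_right q) \<le> 2 * l * norm2 q"
proof -
  have "norm2 (from_right q) \<le> (cmod (- prim q l) + cmod 0 + sqrt l * norm2 q) * sqrt l"
    unfolding from_right_def by (rule W_bound[OF q])
  also have "\<dots> \<le> (sqrt l * norm2 q + 0 + sqrt l * norm2 q) * sqrt l"
    using prim_bound[OF q, of l] l_pos by (intro mult_right_mono add_right_mono) auto
  also have "\<dots> = 2 * (sqrt l * sqrt l) * norm2 q" by (simp add: algebra_simps)
  also have "\<dots> = 2 * l * norm2 q" using l_pos by simp
  finally show ?thesis .
qed

lemma from_left_bound: assumes q: "q \<in> L2 \<Omega>" shows "norm2 (from_left q) \<le> l * norm2 q"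
proof -
  have "norm2 (from_left q) \<le> (cmod 0 + cmod 0 + sqrt l * norm2 q) * sqrt l"
    unfolding from_left_def by (rule W_bound[OF q])
  also have "\<dots> = (sqrt l * sqrt l) * norm2 q" by (simp add: algebra_simps)
  also have "\<dots> = l * norm2 q" using l_pos by simp
  finally show ?thesis .
qed

lemma wderiv_from_left [simp]:
  "p \<in> L2 \<Omega> \<Longrightarrow> wderiv \<Omega> (from_left p) = p" "p \<in> L2 \<Omega> \<Longrightarrow> wderiv Cut (from_left p) = p"
  by (simp_all add: from_left_def wderiv_Omega_W wderiv_Cut_W)

lemma wderiv_from_right [simp]:
  "p \<in> L2 \<Omega> \<Longrightarrow> wderiv \<Omega> (from_right p) = p" "p \<in> L2 \<Omega> \<Longrightarrow> wderiv Cut (from_right p) = p"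
  by (simp_all add: from_right_def wderiv_Omega_W wderiv_Cut_W)

lemma trace_from_left:
  "p \<in> L2 \<Omega> \<Longrightarrow> trace_at (at_left l) (from_left p) = prim p l"
  "p \<in> L2 \<Omega> \<Longrightarrow> trace_at (at \<xi>) (from_left p) = prim p \<xi>"
  "p \<in> L2 \<Omega> \<Longrightarrow> trace_at (at_right 0) (from_left p) = 0"
  by (simp_all add: from_left_def trace_W)

lemma trace_from_right:
  "p \<in> L2 \<Omega> \<Longrightarrow> trace_at (at_left l) (from_right p) = 0"
  "p \<in> L2 \<Omega> \<Longrightarrow> trace_at (at \<xi>) (from_right p) = prim p \<xi> - prim p l"
  by (simp_all add: from_right_def trace_W)

lemma pinned_left: "w \<in> H1 \<Omega> \<and> trace_at (at_right 0) w = 0 \<longleftrightarrow> (\<exists>p\<in>L2 \<Omega>. w = from_left p)"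
  unfolding from_left_def H1_Omega by (auto simp: trace_W)

lemma pinned_right: "w \<in> H1 \<Omega> \<and> trace_at (at_left l) w = 0 \<longleftrightarrow> (\<exists>p\<in>L2 \<Omega>. w = from_right p)"
proof
  assume "w \<in> H1 \<Omega> \<and> trace_at (at_left l) w = 0"
  then obtain c g where g: "g \<in> L2 \<Omega>" "w = W c 0 g" "c + prim g l = 0"
    unfolding H1_Omega by (auto simp: trace_W)
  then have "w = from_right g" by (simp add: from_right_def add_eq_0_iff)
  then show "\<exists>p\<in>L2 \<Omega>. w = from_right p" using g by blast
next
  assume "\<exists>p\<in>L2 \<Omega>. w = from_right p"
  then show "w \<in> H1 \<Omega> \<and> trace_at (at_left l) w = 0"
    unfolding from_right_def H1_Omega by (auto simp: trace_W)
qed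

lemma L2_ip_scaleC: assumes f: "f \<in> L2 \<Omega>" shows "L2_ip (scaleC c f) (scaleC c f) = (cmod c)\<^sup>2 * L2_ip f f"
proof -
  have "L2_ip (scaleC c f) (scaleC c f) = (LINT x|lebesgue. (cmod c)\<^sup>2 * Re (rep_aefun f x * cnj (rep_aefun f x)))"
  proof (rule L2_ip_cong_AE[OF _ L2_scaleC[OF f] L2_scaleC[OF f]])
    show "AE x in lebesgue. Re (rep_aefun (scaleC c f) x * cnj (rep_aefun (scaleC c f) x))
        = (cmod c)\<^sup>2 * Re (rep_aefun f x * cnj (rep_aefun f x))"
      using rep_scaleC[of c f]
      by eventually_elim (simp only: Re_mult_cnj_self norm_mult power_mult_distrib)
    show "(\<lambda>x. (cmod c)\<^sup>2 * Re (rep_aefun f x * cnj (rep_aefun f x))) \<in> borel_measurable lebesgue"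
      by (intro borel_measurable_integrable integrable_mult_right L2_integrable_mult(3)[OF f f])
  qed
  then show ?thesis by (simp only: integral_mult_right_zero L2_ip_def)
qed

end

section \<open>The phase space as a Hilbert space\<close>

locale hybrid_beam = beam_with_cut "tm_ell P" "tm_xi P" for P :: timoshenko +
  assumes pos: "0 < tm_rho1 P" "0 < tm_rho2 P" "0 < tm_kappa P" "0 < tm_b P"
    "0 < tm_gamma1 P" "0 < tm_gamma2 P" "0 < tm_eps P"
begin

abbreviation "l \<equiv> tm_ell P"
abbreviation "\<xi> \<equiv> tm_xi P"
abbreviation "\<kappa> \<equiv> tm_kappa P"
abbreviation "\<rho>\<^sub>1 \<equiv> tm_rho1 P"
abbreviation "\<rho>\<^sub>2 \<equiv> tm_rho2 P"
abbreviation "b \<equiv> tm_b P"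
abbreviation "\<gamma>\<^sub>1 \<equiv> tm_gamma1 P"
abbreviation "\<gamma>\<^sub>2 \<equiv> tm_gamma2 P"
abbreviation "\<epsilon> \<equiv> tm_eps P"

lemma beam_eq: "beam P = \<Omega>" and beam_cut_eq: "beam_cut P = Cut"
  by (simp_all add: beam_def beam_cut_def)

text \<open>Coordinates \<open>(\<phi>\<^sub>x, \<Phi>, \<psi>\<^sub>x, \<Psi>, V)\<close> of the phase space in \<open>L\<^sup>2\<close> and \<open>\<complex>\<close>; the constraint \<open>v = \<phi>(l)\<close> is built in.\<close>

definition state_of :: "aefun \<Rightarrow> aefun \<Rightarrow> aefun \<Rightarrow> aefun \<Rightarrow> complex \<Rightarrow> state" where
  "state_of p \<Phi> q \<Psi> V = (from_left p, \<Phi>, from_right q, \<Psi>, prim p l, V)"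

lemma V_zero_eq: "V_zero P = from_left ` L2 \<Omega>"
  and V_ell_eq: "V_ell P = from_right ` L2 \<Omega>"
  unfolding V_zero_def V_ell_def beam_eq using pinned_left pinned_right by auto

lemma phase_space_iff:
  "X \<in> phase_space P \<longleftrightarrow> (\<exists>p\<in>L2 \<Omega>. \<exists>\<Phi>\<in>L2 \<Omega>. \<exists>q\<in>L2 \<Omega>. \<exists>\<Psi>\<in>L2 \<Omega>. \<exists>V. X = state_of p \<Phi> q \<Psi> V)"
  unfolding phase_space_def V_zero_eq V_ell_eq beam_eq state_of_def
  by (cases X) (auto simp: trace_from_left)

lemma state_of_phase_space [simp, intro]:
  "p \<in> L2 \<Omega> \<Longrightarrow> \<Phi> \<in> L2 \<Omega> \<Longrightarrow> q \<in> L2 \<Omega> \<Longrightarrow> \<Psi> \<in> L2 \<Omega> \<Longrightarrow> state_of p \<Phi> q \<Psi> V \<in> phase_space P"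
  unfolding phase_space_iff by blast

lemma phase_spaceE:
  assumes "X \<in> phase_space P"
  obtains p \<Phi> q \<Psi> V where "p \<in> L2 \<Omega>" "\<Phi> \<in> L2 \<Omega>" "q \<in> L2 \<Omega>" "\<Psi> \<in> L2 \<Omega>" "X = state_of p \<Phi> q \<Psi> V"
  using assms unfolding phase_space_iff by blast

lemma state_of_add:
  "p \<in> L2 \<Omega> \<Longrightarrow> q \<in> L2 \<Omega> \<Longrightarrow> p' \<in> L2 \<Omega> \<Longrightarrow> q' \<in> L2 \<Omega> \<Longrightarrow>
    state_of p \<Phi> q \<Psi> V + state_of p' \<Phi>' q' \<Psi>' V' = state_of (p + p') (\<Phi> + \<Phi>') (q + q') (\<Psi> + \<Psi>') (V + V')"
  by (simp add: state_of_def from_left_add from_right_add prim_add)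

lemma state_of_diff:
  "p \<in> L2 \<Omega> \<Longrightarrow> q \<in> L2 \<Omega> \<Longrightarrow> p' \<in> L2 \<Omega> \<Longrightarrow> q' \<in> L2 \<Omega> \<Longrightarrow>
    state_of p \<Phi> q \<Psi> V - state_of p' \<Phi>' q' \<Psi>' V' = state_of (p - p') (\<Phi> - \<Phi>') (q - q') (\<Psi> - \<Psi>') (V - V')"
  by (simp add: state_of_def from_left_diff from_right_diff prim_diff)

lemma state_of_scaleR:
  "p \<in> L2 \<Omega> \<Longrightarrow> q \<in> L2 \<Omega> \<Longrightarrow>
    r *\<^sub>R state_of p \<Phi> q \<Psi> V = state_of (r *\<^sub>R p) (r *\<^sub>R \<Phi>) (r *\<^sub>R q) (r *\<^sub>R \<Psi>) (r *\<^sub>R V)"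
  by (simp add: state_of_def from_left_scaleR from_right_scaleR prim_scaleR)

lemma state_of_scaleC:
  "p \<in> L2 \<Omega> \<Longrightarrow> q \<in> L2 \<Omega> \<Longrightarrow>
    scaleC_state c (state_of p \<Phi> q \<Psi> V) = state_of (scaleC c p) (scaleC c \<Phi>) (scaleC c q) (scaleC c \<Psi>) (c * V)"
  by (simp add: state_of_def from_left_scaleC from_right_scaleC prim_scaleC)

fun energy_ip :: "state \<Rightarrow> state \<Rightarrow> real" where
  "energy_ip (\<phi>, \<Phi>, \<psi>, \<Psi>, v, V) (\<phi>', \<Phi>', \<psi>', \<Psi>', v', V') =
     \<kappa> * L2_ip (wderiv \<Omega> \<phi> + \<psi>) (wderiv \<Omega> \<phi>' + \<psi>') + \<rho>\<^sub>1 * L2_ip \<Phi> \<Phi>'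
     + b * L2_ip (wderiv \<Omega> \<psi>) (wderiv \<Omega> \<psi>') + \<rho>\<^sub>2 * L2_ip \<Psi> \<Psi>'
     + \<epsilon> * Re (v * cnj v') + \<epsilon> * Re (V * cnj V')"

lemma energy_ip_state_of:
  "p \<in> L2 \<Omega> \<Longrightarrow> q \<in> L2 \<Omega> \<Longrightarrow> p' \<in> L2 \<Omega> \<Longrightarrow> q' \<in> L2 \<Omega> \<Longrightarrow>
    energy_ip (state_of p \<Phi> q \<Psi> V) (state_of p' \<Phi>' q' \<Psi>' V') =
      \<kappa> * L2_ip (p + from_right q) (p' + from_right q') + \<rho>\<^sub>1 * L2_ip \<Phi> \<Phi>' + b * L2_ip q q' + \<rho>\<^sub>2 * L2_ip \<Psi> \<Psi>'
      + \<epsilon> * Re (prim p l * cnj (prim p' l)) + \<epsilon> * Re (V * cnj V')"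
  by (simp add: state_of_def)

lemma set_integral_weighted_squares:
  assumes f: "f \<in> L2 \<Omega>" "g \<in> L2 \<Omega>" "h \<in> L2 \<Omega>" "k \<in> L2 \<Omega>"
  shows "(LINT x:\<Omega>|lebesgue. c1 * (cmod (rep_aefun f x))\<^sup>2 + c2 * (cmod (rep_aefun g x))\<^sup>2
      + c3 * (cmod (rep_aefun h x))\<^sup>2 + c4 * (cmod (rep_aefun k x))\<^sup>2)
    = c1 * L2_ip f f + c2 * L2_ip g g + c3 * L2_ip h h + c4 * L2_ip k k"
proof -
  have i: "set_integrable lebesgue \<Omega> (\<lambda>x. (cmod (rep_aefun u x))\<^sup>2)" if "u \<in> L2 \<Omega>" for u
    unfolding set_integrable_def by (intro integrable_mult_indicator L2_square_integrable[OF that]) simp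
  have e: "(LINT x:\<Omega>|lebesgue. (cmod (rep_aefun u x))\<^sup>2) = L2_ip u u" if u: "u \<in> L2 \<Omega>" for u
  proof -
    have "0 \<le> (LINT x:\<Omega>|lebesgue. (cmod (rep_aefun u x))\<^sup>2)"
      unfolding set_lebesgue_integral_def by (intro integral_nonneg_AE) auto
    then show ?thesis using L2.N_sq[OF u] by (simp add: L2_norm_def)
  qed
  show ?thesis
    using f by (simp add: set_integral_add i e set_integral_mult_right)
qed

lemma phase_norm_eq: assumes X: "X \<in> phase_space P" shows "phase_norm P X = sqrt (energy_ip X X)"
proof -
  obtain p \<Phi> q \<Psi> V where s: "p \<in> L2 \<Omega>" "\<Phi> \<in> L2 \<Omega>" "q \<in> L2 \<Omega>" "\<Psi> \<in> L2 \<Omega>" "X = state_of p \<Phi> q \<Psi> V"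
    using X by (rule phase_spaceE)
  have m: "p + from_right q \<in> L2 \<Omega>" using s by (auto intro: L2_add)
  have "phase_norm P X = sqrt ((LINT x:\<Omega>|lebesgue.
          \<kappa> * (cmod (rep_aefun (p + from_right q) x))\<^sup>2 + \<rho>\<^sub>1 * (cmod (rep_aefun \<Phi> x))\<^sup>2
        + b * (cmod (rep_aefun q x))\<^sup>2 + \<rho>\<^sub>2 * (cmod (rep_aefun \<Psi> x))\<^sup>2)
     + \<epsilon> * (cmod (prim p l))\<^sup>2 + \<epsilon> * (cmod V)\<^sup>2)"
    using s by (simp add: state_of_def beam_eq)
  also have "\<dots> = sqrt (energy_ip X X)"
    unfolding set_integral_weighted_squares[OF m s(2,3,4)] s(5) energy_ip_state_of[OF s(1,3,1,3)] Re_mult_cnj_self ..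
  finally show ?thesis .
qed

sublocale E: real_inner_subspace "phase_space P" "phase_norm P" energy_ip
proof
  show "subspace (phase_space P)"
    unfolding subspace_def
  proof (intro conjI ballI allI)
    have "state_of 0 0 0 0 0 \<in> phase_space P" by (intro state_of_phase_space L2_zero)
    moreover have "state_of 0 0 0 0 0 = 0"
      using state_of_scaleR[OF L2_zero L2_zero, of 0 0 0 0] by simp
    ultimately show "0 \<in> phase_space P" by simp
    fix x y assume x: "x \<in> phase_space P" and y: "y \<in> phase_space P"
    show "x + y \<in> phase_space P"
      using x y by (elim phase_spaceE) (auto simp: state_of_add intro!: state_of_phase_space L2_add)
    show "r *\<^sub>R x \<in> phase_space P" for r
      using x by (elim phase_spaceE) (auto simp: state_of_scaleR intro!: state_of_phase_space L2_scaleR)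
  qed
  fix x y z assume x: "x \<in> phase_space P" and y: "y \<in> phase_space P"
  obtain p \<Phi> q \<Psi> V where s: "p \<in> L2 \<Omega>" "\<Phi> \<in> L2 \<Omega>" "q \<in> L2 \<Omega>" "\<Psi> \<in> L2 \<Omega>" "x = state_of p \<Phi> q \<Psi> V"
    using x by (rule phase_spaceE)
  obtain p' \<Phi>' q' \<Psi>' V' where s': "p' \<in> L2 \<Omega>" "\<Phi>' \<in> L2 \<Omega>" "q' \<in> L2 \<Omega>" "\<Psi>' \<in> L2 \<Omega>" "y = state_of p' \<Phi>' q' \<Psi>' V'"
    using y by (rule phase_spaceE)
  show "energy_ip (x + y) z = energy_ip x z + energy_ip y z" if z: "z \<in> phase_space P"
  proof -
    obtain p'' \<Phi>'' q'' \<Psi>'' V'' where s'': "p'' \<in> L2 \<Omega>" "\<Phi>'' \<in> L2 \<Omega>" "q'' \<in> L2 \<Omega>" "\<Psi>'' \<in> L2 \<Omega>" "z = state_of p'' \<Phi>'' q'' \<Psi>'' V''"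
      using z by (rule phase_spaceE)
    have "(p + p') + from_right (q + q') = (p + from_right q) + (p' + from_right q')"
      using s s' by (simp add: from_right_add)
    then have "L2_ip ((p + p') + from_right (q + q')) (p'' + from_right q'')
        = L2_ip (p + from_right q) (p'' + from_right q'') + L2_ip (p' + from_right q') (p'' + from_right q'')"
      using s s' s'' by (simp only:) (intro L2.ip_add L2.H_add from_right_L2)
    moreover have "L2_ip (\<Phi> + \<Phi>') \<Phi>'' = L2_ip \<Phi> \<Phi>'' + L2_ip \<Phi>' \<Phi>''"
      "L2_ip (q + q') q'' = L2_ip q q'' + L2_ip q' q''"
      "L2_ip (\<Psi> + \<Psi>') \<Psi>'' = L2_ip \<Psi> \<Psi>'' + L2_ip \<Psi>' \<Psi>''"
      using s s' s'' by (auto intro: L2.ip_add)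
    ultimately show ?thesis
      using s s' s'' L2_add[of p \<Omega> p'] L2_add[of q \<Omega> q']
      by (simp add: state_of_add energy_ip_state_of prim_add) (simp add: algebra_simps)
  qed
  show "energy_ip (r *\<^sub>R x) y = r * energy_ip x y" for r
  proof -
    have "r *\<^sub>R p + from_right (r *\<^sub>R q) = r *\<^sub>R (p + from_right q)"
      using s by (simp add: from_right_scaleR scaleR_add_right)
    then have "L2_ip (r *\<^sub>R p + from_right (r *\<^sub>R q)) (p' + from_right q') = r * L2_ip (p + from_right q) (p' + from_right q')"
      using s s' by (simp only:) (intro L2.ip_scale L2.H_add from_right_L2)
    moreover have "L2_ip (r *\<^sub>R \<Phi>) \<Phi>' = r * L2_ip \<Phi> \<Phi>'" "L2_ip (r *\<^sub>R q) q' = r * L2_ip q q'"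
      "L2_ip (r *\<^sub>R \<Psi>) \<Psi>' = r * L2_ip \<Psi> \<Psi>'"
      using s s' by (auto intro: L2.ip_scale)
    ultimately show ?thesis
      using s s' L2_scaleR[of p \<Omega> r] L2_scaleR[of q \<Omega> r]
      by (simp add: state_of_scaleR energy_ip_state_of prim_scaleR) (simp add: algebra_simps)
  qed
  show "energy_ip x y = energy_ip y x"
  proof -
    have "L2_ip (p + from_right q) (p' + from_right q') = L2_ip (p' + from_right q') (p + from_right q)"
      using s s' by (intro L2.ip_sym L2.H_add from_right_L2)
    moreover have "L2_ip \<Phi> \<Phi>' = L2_ip \<Phi>' \<Phi>" "L2_ip q q' = L2_ip q' q" "L2_ip \<Psi> \<Psi>' = L2_ip \<Psi>' \<Psi>"
      using s s' by (auto intro: L2.ip_sym)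
    moreover have "Re (u * cnj w) = Re (w * cnj u)" for u w :: complex by (simp add: mult.commute)
    ultimately show ?thesis
      unfolding s(5) s'(5) energy_ip_state_of[OF s(1,3) s'(1,3)] energy_ip_state_of[OF s'(1,3) s(1,3)]
      by (simp only:)
  qed
  show "0 \<le> energy_ip x x"
  proof -
    have "0 \<le> L2_ip (p + from_right q) (p + from_right q)" "0 \<le> L2_ip \<Phi> \<Phi>" "0 \<le> L2_ip q q" "0 \<le> L2_ip \<Psi> \<Psi>"
      using s by (auto intro!: L2.ip_nonneg L2.H_add)
    then show ?thesis
      unfolding s(5) energy_ip_state_of[OF s(1,3,1,3)] Re_mult_cnj_self
      using pos by (intro add_nonneg_nonneg mult_nonneg_nonneg) auto
  qed
  show "phase_norm P x = sqrt (energy_ip x x)" by (rule phase_norm_eq[OF x])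
qed

lemma phase_norm_sq:
  assumes "p \<in> L2 \<Omega>" "\<Phi> \<in> L2 \<Omega>" "q \<in> L2 \<Omega>" "\<Psi> \<in> L2 \<Omega>"
  shows "(phase_norm P (state_of p \<Phi> q \<Psi> V))\<^sup>2 =
    \<kappa> * (norm2 (p + from_right q))\<^sup>2 + \<rho>\<^sub>1 * (norm2 \<Phi>)\<^sup>2 + b * (norm2 q)\<^sup>2 + \<rho>\<^sub>2 * (norm2 \<Psi>)\<^sup>2
    + \<epsilon> * (cmod (prim p l))\<^sup>2 + \<epsilon> * (cmod V)\<^sup>2"
proof -
  have m: "p + from_right q \<in> L2 \<Omega>" using assms by (auto intro: L2_add)
  show ?thesis
    using E.N_sq[OF state_of_phase_space[OF assms]]
    by (simp only: energy_ip_state_of[OF assms(1,3,1,3)] L2.N_sq[OF m] L2.N_sq[OF assms(2)]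
        L2.N_sq[OF assms(3)] L2.N_sq[OF assms(4)] Re_mult_cnj_self)
qed

text \<open>The square root of a number above every reciprocal weight in the energy norm, so that the norm controls each component.\<close>

definition K0 :: real where "K0 = sqrt (1 / \<kappa> + 1 / \<rho>\<^sub>1 + 1 / b + 1 / \<rho>\<^sub>2 + 1 / \<epsilon>)"

lemma K0_nonneg: "0 \<le> K0" using pos by (simp add: K0_def add_nonneg_nonneg)

text \<open>The energy sees \<open>\<phi>\<^sub>x\<close> only through \<open>\<phi>\<^sub>x + \<psi>\<close>.  A bound for \<open>\<phi>\<^sub>x\<close> itself can be derived when it is wanted, since \<open>\<psi>\<close> is the
primitive of \<open>\<psi>\<^sub>x\<close> that vanishes at \<open>l\<close>.\<close>

lemma component_bounds:
  fixes V :: complex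
  assumes s: "p \<in> L2 \<Omega>" "\<Phi> \<in> L2 \<Omega>" "q \<in> L2 \<Omega>" "\<Psi> \<in> L2 \<Omega>"
  defines "n \<equiv> phase_norm P (state_of p \<Phi> q \<Psi> V)"
  shows "norm2 (p + from_right q) \<le> K0 * n" "norm2 \<Phi> \<le> K0 * n" "norm2 q \<le> K0 * n"
    "norm2 \<Psi> \<le> K0 * n" "cmod (prim p l) \<le> K0 * n" "cmod V \<le> K0 * n" "0 \<le> n"
proof -
  show n: "0 \<le> n" unfolding n_def by (intro E.N_nonneg state_of_phase_space s)
  have K: "K0\<^sup>2 = 1 / \<kappa> + 1 / \<rho>\<^sub>1 + 1 / b + 1 / \<rho>\<^sub>2 + 1 / \<epsilon>"
    unfolding K0_def using pos by (intro real_sqrt_pow2 add_nonneg_nonneg) auto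
  have le: "t \<le> K0 * n" if "0 < a" "1 / a \<le> K0\<^sup>2" "a * t\<^sup>2 \<le> n\<^sup>2" for a t
  proof -
    have "t\<^sup>2 \<le> n\<^sup>2 * (1 / a)" using that(1,3) by (simp add: field_simps)
    also have "\<dots> \<le> n\<^sup>2 * K0\<^sup>2" using that(2) by (intro mult_left_mono) auto
    finally have "t\<^sup>2 \<le> (K0 * n)\<^sup>2" by (simp add: power_mult_distrib mult.commute)
    then show ?thesis by (rule power2_le_imp_le) (use n K0_nonneg in auto)
  qed
  have inv: "1 / \<kappa> \<le> K0\<^sup>2" "1 / \<rho>\<^sub>1 \<le> K0\<^sup>2" "1 / b \<le> K0\<^sup>2" "1 / \<rho>\<^sub>2 \<le> K0\<^sup>2" "1 / \<epsilon> \<le> K0\<^sup>2"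
  proof -
    have "0 < 1 / \<kappa>" "0 < 1 / \<rho>\<^sub>1" "0 < 1 / b" "0 < 1 / \<rho>\<^sub>2" "0 < 1 / \<epsilon>" using pos by simp_all
    then show "1 / \<kappa> \<le> K0\<^sup>2" "1 / \<rho>\<^sub>1 \<le> K0\<^sup>2" "1 / b \<le> K0\<^sup>2" "1 / \<rho>\<^sub>2 \<le> K0\<^sup>2" "1 / \<epsilon> \<le> K0\<^sup>2"
      unfolding K by linarith+
  qed
  note sq = phase_norm_sq[OF s, of V, folded n_def]
  have nn: "0 \<le> \<kappa> * (norm2 (p + from_right q))\<^sup>2" "0 \<le> \<rho>\<^sub>1 * (norm2 \<Phi>)\<^sup>2" "0 \<le> b * (norm2 q)\<^sup>2" "0 \<le> \<rho>\<^sub>2 * (norm2 \<Psi>)\<^sup>2"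
    "0 \<le> \<epsilon> * (cmod (prim p l))\<^sup>2" "0 \<le> \<epsilon> * (cmod V)\<^sup>2" using pos by simp_all
  show "norm2 (p + from_right q) \<le> K0 * n" by (rule le[OF pos(3) inv(1)]) (use sq nn in linarith)
  show "norm2 \<Phi> \<le> K0 * n" by (rule le[OF pos(1) inv(2)]) (use sq nn in linarith)
  show "norm2 q \<le> K0 * n" by (rule le[OF pos(4) inv(3)]) (use sq nn in linarith)
  show "norm2 \<Psi> \<le> K0 * n" by (rule le[OF pos(2) inv(4)]) (use sq nn in linarith)
  show "cmod (prim p l) \<le> K0 * n" by (rule le[OF pos(7) inv(5)]) (use sq nn in linarith)
  show "cmod V \<le> K0 * n" by (rule le[OF pos(7) inv(5)]) (use sq nn in linarith)
qed

text \<open>The components \<open>\<phi>\<^sub>x + \<psi>\<close>, \<open>\<Phi>\<close>, \<open>\<psi>\<^sub>x\<close>, \<open>\<Psi>\<close>, \<open>V\<close> of a Cauchy sequence converge separately, and subtracting the limit of \<open>\<psi>\<close> from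
the limit of \<open>\<phi>\<^sub>x + \<psi>\<close> recovers the limit state.\<close>

sublocale E: hilbert_subspace "phase_space P" "phase_norm P" energy_ip
proof
  fix x assume x: "x \<in> phase_space P" and zero: "energy_ip x x = 0"
  obtain p \<Phi> q \<Psi> V where s: "p \<in> L2 \<Omega>" "\<Phi> \<in> L2 \<Omega>" "q \<in> L2 \<Omega>" "\<Psi> \<in> L2 \<Omega>" "x = state_of p \<Phi> q \<Psi> V"
    using x by (rule phase_spaceE)
  have n: "phase_norm P (state_of p \<Phi> q \<Psi> V) = 0" using E.N_eq[OF x] zero s by simp
  have z: "f = 0" if "f \<in> L2 \<Omega>" "norm2 f \<le> 0" for f
  proof -
    have "norm2 f = 0" using that L2.N_nonneg[OF that(1)] by linarith
    then show ?thesis using L2_ip_definite[OF that(1)] L2.N_sq[OF that(1)] by simp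
  qed
  note c = component_bounds[OF s(1-4), of V, unfolded n, simplified]
  have "\<Phi> = 0" "\<Psi> = 0" "q = 0" "p + from_right q = 0" "V = 0"
    using z c s by (auto intro: L2_add)
  moreover have "from_right 0 = 0" using from_right_scaleR[OF L2_zero, of 0] by simp
  ultimately have "x = state_of 0 0 0 0 0" using s by simp
  then show "x = 0" using state_of_scaleR[OF L2_zero L2_zero, of 0 0 0 0] by simp
next
  fix X :: "nat \<Rightarrow> state"
  assume X: "\<And>n. X n \<in> phase_space P"
    and Cauchy: "\<And>e. e > 0 \<Longrightarrow> \<exists>M. \<forall>m\<ge>M. \<forall>n\<ge>M. phase_norm P (X m - X n) < e"
  define p \<Phi> q \<Psi> V where "p n = wderiv \<Omega> (fst (X n))" and "\<Phi> n = fst (snd (X n))"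
    and "q n = wderiv \<Omega> (fst (snd (snd (X n))))" and "\<Psi> n = fst (snd (snd (snd (X n))))"
    and "V n = snd (snd (snd (snd (snd (X n)))))" for n
  have "p n \<in> L2 \<Omega> \<and> \<Phi> n \<in> L2 \<Omega> \<and> q n \<in> L2 \<Omega> \<and> \<Psi> n \<in> L2 \<Omega> \<and> X n = state_of (p n) (\<Phi> n) (q n) (\<Psi> n) (V n)" for n
    using X[of n] by (elim phase_spaceE) (simp add: p_def \<Phi>_def q_def \<Psi>_def V_def state_of_def)
  then have s: "\<And>n. p n \<in> L2 \<Omega>" "\<And>n. \<Phi> n \<in> L2 \<Omega>" "\<And>n. q n \<in> L2 \<Omega>" "\<And>n. \<Psi> n \<in> L2 \<Omega>"
    and Xn: "\<And>n. X n = state_of (p n) (\<Phi> n) (q n) (\<Psi> n) (V n)" by auto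
  define r where "r n = p n + from_right (q n)" for n
  have r: "r n \<in> L2 \<Omega>" for n unfolding r_def by (intro L2_add from_right_L2 s)
  have Xd: "X m - X n = state_of (p m - p n) (\<Phi> m - \<Phi> n) (q m - q n) (\<Psi> m - \<Psi> n) (V m - V n)" for m n
    unfolding Xn by (rule state_of_diff) (rule s)+
  have rd: "(p m - p n) + from_right (q m - q n) = r m - r n" for m n
    unfolding r_def from_right_diff[OF s(3) s(3)] by simp
  have cb: "norm2 (r m - r n) \<le> K0 * phase_norm P (X m - X n)" "norm2 (\<Phi> m - \<Phi> n) \<le> K0 * phase_norm P (X m - X n)"
    "norm2 (q m - q n) \<le> K0 * phase_norm P (X m - X n)" "norm2 (\<Psi> m - \<Psi> n) \<le> K0 * phase_norm P (X m - X n)"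
    "cmod (V m - V n) \<le> K0 * phase_norm P (X m - X n)" for m n
    using component_bounds[OF L2_diff[OF s(1)[of m] s(1)[of n]] L2_diff[OF s(2)[of m] s(2)[of n]]
        L2_diff[OF s(3)[of m] s(3)[of n]] L2_diff[OF s(4)[of m] s(4)[of n]], of "V m - V n"]
    unfolding Xd rd by blast+
  have C: "\<exists>M. \<forall>m\<ge>M. \<forall>n\<ge>M. t m n < e"
    if t: "\<And>m n. t m n \<le> K0 * phase_norm P (X m - X n)" and e: "e > 0" for t :: "nat \<Rightarrow> nat \<Rightarrow> real" and e
  proof -
    obtain M where M: "\<And>m n. M \<le> m \<Longrightarrow> M \<le> n \<Longrightarrow> phase_norm P (X m - X n) < e / (K0 + 1)"
      using Cauchy[of "e / (K0 + 1)"] e K0_nonneg by auto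
    have "t m n < e" if "M \<le> m" "M \<le> n" for m n
    proof -
      have "t m n \<le> K0 * phase_norm P (X m - X n)" by (rule t)
      also have "\<dots> \<le> K0 * (e / (K0 + 1))" using M[OF that] K0_nonneg by (intro mult_left_mono) auto
      also have "\<dots> < e" using e K0_nonneg by (simp add: divide_simps)
      finally show ?thesis .
    qed
    then show ?thesis by blast
  qed
  obtain r' where r': "r' \<in> L2 \<Omega>" "(\<lambda>n. norm2 (r n - r')) \<longlonglongrightarrow> 0"
    using L2_complete[OF Omega_lmeasurable r C[OF cb(1)]] by blast
  obtain \<Phi>' where \<Phi>': "\<Phi>' \<in> L2 \<Omega>" "(\<lambda>n. norm2 (\<Phi> n - \<Phi>')) \<longlonglongrightarrow> 0"
    using L2_complete[OF Omega_lmeasurable s(2) C[OF cb(2)]] by blast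
  obtain q' where q': "q' \<in> L2 \<Omega>" "(\<lambda>n. norm2 (q n - q')) \<longlonglongrightarrow> 0"
    using L2_complete[OF Omega_lmeasurable s(3) C[OF cb(3)]] by blast
  obtain \<Psi>' where \<Psi>': "\<Psi>' \<in> L2 \<Omega>" "(\<lambda>n. norm2 (\<Psi> n - \<Psi>')) \<longlonglongrightarrow> 0"
    using L2_complete[OF Omega_lmeasurable s(4) C[OF cb(4)]] by blast
  have "Cauchy V" by (rule metric_CauchyI) (use C[OF cb(5)] in \<open>simp add: dist_norm\<close>)
  then obtain V' where V': "V \<longlonglongrightarrow> V'" using Cauchy_convergent_iff convergent_def by metis
  define p' where "p' = r' - from_right q'"
  have p': "p' \<in> L2 \<Omega>" unfolding p'_def by (intro L2_diff r' from_right_L2 q')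
  define x where "x = state_of p' \<Phi>' q' \<Psi>' V'"
  have x: "x \<in> phase_space P" unfolding x_def by (intro state_of_phase_space p' \<Phi>' q' \<Psi>')
  have Xx: "X n - x = state_of (p n - p') (\<Phi> n - \<Phi>') (q n - q') (\<Psi> n - \<Psi>') (V n - V')" for n
    unfolding Xn x_def by (rule state_of_diff) (rule s p' q')+
  have d: "p n - p' \<in> L2 \<Omega>" "\<Phi> n - \<Phi>' \<in> L2 \<Omega>" "q n - q' \<in> L2 \<Omega>" "\<Psi> n - \<Psi>' \<in> L2 \<Omega>" "r n - r' \<in> L2 \<Omega>" for n
    by (intro L2_diff s r r' p' q' \<Phi>' \<Psi>')+
  have rx: "(p n - p') + from_right (q n - q') = r n - r'" for n
    unfolding r_def p'_def from_right_diff[OF s(3) q'(1)] by simp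
  have pl: "(\<lambda>n. cmod (prim (p n - p') l)) \<longlonglongrightarrow> 0"
  proof (rule tendsto_sandwich[OF _ _ tendsto_const])
    show "(\<lambda>n. sqrt l * (norm2 (r n - r') + 2 * l * norm2 (q n - q'))) \<longlonglongrightarrow> 0"
      by (intro tendsto_mult_right_zero tendsto_add_zero r' q')
    show "\<forall>\<^sub>F n in sequentially. cmod (prim (p n - p') l) \<le> sqrt l * (norm2 (r n - r') + 2 * l * norm2 (q n - q'))"
    proof (intro always_eventually allI)
      fix n
      have "p n - p' = (r n - r') - from_right (q n - q')" unfolding rx[symmetric] by simp
      then have "norm2 (p n - p') \<le> norm2 (r n - r') + norm2 (from_right (q n - q'))"
        using L2.N_triangle_diff[OF d(5) from_right_L2[OF d(3)]] by simp
      also have "\<dots> \<le> norm2 (r n - r') + 2 * l * norm2 (q n - q')"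
        by (intro add_left_mono from_right_bound d)
      finally have "sqrt l * norm2 (p n - p') \<le> sqrt l * (norm2 (r n - r') + 2 * l * norm2 (q n - q'))"
        using l_pos by (intro mult_left_mono) auto
      then show "cmod (prim (p n - p') l) \<le> sqrt l * (norm2 (r n - r') + 2 * l * norm2 (q n - q'))"
        using prim_bound[OF d(1), of l n] by linarith
    qed
  qed auto
  have "(\<lambda>n. (phase_norm P (X n - x))\<^sup>2) \<longlonglongrightarrow> \<kappa> * 0\<^sup>2 + \<rho>\<^sub>1 * 0\<^sup>2 + b * 0\<^sup>2 + \<rho>\<^sub>2 * 0\<^sup>2 + \<epsilon> * 0\<^sup>2 + \<epsilon> * 0\<^sup>2"
    unfolding Xx phase_norm_sq[OF d(1-4)] rx
    by (intro tendsto_add tendsto_mult tendsto_power tendsto_const r'(2) \<Phi>'(2) q'(2) \<Psi>'(2) pl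
        tendsto_norm_zero LIM_zero V')
  then have "(\<lambda>n. sqrt ((phase_norm P (X n - x))\<^sup>2)) \<longlonglongrightarrow> sqrt 0" by (intro tendsto_real_sqrt) simp
  moreover have "sqrt ((phase_norm P (X n - x))\<^sup>2) = phase_norm P (X n - x)" for n
    by (intro real_sqrt_unique E.N_nonneg E.H_diff X x) simp
  ultimately show "\<exists>x\<in>phase_space P. (\<lambda>n. phase_norm P (X n - x)) \<longlonglongrightarrow> 0"
    using x by auto
qed

section \<open>The domain and the energy identity\<close>

text \<open>The transmission conditions solved for the jumps of \<open>\<phi>\<^sub>x\<close> and \<open>\<psi>\<^sub>x\<close>.  If \<open>\<Phi>\<close> has derivative \<open>u\<close> and vanishes at \<open>0\<close>, then
\<open>\<Phi>(\<xi>)\<close> is \<open>prim u \<xi>\<close>; if \<open>\<Psi>\<close> has derivative \<open>w\<close> and vanishes at \<open>l\<close>, then \<open>\<Psi>(\<xi>)\<close> is \<open>prim w \<xi> - prim w l\<close>.\<close>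

definition jump\<^sub>1 :: "aefun \<Rightarrow> complex" where
  "jump\<^sub>1 u = of_real (\<gamma>\<^sub>1 / \<kappa>) * prim u \<xi>"

definition jump\<^sub>2 :: "aefun \<Rightarrow> complex" where
  "jump\<^sub>2 w = of_real (\<gamma>\<^sub>2 / b) * (prim w \<xi> - prim w l)"

text \<open>The derivatives \<open>\<phi>\<^sub>x\<close> and \<open>\<psi>\<^sub>x\<close> of an element of the domain, in terms of the second derivatives and of the jumps; the
value of \<open>\<phi>\<^sub>x\<close> at \<open>0\<close> is free and that of \<open>\<psi>\<^sub>x\<close> is \<open>0\<close>.\<close>

definition slope\<^sub>1 :: "complex \<Rightarrow> aefun \<Rightarrow> aefun \<Rightarrow> aefun" where
  "slope\<^sub>1 c p' u = W c (jump\<^sub>1 u) p'"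

definition slope\<^sub>2 :: "aefun \<Rightarrow> aefun \<Rightarrow> aefun" where
  "slope\<^sub>2 q' w = W 0 (jump\<^sub>2 w) q'"

text \<open>Coordinates \<open>(\<phi>\<^sub>x(0), \<phi>\<^sub>x\<^sub>x, \<Phi>\<^sub>x, \<psi>\<^sub>x\<^sub>x, \<Psi>\<^sub>x)\<close> of the domain; the condition \<open>V = \<Phi>(l)\<close> is built in.\<close>

definition dom_of :: "complex \<Rightarrow> aefun \<Rightarrow> aefun \<Rightarrow> aefun \<Rightarrow> aefun \<Rightarrow> state" where
  "dom_of c p' u q' w = state_of (slope\<^sub>1 c p' u) (from_left u) (slope\<^sub>2 q' w) (from_right w) (prim u l)"

lemma slope_L2 [simp, intro]: "p' \<in> L2 \<Omega> \<Longrightarrow> slope\<^sub>1 c p' u \<in> L2 \<Omega>" "q' \<in> L2 \<Omega> \<Longrightarrow> slope\<^sub>2 q' w \<in> L2 \<Omega>"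
  by (simp_all add: slope\<^sub>1_def slope\<^sub>2_def W_L2)

lemma jump_add: "u \<in> L2 \<Omega> \<Longrightarrow> v \<in> L2 \<Omega> \<Longrightarrow> jump\<^sub>1 (u + v) = jump\<^sub>1 u + jump\<^sub>1 v"
  "u \<in> L2 \<Omega> \<Longrightarrow> v \<in> L2 \<Omega> \<Longrightarrow> jump\<^sub>2 (u + v) = jump\<^sub>2 u + jump\<^sub>2 v"
  by (simp_all add: jump\<^sub>1_def jump\<^sub>2_def prim_add algebra_simps)

lemma jump_scaleC: "u \<in> L2 \<Omega> \<Longrightarrow> jump\<^sub>1 (scaleC k u) = k * jump\<^sub>1 u"
  "u \<in> L2 \<Omega> \<Longrightarrow> jump\<^sub>2 (scaleC k u) = k * jump\<^sub>2 u"
  by (simp_all add: jump\<^sub>1_def jump\<^sub>2_def prim_scaleC algebra_simps)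

lemma slope_add:
  "p' \<in> L2 \<Omega> \<Longrightarrow> p'' \<in> L2 \<Omega> \<Longrightarrow> u \<in> L2 \<Omega> \<Longrightarrow> v \<in> L2 \<Omega> \<Longrightarrow>
    slope\<^sub>1 (c + c') (p' + p'') (u + v) = slope\<^sub>1 c p' u + slope\<^sub>1 c' p'' v"
  "p' \<in> L2 \<Omega> \<Longrightarrow> p'' \<in> L2 \<Omega> \<Longrightarrow> u \<in> L2 \<Omega> \<Longrightarrow> v \<in> L2 \<Omega> \<Longrightarrow>
    slope\<^sub>2 (p' + p'') (u + v) = slope\<^sub>2 p' u + slope\<^sub>2 p'' v"
  by (simp_all add: slope\<^sub>1_def slope\<^sub>2_def W_add jump_add)

lemma slope_scaleC:
  "p' \<in> L2 \<Omega> \<Longrightarrow> u \<in> L2 \<Omega> \<Longrightarrow> slope\<^sub>1 (k * c) (scaleC k p') (scaleC k u) = scaleC k (slope\<^sub>1 c p' u)"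
  "p' \<in> L2 \<Omega> \<Longrightarrow> u \<in> L2 \<Omega> \<Longrightarrow> slope\<^sub>2 (scaleC k p') (scaleC k u) = scaleC k (slope\<^sub>2 p' u)"
  by (simp_all add: slope\<^sub>1_def slope\<^sub>2_def W_scaleC jump_scaleC)

lemma dom_of_add:
  assumes "p' \<in> L2 \<Omega>" "u \<in> L2 \<Omega>" "q' \<in> L2 \<Omega>" "w \<in> L2 \<Omega>" "p'' \<in> L2 \<Omega>" "u' \<in> L2 \<Omega>" "q'' \<in> L2 \<Omega>" "w' \<in> L2 \<Omega>"
  shows "dom_of c p' u q' w + dom_of c' p'' u' q'' w' = dom_of (c + c') (p' + p'') (u + u') (q' + q'') (w + w')"
  unfolding dom_of_def using assms
  by (simp add: state_of_add slope_add from_left_add from_right_add prim_add)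

lemma dom_of_scaleC:
  assumes "p' \<in> L2 \<Omega>" "u \<in> L2 \<Omega>" "q' \<in> L2 \<Omega>" "w \<in> L2 \<Omega>"
  shows "scaleC_state k (dom_of c p' u q' w) = dom_of (k * c) (scaleC k p') (scaleC k u) (scaleC k q') (scaleC k w)"
  unfolding dom_of_def using assms
  by (simp add: state_of_scaleC slope_scaleC from_left_scaleC from_right_scaleC prim_scaleC)

lemma from_left_H1: "p \<in> L2 \<Omega> \<Longrightarrow> from_left p \<in> H1 Cut" and from_right_H1: "p \<in> L2 \<Omega> \<Longrightarrow> from_right p \<in> H1 Cut"
  unfolding H1_Cut from_left_def from_right_def by blast+

lemma jump_W: "g \<in> L2 \<Omega> \<Longrightarrow> jump \<xi> (W c d g) = d"
  by (simp add: jump_def trace_W)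

text \<open>Every condition in the definition of the domain becomes a choice of coefficients: \<open>H\<^sup>2\<close> regularity on the cut beam turns \<open>\<phi>\<^sub>x\<close> and
\<open>\<psi>\<^sub>x\<close> into piecewise primitives, the transmission conditions fix their jumps, and \<open>\<psi>\<^sub>x(0) = 0\<close> fixes one constant.\<close>

lemma tim_dom_iff:
  "X \<in> tim_dom P \<longleftrightarrow> (\<exists>c. \<exists>p'\<in>L2 \<Omega>. \<exists>u\<in>L2 \<Omega>. \<exists>q'\<in>L2 \<Omega>. \<exists>w\<in>L2 \<Omega>. X = dom_of c p' u q' w)"
proof
  assume "X \<in> tim_dom P"
  then obtain \<phi> \<Phi> \<psi> \<Psi> v V where X: "X = (\<phi>, \<Phi>, \<psi>, \<Psi>, v, V)"
    and ps: "X \<in> phase_space P" and h2: "\<phi> \<in> H2 Cut" "\<psi> \<in> H2 Cut"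
    and vel: "\<Phi> \<in> V_zero P" "\<Psi> \<in> V_ell P"
    and j1: "jump \<xi> (\<kappa> *\<^sub>R wderiv Cut \<phi>) = \<gamma>\<^sub>1 *\<^sub>R trace_at (at \<xi>) \<Phi>"
    and j2: "jump \<xi> (b *\<^sub>R wderiv Cut \<psi>) = \<gamma>\<^sub>2 *\<^sub>R trace_at (at \<xi>) \<Psi>"
    and t0: "trace_at (at_right 0) (wderiv Cut \<psi>) = 0" and tl: "trace_at (at_left l) \<Phi> = V"
    unfolding tim_dom_def beam_cut_eq by auto
  obtain p q where pq: "p \<in> L2 \<Omega>" "q \<in> L2 \<Omega>" "\<phi> = from_left p" "\<psi> = from_right q" "v = prim p l"
    using ps unfolding X phase_space_iff state_of_def by auto
  obtain u where u: "u \<in> L2 \<Omega>" "\<Phi> = from_left u" using vel(1) unfolding V_zero_eq by auto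
  obtain w where w: "w \<in> L2 \<Omega>" "\<Psi> = from_right w" using vel(2) unfolding V_ell_eq by auto
  have "p \<in> H1 Cut" "q \<in> H1 Cut" using h2 pq by (auto simp: H2_def)
  then obtain c d p' a e q' where p': "p' \<in> L2 \<Omega>" "p = W c d p'" and q': "q' \<in> L2 \<Omega>" "q = W a e q'"
    unfolding H1_Cut by blast
  have "\<kappa> * d = \<gamma>\<^sub>1 * prim u \<xi>"
    using j1 pq u p' by (simp add: W_scaleR L2_scaleR jump_W trace_from_left scaleR_conv_of_real)
  then have d: "d = jump\<^sub>1 u" using pos by (simp add: jump\<^sub>1_def field_simps)
  have "b * e = \<gamma>\<^sub>2 * (prim w \<xi> - prim w l)"
    using j2 pq w q' by (simp add: W_scaleR L2_scaleR jump_W trace_from_right scaleR_conv_of_real)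
  then have e: "e = jump\<^sub>2 w" using pos by (simp add: jump\<^sub>2_def field_simps)
  have a: "a = 0" using t0 pq q' by (simp add: trace_W)
  have "V = prim u l" using tl u by (simp add: trace_from_left)
  then have "X = dom_of c p' u q' w"
    unfolding X dom_of_def state_of_def slope\<^sub>1_def slope\<^sub>2_def using pq u w p' q' d e a by simp
  then show "\<exists>c. \<exists>p'\<in>L2 \<Omega>. \<exists>u\<in>L2 \<Omega>. \<exists>q'\<in>L2 \<Omega>. \<exists>w\<in>L2 \<Omega>. X = dom_of c p' u q' w"
    using u(1) w(1) p'(1) q'(1) by blast
next
  assume "\<exists>c. \<exists>p'\<in>L2 \<Omega>. \<exists>u\<in>L2 \<Omega>. \<exists>q'\<in>L2 \<Omega>. \<exists>w\<in>L2 \<Omega>. X = dom_of c p' u q' w"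
  then obtain c p' u q' w where s: "p' \<in> L2 \<Omega>" "u \<in> L2 \<Omega>" "q' \<in> L2 \<Omega>" "w \<in> L2 \<Omega>" and X: "X = dom_of c p' u q' w"
    by blast
  have s1: "slope\<^sub>1 c p' u \<in> L2 \<Omega>" "slope\<^sub>2 q' w \<in> L2 \<Omega>" using s by auto
  have h: "slope\<^sub>1 c p' u \<in> H1 Cut" "slope\<^sub>2 q' w \<in> H1 Cut"
    unfolding H1_Cut slope\<^sub>1_def slope\<^sub>2_def using s by blast+
  have "X \<in> phase_space P" unfolding X dom_of_def using s by auto
  moreover have "from_left (slope\<^sub>1 c p' u) \<in> H2 Cut" "from_right (slope\<^sub>2 q' w) \<in> H2 Cut"
    unfolding H2_def using s1 h by (auto intro: from_left_H1 from_right_H1)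
  moreover have "from_left u \<in> V_zero P" "from_right w \<in> V_ell P"
    unfolding V_zero_eq V_ell_eq using s by auto
  moreover have "jump \<xi> (\<kappa> *\<^sub>R slope\<^sub>1 c p' u) = \<gamma>\<^sub>1 *\<^sub>R prim u \<xi>" "jump \<xi> (b *\<^sub>R slope\<^sub>2 q' w) = \<gamma>\<^sub>2 *\<^sub>R (prim w \<xi> - prim w l)"
    using s pos
    by (simp_all add: slope\<^sub>1_def slope\<^sub>2_def W_scaleR L2_scaleR jump_W jump\<^sub>1_def jump\<^sub>2_def scaleR_conv_of_real)
  moreover have "trace_at (at_right 0) (slope\<^sub>2 q' w) = 0" unfolding slope\<^sub>2_def using s by (simp add: trace_W)
  ultimately show "X \<in> tim_dom P"
    unfolding tim_dom_def beam_cut_eq using s s1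
    by (simp add: X dom_of_def state_of_def trace_from_left trace_from_right)
qed

lemma tim_domE:
  assumes "X \<in> tim_dom P"
  obtains c p' u q' w where "p' \<in> L2 \<Omega>" "u \<in> L2 \<Omega>" "q' \<in> L2 \<Omega>" "w \<in> L2 \<Omega>" "X = dom_of c p' u q' w"
  using assms unfolding tim_dom_iff by blast

text \<open>Since \<open>\<psi>\<close> is continuous at \<open>\<xi>\<close>, the shear force has the same jump as \<open>\<kappa> \<phi>\<^sub>x\<close>.\<close>

lemma shear_W:
  assumes "p' \<in> L2 \<Omega>" "q \<in> L2 \<Omega>"
  shows "slope\<^sub>1 c p' u + from_right q = W (c - prim q l) (jump\<^sub>1 u) (p' + q)"
  using assms by (simp add: slope\<^sub>1_def from_right_def W_add)

lemma tim_op_dom_of: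
  assumes s: "p' \<in> L2 \<Omega>" "u \<in> L2 \<Omega>" "q' \<in> L2 \<Omega>" "w \<in> L2 \<Omega>"
  shows "tim_op P (dom_of c p' u q' w) = state_of u ((\<kappa> / \<rho>\<^sub>1) *\<^sub>R (p' + slope\<^sub>2 q' w)) w
      ((b / \<rho>\<^sub>2) *\<^sub>R q' - (\<kappa> / \<rho>\<^sub>2) *\<^sub>R (slope\<^sub>1 c p' u + from_right (slope\<^sub>2 q' w)))
      (- prim u l - prim (slope\<^sub>1 c p' u) l - of_real (\<kappa> / \<epsilon>) * (c + jump\<^sub>1 u + prim p' l))"
proof -
  let ?p = "slope\<^sub>1 c p' u" and ?q = "slope\<^sub>2 q' w"
  have pq: "?p \<in> L2 \<Omega>" "?q \<in> L2 \<Omega>" using s by auto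
  have sh: "?p + from_right ?q = W (c - prim ?q l) (jump\<^sub>1 u) (p' + ?q)" by (rule shear_W[OF s(1) pq(2)])
  have L: "p' + ?q \<in> L2 \<Omega>" using s pq by (auto intro: L2_add)
  have w1: "wderiv Cut (?p + from_right ?q) = p' + ?q" unfolding sh by (rule wderiv_Cut_W[OF L])
  have w2: "wderiv Cut ?q = q'" unfolding slope\<^sub>2_def by (rule wderiv_Cut_W[OF s(3)])
  have t: "trace_at (at_left l) (\<kappa> *\<^sub>R (?p + from_right ?q)) = of_real \<kappa> * (c + jump\<^sub>1 u + prim p' l)"
    unfolding sh W_scaleR[OF L] trace_W(2)[OF L2_scaleR[OF L]] prim_scaleR[OF L] prim_add[OF s(1) pq(2)]
    by (simp add: scaleR_conv_of_real algebra_simps)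
  show ?thesis
    using pq by (simp add: dom_of_def state_of_def beam_cut_eq shear_def w1 w2 t) (simp add: scaleR_conv_of_real)
qed

lemma tim_op_in_phase_space:
  assumes X: "X \<in> tim_dom P" shows "tim_op P X \<in> phase_space P"
proof -
  obtain c p' u q' w where s: "p' \<in> L2 \<Omega>" "u \<in> L2 \<Omega>" "q' \<in> L2 \<Omega>" "w \<in> L2 \<Omega>" and X: "X = dom_of c p' u q' w"
    using X by (rule tim_domE)
  show ?thesis unfolding X tim_op_dom_of[OF s]
    using s by (intro state_of_phase_space L2_diff L2_scaleR L2_add) auto
qed

lemma tim_op_add:
  assumes X: "X \<in> tim_dom P" and Y: "Y \<in> tim_dom P" shows "X + Y \<in> tim_dom P" "tim_op P (X + Y) = tim_op P X + tim_op P Y"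
proof -
  obtain c p' u q' w where s: "p' \<in> L2 \<Omega>" "u \<in> L2 \<Omega>" "q' \<in> L2 \<Omega>" "w \<in> L2 \<Omega>" and X: "X = dom_of c p' u q' w"
    using X by (rule tim_domE)
  obtain c' p'' u' q'' w' where s': "p'' \<in> L2 \<Omega>" "u' \<in> L2 \<Omega>" "q'' \<in> L2 \<Omega>" "w' \<in> L2 \<Omega>" and Y: "Y = dom_of c' p'' u' q'' w'"
    using Y by (rule tim_domE)
  have a: "p' + p'' \<in> L2 \<Omega>" "u + u' \<in> L2 \<Omega>" "q' + q'' \<in> L2 \<Omega>" "w + w' \<in> L2 \<Omega>"
    by (intro L2_add s s')+
  have XY: "X + Y = dom_of (c + c') (p' + p'') (u + u') (q' + q'') (w + w')"
    unfolding X Y by (rule dom_of_add[OF s s'])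
  show "X + Y \<in> tim_dom P" unfolding XY tim_dom_iff using a by blast
  have L: "slope\<^sub>1 c p' u \<in> L2 \<Omega>" "slope\<^sub>2 q' w \<in> L2 \<Omega>" "slope\<^sub>1 c' p'' u' \<in> L2 \<Omega>" "slope\<^sub>2 q'' w' \<in> L2 \<Omega>"
    using s s' by auto
  show "tim_op P (X + Y) = tim_op P X + tim_op P Y"
    unfolding XY tim_op_dom_of[OF a] unfolding X Y tim_op_dom_of[OF s] tim_op_dom_of[OF s']
      slope_add[OF s(1) s'(1) s(2) s'(2)] slope_add(2)[OF s(3) s'(3) s(4) s'(4)]
      from_right_add[OF L(2,4)] jump_add(1)[OF s(2) s'(2)] prim_add[OF s(2) s'(2)] prim_add[OF s(1) s'(1)]
      prim_add[OF L(1,3)] state_of_add[OF s(2,4) s'(2,4)]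
    by (simp add: scaleR_add_right algebra_simps)
qed

lemma tim_op_scaleC:
  assumes X: "X \<in> tim_dom P" shows "scaleC_state k X \<in> tim_dom P" "tim_op P (scaleC_state k X) = scaleC_state k (tim_op P X)"
proof -
  obtain c p' u q' w where s: "p' \<in> L2 \<Omega>" "u \<in> L2 \<Omega>" "q' \<in> L2 \<Omega>" "w \<in> L2 \<Omega>" and X: "X = dom_of c p' u q' w"
    using X by (rule tim_domE)
  have a: "scaleC k p' \<in> L2 \<Omega>" "scaleC k u \<in> L2 \<Omega>" "scaleC k q' \<in> L2 \<Omega>" "scaleC k w \<in> L2 \<Omega>"
    by (intro L2_scaleC s)+
  have kX: "scaleC_state k X = dom_of (k * c) (scaleC k p') (scaleC k u) (scaleC k q') (scaleC k w)"
    unfolding X by (rule dom_of_scaleC[OF s])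
  show "scaleC_state k X \<in> tim_dom P" unfolding kX tim_dom_iff using a by blast
  have L: "slope\<^sub>1 c p' u \<in> L2 \<Omega>" "slope\<^sub>2 q' w \<in> L2 \<Omega>" using s by auto
  show "tim_op P (scaleC_state k X) = scaleC_state k (tim_op P X)"
    unfolding kX tim_op_dom_of[OF a] unfolding X tim_op_dom_of[OF s]
      slope_scaleC(1)[OF s(1,2)] slope_scaleC(2)[OF s(3,4)]
      from_right_scaleC[OF L(2)] jump_scaleC(1)[OF s(2)] prim_scaleC[OF s(2)] prim_scaleC[OF s(1)]
      prim_scaleC[OF L(1)] state_of_scaleC[OF s(2,4)]
    by (simp add: scaleC_diff scaleC_add scaleC_scaleR algebra_simps)
qed

lemma scaleC_state_real: "scaleC_state (complex_of_real r) X = r *\<^sub>R X"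
  by (cases X) (simp add: scaleR_eq_scaleC scaleR_conv_of_real)

lemma Re_of_real_mult: "Re (complex_of_real r * z) = r * Re z"
  by simp

text \<open>With \<open>\<sigma> = \<phi>\<^sub>x + \<psi>\<close>, integration by parts turns \<open>\<langle>\<sigma>, \<Phi>\<^sub>x\<rangle> + \<langle>\<sigma>\<^sub>x, \<Phi>\<rangle>\<close> and \<open>\<langle>\<psi>\<^sub>x, \<Psi>\<^sub>x\<rangle> + \<langle>\<psi>\<^sub>x\<^sub>x, \<Psi>\<rangle>\<close> into boundary terms and jumps, and
the coupling terms \<open>\<langle>\<sigma>, \<Psi>\<rangle>\<close> cancel.  The boundary term at \<open>l\<close> is cancelled by the tip equation, and what remains is
\<open>- \<gamma>\<^sub>1 |\<Phi>(\<xi>)|\<^sup>2 - \<gamma>\<^sub>2 |\<Psi>(\<xi>)|\<^sup>2 - \<epsilon> |V|\<^sup>2\<close>.\<close>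

lemma tim_op_dissipative:
  assumes X: "X \<in> tim_dom P" shows "energy_ip (tim_op P X) X \<le> 0"
proof -
  obtain c p' u q' w where s: "p' \<in> L2 \<Omega>" "u \<in> L2 \<Omega>" "q' \<in> L2 \<Omega>" "w \<in> L2 \<Omega>" and X: "X = dom_of c p' u q' w"
    using X by (rule tim_domE)
  define p q where "p = slope\<^sub>1 c p' u" and "q = slope\<^sub>2 q' w"
  have pq: "p \<in> L2 \<Omega>" "q \<in> L2 \<Omega>" using s by (auto simp: p_def q_def)
  define \<sigma> where "\<sigma> = p + from_right q"
  have \<sigma>W: "\<sigma> = W (c - prim q l) (jump\<^sub>1 u) (p' + q)"
    unfolding \<sigma>_def p_def by (rule shear_W[OF s(1) pq(2)])
  have g: "p' + q \<in> L2 \<Omega>" using s pq by (auto intro: L2_add)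
  have \<sigma>: "\<sigma> \<in> L2 \<Omega>" unfolding \<sigma>W by (rule W_L2[OF g])
  define S V where "S = c + jump\<^sub>1 u + prim p' l" and "V = prim u l"
  have rw: "from_right w \<in> L2 \<Omega>" and lu: "from_left u \<in> L2 \<Omega>" using s by auto
  have e: "energy_ip (tim_op P X) X = \<kappa> * L2_ip (u + from_right w) \<sigma>
      + \<rho>\<^sub>1 * L2_ip ((\<kappa> / \<rho>\<^sub>1) *\<^sub>R (p' + q)) (from_left u) + b * L2_ip w q
      + \<rho>\<^sub>2 * L2_ip ((b / \<rho>\<^sub>2) *\<^sub>R q' - (\<kappa> / \<rho>\<^sub>2) *\<^sub>R \<sigma>) (from_right w)
      + \<epsilon> * Re (V * cnj (prim p l)) + \<epsilon> * Re ((- V - prim p l - of_real (\<kappa> / \<epsilon>) * S) * cnj V)"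
    unfolding X tim_op_dom_of[OF s] unfolding dom_of_def
    unfolding p_def[symmetric] q_def[symmetric] \<sigma>_def[symmetric] S_def[symmetric] V_def[symmetric]
    by (subst energy_ip_state_of) (use s pq in \<open>auto simp: \<sigma>_def V_def\<close>)
  have i1: "L2_ip (u + from_right w) \<sigma> = L2_ip \<sigma> u + L2_ip \<sigma> (from_right w)"
    using L2.ip_add[OF s(2) rw \<sigma>] L2.ip_sym[OF s(2) \<sigma>] L2.ip_sym[OF rw \<sigma>] by simp
  have i2: "\<rho>\<^sub>1 * L2_ip ((\<kappa> / \<rho>\<^sub>1) *\<^sub>R (p' + q)) (from_left u) = \<kappa> * L2_ip (p' + q) (from_left u)"
    using L2.ip_scale[OF g lu, of "\<kappa> / \<rho>\<^sub>1"] pos by simp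
  have i3: "\<rho>\<^sub>2 * L2_ip ((b / \<rho>\<^sub>2) *\<^sub>R q' - (\<kappa> / \<rho>\<^sub>2) *\<^sub>R \<sigma>) (from_right w)
      = b * L2_ip q' (from_right w) - \<kappa> * L2_ip \<sigma> (from_right w)"
    using L2.ip_diff[OF L2_scaleR[OF s(3)] L2_scaleR[OF \<sigma>] rw, of "b / \<rho>\<^sub>2" "\<kappa> / \<rho>\<^sub>2"]
      L2.ip_scale[OF s(3) rw, of "b / \<rho>\<^sub>2"] L2.ip_scale[OF \<sigma> rw, of "\<kappa> / \<rho>\<^sub>2"] pos
    by (simp add: right_diff_distrib)
  have i4: "L2_ip w q = L2_ip q w" by (rule L2.ip_sym[OF s(4) pq(2)])
  have P1: "L2_ip \<sigma> u + L2_ip (p' + q) (from_left u) = Re (S * cnj V) - Re (jump\<^sub>1 u * cnj (prim u \<xi>))"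
    using integration_by_parts[OF g s(2), of "c - prim q l" "jump\<^sub>1 u" 0, folded \<sigma>W from_left_def]
    by (simp add: S_def V_def prim_add[OF s(1) pq(2)] algebra_simps)
  have P2: "L2_ip q w + L2_ip q' (from_right w) = - Re (jump\<^sub>2 w * cnj (prim w \<xi> - prim w l))"
    using integration_by_parts[OF s(3,4), of 0 "jump\<^sub>2 w" "- prim w l", folded slope\<^sub>2_def q_def from_right_def]
    by (simp add: algebra_simps)
  have D1: "\<kappa> * Re (jump\<^sub>1 u * cnj (prim u \<xi>)) = \<gamma>\<^sub>1 * (cmod (prim u \<xi>))\<^sup>2"
  proof -
    have "Re (jump\<^sub>1 u * cnj (prim u \<xi>)) = \<gamma>\<^sub>1 / \<kappa> * Re (prim u \<xi> * cnj (prim u \<xi>))"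
      unfolding jump\<^sub>1_def mult.assoc by (rule Re_of_real_mult)
    then show ?thesis unfolding Re_mult_cnj_self using pos by simp
  qed
  have D2: "b * Re (jump\<^sub>2 w * cnj (prim w \<xi> - prim w l)) = \<gamma>\<^sub>2 * (cmod (prim w \<xi> - prim w l))\<^sup>2"
  proof -
    have "Re (jump\<^sub>2 w * cnj (prim w \<xi> - prim w l))
        = \<gamma>\<^sub>2 / b * Re ((prim w \<xi> - prim w l) * cnj (prim w \<xi> - prim w l))"
      unfolding jump\<^sub>2_def mult.assoc by (rule Re_of_real_mult)
    then show ?thesis unfolding Re_mult_cnj_self using pos by simp
  qed
  have B: "\<epsilon> * Re (V * cnj (prim p l)) + \<epsilon> * Re ((- V - prim p l - of_real (\<kappa> / \<epsilon>) * S) * cnj V)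
      = - \<epsilon> * (cmod V)\<^sup>2 - \<kappa> * Re (S * cnj V)"
  proof -
    have "Re ((- V - prim p l - of_real (\<kappa> / \<epsilon>) * S) * cnj V)
        = - Re (V * cnj V) - Re (prim p l * cnj V) - \<kappa> / \<epsilon> * Re (S * cnj V)"
      by (simp only: left_diff_distrib mult_minus_left mult.assoc minus_complex.sel uminus_complex.sel Re_of_real_mult)
    moreover have "Re (V * cnj (prim p l)) = Re (prim p l * cnj V)" by (simp add: mult.commute)
    moreover have "\<epsilon> * (\<kappa> / \<epsilon> * Re (S * cnj V)) = \<kappa> * Re (S * cnj V)" using pos by simp
    ultimately show ?thesis unfolding Re_mult_cnj_self by (simp only: right_diff_distrib)
  qed
  have "energy_ip (tim_op P X) X = \<kappa> * (L2_ip \<sigma> u + L2_ip (p' + q) (from_left u)) + b * (L2_ip q w + L2_ip q' (from_right w))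
      + (- \<epsilon> * (cmod V)\<^sup>2 - \<kappa> * Re (S * cnj V))"
    unfolding e i1 i2 i3 i4 B[symmetric] by (simp add: distrib_left)
  also have "\<dots> = - \<gamma>\<^sub>1 * (cmod (prim u \<xi>))\<^sup>2 - \<gamma>\<^sub>2 * (cmod (prim w \<xi> - prim w l))\<^sup>2 - \<epsilon> * (cmod V)\<^sup>2"
    unfolding P1 P2 right_diff_distrib mult_minus_right D1 D2 by simp
  also have "\<dots> \<le> 0"
  proof -
    have "0 \<le> \<gamma>\<^sub>1 * (cmod (prim u \<xi>))\<^sup>2" "0 \<le> \<gamma>\<^sub>2 * (cmod (prim w \<xi> - prim w l))\<^sup>2" "0 \<le> \<epsilon> * (cmod V)\<^sup>2"
      using pos by simp_all
    then show ?thesis by simp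
  qed
  finally show ?thesis .
qed

section \<open>The bounded inverse\<close>

text \<open>The constant function on the beam: the direction along which the integration constant of the shear force varies.\<close>

definition one :: aefun where "one = W 1 0 0"

lemma one_L2 [simp, intro]: "one \<in> L2 \<Omega>" unfolding one_def by (rule W_L2[OF L2_zero])

lemma prim_zero: "prim 0 x = 0" using prim_scaleR[OF L2_zero, of 0 x] by simp

lemma W_const: "W c 0 0 = scaleC c one"
  unfolding one_def W_scaleC[OF L2_zero] using scaleC_scaleR[of c 0 0] by simp

lemma W_split: "g \<in> L2 \<Omega> \<Longrightarrow> W (c + c') d g = W c d g + scaleC c' one"
  unfolding W_const[symmetric] by (simp add: W_add L2_zero)

lemma Re_prim_l: assumes g: "g \<in> L2 \<Omega>" shows "Re (prim g l) = L2_ip g one"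
proof -
  have "Re (prim g l) = (LINT x|lebesgue. Re (rep_aefun g x))"
    unfolding prim_total[OF g, symmetric] by (rule integral_Re[symmetric, OF integrable_rep[OF g]])
  also have "\<dots> = L2_ip g one"
  proof (rule L2_ip_cong_AE[symmetric, OF _ g one_L2])
    show "AE x in lebesgue. Re (rep_aefun g x * cnj (rep_aefun one x)) = Re (rep_aefun g x)"
      using rep_cls[of "\<lambda>x. 1 + (if \<xi> < x then 0 else 0) + prim 0 x", folded W_def one_def] L2_AE_zero[OF g]
      by eventually_elim (auto simp: prim_zero)
    show "(\<lambda>x. Re (rep_aefun g x)) \<in> borel_measurable lebesgue"
      by (intro borel_measurable_integrable integrable_Re integrable_rep g)
  qed
  finally show ?thesis .
qed

lemma norm2_scaleC: assumes f: "f \<in> L2 \<Omega>" shows "norm2 (scaleC k f) = cmod k * norm2 f"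
  using L2_ip_scaleC[OF f, of k] by (simp add: norm2_eq f L2_scaleC real_sqrt_mult)

text \<open>This lemma and the following ones propagate bounds of the form \<open>a * n\<close>, where \<open>n\<close> is the norm of the right hand side of
the stationary problem, through the steps of its solution.\<close>

lemma norm2_le_add: "f \<in> L2 \<Omega> \<Longrightarrow> g \<in> L2 \<Omega> \<Longrightarrow> norm2 f \<le> a * n \<Longrightarrow> norm2 g \<le> a' * n \<Longrightarrow> norm2 (f + g) \<le> (a + a') * n"
  using L2.N_triangle[of f g] by (simp add: distrib_right)

lemma norm2_le_diff: "f \<in> L2 \<Omega> \<Longrightarrow> g \<in> L2 \<Omega> \<Longrightarrow> norm2 f \<le> a * n \<Longrightarrow> norm2 g \<le> a' * n \<Longrightarrow> norm2 (f - g) \<le> (a + a') * n"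
  using L2.N_triangle_diff[of f g] by (simp add: distrib_right)

lemma norm2_le_scaleR: "f \<in> L2 \<Omega> \<Longrightarrow> norm2 f \<le> a * n \<Longrightarrow> norm2 (r *\<^sub>R f) \<le> (\<bar>r\<bar> * a) * n"
  using L2.N_scale[of f r] mult_left_mono[of "norm2 f" "a * n" "\<bar>r\<bar>"] by (simp add: mult.assoc)

lemma norm2_le_scaleC: "f \<in> L2 \<Omega> \<Longrightarrow> cmod k \<le> a * n \<Longrightarrow> norm2 (scaleC k f) \<le> (a * norm2 f) * n"
  using norm2_scaleC[of f k] mult_right_mono[of "cmod k" "a * n" "norm2 f"] by (simp add: mult_ac)

lemma cmod_prim_le: "f \<in> L2 \<Omega> \<Longrightarrow> norm2 f \<le> a * n \<Longrightarrow> x \<le> l \<Longrightarrow> cmod (prim f x) \<le> (sqrt l * a) * n"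
proof -
  assume f: "f \<in> L2 \<Omega>" and le: "norm2 f \<le> a * n" and x: "x \<le> l"
  have "sqrt l * norm2 f \<le> sqrt l * (a * n)" using le l_pos by (intro mult_left_mono) auto
  then show "cmod (prim f x) \<le> (sqrt l * a) * n" using prim_bound[OF f x] by (simp only: mult.assoc)
qed

lemma norm2_le_W:
  assumes "g \<in> L2 \<Omega>" "cmod c \<le> a * n" "cmod d \<le> a' * n" "norm2 g \<le> a'' * n"
  shows "norm2 (W c d g) \<le> ((a + a' + sqrt l * a'') * sqrt l) * n"
proof -
  have "sqrt l * norm2 g \<le> sqrt l * (a'' * n)" using assms(4) l_pos by (intro mult_left_mono) auto
  then have "cmod c + cmod d + sqrt l * norm2 g \<le> (a + a' + sqrt l * a'') * n"
    using assms(2,3) by (simp add: algebra_simps)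
  then have "(cmod c + cmod d + sqrt l * norm2 g) * sqrt l \<le> ((a + a' + sqrt l * a'') * n) * sqrt l"
    using l_pos by (intro mult_right_mono) auto
  then show ?thesis using W_bound[OF assms(1), of c d] by (simp add: mult_ac)
qed

lemma scale_le: "t \<le> a * n \<Longrightarrow> 0 \<le> r \<Longrightarrow> r * t \<le> (r * a) * n" for r t a n :: real
  by (simp only: mult.assoc mult_left_mono)

lemma norm2_le_from_left: "f \<in> L2 \<Omega> \<Longrightarrow> norm2 f \<le> a * n \<Longrightarrow> norm2 (from_left f) \<le> (l * a) * n"
  by (rule order_trans[OF from_left_bound scale_le]) (use l_pos in auto)

lemma norm2_le_from_right: "f \<in> L2 \<Omega> \<Longrightarrow> norm2 f \<le> a * n \<Longrightarrow> norm2 (from_right f) \<le> (2 * l * a) * n"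
  by (rule order_trans[OF from_right_bound scale_le]) (use l_pos in auto)

text \<open>The change of \<open>\<phi>\<^sub>x\<close> if \<open>\<phi>\<^sub>x + \<psi>\<close> is increased by the constant \<open>1\<close>: then \<open>b \<psi>\<^sub>x\<^sub>x\<close> grows by \<open>\<kappa>\<close>, hence \<open>\<psi>\<close> by \<open>\<kappa> / b\<close> times the
twofold primitive of \<open>1\<close>.\<close>

definition unit_response :: aefun where "unit_response = one - (\<kappa> / b) *\<^sub>R from_right (from_left one)"

lemma unit_response_L2: "unit_response \<in> L2 \<Omega>" unfolding unit_response_def by (intro L2_diff L2_scaleR) auto

text \<open>The coefficient of the unknown constant in the tip equation: \<open>\<kappa> / \<epsilon>\<close> from the shear force at the tip, and the response of
\<open>\<phi>(l)\<close>.\<close>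

definition determinant :: complex where "determinant = of_real (\<kappa> / \<epsilon>) + prim unit_response l"

text \<open>A greater shear force lifts the tip: the twofold primitive \<open>y\<close> of \<open>1\<close> with \<open>y'(0) = 0\<close>, \<open>y(l) = 0\<close> satisfies
\<open>\<integral> y = - \<integral> (y')\<^sup>2 \<le> 0\<close>, so the real part of the response is nonnegative and that of the determinant is positive.\<close>

lemma determinant_nonzero: "determinant \<noteq> 0"
proof -
  let ?x = "from_left one"
  have x: "?x \<in> L2 \<Omega>" "from_right ?x \<in> L2 \<Omega>" by auto
  have "L2_ip ?x ?x + L2_ip one (from_right ?x) = 0"
    using integration_by_parts[OF one_L2 x(1), of 0 0 "- prim ?x l", folded from_left_def from_right_def] by simp
  then have neg: "L2_ip (from_right ?x) one \<le> 0"
    using L2.ip_nonneg[OF x(1)] L2.ip_sym[OF x(2) one_L2] by simp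
  have "Re (prim unit_response l) = L2_ip one one - \<kappa> / b * L2_ip (from_right ?x) one"
    unfolding Re_prim_l[OF unit_response_L2] unfolding unit_response_def
    using L2.ip_diff[OF one_L2 L2_scaleR[OF x(2)] one_L2, of "\<kappa> / b"] L2.ip_scale[OF x(2) one_L2, of "\<kappa> / b"] by simp
  moreover have "\<kappa> / b * L2_ip (from_right ?x) one \<le> 0"
    using neg pos by (intro mult_nonneg_nonpos) auto
  ultimately have "0 \<le> Re (prim unit_response l)" using L2.ip_nonneg[OF one_L2] by linarith
  then have "0 < Re determinant" using pos by (simp add: determinant_def add_pos_nonneg)
  then show ?thesis by auto
qed

text \<open>The stationary problem is solved from the shear force downwards.  The velocities \<open>\<Phi>\<close>, \<open>\<Psi>\<close>, and with them \<open>V\<close> and both jumps,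
are part of the right hand side.  The second component gives \<open>(\<phi>\<^sub>x + \<psi>)\<^sub>x\<close>, so \<open>\<phi>\<^sub>x + \<psi> = \<sigma>\<^sub>0 + c\<^sub>0\<close> with a constant
\<open>c\<^sub>0\<close>; the fourth gives \<open>\<psi>\<^sub>x\<^sub>x\<close>, hence \<open>\<psi>\<close> and \<open>\<phi>\<^sub>x\<close>, all affine in \<open>c\<^sub>0\<close>; the last one determines \<open>c\<^sub>0\<close>.  In
the proof the constants \<open>K\<close> bound the data, the solution with \<open>c\<^sub>0 = 0\<close> and \<open>c\<^sub>0\<close> itself, the constants \<open>L\<close> the final
solution.\<close>

theorem tim_op_bounded_inverse:
  "\<exists>K. \<forall>F\<in>phase_space P. \<exists>X\<in>tim_dom P. tim_op P X = F \<and> phase_norm P X \<le> K * phase_norm P F"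
proof -
  define K1 where "K1 = K0 + 2 * l * K0"
  define Kd where "Kd = \<gamma>\<^sub>1 / \<kappa> * (sqrt l * K1)"
  define Ke where "Ke = \<gamma>\<^sub>2 / b * (sqrt l * K0 + sqrt l * K0)"
  define Kg where "Kg = \<bar>\<rho>\<^sub>1 / \<kappa>\<bar> * K0"
  define Ks where "Ks = (0 + Kd + sqrt l * Kg) * sqrt l"
  define Kq' where "Kq' = \<bar>\<rho>\<^sub>2 / b\<bar> * K0 + \<bar>\<kappa> / b\<bar> * Ks"
  define Kq where "Kq = (0 + Ke + sqrt l * Kq') * sqrt l"
  define Kp where "Kp = Ks + 2 * l * Kq"
  define Kc where "Kc = (K0 + K0 + sqrt l * Kp + \<kappa> / \<epsilon> * (Kd + sqrt l * Kg)) / cmod determinant"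
  define Ls where "Ls = Ks + Kc * norm2 one"
  define Lq where "Lq = Kq + (\<kappa> / b * Kc) * norm2 (from_left one)"
  define Lp where "Lp = Ls + 2 * l * Lq"
  define M where "M = sqrt (\<kappa> * Ls\<^sup>2 + \<rho>\<^sub>1 * (l * K1)\<^sup>2 + b * Lq\<^sup>2 + \<rho>\<^sub>2 * (2 * l * K0)\<^sup>2 + \<epsilon> * (sqrt l * Lp)\<^sup>2 + \<epsilon> * K0\<^sup>2)"
  have "\<exists>X\<in>tim_dom P. tim_op P X = F \<and> phase_norm P X \<le> M * phase_norm P F" if F: "F \<in> phase_space P" for F
  proof -
    obtain f1 f2 f3 f4 f6 where f: "f1 \<in> L2 \<Omega>" "f2 \<in> L2 \<Omega>" "f3 \<in> L2 \<Omega>" "f4 \<in> L2 \<Omega>" and F: "F = state_of f1 f2 f3 f4 f6"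
      using F by (rule phase_spaceE)
    define n where "n = phase_norm P F"
    note cb = component_bounds[OF f, of f6, folded F n_def]
    define d e g where "d = jump\<^sub>1 f1" and "e = jump\<^sub>2 f3" and "g = (\<rho>\<^sub>1 / \<kappa>) *\<^sub>R f2"
    have g: "g \<in> L2 \<Omega>" unfolding g_def by (rule L2_scaleR[OF f(2)])
    define \<sigma>\<^sub>0 where "\<sigma>\<^sub>0 = W 0 d g"
    have \<sigma>\<^sub>0: "\<sigma>\<^sub>0 \<in> L2 \<Omega>" unfolding \<sigma>\<^sub>0_def by (rule W_L2[OF g])
    define q0' where "q0' = (\<rho>\<^sub>2 / b) *\<^sub>R f4 + (\<kappa> / b) *\<^sub>R \<sigma>\<^sub>0"
    have q0': "q0' \<in> L2 \<Omega>" unfolding q0'_def by (intro L2_add L2_scaleR f \<sigma>\<^sub>0)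
    define q0 where "q0 = W 0 e q0'"
    have q0: "q0 \<in> L2 \<Omega>" unfolding q0_def by (rule W_L2[OF q0'])
    define p0 where "p0 = \<sigma>\<^sub>0 - from_right q0"
    have p0: "p0 \<in> L2 \<Omega>" unfolding p0_def by (intro L2_diff \<sigma>\<^sub>0 from_right_L2 q0)
    define c0 where "c0 = (- prim f1 l - f6 - prim p0 l - of_real (\<kappa> / \<epsilon>) * (d + prim g l)) / determinant"
    define k where "k = of_real (\<kappa> / b) * c0"
    define q' where "q' = q0' + scaleC k one"
    have q': "q' \<in> L2 \<Omega>" unfolding q'_def by (intro L2_add L2_scaleC q0' one_L2)
    define q where "q = slope\<^sub>2 q' f3"
    have qL: "q \<in> L2 \<Omega>" unfolding q_def by (rule slope_L2(2)[OF q'])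
    have qs: "q = q0 + scaleC k (from_left one)"
    proof -
      have "q = W 0 e q0' + from_left (scaleC k one)"
        unfolding q_def slope\<^sub>2_def e_def q'_def from_left_def
        using W_add[OF q0' L2_scaleC[OF one_L2], of 0 "jump\<^sub>2 f3" 0 0 k] by simp
      then show ?thesis unfolding q0_def from_left_scaleC[OF one_L2] .
    qed
    define c p' where "c = c0 + prim q l" and "p' = g - q"
    have p': "p' \<in> L2 \<Omega>" unfolding p'_def by (intro L2_diff g qL)
    define p where "p = slope\<^sub>1 c p' f1"
    have pL: "p \<in> L2 \<Omega>" unfolding p_def by (rule slope_L2(1)[OF p'])
    define \<sigma> where "\<sigma> = p + from_right q"
    have \<sigma>: "\<sigma> = \<sigma>\<^sub>0 + scaleC c0 one"
      unfolding \<sigma>_def p_def shear_W[OF p' qL] unfolding c_def p'_def d_def[symmetric] \<sigma>\<^sub>0_def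
      using W_split[OF g, of 0 c0 d] by simp
    have kr: "scaleC k f = (\<kappa> / b) *\<^sub>R scaleC c0 f" for f
      by (simp add: k_def scaleR_eq_scaleC scaleC_scaleC)
    have ps: "p = p0 + scaleC c0 unit_response"
    proof -
      have "from_right q = from_right q0 + (\<kappa> / b) *\<^sub>R scaleC c0 (from_right (from_left one))"
        unfolding qs from_right_add[OF q0 L2_scaleC[OF from_left_L2[OF one_L2]]]
          from_right_scaleC[OF from_left_L2[OF one_L2]] by (simp only: kr)
      moreover have "p = \<sigma> - from_right q" by (simp add: \<sigma>_def)
      ultimately show ?thesis
        unfolding \<sigma> p0_def unit_response_def by (simp add: scaleC_diff scaleC_scaleR)
    qed
    define X where "X = dom_of c p' f1 q' f3"
    have X: "X \<in> tim_dom P" unfolding X_def tim_dom_iff using p' f q' by blast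
    have pq: "p' + q = g" by (simp add: p'_def)
    have "tim_op P X = F"
      unfolding X_def tim_op_dom_of[OF p' f(1) q' f(3)] q_def[symmetric] p_def[symmetric] pq \<sigma>_def[symmetric] F
    proof (intro arg_cong3[where f = "\<lambda>a. state_of f1 a f3"] )
      show "(\<kappa> / \<rho>\<^sub>1) *\<^sub>R g = f2" using pos by (simp add: g_def)
      show "(b / \<rho>\<^sub>2) *\<^sub>R q' - (\<kappa> / \<rho>\<^sub>2) *\<^sub>R \<sigma> = f4"
        unfolding q'_def q0'_def \<sigma> kr using pos by (simp add: scaleR_add_right)
      have "prim p l = prim p0 l + c0 * prim unit_response l"
        unfolding ps by (simp add: prim_add p0 L2_scaleC unit_response_L2 prim_scaleC)
      moreover have "prim p' l = prim g l - prim q l" unfolding p'_def by (rule prim_diff[OF g qL])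
      moreover have "c0 * determinant = - prim f1 l - f6 - prim p0 l - of_real (\<kappa> / \<epsilon>) * (d + prim g l)"
        unfolding c0_def using determinant_nonzero by simp
      ultimately show "- prim f1 l - prim p l - of_real (\<kappa> / \<epsilon>) * (c + jump\<^sub>1 f1 + prim p' l) = f6"
        unfolding determinant_def c_def d_def by (simp add: algebra_simps)
    qed
    moreover have "phase_norm P X \<le> M * n"
    proof -
      have n: "0 \<le> n" by (rule cb(7))
      have b1: "norm2 f1 \<le> K1 * n"
      proof -
        have "norm2 (from_right f3) \<le> (2 * l * K0) * n"
          by (rule norm2_le_from_right[OF f(3) cb(3)])
        then have "norm2 ((f1 + from_right f3) - from_right f3) \<le> (K0 + 2 * l * K0) * n"
          using cb(1) f by (intro norm2_le_diff L2_add) auto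
        then show ?thesis by (simp add: K1_def)
      qed
      have bd: "cmod d \<le> Kd * n"
      proof -
        have "\<gamma>\<^sub>1 / \<kappa> * cmod (prim f1 \<xi>) \<le> Kd * n"
          unfolding Kd_def by (intro scale_le cmod_prim_le f b1) (use xi_less pos in auto)
        then show ?thesis using pos by (simp add: d_def jump\<^sub>1_def norm_mult norm_divide)
      qed
      have be: "cmod e \<le> Ke * n"
      proof -
        have "cmod (prim f3 \<xi> - prim f3 l) \<le> (sqrt l * K0) * n + (sqrt l * K0) * n"
          using cmod_prim_le[OF f(3) cb(3), of \<xi>] cmod_prim_le[OF f(3) cb(3), of l] xi_less
            norm_triangle_ineq4[of "prim f3 \<xi>" "prim f3 l"] by linarith
        then have "cmod (prim f3 \<xi> - prim f3 l) \<le> (sqrt l * K0 + sqrt l * K0) * n"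
          by (simp only: distrib_right)
        then have "\<gamma>\<^sub>2 / b * cmod (prim f3 \<xi> - prim f3 l) \<le> Ke * n"
          unfolding Ke_def using pos by (intro scale_le) auto
        then show ?thesis using pos by (simp add: e_def jump\<^sub>2_def norm_mult norm_divide)
      qed
      have bg: "norm2 g \<le> Kg * n" unfolding g_def Kg_def by (rule norm2_le_scaleR[OF f(2) cb(2)])
      have bs: "norm2 \<sigma>\<^sub>0 \<le> Ks * n" unfolding \<sigma>\<^sub>0_def Ks_def by (rule norm2_le_W[OF g _ bd bg]) simp
      have bq': "norm2 q0' \<le> Kq' * n" unfolding q0'_def Kq'_def
        by (intro norm2_le_add norm2_le_scaleR L2_scaleR f \<sigma>\<^sub>0 cb bs)
      have bq: "norm2 q0 \<le> Kq * n" unfolding q0_def Kq_def by (rule norm2_le_W[OF q0' _ be bq']) simp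
      have fr: "norm2 (from_right h) \<le> (2 * l * K) * n" if "h \<in> L2 \<Omega>" "norm2 h \<le> K * n" for h K
        by (rule norm2_le_from_right[OF that])
      have bp: "norm2 p0 \<le> Kp * n" unfolding p0_def Kp_def
        by (intro norm2_le_diff fr from_right_L2 \<sigma>\<^sub>0 q0 bs bq)
      have bc: "cmod c0 \<le> Kc * n"
      proof -
        have "cmod (of_real (\<kappa> / \<epsilon>) * (d + prim g l)) \<le> (\<kappa> / \<epsilon> * (Kd + sqrt l * Kg)) * n"
        proof -
          have "cmod (d + prim g l) \<le> (Kd + sqrt l * Kg) * n"
            using norm_triangle_ineq[of d "prim g l"] bd cmod_prim_le[OF g bg, of l] by (simp add: distrib_right)
          then have "\<kappa> / \<epsilon> * cmod (d + prim g l) \<le> (\<kappa> / \<epsilon> * (Kd + sqrt l * Kg)) * n"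
            using pos by (intro scale_le) auto
          moreover have "cmod (of_real (\<kappa> / \<epsilon>) * (d + prim g l)) = \<kappa> / \<epsilon> * cmod (d + prim g l)"
            using pos by (simp add: norm_mult norm_divide)
          ultimately show ?thesis by (simp only:)
        qed
        moreover have "cmod (- prim f1 l - f6 - prim p0 l - of_real (\<kappa> / \<epsilon>) * (d + prim g l))
            \<le> cmod (prim f1 l) + cmod f6 + cmod (prim p0 l) + cmod (of_real (\<kappa> / \<epsilon>) * (d + prim g l))"
          using norm_triangle_ineq4[of "- prim f1 l - f6 - prim p0 l" "of_real (\<kappa> / \<epsilon>) * (d + prim g l)"]
            norm_triangle_ineq4[of "- prim f1 l - f6" "prim p0 l"] norm_triangle_ineq4[of "- prim f1 l" f6]
          by simp
        ultimately have "cmod (- prim f1 l - f6 - prim p0 l - of_real (\<kappa> / \<epsilon>) * (d + prim g l))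
            \<le> (K0 + K0 + sqrt l * Kp + \<kappa> / \<epsilon> * (Kd + sqrt l * Kg)) * n"
          using cb(5,6) cmod_prim_le[OF p0 bp, of l] by (simp add: distrib_right)
        then show ?thesis
          unfolding c0_def Kc_def norm_divide by (simp add: divide_right_mono)
      qed
      have Bs: "norm2 \<sigma> \<le> Ls * n" unfolding \<sigma> Ls_def
        by (intro norm2_le_add norm2_le_scaleC L2_scaleC \<sigma>\<^sub>0 one_L2 bs bc)
      have bk: "cmod k \<le> (\<kappa> / b * Kc) * n"
      proof -
        have "\<kappa> / b * cmod c0 \<le> (\<kappa> / b * Kc) * n" using pos by (intro scale_le bc) auto
        moreover have "cmod k = \<kappa> / b * cmod c0" using pos by (simp add: k_def norm_mult norm_divide)
        ultimately show ?thesis by (simp only:)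
      qed
      have Bq: "norm2 q \<le> Lq * n" unfolding qs Lq_def
        by (intro norm2_le_add norm2_le_scaleC L2_scaleC q0 from_left_L2 one_L2 bq bk)
      have Bp: "norm2 p \<le> Lp * n"
      proof -
        have "norm2 (\<sigma> - from_right q) \<le> (Ls + 2 * l * Lq) * n"
          by (intro norm2_le_diff fr from_right_L2 qL Bs Bq) (simp add: \<sigma>_def L2_add pL qL)
        then show ?thesis by (simp add: \<sigma>_def Lp_def)
      qed
      have Bv: "cmod (prim p l) \<le> (sqrt l * Lp) * n" by (rule cmod_prim_le[OF pL Bp]) simp
      have B1: "norm2 (from_left f1) \<le> (l * K1) * n"
        by (rule norm2_le_from_left[OF f(1) b1])
      have B3: "norm2 (from_right f3) \<le> (2 * l * K0) * n" by (rule fr[OF f(3) cb(3)])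
      have sq: "a * t\<^sup>2 \<le> a * K\<^sup>2 * n\<^sup>2" if "0 < a" "0 \<le> t" "t \<le> K * n" for a t K
      proof -
        have "t\<^sup>2 \<le> (K * n)\<^sup>2" using that by (intro power_mono) auto
        then show ?thesis using that(1) by (simp add: power_mult_distrib mult.assoc)
      qed
      have nn: "0 \<le> norm2 h" if "h \<in> L2 \<Omega>" for h using that by (rule L2.N_nonneg)
      have \<sigma>L: "\<sigma> \<in> L2 \<Omega>" unfolding \<sigma>_def by (intro L2_add pL from_right_L2 qL)
      have "(phase_norm P X)\<^sup>2 = \<kappa> * (norm2 \<sigma>)\<^sup>2 + \<rho>\<^sub>1 * (norm2 (from_left f1))\<^sup>2 + b * (norm2 q)\<^sup>2
          + \<rho>\<^sub>2 * (norm2 (from_right f3))\<^sup>2 + \<epsilon> * (cmod (prim p l))\<^sup>2 + \<epsilon> * (cmod (prim f1 l))\<^sup>2"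
        unfolding X_def dom_of_def p_def[symmetric] q_def[symmetric] \<sigma>_def
        by (rule phase_norm_sq[OF pL from_left_L2[OF f(1)] qL from_right_L2[OF f(3)]])
      also have "\<dots> \<le> \<kappa> * Ls\<^sup>2 * n\<^sup>2 + \<rho>\<^sub>1 * (l * K1)\<^sup>2 * n\<^sup>2 + b * Lq\<^sup>2 * n\<^sup>2 + \<rho>\<^sub>2 * (2 * l * K0)\<^sup>2 * n\<^sup>2
          + \<epsilon> * (sqrt l * Lp)\<^sup>2 * n\<^sup>2 + \<epsilon> * K0\<^sup>2 * n\<^sup>2"
        by (intro add_mono sq pos nn \<sigma>L qL from_left_L2 from_right_L2 f norm_ge_zero Bs B1 Bq B3 Bv cb(5))
      also have "\<dots> = M\<^sup>2 * n\<^sup>2"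
      proof -
        have "M\<^sup>2 = \<kappa> * Ls\<^sup>2 + \<rho>\<^sub>1 * (l * K1)\<^sup>2 + b * Lq\<^sup>2 + \<rho>\<^sub>2 * (2 * l * K0)\<^sup>2 + \<epsilon> * (sqrt l * Lp)\<^sup>2 + \<epsilon> * K0\<^sup>2"
          unfolding M_def using pos by (intro real_sqrt_pow2 add_nonneg_nonneg mult_nonneg_nonneg) auto
        then show ?thesis by (simp only: distrib_right)
      qed
      finally have sq_le: "(phase_norm P X)\<^sup>2 \<le> (M * n)\<^sup>2" by (simp add: power_mult_distrib)
      have "0 \<le> M" unfolding M_def using pos by (intro real_sqrt_ge_zero add_nonneg_nonneg mult_nonneg_nonneg) auto
      then have "0 \<le> M * n" using n by (rule mult_nonneg_nonneg)
      then show ?thesis by (rule power2_le_imp_le[OF sq_le])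
    qed
    ultimately have "tim_op P X = F \<and> phase_norm P X \<le> M * phase_norm P F" unfolding n_def by (rule conjI)
    then show ?thesis using X by (rule rev_bexI[rotated])
  qed
  then show ?thesis by blast
qed

lemma phase_norm_scaleC:
  assumes X: "X \<in> phase_space P" shows "scaleC_state c X \<in> phase_space P" "phase_norm P (scaleC_state c X) = cmod c * phase_norm P X"
proof -
  obtain p \<Phi> q \<Psi> V where s: "p \<in> L2 \<Omega>" "\<Phi> \<in> L2 \<Omega>" "q \<in> L2 \<Omega>" "\<Psi> \<in> L2 \<Omega>" and X': "X = state_of p \<Phi> q \<Psi> V"
    using X by (rule phase_spaceE)
  have cX: "scaleC_state c X = state_of (scaleC c p) (scaleC c \<Phi>) (scaleC c q) (scaleC c \<Psi>) (c * V)"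
    unfolding X' by (rule state_of_scaleC[OF s(1,3)])
  show cL: "scaleC_state c X \<in> phase_space P" unfolding cX by (intro state_of_phase_space L2_scaleC s)
  have m: "p + from_right q \<in> L2 \<Omega>" using s by (auto intro: L2_add)
  have e: "scaleC c p + from_right (scaleC c q) = scaleC c (p + from_right q)"
    using s by (simp add: from_right_scaleC scaleC_add)
  have "(phase_norm P (scaleC_state c X))\<^sup>2 = (cmod c)\<^sup>2 * (phase_norm P X)\<^sup>2"
    unfolding cX unfolding phase_norm_sq[OF L2_scaleC[OF s(1)] L2_scaleC[OF s(2)] L2_scaleC[OF s(3)] L2_scaleC[OF s(4)]] e X' phase_norm_sq[OF s]
    by (simp add: norm2_scaleC m s prim_scaleC norm_mult power_mult_distrib algebra_simps)
  then have "(phase_norm P (scaleC_state c X))\<^sup>2 = (cmod c * phase_norm P X)\<^sup>2" by (simp add: power_mult_distrib)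
  then show "phase_norm P (scaleC_state c X) = cmod c * phase_norm P X"
    using E.N_nonneg[OF cL] E.N_nonneg[OF X] by (simp add: power2_eq_iff_nonneg)
qed

sublocale G: complex_dissipative_bijection "phase_space P" "phase_norm P" energy_ip "tim_dom P" "tim_op P" scaleC_state
proof
  fix X Y c r
  have real: "X \<in> tim_dom P \<Longrightarrow> r *\<^sub>R X \<in> tim_dom P" "X \<in> tim_dom P \<Longrightarrow> tim_op P (r *\<^sub>R X) = r *\<^sub>R tim_op P X" for X r
    using tim_op_scaleC[of X "complex_of_real r"] by (simp_all add: scaleC_state_real)
  show "subspace (tim_dom P)"
    unfolding subspace_def
  proof (intro conjI ballI allI)
    have "dom_of 0 0 0 0 0 \<in> tim_dom P" unfolding tim_dom_iff using L2_zero by blast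
    then show "0 \<in> tim_dom P" using real(1)[of _ 0] by simp
  qed (use tim_op_add real in auto)
  show "tim_dom P \<subseteq> phase_space P" unfolding tim_dom_def by auto
  show "X \<in> tim_dom P \<Longrightarrow> tim_op P X \<in> phase_space P" by (rule tim_op_in_phase_space)
  show "X \<in> tim_dom P \<Longrightarrow> Y \<in> tim_dom P \<Longrightarrow> tim_op P (X + Y) = tim_op P X + tim_op P Y" by (rule tim_op_add)
  show "X \<in> tim_dom P \<Longrightarrow> tim_op P (r *\<^sub>R X) = r *\<^sub>R tim_op P X" by (rule real)
  show "X \<in> tim_dom P \<Longrightarrow> energy_ip (tim_op P X) X \<le> 0" by (rule tim_op_dissipative)
  show "\<exists>K. \<forall>F\<in>phase_space P. \<exists>X\<in>tim_dom P. tim_op P X = F \<and> phase_norm P X \<le> K * phase_norm P F"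
    by (rule tim_op_bounded_inverse)
  show "X \<in> phase_space P \<Longrightarrow> scaleC_state c X \<in> phase_space P" by (rule phase_norm_scaleC)
  show "X \<in> tim_dom P \<Longrightarrow> scaleC_state c X \<in> tim_dom P" by (rule tim_op_scaleC)
  show "scaleC_state c (X - Y) = scaleC_state c X - scaleC_state c Y"
    by (cases X; cases Y) (simp add: scaleC_diff right_diff_distrib)
  show "scaleC_state c (r *\<^sub>R X) = r *\<^sub>R scaleC_state c X"
    by (cases X) (simp add: scaleC_scaleR scaleR_conv_of_real)
  show "scaleC_state (complex_of_real r) X = r *\<^sub>R X" by (rule scaleC_state_real)
  show "X \<in> phase_space P \<Longrightarrow> phase_norm P (scaleC_state c X) \<le> cmod c * phase_norm P X"
    by (simp add: phase_norm_scaleC)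
  show "X \<in> tim_dom P \<Longrightarrow> tim_op P (scaleC_state c X) = scaleC_state c (tim_op P X)" by (rule tim_op_scaleC)
qed

text \<open>The energy norm controls the \<open>L\<^sup>2\<close> norms of \<open>\<Phi>\<close> and \<open>\<Psi>\<close>, but in general a mild solution is not differentiable in it.  Writing \<open>U\<^sub>0 = \<A> Y\<close>
helps: the orbit of \<open>Y\<close> is differentiable with derivative the orbit of \<open>U\<^sub>0\<close>, and its velocity components are the
displacements of the latter, since the displacement components of \<open>\<A> X\<close> are the velocities of \<open>X\<close>.\<close>

lemma velocities_of_solution:
  assumes gs: "contraction_semigroup (phase_space P) (phase_norm P) scaleC_state T"
      "generator (phase_space P) (phase_norm P) T (tim_dom P) (tim_op P)"
    and U0: "U0 \<in> phase_space P"
  shows "velocities P (\<lambda>t. T t U0)"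
proof -
  interpret S: generated_semigroup "phase_space P" "phase_norm P" energy_ip "tim_dom P" "tim_op P" scaleC_state T
    by unfold_locales (rule gs)+
  obtain Y where Y: "Y \<in> tim_dom P" "tim_op P Y = U0" using S.range_A[OF U0] by blast
  have Yt: "T t Y \<in> tim_dom P" "tim_op P (T t Y) = T t U0" if "0 \<le> t" for t
    using S.S_domain[OF Y(1) that] Y(2) by auto
  have Ut: "T t U0 \<in> phase_space P" if "0 \<le> t" for t using U0 that by (rule S.S_H[rotated])
  have comp: "fst (tim_op P X) = fst (snd X)" "fst (snd (snd (tim_op P X))) = fst (snd (snd (snd X)))" for X
    by (cases X; simp)+
  have d: "((\<lambda>s. phase_norm P ((1 / (s - t)) *\<^sub>R (T s Y - T t Y) - T t U0)) \<longlongrightarrow> 0) (at t within {0..})" if "0 \<le> t" for t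
    using S.has_deriv_wrt_S[OF Y(1)] Y(2) that unfolding has_deriv_wrt_def by simp
  have bound: "L2_norm \<Omega> (fst (snd X)) \<le> K0 * phase_norm P X" "L2_norm \<Omega> (fst (snd (snd (snd X)))) \<le> K0 * phase_norm P X"
    "0 \<le> L2_norm \<Omega> (fst (snd X))" "0 \<le> L2_norm \<Omega> (fst (snd (snd (snd X))))"
    if X: "X \<in> phase_space P" for X
  proof -
    obtain p \<Phi> q \<Psi> V where s: "p \<in> L2 \<Omega>" "\<Phi> \<in> L2 \<Omega>" "q \<in> L2 \<Omega>" "\<Psi> \<in> L2 \<Omega>" and X': "X = state_of p \<Phi> q \<Psi> V"
      using X by (rule phase_spaceE)
    show "L2_norm \<Omega> (fst (snd X)) \<le> K0 * phase_norm P X" "L2_norm \<Omega> (fst (snd (snd (snd X)))) \<le> K0 * phase_norm P X"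
      "0 \<le> L2_norm \<Omega> (fst (snd X))" "0 \<le> L2_norm \<Omega> (fst (snd (snd (snd X))))"
      using component_bounds(2,4)[OF s, of V] s unfolding X' by (auto simp: state_of_def)
  qed
  have quot: "(1 / (s - t)) *\<^sub>R (T s Y - T t Y) - T t U0 \<in> phase_space P" if "0 \<le> s" "0 \<le> t" for s t
    by (intro E.H_diff E.H_scale G.D_imp_H[OF Yt(1)] Ut that)
  have lim: "((\<lambda>s. L2_norm \<Omega> (f ((1 / (s - t)) *\<^sub>R (T s Y - T t Y) - T t U0))) \<longlongrightarrow> 0) (at t within {0..})"
    if t: "0 \<le> t" and f: "\<And>X. X \<in> phase_space P \<Longrightarrow> L2_norm \<Omega> (f X) \<le> K0 * phase_norm P X \<and> 0 \<le> L2_norm \<Omega> (f X)"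
    for t and f :: "state \<Rightarrow> aefun"
  proof (rule tendsto_sandwich[OF _ _ tendsto_const])
    show "((\<lambda>s. K0 * phase_norm P ((1 / (s - t)) *\<^sub>R (T s Y - T t Y) - T t U0)) \<longlongrightarrow> 0) (at t within {0..})"
      by (rule tendsto_mult_right_zero[OF d[OF t]])
    have ev: "\<forall>\<^sub>F s in at t within {0..}. 0 \<le> s"
      unfolding eventually_at by (intro exI[of _ 1]) auto
    show "\<forall>\<^sub>F s in at t within {0..}. L2_norm \<Omega> (f ((1 / (s - t)) *\<^sub>R (T s Y - T t Y) - T t U0))
        \<le> K0 * phase_norm P ((1 / (s - t)) *\<^sub>R (T s Y - T t Y) - T t U0)"
      "\<forall>\<^sub>F s in at t within {0..}. 0 \<le> L2_norm \<Omega> (f ((1 / (s - t)) *\<^sub>R (T s Y - T t Y) - T t U0))"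
      using ev by (eventually_elim, use f quot t in blast)+
  qed
  show ?thesis
    unfolding velocities_def has_deriv_wrt_def beam_eq
  proof (intro conjI ballI)
    fix t :: real assume "t \<in> {0..}"
    then have t: "0 \<le> t" by simp
    have "((\<lambda>s. L2_norm \<Omega> ((1 / (s - t)) *\<^sub>R (fst (T s U0) - fst (T t U0)) - fst (snd (T t U0)))) \<longlongrightarrow> 0) (at t within {0..})
      \<and> ((\<lambda>s. L2_norm \<Omega> ((1 / (s - t)) *\<^sub>R (fst (snd (snd (T s U0))) - fst (snd (snd (T t U0))))
          - fst (snd (snd (snd (T t U0)))))) \<longlongrightarrow> 0) (at t within {0..})"
    proof
      have ev: "\<forall>\<^sub>F s in at t within {0..}. 0 \<le> s"
        unfolding eventually_at by (intro exI[of _ 1]) auto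
      have c: "fst (T s U0) = fst (snd (T s Y))" "fst (snd (snd (T s U0))) = fst (snd (snd (snd (T s Y))))" if "0 \<le> s" for s
        using comp[of "T s Y"] Yt(2)[OF that] by simp_all
      show "((\<lambda>s. L2_norm \<Omega> ((1 / (s - t)) *\<^sub>R (fst (T s U0) - fst (T t U0)) - fst (snd (T t U0)))) \<longlongrightarrow> 0) (at t within {0..})"
      proof (rule Lim_transform_eventually[OF lim[OF t, of "\<lambda>X. fst (snd X)"]])
        show "\<forall>\<^sub>F s in at t within {0..}. L2_norm \<Omega> (fst (snd ((1 / (s - t)) *\<^sub>R (T s Y - T t Y) - T t U0)))
            = L2_norm \<Omega> ((1 / (s - t)) *\<^sub>R (fst (T s U0) - fst (T t U0)) - fst (snd (T t U0)))"
          using ev by eventually_elim (simp add: c t)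
      qed (use bound in auto)
      show "((\<lambda>s. L2_norm \<Omega> ((1 / (s - t)) *\<^sub>R (fst (snd (snd (T s U0))) - fst (snd (snd (T t U0))))
          - fst (snd (snd (snd (T t U0)))))) \<longlongrightarrow> 0) (at t within {0..})"
      proof (rule Lim_transform_eventually[OF lim[OF t, of "\<lambda>X. fst (snd (snd (snd X)))"]])
        show "\<forall>\<^sub>F s in at t within {0..}. L2_norm \<Omega> (fst (snd (snd (snd ((1 / (s - t)) *\<^sub>R (T s Y - T t Y) - T t U0)))))
            = L2_norm \<Omega> ((1 / (s - t)) *\<^sub>R (fst (snd (snd (T s U0))) - fst (snd (snd (T t U0)))) - fst (snd (snd (snd (T t U0)))))"
          using ev by eventually_elim (simp add: c t)
      qed (use bound in auto)
    qed
    then show "((\<lambda>s. L2_norm \<Omega> ((1 / (s - t)) *\<^sub>R (fst (T s U0) - fst (T t U0)) - fst (snd (T t U0)))) \<longlongrightarrow> 0) (at t within {0..})"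
      "((\<lambda>s. L2_norm \<Omega> ((1 / (s - t)) *\<^sub>R (fst (snd (snd (T s U0))) - fst (snd (snd (T t U0))))
          - fst (snd (snd (snd (T t U0)))))) \<longlongrightarrow> 0) (at t within {0..})" by blast+
  qed
qed

end

section \<open>Well-posedness of the hybrid model\<close>

text \<open>Existence of the semigroup comes from the Euler scheme; the statements about solutions are those for an arbitrary
semigroup with generator \<open>\<A>\<close>.\<close>

theorem theorem3p1:
  fixes P :: timoshenko
  assumes "0 < tm_ell P" and "0 < tm_xi P" and "tm_xi P < tm_ell P"
    and "0 < tm_rho1 P" and "0 < tm_rho2 P" and "0 < tm_kappa P" and "0 < tm_b P"
    and "0 < tm_gamma1 P" and "0 < tm_gamma2 P" and "0 < tm_eps P"
  defines "H \<equiv> phase_space P" and "N \<equiv> phase_norm P"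
    and "D \<equiv> tim_dom P" and "A \<equiv> tim_op P"
  shows "(\<exists>T. contraction_semigroup H N scaleC_state T \<and> generator H N T D A) \<and>
    (\<forall>T. contraction_semigroup H N scaleC_state T \<and> generator H N T D A \<longrightarrow>
      (\<forall>U0\<in>H.
         mild_solution H N D A U0 (\<lambda>t. T t U0) \<and> velocities P (\<lambda>t. T t U0) \<and>
         (\<forall>W. mild_solution H N D A U0 W \<longrightarrow> (\<forall>t\<ge>0. W t = T t U0)) \<and>
         (U0 \<in> D \<longrightarrow> (\<forall>\<tau>>0. strong_solution H N D A U0 \<tau> (\<lambda>t. T t U0)))))"
proof -
  interpret hybrid_beam P by unfold_locales (use assms in auto)
  show ?thesis
  proof (intro conjI allI impI ballI)
    show "\<exists>T. contraction_semigroup H N scaleC_state T \<and> generator H N T D A"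
      unfolding H_def N_def D_def A_def using G.generates by blast
  next
    fix T U0 assume T: "contraction_semigroup H N scaleC_state T \<and> generator H N T D A" and U0: "U0 \<in> H"
    interpret S: generated_semigroup "phase_space P" "phase_norm P" energy_ip "tim_dom P" "tim_op P" scaleC_state T
      by unfold_locales (use T in \<open>simp_all add: H_def N_def D_def A_def\<close>)
    have U0': "U0 \<in> phase_space P" using U0 by (simp add: H_def)
    show "mild_solution H N D A U0 (\<lambda>t. T t U0)"
      unfolding H_def N_def D_def A_def by (rule S.mild_solution_S[OF U0'])
    show "velocities P (\<lambda>t. T t U0)"
      by (rule velocities_of_solution[OF S.semigroup S.generator U0'])
    show "W t = T t U0" if "mild_solution H N D A U0 W" "0 \<le> t" for W t
      using that unfolding H_def N_def D_def A_def by (intro S.mild_solution_unique U0')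
    show "strong_solution H N D A U0 \<tau> (\<lambda>t. T t U0)" if "U0 \<in> D" "0 < \<tau>" for \<tau>
      using that unfolding H_def N_def D_def A_def by (intro S.strong_solution_S)
  qed
qed

end
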